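(* Let $(\mathsf C,\mathcal S_{\mathsf C})$ be a category with covers, $(\mathsf D,\mathcal S_{\mathsf D})$ a descent category, and $F\colon\mathsf C\to\mathsf D$ a geometric functor. Let $F_\bullet\colon s\mathsf C\to s\mathsf D$ be the induced functor between simplicial objects. (1) $F_\bullet$ restricts to a functor $F_\bullet\colon\mathsf{Gpd}_\infty(\mathsf C)\to\mathsf{Gpd}_\infty(\mathsf D)$ between categories of $\infty$-groupoid objects, which sends Kan fibrations to Kan fibrations and covering fibrations to covering fibrations. If $F$ reflects covers, then $F_\bullet$ reflects Kan fibrations and covering fibrations. (2) $F_\bullet\colon\mathsf{Gpd}_\infty(\mathsf C)\to\mathsf{Gpd}_\infty(\mathsf D)$ preserves hypercovers. If $F$ reflects covers, then $F_\bullet$ reflects hypercovers. (3) $F_\bullet\colon\mathsf{Gpd}_\infty(\mathsf C)\to\mathsf{Gpd}_\infty(\mathsf D)$ preserves pullbacks along covering fibrations. (4) $F$ and $F_\bullet$ restrict to functors $F\colon\mathsf{Grp}(\mathsf C)\to\mathsf{Grp}(\mathsf D)$ and $F_\bullet\colon\mathsf{Grp}(s\mathsf C)\to\mathsf{Grp}(s\mathsf D)$ between categories of group objects. (5) There is a natural isomorphism $F_\bullet\circ\overline{\mathcal W}_\bullet(-)\cong\overline{\mathcal W}_\bullet(-)\circ F_\bullet$ between functors from $\mathsf{Grp}(s\mathsf C)$ to $\mathsf{Gpd}_\infty(\mathsf D)$.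
   Context: **Category with covers** $(\mathsf C,\mathcal S)$: a category with a subcategory $\mathcal S$ of covers such that (a) $\mathsf C$ has a terminal object $*$ and every $X\to*$ is a cover; (b) pullbacks of covers exist and are covers; (c) if $f$ and $g\circ f$ are covers, so is $g$; (d) every cover is an effective epimorphism. **Descent category** $(\mathsf D,\mathcal S)$: a category with all finite limits and a subcategory $\mathcal S$ of covers such that the identity of the terminal object is a cover, covers are closed under base change, if $f$ and $g\circ f$ are covers so is $g$, and every cover is an effective epimorphism. A functor $F$ from a category with covers to a descent category is **geometric** if it sends covers to covers and preserves pullbacks of covers; it **reflects covers** if $F(f)$ a cover implies $f$ a cover. **Simplicial notions** (for a category with covers the limits involved are required to exist). $X^K=\hom(K,X_\bullet)$ is the matching object for a finite simplicial set $K$. $f\colon X_\bullet\to Y_\bullet$ is a Kan fibration if all $X_n\to X^{\Lambda^n_k}\times_{Y^{\Lambda^n_k}}Y_n$ ($n\ge1$, $0\le k\le n$) are covers; a covering fibration if moreover $f_0$ is a cover; a hypercover if all $X_m\to X^{\partial\Delta^m}\times_{Y^{\partial\Delta^m}}Y_m$ ($m\ge0$) are covers. $X_\bullet$ is an $\infty$-groupoid if $X_\bullet\to*$ is a Kan fibration; $\mathsf{Gpd}_\infty$ is the full subcategory of these. **$\overline{\mathcal W}$.** For a simplicial group object $G_\bullet$, $\overline{\mathcal W}_0G=*$, $\overline{\mathcal W}_nG=G_{n-1}\times\cdots\times G_0$, with $d_0(g_{n-1},\dots,g_0)=(g_{n-2},\dots,g_0)$, $d_i(g_{n-1},\dots,g_0)=(d_{i-1}g_{n-1},\dots,d_1g_{n-i+1},(d_0g_{n-i})g_{n-i-1},g_{n-i-2},\dots,g_0)$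 for $1\le i\le n-1$, $d_n(g_{n-1},\dots,g_0)=(d_{n-1}g_{n-1},\dots,d_1g_1)$, $s_i(g_{n-1},\dots,g_0)=(s_{i-1}g_{n-1},\dots,s_0g_{n-i},e,g_{n-i-1},\dots,g_0)$. For a simplicial group object in a category with covers it is an $\infty$-groupoid object.
   Formalization: Parts (4) and (5) additionally assume that F preserves terminal objects; without this they fail, e.g. for F constant at a two-element set from nonempty sets to sets with surjections as covers, which is geometric as defined. *)

theory Defs
  imports Main
begin

section \<open>Categories, functors, limits\<close>

record ('o, 'm) cat =
  Obj :: "'o set"
  Arr :: "'m set"
  Dom :: "'m \<Rightarrow> 'o"
  Cod :: "'m \<Rightarrow> 'o"
  Idm :: "'o \<Rightarrow> 'm"
  Cmp :: "'m \<Rightarrow> 'm \<Rightarrow> 'm"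

(* Composition is written in the applicative order: g \<cdot> f is "g after f". *)
abbreviation cat_comp :: "'m \<Rightarrow> ('o, 'm) cat \<Rightarrow> 'm \<Rightarrow> 'm"
    ("(_ \<cdot>\<^bsub>_\<^esub>/ _)" [66, 0, 65] 65) where
  "g \<cdot>\<^bsub>C\<^esub> f \<equiv> Cmp C g f"

definition Hom :: "('o, 'm) cat \<Rightarrow> 'o \<Rightarrow> 'o \<Rightarrow> 'm set" where
  "Hom C X Y = {f \<in> Arr C. Dom C f = X \<and> Cod C f = Y}"

definition is_category :: "('o, 'm) cat \<Rightarrow> bool" where
  "is_category C \<longleftrightarrow>
     (\<forall>f\<in>Arr C. Dom C f \<in> Obj C \<and> Cod C f \<in> Obj C) \<and>
     (\<forall>X\<in>Obj C. Idm C X \<in> Hom C X X) \<and>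
     (\<forall>f\<in>Arr C. \<forall>g\<in>Arr C. Cod C f = Dom C g \<longrightarrow> g \<cdot>\<^bsub>C\<^esub> f \<in> Hom C (Dom C f) (Cod C g)) \<and>
     (\<forall>f\<in>Arr C. f \<cdot>\<^bsub>C\<^esub> Idm C (Dom C f) = f \<and> Idm C (Cod C f) \<cdot>\<^bsub>C\<^esub> f = f) \<and>
     (\<forall>f\<in>Arr C. \<forall>g\<in>Arr C. \<forall>h\<in>Arr C. Cod C f = Dom C g \<longrightarrow> Cod C g = Dom C h \<longrightarrow>
        h \<cdot>\<^bsub>C\<^esub> (g \<cdot>\<^bsub>C\<^esub> f) = (h \<cdot>\<^bsub>C\<^esub> g) \<cdot>\<^bsub>C\<^esub> f)"

definition full_subcategory :: "('o, 'm) cat \<Rightarrow> ('o \<Rightarrow> bool) \<Rightarrow> ('o, 'm) cat" where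
  "full_subcategory C P =
     \<lparr>Obj = {X \<in> Obj C. P X}, Arr = {f \<in> Arr C. P (Dom C f) \<and> P (Cod C f)},
      Dom = Dom C, Cod = Cod C, Idm = Idm C, Cmp = Cmp C\<rparr>"

record ('o, 'm, 'p, 'n) func =
  OMap :: "'o \<Rightarrow> 'p"
  AMap :: "'m \<Rightarrow> 'n"

definition is_functor :: "('o, 'm) cat \<Rightarrow> ('p, 'n) cat \<Rightarrow> ('o, 'm, 'p, 'n) func \<Rightarrow> bool" where
  "is_functor C D F \<longleftrightarrow>
     is_category C \<and> is_category D \<and>
     (\<forall>X\<in>Obj C. OMap F X \<in> Obj D) \<and>
     (\<forall>f\<in>Arr C. AMap F f \<in> Hom D (OMap F (Dom C f)) (OMap F (Cod C f))) \<and>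
     (\<forall>X\<in>Obj C. AMap F (Idm C X) = Idm D (OMap F X)) \<and>
     (\<forall>f\<in>Arr C. \<forall>g\<in>Arr C. Cod C f = Dom C g \<longrightarrow>
        AMap F (g \<cdot>\<^bsub>C\<^esub> f) = AMap F g \<cdot>\<^bsub>D\<^esub> AMap F f)"

definition func_comp ::
    "('p, 'n, 'q, 'k) func \<Rightarrow> ('o, 'm, 'p, 'n) func \<Rightarrow> ('o, 'm, 'q, 'k) func" where
  "func_comp G F = \<lparr>OMap = OMap G \<circ> OMap F, AMap = AMap G \<circ> AMap F\<rparr>"

definition is_iso :: "('o, 'm) cat \<Rightarrow> 'm \<Rightarrow> bool" where
  "is_iso C f \<longleftrightarrow> f \<in> Arr C \<and>
     (\<exists>g\<in>Hom C (Cod C f) (Dom C f). g \<cdot>\<^bsub>C\<^esub> f = Idm C (Dom C f) \<and> f \<cdot>\<^bsub>C\<^esub> g = Idm C (Cod C f))"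

definition naturally_isomorphic ::
    "('o, 'm) cat \<Rightarrow> ('p, 'n) cat \<Rightarrow> ('o, 'm, 'p, 'n) func \<Rightarrow> ('o, 'm, 'p, 'n) func \<Rightarrow> bool" where
  "naturally_isomorphic C D F G \<longleftrightarrow>
     is_functor C D F \<and> is_functor C D G \<and>
     (\<exists>\<eta>. (\<forall>X\<in>Obj C. \<eta> X \<in> Hom D (OMap F X) (OMap G X) \<and> is_iso D (\<eta> X)) \<and>
          (\<forall>f\<in>Arr C. \<eta> (Cod C f) \<cdot>\<^bsub>D\<^esub> AMap F f = AMap G f \<cdot>\<^bsub>D\<^esub> \<eta> (Dom C f)))"

definition is_terminal :: "('o, 'm) cat \<Rightarrow> 'o \<Rightarrow> bool" where
  "is_terminal C t \<longleftrightarrow> t \<in> Obj C \<and> (\<forall>T\<in>Obj C. \<exists>!u. u \<in> Hom C T t)"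

definition is_product :: "('o, 'm) cat \<Rightarrow> 'i set \<Rightarrow> ('i \<Rightarrow> 'o) \<Rightarrow> 'o \<Rightarrow> ('i \<Rightarrow> 'm) \<Rightarrow> bool" where
  "is_product C I A P p \<longleftrightarrow>
     P \<in> Obj C \<and> (\<forall>i\<in>I. p i \<in> Hom C P (A i)) \<and>
     (\<forall>T\<in>Obj C. \<forall>a. (\<forall>i\<in>I. a i \<in> Hom C T (A i)) \<longrightarrow>
        (\<exists>!u. u \<in> Hom C T P \<and> (\<forall>i\<in>I. p i \<cdot>\<^bsub>C\<^esub> u = a i)))"

(* The square  f p = g q  is cartesian; q is the base change of f along g. *)
definition is_pullback :: "('o, 'm) cat \<Rightarrow> 'm \<Rightarrow> 'm \<Rightarrow> 'm \<Rightarrow> 'm \<Rightarrow> bool" where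
  "is_pullback C f g p q \<longleftrightarrow>
     f \<in> Arr C \<and> g \<in> Arr C \<and> Cod C f = Cod C g \<and>
     p \<in> Arr C \<and> q \<in> Arr C \<and> Dom C p = Dom C q \<and>
     Cod C p = Dom C f \<and> Cod C q = Dom C g \<and> f \<cdot>\<^bsub>C\<^esub> p = g \<cdot>\<^bsub>C\<^esub> q \<and>
     (\<forall>T\<in>Obj C. \<forall>a\<in>Hom C T (Dom C f). \<forall>b\<in>Hom C T (Dom C g). f \<cdot>\<^bsub>C\<^esub> a = g \<cdot>\<^bsub>C\<^esub> b \<longrightarrow>
        (\<exists>!u. u \<in> Hom C T (Dom C p) \<and> p \<cdot>\<^bsub>C\<^esub> u = a \<and> q \<cdot>\<^bsub>C\<^esub> u = b))"

definition is_coequalizer :: "('o, 'm) cat \<Rightarrow> 'm \<Rightarrow> 'm \<Rightarrow> 'm \<Rightarrow> bool" where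
  "is_coequalizer C p q f \<longleftrightarrow>
     p \<in> Arr C \<and> q \<in> Arr C \<and> Dom C p = Dom C q \<and> Cod C p = Cod C q \<and>
     f \<in> Arr C \<and> Dom C f = Cod C p \<and> f \<cdot>\<^bsub>C\<^esub> p = f \<cdot>\<^bsub>C\<^esub> q \<and>
     (\<forall>h\<in>Arr C. Dom C h = Cod C p \<longrightarrow> h \<cdot>\<^bsub>C\<^esub> p = h \<cdot>\<^bsub>C\<^esub> q \<longrightarrow>
        (\<exists>!u. u \<in> Hom C (Cod C f) (Cod C h) \<and> u \<cdot>\<^bsub>C\<^esub> f = h))"

definition is_effective_epi :: "('o, 'm) cat \<Rightarrow> 'm \<Rightarrow> bool" where
  "is_effective_epi C f \<longleftrightarrow> (\<exists>p q. is_pullback C f f p q \<and> is_coequalizer C p q f)"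

definition is_cone ::
    "('i, 'a) cat \<Rightarrow> ('o, 'm) cat \<Rightarrow> ('i, 'a, 'o, 'm) func \<Rightarrow> 'o \<Rightarrow> ('i \<Rightarrow> 'm) \<Rightarrow> bool" where
  "is_cone J C E T a \<longleftrightarrow>
     T \<in> Obj C \<and> (\<forall>i\<in>Obj J. a i \<in> Hom C T (OMap E i)) \<and>
     (\<forall>e\<in>Arr J. AMap E e \<cdot>\<^bsub>C\<^esub> a (Dom J e) = a (Cod J e))"

definition is_limit ::
    "('i, 'a) cat \<Rightarrow> ('o, 'm) cat \<Rightarrow> ('i, 'a, 'o, 'm) func \<Rightarrow> 'o \<Rightarrow> ('i \<Rightarrow> 'm) \<Rightarrow> bool" where
  "is_limit J C E L l \<longleftrightarrow>
     is_cone J C E L l \<and>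
     (\<forall>T a. is_cone J C E T a \<longrightarrow>
        (\<exists>!u. u \<in> Hom C T L \<and> (\<forall>i\<in>Obj J. l i \<cdot>\<^bsub>C\<^esub> u = a i)))"

(* Every finite category is isomorphic to one whose objects and arrows are natural numbers,
   so it suffices to quantify over index categories of this type. *)
definition has_finite_limits :: "('o, 'm) cat \<Rightarrow> bool" where
  "has_finite_limits C \<longleftrightarrow>
     (\<forall>(J :: (nat, nat) cat) E. finite (Obj J) \<longrightarrow> finite (Arr J) \<longrightarrow> is_functor J C E \<longrightarrow>
        (\<exists>L l. is_limit J C E L l))"


section \<open>Categories with covers, descent categories, geometric functors\<close>

definition is_subcategory :: "('o, 'm) cat \<Rightarrow> 'm set \<Rightarrow> bool" where
  "is_subcategory C S \<longleftrightarrow>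
     S \<subseteq> Arr C \<and>
     (\<forall>f\<in>S. Idm C (Dom C f) \<in> S \<and> Idm C (Cod C f) \<in> S) \<and>
     (\<forall>f\<in>S. \<forall>g\<in>S. Cod C f = Dom C g \<longrightarrow> g \<cdot>\<^bsub>C\<^esub> f \<in> S)"

definition right_cancellative :: "('o, 'm) cat \<Rightarrow> 'm set \<Rightarrow> bool" where
  "right_cancellative C S \<longleftrightarrow>
     (\<forall>f\<in>Arr C. \<forall>g\<in>Arr C. Cod C f = Dom C g \<longrightarrow> f \<in> S \<longrightarrow> g \<cdot>\<^bsub>C\<^esub> f \<in> S \<longrightarrow> g \<in> S)"

definition category_with_covers :: "('o, 'm) cat \<Rightarrow> 'm set \<Rightarrow> bool" where
  "category_with_covers C S \<longleftrightarrow>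
     is_category C \<and> is_subcategory C S \<and>
     (\<exists>t. is_terminal C t \<and> (\<forall>f\<in>Arr C. Cod C f = t \<longrightarrow> f \<in> S)) \<and>
     (\<forall>f\<in>S. \<forall>g\<in>Arr C. Cod C g = Cod C f \<longrightarrow> (\<exists>p q. is_pullback C f g p q)) \<and>
     (\<forall>f g p q. f \<in> S \<longrightarrow> is_pullback C f g p q \<longrightarrow> q \<in> S) \<and>
     right_cancellative C S \<and>
     (\<forall>f\<in>S. is_effective_epi C f)"

definition descent_category :: "('o, 'm) cat \<Rightarrow> 'm set \<Rightarrow> bool" where
  "descent_category D S \<longleftrightarrow>
     is_category D \<and> has_finite_limits D \<and> is_subcategory D S \<and>
     (\<exists>t. is_terminal D t \<and> Idm D t \<in> S) \<and>
     (\<forall>f g p q. f \<in> S \<longrightarrow> is_pullback D f g p q \<longrightarrow> q \<in> S) \<and>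
     right_cancellative D S \<and>
     (\<forall>f\<in>S. is_effective_epi D f)"

definition geometric_functor ::
    "('o, 'm) cat \<Rightarrow> 'm set \<Rightarrow> ('p, 'n) cat \<Rightarrow> 'n set \<Rightarrow> ('o, 'm, 'p, 'n) func \<Rightarrow> bool" where
  "geometric_functor C S D S' F \<longleftrightarrow>
     is_functor C D F \<and>
     (\<forall>f\<in>S. AMap F f \<in> S') \<and>
     (\<forall>f g p q. f \<in> S \<longrightarrow> is_pullback C f g p q \<longrightarrow>
        is_pullback D (AMap F f) (AMap F g) (AMap F p) (AMap F q))"

definition reflects_covers ::
    "('o, 'm) cat \<Rightarrow> 'm set \<Rightarrow> 'n set \<Rightarrow> ('o, 'm, 'p, 'n) func \<Rightarrow> bool" where
  "reflects_covers C S S' F \<longleftrightarrow> (\<forall>f\<in>Arr C. AMap F f \<in> S' \<longrightarrow> f \<in> S)"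

(* Not implied by geometric_functor: every constant functor to a descent category is geometric.
   A functor that acts on group objects must preserve terminal objects, since the unit of F(G)
   has domain F( * ). *)
definition preserves_terminal ::
    "('o, 'm) cat \<Rightarrow> ('p, 'n) cat \<Rightarrow> ('o, 'm, 'p, 'n) func \<Rightarrow> bool" where
  "preserves_terminal C D F \<longleftrightarrow> (\<forall>t. is_terminal C t \<longrightarrow> is_terminal D (OMap F t))"


section \<open>Simplicial objects\<close>

(* Faces are indexed by their target: face X n i is d_i : X_(n+1) -> X_n for i <= n+1, and
   degen X n i is s_i : X_n -> X_(n+1) for i <= n.  Values at other indices are irrelevant;
   simplicial objects differing only there are isomorphic. *)
record ('o, 'm) sobj =
  level :: "nat \<Rightarrow> 'o"
  face :: "nat \<Rightarrow> nat \<Rightarrow> 'm"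
  degen :: "nat \<Rightarrow> nat \<Rightarrow> 'm"

definition is_sobj :: "('o, 'm) cat \<Rightarrow> ('o, 'm) sobj \<Rightarrow> bool" where
  "is_sobj C X \<longleftrightarrow>
     (\<forall>n. level X n \<in> Obj C) \<and>
     (\<forall>n i. i \<le> Suc n \<longrightarrow> face X n i \<in> Hom C (level X (Suc n)) (level X n)) \<and>
     (\<forall>n i. i \<le> n \<longrightarrow> degen X n i \<in> Hom C (level X n) (level X (Suc n))) \<and>
     (\<forall>n i j. i < j \<longrightarrow> j \<le> Suc (Suc n) \<longrightarrow>
        face X n i \<cdot>\<^bsub>C\<^esub> face X (Suc n) j = face X n (j - 1) \<cdot>\<^bsub>C\<^esub> face X (Suc n) i) \<and>
     (\<forall>n i j. i \<le> j \<longrightarrow> j \<le> n \<longrightarrow>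
        degen X (Suc n) i \<cdot>\<^bsub>C\<^esub> degen X n j = degen X (Suc n) (Suc j) \<cdot>\<^bsub>C\<^esub> degen X n i) \<and>
     (\<forall>n i j. i < j \<longrightarrow> j \<le> Suc n \<longrightarrow>
        face X (Suc n) i \<cdot>\<^bsub>C\<^esub> degen X (Suc n) j = degen X n (j - 1) \<cdot>\<^bsub>C\<^esub> face X n i) \<and>
     (\<forall>n i j. i = j \<or> i = Suc j \<longrightarrow> j \<le> n \<longrightarrow>
        face X n i \<cdot>\<^bsub>C\<^esub> degen X n j = Idm C (level X n)) \<and>
     (\<forall>n i j. Suc j < i \<longrightarrow> i \<le> Suc (Suc n) \<longrightarrow>
        face X (Suc n) i \<cdot>\<^bsub>C\<^esub> degen X (Suc n) j = degen X n j \<cdot>\<^bsub>C\<^esub> face X n (i - 1))"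

(* An arrow of sC records its source, its target and its components. *)
type_synonym ('o, 'm) sarr = "('o, 'm) sobj \<times> ('o, 'm) sobj \<times> (nat \<Rightarrow> 'm)"

definition comps :: "('o, 'm) sarr \<Rightarrow> nat \<Rightarrow> 'm" where
  "comps f = snd (snd f)"

definition is_smap ::
    "('o, 'm) cat \<Rightarrow> ('o, 'm) sobj \<Rightarrow> ('o, 'm) sobj \<Rightarrow> (nat \<Rightarrow> 'm) \<Rightarrow> bool" where
  "is_smap C X Y f \<longleftrightarrow>
     (\<forall>n. f n \<in> Hom C (level X n) (level Y n)) \<and>
     (\<forall>n i. i \<le> Suc n \<longrightarrow> f n \<cdot>\<^bsub>C\<^esub> face X n i = face Y n i \<cdot>\<^bsub>C\<^esub> f (Suc n)) \<and>
     (\<forall>n i. i \<le> n \<longrightarrow> f (Suc n) \<cdot>\<^bsub>C\<^esub> degen X n i = degen Y n i \<cdot>\<^bsub>C\<^esub> f n)"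

definition sCat :: "('o, 'm) cat \<Rightarrow> (('o, 'm) sobj, ('o, 'm) sarr) cat" where
  "sCat C =
     \<lparr>Obj = {X. is_sobj C X},
      Arr = {(X, Y, f). is_sobj C X \<and> is_sobj C Y \<and> is_smap C X Y f},
      Dom = fst, Cod = fst \<circ> snd,
      Idm = (\<lambda>X. (X, X, \<lambda>n. Idm C (level X n))),
      Cmp = (\<lambda>g f. (fst f, fst (snd g), \<lambda>n. comps g n \<cdot>\<^bsub>C\<^esub> comps f n))\<rparr>"

(* The functor between categories of simplicial objects induced by F. *)
definition sFun ::
    "('o, 'm, 'p, 'n) func \<Rightarrow> (('o, 'm) sobj, ('o, 'm) sarr, ('p, 'n) sobj, ('p, 'n) sarr) func"
  where
  "sFun F =
     (let ob = (\<lambda>X. \<lparr>level = (\<lambda>n. OMap F (level X n)), face = (\<lambda>n i. AMap F (face X n i)),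
                     degen = (\<lambda>n i. AMap F (degen X n i))\<rparr>)
      in \<lparr>OMap = ob, AMap = (\<lambda>(X, Y, f). (ob X, ob Y, \<lambda>n. AMap F (f n)))\<rparr>)"


section \<open>Matching objects and fibrations\<close>

(* An m-simplex of the standard n-simplex is a monotone map [m] -> [n], written as the list of
   its m+1 values; d_i deletes the i-th entry and s_i repeats it.  A simplicial subset of the
   standard n-simplex is thus a set of such lists. *)
definition del_nth :: "nat \<Rightarrow> nat list \<Rightarrow> nat list" where
  "del_nth i \<kappa> = take i \<kappa> @ drop (Suc i) \<kappa>"

definition dup_nth :: "nat \<Rightarrow> nat list \<Rightarrow> nat list" where
  "dup_nth i \<kappa> = take (Suc i) \<kappa> @ drop i \<kappa>"

definition std_simplex :: "nat \<Rightarrow> nat list set" where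
  "std_simplex n = {\<kappa>. \<kappa> \<noteq> [] \<and> sorted \<kappa> \<and> set \<kappa> \<subseteq> {..n}}"

definition bdry :: "nat \<Rightarrow> nat list set" where
  "bdry n = {\<kappa> \<in> std_simplex n. set \<kappa> \<noteq> {..n}}"

definition horn :: "nat \<Rightarrow> nat \<Rightarrow> nat list set" where
  "horn n k = {\<kappa> \<in> std_simplex n. insert k (set \<kappa>) \<noteq> {..n}}"

definition dim :: "nat list \<Rightarrow> nat" where
  "dim \<kappa> = length \<kappa> - 1"

(* Simplicial maps from K to the simplicial set Hom(T, X): the T-points of X^K = hom(K, X). *)
definition is_point ::
    "('o, 'm) cat \<Rightarrow> nat list set \<Rightarrow> ('o, 'm) sobj \<Rightarrow> 'o \<Rightarrow> (nat list \<Rightarrow> 'm) \<Rightarrow> bool" where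
  "is_point C K X T x \<longleftrightarrow>
     (\<forall>\<kappa>\<in>K. x \<kappa> \<in> Hom C T (level X (dim \<kappa>))) \<and>
     (\<forall>\<kappa>\<in>K. \<forall>m i. dim \<kappa> = Suc m \<longrightarrow> i \<le> Suc m \<longrightarrow>
        x (del_nth i \<kappa>) = face X m i \<cdot>\<^bsub>C\<^esub> x \<kappa>) \<and>
     (\<forall>\<kappa>\<in>K. \<forall>m i. dim \<kappa> = m \<longrightarrow> i \<le> m \<longrightarrow>
        x (dup_nth i \<kappa>) = degen X m i \<cdot>\<^bsub>C\<^esub> x \<kappa>)"

(* The operator X_n -> X_m attached to a monotone map \<kappa> : [m] -> [n].  By the Yoneda lemma it is
   the value at \<kappa> of the unique point of X^(Delta^n) over X_n taking the fundamental simplex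
   [0,...,n] to the identity. *)
definition sop :: "('o, 'm) cat \<Rightarrow> ('o, 'm) sobj \<Rightarrow> nat \<Rightarrow> nat list \<Rightarrow> 'm" where
  "sop C X n \<kappa> = (THE a. \<exists>\<xi>. is_point C (std_simplex n) X (level X n) \<xi> \<and>
                     \<xi> [0..<Suc n] = Idm C (level X n) \<and> a = \<xi> \<kappa>)"

(* T-points of the fibre product X^K x_(Y^K) Y_n, for K contained in the standard n-simplex. *)
definition is_rel_point ::
    "('o, 'm) cat \<Rightarrow> nat list set \<Rightarrow> nat \<Rightarrow> ('o, 'm) sarr \<Rightarrow> 'o \<Rightarrow> (nat list \<Rightarrow> 'm) \<Rightarrow> 'm \<Rightarrow> bool"
  where
  "is_rel_point C K n f T x y \<longleftrightarrow>
     is_point C K (Dom (sCat C) f) T x \<and> y \<in> Hom C T (level (Cod (sCat C) f) n) \<and>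
     (\<forall>\<kappa>\<in>K. comps f (dim \<kappa>) \<cdot>\<^bsub>C\<^esub> x \<kappa> = sop C (Cod (sCat C) f) n \<kappa> \<cdot>\<^bsub>C\<^esub> y)"

(* L represents X^K x_(Y^K) Y_n.  The fibre product is treated as a single limit: in a category
   with covers X^K and Y^K need not exist separately (e.g. for hypercovers). *)
definition is_rel_matching ::
    "('o, 'm) cat \<Rightarrow> nat list set \<Rightarrow> nat \<Rightarrow> ('o, 'm) sarr \<Rightarrow> 'o \<Rightarrow> (nat list \<Rightarrow> 'm) \<Rightarrow> 'm \<Rightarrow> bool"
  where
  "is_rel_matching C K n f L x y \<longleftrightarrow>
     L \<in> Obj C \<and> is_rel_point C K n f L x y \<and>
     (\<forall>T\<in>Obj C. \<forall>x' y'. is_rel_point C K n f T x' y' \<longrightarrow>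
        (\<exists>!u. u \<in> Hom C T L \<and> (\<forall>\<kappa>\<in>K. x \<kappa> \<cdot>\<^bsub>C\<^esub> u = x' \<kappa>) \<and> y \<cdot>\<^bsub>C\<^esub> u = y'))"

(* X^K x_(Y^K) Y_n exists and the canonical map X_n -> X^K x_(Y^K) Y_n is a cover. *)
definition rel_matching_cover ::
    "('o, 'm) cat \<Rightarrow> 'm set \<Rightarrow> nat list set \<Rightarrow> nat \<Rightarrow> ('o, 'm) sarr \<Rightarrow> bool" where
  "rel_matching_cover C S K n f \<longleftrightarrow>
     (\<exists>L x y. is_rel_matching C K n f L x y \<and>
        (\<exists>c\<in>S. c \<in> Hom C (level (Dom (sCat C) f) n) L \<and>
           (\<forall>\<kappa>\<in>K. x \<kappa> \<cdot>\<^bsub>C\<^esub> c = sop C (Dom (sCat C) f) n \<kappa>) \<and> y \<cdot>\<^bsub>C\<^esub> c = comps f n))"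

definition kan_fibration :: "('o, 'm) cat \<Rightarrow> 'm set \<Rightarrow> ('o, 'm) sarr \<Rightarrow> bool" where
  "kan_fibration C S f \<longleftrightarrow> f \<in> Arr (sCat C) \<and>
     (\<forall>n k. 1 \<le> n \<longrightarrow> k \<le> n \<longrightarrow> rel_matching_cover C S (horn n k) n f)"

definition covering_fibration :: "('o, 'm) cat \<Rightarrow> 'm set \<Rightarrow> ('o, 'm) sarr \<Rightarrow> bool" where
  "covering_fibration C S f \<longleftrightarrow> kan_fibration C S f \<and> comps f 0 \<in> S"

definition hypercover :: "('o, 'm) cat \<Rightarrow> 'm set \<Rightarrow> ('o, 'm) sarr \<Rightarrow> bool" where
  "hypercover C S f \<longleftrightarrow> f \<in> Arr (sCat C) \<and> (\<forall>m. rel_matching_cover C S (bdry m) m f)"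

definition inf_groupoid :: "('o, 'm) cat \<Rightarrow> 'm set \<Rightarrow> ('o, 'm) sobj \<Rightarrow> bool" where
  "inf_groupoid C S X \<longleftrightarrow> X \<in> Obj (sCat C) \<and>
     (\<exists>pt f. is_terminal (sCat C) pt \<and> f \<in> Hom (sCat C) X pt \<and> kan_fibration C S f)"

definition Gpd :: "('o, 'm) cat \<Rightarrow> 'm set \<Rightarrow> (('o, 'm) sobj, ('o, 'm) sarr) cat" where
  "Gpd C S = full_subcategory (sCat C) (inf_groupoid C S)"


section \<open>Group objects\<close>

(* Products and terminal objects are only determined up to isomorphism, so a group object
   carries the product G x G and the terminal object on which its operations are defined. *)
record ('o, 'm) grp =
  Gob :: 'o
  Gsq :: 'o
  Gfst :: 'm
  Gsnd :: 'm
  Gpt :: 'o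
  Gmult :: 'm
  Gunit :: 'm
  Ginv :: 'm

definition gpair :: "('o, 'm) cat \<Rightarrow> ('o, 'm) grp \<Rightarrow> 'm \<Rightarrow> 'm \<Rightarrow> 'm" where
  "gpair C G a b = (THE u. u \<in> Hom C (Dom C a) (Gsq G) \<and> Gfst G \<cdot>\<^bsub>C\<^esub> u = a \<and> Gsnd G \<cdot>\<^bsub>C\<^esub> u = b)"

(* Multiplication, unit and inverse on generalized elements T -> G. *)
definition gmul :: "('o, 'm) cat \<Rightarrow> ('o, 'm) grp \<Rightarrow> 'm \<Rightarrow> 'm \<Rightarrow> 'm" where
  "gmul C G a b = Gmult G \<cdot>\<^bsub>C\<^esub> gpair C G a b"

definition gone :: "('o, 'm) cat \<Rightarrow> ('o, 'm) grp \<Rightarrow> 'o \<Rightarrow> 'm" where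
  "gone C G T = Gunit G \<cdot>\<^bsub>C\<^esub> (THE u. u \<in> Hom C T (Gpt G))"

definition is_group_object :: "('o, 'm) cat \<Rightarrow> ('o, 'm) grp \<Rightarrow> bool" where
  "is_group_object C G \<longleftrightarrow>
     Gob G \<in> Obj C \<and>
     is_product C UNIV (\<lambda>_::bool. Gob G) (Gsq G) (\<lambda>b. if b then Gfst G else Gsnd G) \<and>
     is_terminal C (Gpt G) \<and>
     Gmult G \<in> Hom C (Gsq G) (Gob G) \<and>
     Gunit G \<in> Hom C (Gpt G) (Gob G) \<and>
     Ginv G \<in> Hom C (Gob G) (Gob G) \<and>
     (\<forall>T\<in>Obj C. \<forall>a\<in>Hom C T (Gob G). \<forall>b\<in>Hom C T (Gob G). \<forall>c\<in>Hom C T (Gob G).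
        gmul C G (gmul C G a b) c = gmul C G a (gmul C G b c)) \<and>
     (\<forall>T\<in>Obj C. \<forall>a\<in>Hom C T (Gob G).
        gmul C G (gone C G T) a = a \<and> gmul C G a (gone C G T) = a \<and>
        gmul C G (Ginv G \<cdot>\<^bsub>C\<^esub> a) a = gone C G T \<and> gmul C G a (Ginv G \<cdot>\<^bsub>C\<^esub> a) = gone C G T)"

type_synonym ('o, 'm) garr = "('o, 'm) grp \<times> ('o, 'm) grp \<times> 'm"

definition Grp :: "('o, 'm) cat \<Rightarrow> (('o, 'm) grp, ('o, 'm) garr) cat" where
  "Grp C =
     \<lparr>Obj = {G. is_group_object C G},
      Arr = {(G, H, f). is_group_object C G \<and> is_group_object C H \<and> f \<in> Hom C (Gob G) (Gob H) \<and>
               f \<cdot>\<^bsub>C\<^esub> Gmult G = gmul C H (f \<cdot>\<^bsub>C\<^esub> Gfst G) (f \<cdot>\<^bsub>C\<^esub> Gsnd G)},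
      Dom = fst, Cod = fst \<circ> snd,
      Idm = (\<lambda>G. (G, G, Idm C (Gob G))),
      Cmp = (\<lambda>g f. (fst f, fst (snd g), snd (snd g) \<cdot>\<^bsub>C\<^esub> snd (snd f)))\<rparr>"

(* F applied to all the structure of a group object. *)
definition grpFun ::
    "('o, 'm, 'p, 'n) func \<Rightarrow> (('o, 'm) grp, ('o, 'm) garr, ('p, 'n) grp, ('p, 'n) garr) func" where
  "grpFun F =
     (let ob = (\<lambda>G. \<lparr>Gob = OMap F (Gob G), Gsq = OMap F (Gsq G),
                     Gfst = AMap F (Gfst G), Gsnd = AMap F (Gsnd G), Gpt = OMap F (Gpt G),
                     Gmult = AMap F (Gmult G), Gunit = AMap F (Gunit G), Ginv = AMap F (Ginv G)\<rparr>)
      in \<lparr>OMap = ob, AMap = (\<lambda>(G, H, f). (ob G, ob H, AMap F f))\<rparr>)"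


section \<open>The functor Wbar\<close>

type_synonym ('o, 'm) sgrp = "(('o, 'm) sobj, ('o, 'm) sarr) grp"

definition glevel :: "('o, 'm) sgrp \<Rightarrow> nat \<Rightarrow> ('o, 'm) grp" where
  "glevel G j = \<lparr>Gob = level (Gob G) j, Gsq = level (Gsq G) j,
                Gfst = comps (Gfst G) j, Gsnd = comps (Gsnd G) j, Gpt = level (Gpt G) j,
                Gmult = comps (Gmult G) j, Gunit = comps (Gunit G) j, Ginv = comps (Ginv G) j\<rparr>"

(* A chosen product G_(n-1) x ... x G_0 with its projections; for n = 0 a terminal object. *)
definition Wprod :: "('o, 'm) cat \<Rightarrow> ('o, 'm) sgrp \<Rightarrow> nat \<Rightarrow> 'o \<times> (nat \<Rightarrow> 'm)" where
  "Wprod C G n = (SOME (P, p). is_product C {..<n} (level (Gob G)) P p)"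

definition Wob :: "('o, 'm) cat \<Rightarrow> ('o, 'm) sgrp \<Rightarrow> nat \<Rightarrow> 'o" where
  "Wob C G n = fst (Wprod C G n)"

definition Wproj :: "('o, 'm) cat \<Rightarrow> ('o, 'm) sgrp \<Rightarrow> nat \<Rightarrow> nat \<Rightarrow> 'm" where
  "Wproj C G n = snd (Wprod C G n)"

(* The arrow T -> Wbar_n G with coordinates (a (n-1), ..., a 0). *)
definition Wtuple ::
    "('o, 'm) cat \<Rightarrow> ('o, 'm) sgrp \<Rightarrow> nat \<Rightarrow> 'o \<Rightarrow> (nat \<Rightarrow> 'm) \<Rightarrow> 'm" where
  "Wtuple C G n T a = (THE u. u \<in> Hom C T (Wob C G n) \<and> (\<forall>j<n. Wproj C G n j \<cdot>\<^bsub>C\<^esub> u = a j))"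

(* In terms of (g_n, ..., g_0) in Wbar_(n+1), the G_j-coordinate of d_i is
     d_(j+i-n) g_(j+1)       for j > n-i,
     (d_0 g_(j+1)) g_j       for j = n-i,
     g_j                     for j < n-i;
   the cases i = 0 and i = n+1 are included, since 0 <= j < n. *)
definition Wface :: "('o, 'm) cat \<Rightarrow> ('o, 'm) sgrp \<Rightarrow> nat \<Rightarrow> nat \<Rightarrow> 'm" where
  "Wface C G n i =
     (let g = Wproj C G (Suc n) in
      Wtuple C G n (Wob C G (Suc n))
        (\<lambda>j. if n < j + i then face (Gob G) j (j + i - n) \<cdot>\<^bsub>C\<^esub> g (Suc j)
             else if j + i = n then gmul C (glevel G j) (face (Gob G) j 0 \<cdot>\<^bsub>C\<^esub> g (Suc j)) (g j)
             else g j))"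

(* In terms of (g_(n-1), ..., g_0) in Wbar_n, the G_j-coordinate of s_i is
     s_(j+i-n-1) g_(j-1)     for j > n-i,
     e                       for j = n-i,
     g_j                     for j < n-i. *)
definition Wdegen :: "('o, 'm) cat \<Rightarrow> ('o, 'm) sgrp \<Rightarrow> nat \<Rightarrow> nat \<Rightarrow> 'm" where
  "Wdegen C G n i =
     (let g = Wproj C G n in
      Wtuple C G (Suc n) (Wob C G n)
        (\<lambda>j. if n < j + i then degen (Gob G) (j - 1) (j + i - n - 1) \<cdot>\<^bsub>C\<^esub> g (j - 1)
             else if j + i = n then gone C (glevel G j) (Wob C G n)
             else g j))"

definition Wbar ::
    "('o, 'm) cat \<Rightarrow> (('o, 'm) sgrp, ('o, 'm) sgrp \<times> ('o, 'm) sgrp \<times> ('o, 'm) sarr,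
                    ('o, 'm) sobj, ('o, 'm) sarr) func" where
  "Wbar C =
     (let ob = (\<lambda>G. \<lparr>level = Wob C G, face = Wface C G, degen = Wdegen C G\<rparr>)
      in \<lparr>OMap = ob,
          AMap = (\<lambda>(G, H, f). (ob G, ob H,
            \<lambda>n. Wtuple C H n (Wob C G n) (\<lambda>j. comps f j \<cdot>\<^bsub>C\<^esub> Wproj C G n j)))\<rparr>)"

end

theory Submission
  imports Defs
begin

text \<open>The matching objects \<open>X\<^sup>K \<times>\<^bsub>Y\<^sup>K\<^esub> Y\<^sub>n\<close> are built by attaching one simplex at a time. Each
 attachment is a pullback along a comparison map of lower dimension, which is a cover, so a geometric functor preserves
 these objects together with their comparison maps; fibrations and hypercovers are thereby preserved and reflected.
 Everything is expressed through generalized elements \<open>T \<rightarrow> X\<^sub>n\<close>, which turn simplicial objects into simplicial sets.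

 For \<open>Wbar G\<close>, the simplices with a given horn are those with one given face whose leading coordinate has a given horn
 in \<open>G\<close>. The comparison maps of \<open>Wbar G\<close> are therefore base changes of those of \<open>G\<close>, which are covers by
 Moore's argument, applied to generalized elements. The image of \<open>Wbar G\<close> consists of products again, and comparing
 products gives the natural isomorphism; it also transports the Kan property to the right-hand side.\<close>

text \<open>A category with covers only guarantees pullbacks of covers, so \<open>X^K\<close> alone
  may be missing and a limit can be formed only where one leg is already known to be a cover. Among
  lower comparison maps a horn can use only those of horns, so every intermediate subset is a cone
  with the same apex, and the step at the apex itself needs the vertex operators of the base to be
  covers. They are when the base is an infinity-groupoid.

  Outside the statements on groups, F need not preserve terminal objects, so the image of the
  terminal base of an infinity-groupoid may fail to be terminal. Its vertex operators stay
  invertible, and since horns are connected this suffices to exchange the base for a terminal one.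

  In D an arrow to the terminal object need not be a cover, hence neither need a projection of a
  product, and Moore's argument does not apply there. It is carried out in C, and the right-hand
  side of the natural isomorphism is an infinity-groupoid because it is isomorphic to an image from
  C.\<close>

notation Cmp ("(_ \<cdot>\<index>/ _)" [66, 65] 65)
  and Hom ("(_ ->\<index>/ _)" [56, 56] 55)

section \<open>Monotone maps as lists: faces, degeneracies, generation by the top simplex\<close>

section \<open>Simplices of the standard simplex\<close>

lemma del_nth_0 [simp]: "del_nth 0 (a # \<mu>) = \<mu>"
 by (simp add: del_nth_def)

lemma del_nth_Suc [simp]: "del_nth (Suc i) (a # \<mu>) = a # del_nth i \<mu>"
 by (simp add: del_nth_def)

lemma dup_nth_0 [simp]: "dup_nth 0 (a # \<mu>) = a # a # \<mu>"
 by (simp add: dup_nth_def)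

lemma dup_nth_Suc [simp]: "dup_nth (Suc i) (a # \<mu>) = a # dup_nth i \<mu>"
 by (simp add: dup_nth_def)

lemma del_nth_map: "del_nth i (map f \<mu>) = map f (del_nth i \<mu>)"
 by (simp add: del_nth_def take_map drop_map)

lemma dup_nth_map: "dup_nth i (map f \<mu>) = map f (dup_nth i \<mu>)"
 by (simp add: dup_nth_def take_map drop_map)

lemma length_del_nth [simp]: "i < length \<mu> ==> length (del_nth i \<mu>) = length \<mu> - 1"
 by (simp add: del_nth_def)

lemma length_dup_nth [simp]: "i < length \<mu> ==> length (dup_nth i \<mu>) = Suc (length \<mu>)"
 by (simp add: dup_nth_def)

lemma set_del_nth: "set (del_nth i \<mu>) \<subseteq> set \<mu>"
 unfolding del_nth_def by (auto dest: in_set_takeD in_set_dropD)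

lemma set_dup_nth: "set (dup_nth i \<mu>) \<subseteq> set \<mu>"
 unfolding dup_nth_def by (auto dest: in_set_takeD in_set_dropD)

lemma sorted_del_nth: "sorted \<mu> ==> sorted (del_nth i \<mu>)"
proof (induction \<mu> arbitrary: i)
 case (Cons a \<mu>)
 then show ?case
  using set_del_nth by (cases i) fastforce+
qed (simp add: del_nth_def)

lemma sorted_dup_nth: "sorted \<mu> ==> sorted (dup_nth i \<mu>)"
proof (induction \<mu> arbitrary: i)
 case (Cons a \<mu>)
 then show ?case
  using set_dup_nth by (cases i) fastforce+
qed (simp add: dup_nth_def)

lemma std_simplex_del_nth:
 assumes "\<mu> \<in> std_simplex n" "dim \<mu> = Suc m" "i \<le> Suc m"
 shows "del_nth i \<mu> \<in> std_simplex n"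
proof -
 have "length (del_nth i \<mu>) \<noteq> 0" using assms by (simp add: dim_def)
 then show ?thesis
  using assms set_del_nth[of i \<mu>] sorted_del_nth[of \<mu> i] unfolding std_simplex_def by auto
qed

lemma std_simplex_dup_nth:
 assumes "\<mu> \<in> std_simplex n" "i \<le> dim \<mu>"
 shows "dup_nth i \<mu> \<in> std_simplex n"
proof -
 have "i < length \<mu>" using assms by (cases \<mu>) (auto simp: std_simplex_def dim_def)
 then have "length (dup_nth i \<mu>) \<noteq> 0" by simp
 then show ?thesis
  using assms set_dup_nth[of i \<mu>] sorted_dup_nth[of \<mu> i] unfolding std_simplex_def by auto
qed

lemma dim_del_nth: "dim \<mu> = Suc m ==> i \<le> Suc m ==> dim (del_nth i \<mu>) = m"
 by (simp add: dim_def)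

lemma dim_dup_nth: "\<mu> \<noteq> [] ==> i \<le> dim \<mu> ==> dim (dup_nth i \<mu>) = Suc (dim \<mu>)"
 by (cases \<mu>) (simp_all add: dim_def)

lemma dim_Cons [simp]: "dim (a # \<mu>) = length \<mu>"
 by (simp add: dim_def)

lemma dim_map [simp]: "dim (map f \<mu>) = dim \<mu>"
 by (simp add: dim_def)

lemma dim_upt [simp]: "dim [0..<Suc n] = n"
 by (simp add: dim_def)

lemma upt_in_std_simplex: "[0..<Suc n] \<in> std_simplex n"
 by (auto simp: std_simplex_def simp del: upt_Suc)

lemma finite_chain_eq_upt:
 assumes "sorted \<mu>" "distinct \<mu>" "set \<mu> = {..n}"
 shows "\<mu> = [0..<Suc n]"
proof -
 have "set \<mu> = set [0..<Suc n]" unfolding set_upt assms(3) by auto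
 then show ?thesis using sorted_distinct_set_unique assms(1,2) sorted_upt distinct_upt by blast
qed

text \<open>Locates the slot into which a missing vertex \<open>v\<close> fits, which exhibits the
  simplex as a face of \<open>as @ v # bs\<close>.\<close>

lemma sorted_split:
 fixes v :: nat
 assumes "sorted \<mu>" "v \<notin> set \<mu>"
 obtains as bs where "\<mu> = as @ bs" "\<forall>a\<in>set as. a < v" "\<forall>b\<in>set bs. v < b"
proof -
 have "\<exists>as bs. \<mu> = as @ bs \<and> (\<forall>a\<in>set as. a < v) \<and> (\<forall>b\<in>set bs. v < b)"
  using assms
 proof (induction \<mu>)
  case (Cons a \<mu>)
  show ?case
  proof (cases "a < v")
   case True
   from Cons obtain as bs where
    "\<mu> = as @ bs" "\<forall>a\<in>set as. a < v" "\<forall>b\<in>set bs. v < b" by auto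
   then show ?thesis using True by (intro exI[of _ "a # as"] exI[of _ bs]) auto
  next
   case False
   then show ?thesis using Cons.prems by (intro exI[of _ "[]"] exI[of _ "a # \<mu>"]) force
  qed
 qed auto
 then show thesis using that by blast
qed

text \<open>Equal entries of a sorted list are adjacent, so a simplex with a repeated vertex is a
  degeneracy.\<close>

lemma sorted_not_distinct_split:
 assumes "sorted (\<mu> :: nat list)" "\<not> distinct \<mu>"
 obtains as a bs where "\<mu> = as @ a # a # bs"
proof -
 have "\<exists>as a bs. \<mu> = as @ a # a # bs"
  using assms
 proof (induction \<mu>)
  case (Cons a \<mu>)
  show ?case
  proof (cases "distinct \<mu>")
   case True
   then have "a \<in> set \<mu>" using Cons.prems by simp
   then obtain b \<mu>' where k: "\<mu> = b # \<mu>'" by (cases \<mu>) auto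
   then have "a = b" using Cons.prems \<open>a \<in> set \<mu>\<close> by force
   then show ?thesis using k by (metis append_Nil)
  next
   case False
   then show ?thesis using Cons by (metis append_Cons sorted_simps(2))
  qed
 qed simp
 then show thesis using that by blast
qed

lemma del_nth_append_Cons [simp]: "del_nth (length as) (as @ v # bs) = as @ bs"
 by (simp add: del_nth_def)

lemma dup_nth_append_Cons [simp]: "dup_nth (length as) (as @ v # bs) = as @ v # v # bs"
 by (simp add: dup_nth_def)

text \<open>A list with a repeated vertex is a degeneracy of a shorter one, and a list with a
  missing vertex is a face of a longer one. This yields the uniqueness half of the Yoneda
  lemma.\<close>

lemma std_simplex_generated [consumes 1, case_names top del dup]:
 assumes "\<mu> \<in> std_simplex n"
  and top: "P [0..<Suc n]"
  and del: "\<And>\<mu> m i. \<mu> \<in> std_simplex n ==> dim \<mu> = Suc m ==> i \<le> Suc m ==> P \<mu> ==> P (del_nth i \<mu>)"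
  and dup: "\<And>\<mu> i. \<mu> \<in> std_simplex n ==> i \<le> dim \<mu> ==> P \<mu> ==> P (dup_nth i \<mu>)"
 shows "P \<mu>"
 using assms(1)
\<comment> \<open>Inserting a missing vertex lengthens the list by one. The weight 2 on missing
  vertices makes the measure drop in that case as well.\<close>
proof (induction "2 * (Suc n - card (set \<mu>)) + length \<mu>" arbitrary: \<mu> rule: less_induct)
 case less
 have s: "sorted \<mu>" "set \<mu> \<subseteq> {..n}" "\<mu> \<noteq> []" using less.prems by (auto simp: std_simplex_def)
 consider "\<not> distinct \<mu>" | "distinct \<mu>" "set \<mu> = {..n}" | v where "distinct \<mu>" "v \<le> n" "v \<notin> set \<mu>"
  using s(2) by auto
 then show ?case
 proof cases
  case 1
  then obtain as a bs where k: "\<mu> = as @ a # a # bs"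
   using s(1) sorted_not_distinct_split by blast
  let ?l = "as @ a # bs"
  have l: "?l \<in> std_simplex n" using less.prems by (auto simp: k std_simplex_def sorted_append)
  have "P ?l" using less.hyps[OF _ l] by (simp add: k)
  then show ?thesis using dup[OF l, of "length as"] by (simp add: k dim_def)
 next
  case 2
  then show ?thesis using top finite_chain_eq_upt s(1) by simp
 next
  case 3
  obtain as bs where k: "\<mu> = as @ bs" "\<forall>a\<in>set as. a < v" "\<forall>b\<in>set bs. v < b"
   using sorted_split[OF s(1) 3(3)] by blast
  let ?l = "as @ v # bs"
  have l: "?l \<in> std_simplex n"
   using less.prems k(2,3) \<open>v \<le> n\<close>
   by (auto simp: k(1) std_simplex_def sorted_append intro: less_imp_le order.strict_implies_order)
  have sl: "set ?l = insert v (set \<mu>)" by (auto simp: k(1))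
  have le: "card (insert v (set \<mu>)) \<le> Suc n"
   using card_mono[of "{..n}" "insert v (set \<mu>)"] s(2) 3(2) by simp
  have "card (set ?l) = Suc (card (set \<mu>))" using 3(3) by (simp add: sl del: set_append)
  then have "2 * (Suc n - card (set ?l)) + length ?l < 2 * (Suc n - card (set \<mu>)) + length \<mu>"
   using le 3(3) by (simp add: k(1))
  from less.hyps[OF this l] have "P ?l" .
  moreover have "dim ?l = Suc (length \<mu> - 1)" using s(3) by (simp add: k(1) dim_def)
  ultimately show ?thesis using del[OF l, of "length \<mu> - 1" "length as"] s(3)
   by (simp add: k(1))
 qed
qed


section \<open>Operators attached to monotone maps, constructed through the decalage\<close>

section \<open>Simplicial sets and their operators\<close>

record 'a sset =
 pts :: "nat => 'a set"
 fc :: "nat => nat => 'a => 'a"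
 dg :: "nat => nat => 'a => 'a"

locale simplicial_set =
 fixes X :: "'a sset"
 assumes fc_pts: "\<And>n i x. i \<le> Suc n ==> x \<in> pts X (Suc n) ==> fc X n i x \<in> pts X n"
  and dg_pts: "\<And>n i x. i \<le> n ==> x \<in> pts X n ==> dg X n i x \<in> pts X (Suc n)"
  and fc_fc: "\<And>n i j x. i < j ==> j \<le> Suc (Suc n) ==> x \<in> pts X (Suc (Suc n)) ==>
   fc X n i (fc X (Suc n) j x) = fc X n (j - 1) (fc X (Suc n) i x)"
  and dg_dg: "\<And>n i j x. i \<le> j ==> j \<le> n ==> x \<in> pts X n ==>
   dg X (Suc n) i (dg X n j x) = dg X (Suc n) (Suc j) (dg X n i x)"
  and fc_dg_less: "\<And>n i j x. i < j ==> j \<le> Suc n ==> x \<in> pts X (Suc n) ==>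
   fc X (Suc n) i (dg X (Suc n) j x) = dg X n (j - 1) (fc X n i x)"
  and fc_dg_id: "\<And>n i j x. i = j \<or> i = Suc j ==> j \<le> n ==> x \<in> pts X n ==>
   fc X n i (dg X n j x) = x"
  and fc_dg_greater: "\<And>n i j x. Suc j < i ==> i \<le> Suc (Suc n) ==> x \<in> pts X (Suc n) ==>
   fc X (Suc n) i (dg X (Suc n) j x) = dg X n j (fc X n (i - 1) x)"

text \<open>The set-level counterpart of \<open>is_point\<close>, which becomes an instance of it
  through \<open>hset\<close>.\<close>

definition spoint :: "nat list set => 'a sset => (nat list => 'a) => bool" where
 "spoint K X x \<longleftrightarrow>
   (\<forall>\<mu>\<in>K. x \<mu> \<in> pts X (dim \<mu>)) \<and>
   (\<forall>\<mu>\<in>K. \<forall>m i. dim \<mu> = Suc m --> i \<le> Suc m --> x (del_nth i \<mu>) = fc X m i (x \<mu>)) \<and>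
   (\<forall>\<mu>\<in>K. \<forall>m i. dim \<mu> = m --> i \<le> m --> x (dup_nth i \<mu>) = dg X m i (x \<mu>))"

definition ssmap :: "'a sset => 'b sset => (nat => 'a => 'b) => bool" where
 "ssmap X Y \<phi> \<longleftrightarrow>
   (\<forall>n. \<forall>x\<in>pts X n. \<phi> n x \<in> pts Y n) \<and>
   (\<forall>n i. i \<le> Suc n --> (\<forall>x\<in>pts X (Suc n). \<phi> n (fc X n i x) = fc Y n i (\<phi> (Suc n) x))) \<and>
   (\<forall>n i. i \<le> n --> (\<forall>x\<in>pts X n. \<phi> (Suc n) (dg X n i x) = dg Y n i (\<phi> n x)))"

text \<open>The decalage: \<open>d_0\<close> and \<open>s_0\<close> are dropped and the remaining
  operators renumbered. Its \<open>n\<close>-simplices are the \<open>(n + 1)\<close>-simplices of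
  X, viewed as cones with apex the vertex 0, and \<open>d_0\<close> becomes a simplicial map to X
  that takes a cone to its base.\<close>

definition dec :: "'a sset => 'a sset" where
 "dec X = \<lparr>pts = (\<lambda>n. pts X (Suc n)), fc = (\<lambda>n i. fc X (Suc n) (Suc i)),
      dg = (\<lambda>n i. dg X (Suc n) (Suc i))\<rparr>"

lemma spoint_pts: "spoint K X x ==> \<mu> \<in> K ==> x \<mu> \<in> pts X (dim \<mu>)"
 and spoint_del: "spoint K X x ==> \<mu> \<in> K ==> dim \<mu> = Suc m ==> i \<le> Suc m ==>
  x (del_nth i \<mu>) = fc X m i (x \<mu>)"
 and spoint_dup: "spoint K X x ==> \<mu> \<in> K ==> i \<le> dim \<mu> ==>
  x (dup_nth i \<mu>) = dg X (dim \<mu>) i (x \<mu>)"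
 by (auto simp: spoint_def)

lemma spoint_subset: "spoint K X x ==> K' \<subseteq> K ==> spoint K' X x"
 unfolding spoint_def by (meson subset_iff)

lemma simplicial_set_dec: "simplicial_set X ==> simplicial_set (dec X)"
proof -
 assume "simplicial_set X"
 then interpret simplicial_set X .
 show ?thesis
 proof
  fix n i j x
  assume "i < j" "j \<le> Suc (Suc n)" "x \<in> pts (dec X) (Suc (Suc n))"
  then show "fc (dec X) n i (fc (dec X) (Suc n) j x) = fc (dec X) n (j - 1) (fc (dec X) (Suc n) i x)"
   using fc_fc[of "Suc i" "Suc j" "Suc n" x] by (simp add: dec_def)
 next
  fix n i j x
  assume "i < j" "j \<le> Suc n" "x \<in> pts (dec X) (Suc n)"
  then show "fc (dec X) (Suc n) i (dg (dec X) (Suc n) j x) = dg (dec X) n (j - 1) (fc (dec X) n i x)"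
   using fc_dg_less[of "Suc i" "Suc j" "Suc n" x] by (simp add: dec_def)
 next
  fix n i j x
  assume "Suc j < i" "i \<le> Suc (Suc n)" "x \<in> pts (dec X) (Suc n)"
  then show "fc (dec X) (Suc n) i (dg (dec X) (Suc n) j x) = dg (dec X) n j (fc (dec X) n (i - 1) x)"
   using fc_dg_greater[of "Suc j" "Suc i" "Suc n" x] by (simp add: dec_def)
 qed (auto simp: dec_def fc_pts dg_pts fc_dg_id intro!: dg_dg)
qed

text \<open>The empty list has \<open>dim\<close> 0 and is fixed by \<open>dup_nth\<close>, so
  duplication would not raise its dimension; \<open>[] \<notin> K\<close> rules this out.\<close>

lemma ssmap_spoint: "[] \<notin> K ==> ssmap X Y \<phi> ==> spoint K X x ==> spoint K Y (\<lambda>\<mu>. \<phi> (dim \<mu>) (x \<mu>))"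
 unfolding spoint_def
proof (intro conjI ballI allI impI; elim conjE)
 fix \<mu> m i
 assume "[] \<notin> K" "ssmap X Y \<phi>" "\<mu> \<in> K" "dim \<mu> = m" "i \<le> m" "\<forall>\<mu>\<in>K. x \<mu> \<in> pts X (dim \<mu>)"
  "\<forall>\<mu>\<in>K. \<forall>m i. dim \<mu> = m --> i \<le> m --> x (dup_nth i \<mu>) = dg X m i (x \<mu>)"
 then show "\<phi> (dim (dup_nth i \<mu>)) (x (dup_nth i \<mu>)) = dg Y m i (\<phi> (dim \<mu>) (x \<mu>))"
  using dim_dup_nth[of \<mu> i] by (cases "\<mu> = []") (auto simp: ssmap_def)
qed (auto simp: ssmap_def dim_del_nth)

lemma spoint_unique:
 assumes "\<mu> \<in> std_simplex n" "spoint (std_simplex n) X x" "spoint (std_simplex n) X y"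
  and "x [0..<Suc n] = y [0..<Suc n]"
 shows "x \<mu> = y \<mu>"
 using assms(1)
proof (induction rule: std_simplex_generated)
 case top
 show ?case using assms by simp
next
 case (del \<mu> m i)
 then show ?case using assms(2,3) by (simp add: spoint_del)
next
 case (dup \<mu> i)
 then show ?case using assms(2,3) by (simp add: spoint_dup)
qed

text \<open>The operators are constructed by induction on the dimension: the simplex on vertices
 \<open>0, \<dots>, n + 1\<close> is the cone with apex \<open>0\<close> over the simplex on \<open>1, \<dots>, n + 1\<close>, and the simplices
 meeting the apex are simplices of the decalage.\<close>

context
 fixes X :: "'a sset" and v :: 'a and \<xi>0 \<xi>1 :: "nat list => 'a"
begin

text \<open>\<open>\<xi>0\<close> gives the values on the base, \<open>\<xi>1\<close> those on the
  cones over it, \<open>v\<close> that at the apex. A doubled leading 0 must be sent to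
  \<open>s_0\<close> of the rest. The value at \<open>[]\<close> is a placeholder.\<close>

primrec cone :: "nat list => 'a" where
 "cone [] = v"
| "cone (a # r) =
  (if a \<noteq> 0 then \<xi>0 (map (\<lambda>u. u - 1) (a # r)) else if r = [] then v
   else if hd r = 0 then dg X (length r - 1) 0 (cone r) else \<xi>1 (map (\<lambda>u. u - 1) r))"

lemma cone_nonzero: "\<mu> \<noteq> [] ==> 0 \<notin> set \<mu> ==> cone \<mu> = \<xi>0 (map (\<lambda>u. u - 1) \<mu>)"
 by (cases \<mu>) auto

text \<open>Two compatibilities make the pieces fit: \<open>d_0\<close> of a cone is its base
  (\<open>face0\<close>), and all edges issuing from the apex have the same initial vertex
  (\<open>apex\<close>). The other identities are inherited from \<open>\<xi>0\<close> and
  \<open>\<xi>1\<close>, or come from the commutation of \<open>s_0\<close> with the other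
  operators.\<close>

lemma spoint_cone:
 assumes X: "simplicial_set X" and v: "v \<in> pts X 0"
  and \<xi>0: "spoint K0 X \<xi>0" and \<xi>1: "spoint K0 (dec X) \<xi>1"
  and face0: "\<And>\<nu>. \<nu> \<in> K0 ==> fc X (dim \<nu>) 0 (\<xi>1 \<nu>) = \<xi>0 \<nu>"
  and apex: "\<And>j. [j] \<in> K0 ==> fc X 0 1 (\<xi>1 [j]) = v"
  and K: "\<And>\<mu>. \<mu> \<in> K ==> sorted \<mu> \<and> \<mu> \<noteq> []"
  and K_tl: "\<And>a r. a # r \<in> K ==> r \<noteq> [] ==> r \<in> K"
  and K_K0: "\<And>\<mu>. \<mu> \<in> K ==> 0 \<notin> set \<mu> ==> map (\<lambda>u. u - 1) \<mu> \<in> K0"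
 shows "spoint K X cone"
proof -
 interpret simplicial_set X by (rule X)
 let ?p = "map (\<lambda>u::nat. u - 1)"
 have "\<mu> \<in> K ==> cone \<mu> \<in> pts X (dim \<mu>) \<and>
   (\<forall>m i. dim \<mu> = Suc m --> i \<le> Suc m --> cone (del_nth i \<mu>) = fc X m i (cone \<mu>)) \<and>
   (\<forall>m i. dim \<mu> = m --> i \<le> m --> cone (dup_nth i \<mu>) = dg X m i (cone \<mu>))" for \<mu>
 proof (induction \<mu>)
  case Nil
  then show ?case using K by blast
 next
  case (Cons a r)
  consider "a \<noteq> 0" | "a = 0" "r = []" | "a = 0" "r \<noteq> []" "hd r = 0" | "a = 0" "r \<noteq> []" "hd r \<noteq> 0"
   by blast
  then show ?case
  proof cases
   case 1
   then have nz: "0 \<notin> set (a # r)" using K[OF Cons.prems] by auto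
   let ?k = "a # r"
   have pk: "?p ?k \<in> K0" using K_K0[OF Cons.prems nz] .
   have c: "cone ?k = \<xi>0 (?p ?k)" using nz cone_nonzero by blast
   have "cone (del_nth i ?k) = fc X m i (cone ?k)" if "dim ?k = Suc m" "i \<le> Suc m" for m i
   proof -
    have "length (del_nth i ?k) \<noteq> 0" using that by (simp add: dim_def)
    moreover have "0 \<notin> set (del_nth i ?k)" using nz set_del_nth by blast
    ultimately have "cone (del_nth i ?k) = \<xi>0 (?p (del_nth i ?k))" using cone_nonzero by blast
    also have "\<dots> = fc X m i (\<xi>0 (?p ?k))"
     unfolding del_nth_map[symmetric] using spoint_del[OF \<xi>0 pk] that by (simp only: dim_map)
    finally show ?thesis using c by simp
   qed
   moreover have "cone (dup_nth i ?k) = dg X (dim ?k) i (cone ?k)" if "i \<le> dim ?k" for i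
   proof -
    have "length (dup_nth i ?k) \<noteq> 0" using that by (subst length_dup_nth) (simp_all add: dim_def)
    moreover have "0 \<notin> set (dup_nth i ?k)" using nz set_dup_nth by blast
    ultimately have "cone (dup_nth i ?k) = \<xi>0 (?p (dup_nth i ?k))" using cone_nonzero by blast
    also have "\<dots> = dg X (dim ?k) i (\<xi>0 (?p ?k))"
     unfolding dup_nth_map[symmetric] using spoint_dup[OF \<xi>0 pk] that by (simp only: dim_map)
    finally show ?thesis using c by simp
   qed
   moreover have "cone ?k \<in> pts X (dim ?k)"
    using spoint_pts[OF \<xi>0 pk] c by (simp only: dim_map)
   ultimately show ?thesis by blast
  next
   case 2
   then show ?thesis using v by simp
  next
   case 3
   then have rK: "r \<in> K" using K_tl[OF Cons.prems] by blast
   note IH = Cons.IH[OF rK]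
   obtain r' where r: "r = 0 # r'" using 3 by (cases r) auto
   have c: "cone (a # r) = dg X (length r') 0 (cone r)" using 3 r by simp
   have cr: "cone r \<in> pts X (length r')" using IH r by simp
   have "cone (del_nth i (a # r)) = fc X m i (cone (a # r))"
    if m: "dim (a # r) = Suc m" "i \<le> Suc m" for m i
   proof -
    have m': "m = length r'" using m r by simp
    consider "i = 0" | "i = 1" | l where "i = Suc (Suc l)" by (metis One_nat_def not0_implies_Suc)
    then show ?thesis
    proof cases
     case 1
     then show ?thesis using c cr m' fc_dg_id by simp
    next
     case 2
     then show ?thesis using c cr m' fc_dg_id r 3 by simp
    next
     case (3 l)
     then obtain q where q: "m = Suc q" using m(2) by (cases m) auto
     have "cone (del_nth (Suc l) r) = fc X q (Suc l) (cone r)"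
      using conjunct1[OF conjunct2[OF IH], rule_format, of q "Suc l"] r m' q 3 m(2) by (simp only: dim_Cons list.size)
     moreover have "hd (del_nth (Suc l) r) = 0" "del_nth (Suc l) r \<noteq> []" using r by auto
     moreover have "length (del_nth (Suc l) r) - 1 = q" using m m' q r 3 by simp
     ultimately have "cone (del_nth i (a # r)) = dg X q 0 (fc X q (Suc l) (cone r))"
      using 3 \<open>a = 0\<close> by (simp only: del_nth_Suc cone.simps) simp
     also have "\<dots> = fc X (Suc q) i (dg X (Suc q) 0 (cone r))"
      using fc_dg_greater[of 0 i q "cone r"] cr m' q 3 m(2) by simp
     finally show ?thesis using c m' q by simp
    qed
   qed
   moreover have "cone (dup_nth i (a # r)) = dg X (dim (a # r)) i (cone (a # r))"
    if i: "i \<le> dim (a # r)" for i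
   proof (cases i)
    case 0
    then show ?thesis using c 3 r by simp
   next
    case (Suc l)
    have "cone (dup_nth l r) = dg X (length r') l (cone r)"
     using IH i Suc r by simp
    moreover have "hd (dup_nth l r) = 0" "dup_nth l r \<noteq> []" using r by (cases l; simp)+
    moreover have "length (dup_nth l r) - 1 = length r" using i Suc r by simp
    ultimately have "cone (dup_nth i (a # r)) = dg X (length r) 0 (dg X (length r') l (cone r))"
     using \<open>a = 0\<close> Suc by (simp only: dup_nth_Suc cone.simps) simp
    also have "\<dots> = dg X (length r) (Suc l) (dg X (length r') 0 (cone r))"
     using dg_dg[of 0 l "length r'" "cone r"] cr i Suc r by simp
    finally show ?thesis using c Suc by simp
   qed
   moreover have "cone (a # r) \<in> pts X (dim (a # r))"
    using c cr r dg_pts by simp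
   ultimately show ?thesis by blast
  next
   case 4
   then have rK: "r \<in> K" using K_tl[OF Cons.prems] by blast
   have nz: "0 \<notin> set r" using K[OF rK] 4 by (cases r) auto
   have pk: "?p r \<in> K0" using K_K0[OF rK nz] .
   have c: "cone (a # r) = \<xi>1 (?p r)" using 4 by simp
   have "cone (del_nth i (a # r)) = fc X m i (cone (a # r))"
    if m: "dim (a # r) = Suc m" "i \<le> Suc m" for m i
   proof (cases i)
    case 0
    have "dim (?p r) = m" using m 4(2) by (simp add: dim_def)
    then show ?thesis using face0[OF pk] c cone_nonzero[OF 4(2) nz] 0 by simp
   next
    case (Suc l)
    show ?thesis
    proof (cases m)
     case 0
     \<comment> \<open>Deleting \<open>b\<close> from the edge \<open>[0, b]\<close> leaves the apex
       alone, so the hypothesis \<open>apex\<close> is used here.\<close>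
     then obtain b where b: "r = [b]" using m by (cases r) auto
     then have "l = 0" using Suc m 0 by simp
     then show ?thesis using c apex[of "b - 1"] pk b 0 Suc 4 by simp
    next
     case (Suc q)
     have d: "dim (?p r) = Suc q" using m 4(2) Suc by (simp add: dim_def)
     have ne: "del_nth l r \<noteq> []" using m \<open>i = Suc l\<close> Suc
      by (metis length_del_nth dim_Cons Suc_le_lessD diff_Suc_1 list.size(3) nat.distinct(1) not_less_eq_eq)
     moreover have "hd (del_nth l r) \<noteq> 0"
      using ne nz set_del_nth[of l r] hd_in_set[OF ne] by (metis subsetD)
     ultimately have "cone (del_nth i (a # r)) = \<xi>1 (?p (del_nth l r))"
      using 4 \<open>i = Suc l\<close> by simp
     also have "\<dots> = fc (dec X) q l (\<xi>1 (?p r))"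
      unfolding del_nth_map[symmetric] using spoint_del[OF \<xi>1 pk d] m \<open>i = Suc l\<close> Suc by simp
     finally show ?thesis using c \<open>i = Suc l\<close> Suc by (simp add: dec_def)
    qed
   qed
   moreover have "cone (dup_nth i (a # r)) = dg X (dim (a # r)) i (cone (a # r))"
    if i: "i \<le> dim (a # r)" for i
   proof (cases i)
    case 0
    then show ?thesis using c 4 by simp
   next
    case (Suc l)
    have d: "l \<le> dim (?p r)" "Suc (dim (?p r)) = length r" using i Suc 4(2) by (auto simp: dim_def)
    have ne: "dup_nth l r \<noteq> []" using 4(2) by (cases r; cases l) auto
    moreover have "hd (dup_nth l r) \<noteq> 0"
     using ne nz set_dup_nth[of l r] hd_in_set[OF ne] by (metis subsetD)
    ultimately have "cone (dup_nth i (a # r)) = \<xi>1 (?p (dup_nth l r))"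
     using 4 Suc by simp
    also have "\<dots> = dg (dec X) (dim (?p r)) l (\<xi>1 (?p r))"
     unfolding dup_nth_map[symmetric] using spoint_dup[OF \<xi>1 pk d(1)] .
    finally show ?thesis using c Suc d(2) by (simp add: dec_def)
   qed
   moreover have "cone (a # r) \<in> pts X (dim (a # r))"
   proof -
    have "Suc (dim (?p r)) = length r" using 4(2) by (simp add: dim_def)
    then show ?thesis using spoint_pts[OF \<xi>1 pk] c by (simp add: dec_def)
   qed
   ultimately show ?thesis by blast
  qed
 qed
 then show ?thesis unfolding spoint_def by blast
qed

end

text \<open>The existence half of the Yoneda lemma, without which the description in
  \<open>sop\<close> need not denote anything. An \<open>(n + 1)\<close>-simplex of X is an
  \<open>n\<close>-simplex of the decalage. The point it spans there supplies the cones,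
  \<open>d_0\<close> of these the base, and the initial vertex of an edge the apex.\<close>

lemma ex_spoint:
 assumes "simplicial_set X" "x \<in> pts X n"
 shows "\<exists>\<xi>. spoint (std_simplex n) X \<xi> \<and> \<xi> [0..<Suc n] = x"
 using assms
proof (induction n arbitrary: X x)
 case 0
 \<comment> \<open>In dimension 0 the base is empty, so the two functions passed for
   \<open>\<xi>0\<close> and \<open>\<xi>1\<close> are placeholders.\<close>
 have "spoint (std_simplex 0) X (cone X x (\<lambda>_. x) (\<lambda>_. x))"
  by (rule spoint_cone[where ?K0.0 = "{}"]) (use 0 in \<open>auto simp: spoint_def std_simplex_def neq_Nil_conv\<close>)
 moreover have "cone X x (\<lambda>_. x) (\<lambda>_. x) [0..<Suc 0] = x" by simp
 ultimately show ?case by blast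
next
 case (Suc n)
 interpret simplicial_set X by (rule Suc.prems)
 have dX: "simplicial_set (dec X)" by (rule simplicial_set_dec) (rule Suc.prems)
 obtain \<xi>1 where \<xi>1: "spoint (std_simplex n) (dec X) \<xi>1" "\<xi>1 [0..<Suc n] = x"
  using Suc.IH[OF dX, of x] Suc.prems by (auto simp: dec_def)
 have dm: "ssmap (dec X) X (\<lambda>m. fc X m 0)"
  unfolding ssmap_def
 proof (intro conjI allI ballI impI)
  fix m i z assume "i \<le> Suc m" "z \<in> pts (dec X) (Suc m)"
  then show "fc X m 0 (fc (dec X) m i z) = fc X m i (fc X (Suc m) 0 z)"
   using fc_fc[of 0 "Suc i" m z] by (simp add: dec_def)
 next
  fix m i z assume "i \<le> m" "z \<in> pts (dec X) m"
  then show "fc X (Suc m) 0 (dg (dec X) m i z) = dg X m i (fc X m 0 z)"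
   using fc_dg_less[of 0 "Suc i" m z] by (simp add: dec_def)
 qed (auto simp: dec_def fc_pts)
 define \<xi>0 where "\<xi>0 = (\<lambda>\<nu>. fc X (dim \<nu>) 0 (\<xi>1 \<nu>))"
 have \<xi>0: "spoint (std_simplex n) X \<xi>0"
  unfolding \<xi>0_def by (rule ssmap_spoint[OF _ dm \<xi>1(1)]) (auto simp: std_simplex_def)
 define v where "v = fc X 0 1 (\<xi>1 [0])"
 have p1: "\<xi>1 [j] \<in> pts X 1" if "j \<le> n" for j
  using spoint_pts[OF \<xi>1(1), of "[j]"] that by (auto simp: dec_def std_simplex_def)
 \<comment> \<open>The edges \<open>\<xi>1 [0]\<close> and \<open>\<xi>1 [j]\<close> are the faces
   \<open>d_2\<close> and \<open>d_1\<close> of the triangle \<open>\<xi>1 [0, j]\<close>, so they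
   share their initial vertex.\<close>
 have apex: "fc X 0 1 (\<xi>1 [j]) = v" if "j \<le> n" for j
 proof -
  have e: "[0, j] \<in> std_simplex n" using that by (auto simp: std_simplex_def)
  have "\<xi>1 (del_nth 0 [0, j]) = fc X 1 1 (\<xi>1 [0, j])" "\<xi>1 (del_nth 1 [0, j]) = fc X 1 2 (\<xi>1 [0, j])"
   using spoint_del[OF \<xi>1(1) e, of 0 0] spoint_del[OF \<xi>1(1) e, of 0 1]
   by (simp_all add: dec_def numeral_2_eq_2)
  moreover have "\<xi>1 [0, j] \<in> pts X 2"
   using spoint_pts[OF \<xi>1(1) e] by (simp add: dec_def numeral_2_eq_2)
  ultimately show ?thesis unfolding v_def using fc_fc[of 1 2 0 "\<xi>1 [0, j]"]
   by (simp add: numeral_2_eq_2)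
 qed
 let ?c = "cone X v \<xi>0 \<xi>1"
 have "spoint (std_simplex (Suc n)) X ?c"
 proof (rule spoint_cone[OF Suc.prems(1) _ \<xi>0 \<xi>1(1)])
  show "v \<in> pts X 0" unfolding v_def using p1[of 0] fc_pts[of 1 0] by simp
  fix \<mu> assume k: "\<mu> \<in> std_simplex (Suc n)" "0 \<notin> set \<mu>"
  then show "map (\<lambda>u. u - 1) \<mu> \<in> std_simplex n"
   by (force simp: std_simplex_def sorted_map intro: sorted_wrt_mono_rel[of \<mu> "(\<le>)"])
 qed (use apex in \<open>auto simp: \<xi>0_def std_simplex_def\<close>)
 moreover have "?c [0..<Suc (Suc n)] = x"
 proof -
  have "[0..<Suc (Suc n)] = 0 # map Suc [0..<Suc n]"
   by (metis map_Suc_upt upt_conv_Cons zero_less_Suc)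
  moreover have "map Suc [0..<Suc n] \<noteq> []" "hd (map Suc [0..<Suc n]) \<noteq> 0"
   by (simp, metis hd_map map_is_Nil_conv nat.distinct(1) upt_conv_Cons zero_less_Suc list.distinct(1))
  moreover have "map (\<lambda>u. u - 1) (map Suc [0..<Suc n]) = [0..<Suc n]"
   by (simp add: comp_def del: upt_Suc)
  ultimately show ?thesis using \<xi>1(2) by (simp del: upt_Suc)
 qed
 ultimately show ?case by blast
qed

text \<open>Given the same shape as \<open>sop\<close>, so that \<open>sop\<close> is literally its
  value at an identity arrow.\<close>

definition sact :: "'a sset => nat => nat list => 'a => 'a" where
 "sact X n \<mu> x =
   (THE a. \<exists>\<xi>. spoint (std_simplex n) X \<xi> \<and> \<xi> [0..<Suc n] = x \<and> a = \<xi> \<mu>)"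

lemma sact_eq:
 assumes "spoint (std_simplex n) X \<xi>" "\<mu> \<in> std_simplex n"
 shows "sact X n \<mu> (\<xi> [0..<Suc n]) = \<xi> \<mu>"
 unfolding sact_def
proof (rule the_equality)
 fix a assume "\<exists>\<xi>'. spoint (std_simplex n) X \<xi>' \<and> \<xi>' [0..<Suc n] = \<xi> [0..<Suc n] \<and> a = \<xi>' \<mu>"
 then show "a = \<xi> \<mu>" using spoint_unique[OF assms(2) _ assms(1)] by blast
qed (use assms in blast)

definition lcomp :: "nat list => nat list => nat list" where
 "lcomp \<mu> \<nu> = map ((!) \<mu>) \<nu>"

text \<open>A simplex of the standard simplex factors through every other one whose vertices include
  its own, so closure under all operators is a condition on vertex sets alone.\<close>

definition ssubset :: "nat => nat list set => bool" where
 "ssubset n K \<longleftrightarrow> K \<subseteq> std_simplex n \<and>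
   (\<forall>\<mu>\<in>K. \<forall>\<mu>'\<in>std_simplex n. set \<mu>' \<subseteq> set \<mu> --> \<mu>' \<in> K)"

lemma ssubset_std_simplex [simp]: "ssubset n (std_simplex n)"
 by (simp add: ssubset_def)

lemma lcomp_upt [simp]: "lcomp \<mu> [0..<length \<mu>] = \<mu>"
 by (simp add: lcomp_def map_nth)

lemma lcomp_in_std_simplex:
 assumes "\<mu> \<in> std_simplex n" "\<nu> \<in> std_simplex (dim \<mu>)"
 shows "lcomp \<mu> \<nu> \<in> std_simplex n" "set (lcomp \<mu> \<nu>) \<subseteq> set \<mu>"
proof -
 have l: "v < length \<mu>" if "v \<in> set \<nu>" for v
  using assms that by (cases \<mu>) (force simp: std_simplex_def)+
 then show *: "set (lcomp \<mu> \<nu>) \<subseteq> set \<mu>" by (auto simp: lcomp_def)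
 have "sorted \<nu>" "sorted \<mu>" using assms by (auto simp: std_simplex_def)
 then have "sorted (lcomp \<mu> \<nu>)" unfolding lcomp_def sorted_map
  by (rule_tac sorted_wrt_mono_rel[of \<nu> "(\<le>)"]) (auto simp: l sorted_nth_mono)
 then show "lcomp \<mu> \<nu> \<in> std_simplex n"
  using * assms unfolding std_simplex_def lcomp_def by auto
qed

lemma ssubset_lcomp:
 "ssubset n K ==> \<mu> \<in> K ==> \<nu> \<in> std_simplex (dim \<mu>) ==> lcomp \<mu> \<nu> \<in> K"
 using lcomp_in_std_simplex unfolding ssubset_def by blast

lemma spoint_lcomp:
 assumes "ssubset n K" "\<mu> \<in> K" "spoint K X x"
 shows "spoint (std_simplex (dim \<mu>)) X (\<lambda>\<nu>. x (lcomp \<mu> \<nu>))"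
proof -
 have d: "lcomp \<mu> \<nu> \<in> K" "dim (lcomp \<mu> \<nu>) = dim \<nu>" if "\<nu> \<in> std_simplex (dim \<mu>)" for \<nu>
  using ssubset_lcomp[OF assms(1,2) that] by (auto simp: lcomp_def)
 show ?thesis
  unfolding spoint_def
 proof (intro conjI ballI allI impI)
  fix \<nu> assume "\<nu> \<in> std_simplex (dim \<mu>)"
  then show "x (lcomp \<mu> \<nu>) \<in> pts X (dim \<nu>)"
   using spoint_pts[OF assms(3) d(1)] d(2) by metis
 next
  fix \<nu> m i assume t: "\<nu> \<in> std_simplex (dim \<mu>)" "dim \<nu> = Suc m" "i \<le> Suc m"
  then show "x (lcomp \<mu> (del_nth i \<nu>)) = fc X m i (x (lcomp \<mu> \<nu>))"
   using spoint_del[OF assms(3) d(1)[OF t(1)]] d(2)[OF t(1)]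
   by (simp add: lcomp_def del_nth_map)
 next
  fix \<nu> m i assume t: "\<nu> \<in> std_simplex (dim \<mu>)" "dim \<nu> = m" "i \<le> m"
  then show "x (lcomp \<mu> (dup_nth i \<nu>)) = dg X m i (x (lcomp \<mu> \<nu>))"
   using spoint_dup[OF assms(3) d(1)[OF t(1)], of i] d(2)[OF t(1)]
   by (simp add: lcomp_def dup_nth_map)
 qed
qed

lemma std_simplex_upt_dim: "\<mu> \<in> std_simplex n ==> [0..<Suc (dim \<mu>)] = [0..<length \<mu>]"
 by (cases \<mu>) (auto simp: std_simplex_def)

text \<open>Restricted along \<open>\<mu>\<close>, the point \<open>x\<close> becomes a point of a
  full standard simplex, and such a point is spanned by its top value, here
  \<open>x \<mu>\<close>.\<close>

lemma spoint_sact: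
 assumes "ssubset n K" "\<mu> \<in> K" "spoint K X x" "\<nu> \<in> std_simplex (dim \<mu>)"
 shows "x (lcomp \<mu> \<nu>) = sact X (dim \<mu>) \<nu> (x \<mu>)"
proof -
 have "\<mu> \<in> std_simplex n" using assms by (auto simp: ssubset_def)
 then show ?thesis
  using sact_eq[OF spoint_lcomp[OF assms(1-3)] assms(4)] std_simplex_upt_dim[of \<mu> n]
  by (simp del: upt_Suc)
qed

context simplicial_set
begin

lemma spoint_std_sact:
 assumes "x \<in> pts X n"
 shows "spoint (std_simplex n) X (\<lambda>\<mu>. sact X n \<mu> x)" and sact_upt: "sact X n [0..<Suc n] x = x"
proof -
 obtain \<xi> where x: "spoint (std_simplex n) X \<xi>" "\<xi> [0..<Suc n] = x"
  using ex_spoint[OF simplicial_set_axioms assms] by blast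
 then have e: "sact X n \<mu> x = \<xi> \<mu>" if "\<mu> \<in> std_simplex n" for \<mu>
  using sact_eq[OF x(1) that] by simp
 then show "sact X n [0..<Suc n] x = x" using upt_in_std_simplex x(2) by metis
 show "spoint (std_simplex n) X (\<lambda>\<mu>. sact X n \<mu> x)"
  using x(1) unfolding spoint_def
  by (simp add: e std_simplex_del_nth std_simplex_dup_nth)
qed

lemma sact_pts: "x \<in> pts X n ==> \<mu> \<in> std_simplex n ==> sact X n \<mu> x \<in> pts X (dim \<mu>)"
 using spoint_pts[OF spoint_std_sact(1)] by blast

lemma sact_lcomp:
 assumes "x \<in> pts X n" "\<mu> \<in> std_simplex n" "\<nu> \<in> std_simplex (dim \<mu>)"
 shows "sact X n (lcomp \<mu> \<nu>) x = sact X (dim \<mu>) \<nu> (sact X n \<mu> x)"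
 using spoint_sact[OF ssubset_std_simplex assms(2) spoint_std_sact(1)[OF assms(1)] assms(3)] .

lemma sact_del_nth:
 "x \<in> pts X n ==> \<mu> \<in> std_simplex n ==> dim \<mu> = Suc m ==> i \<le> Suc m ==>
  sact X n (del_nth i \<mu>) x = fc X m i (sact X n \<mu> x)"
 using spoint_del[OF spoint_std_sact(1)] by blast

lemma sact_dup_nth:
 "x \<in> pts X n ==> \<mu> \<in> std_simplex n ==> i \<le> dim \<mu> ==>
  sact X n (dup_nth i \<mu>) x = dg X (dim \<mu>) i (sact X n \<mu> x)"
 using spoint_dup[OF spoint_std_sact(1)] by blast

text \<open>The image of the point spanned by \<open>x\<close> is again a point, with top value
  \<open>\<phi> n x\<close>, hence the one spanned by that simplex.\<close>

lemma sact_ssmap: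
 assumes "ssmap X Y \<phi>" "x \<in> pts X n" "\<mu> \<in> std_simplex n"
 shows "sact Y n \<mu> (\<phi> n x) = \<phi> (dim \<mu>) (sact X n \<mu> x)"
proof -
 have "spoint (std_simplex n) Y (\<lambda>\<mu>. \<phi> (dim \<mu>) (sact X n \<mu> x))"
  by (rule ssmap_spoint[OF _ assms(1) spoint_std_sact(1)[OF assms(2)]]) (simp add: std_simplex_def)
 from sact_eq[OF this assms(3)] show ?thesis using sact_upt[OF assms(2)] by (simp del: upt_Suc)
qed

end

section \<open>The Yoneda dictionary between simplicial objects and simplicial sets\<close>

section \<open>Categories and simplicial objects through generalized elements\<close>

lemma HomD: "f \<in> Hom C X Y ==> f \<in> Arr C" "f \<in> Hom C X Y ==> Dom C f = X" "f \<in> Hom C X Y ==> Cod C f = Y"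
 by (simp_all add: Hom_def)

locale category =
 fixes C :: "('o, 'm) cat" (structure)
 assumes is_cat: "is_category C"
begin

lemma Hom_Obj: "f \<in> X -> Y ==> X \<in> Obj C" "f \<in> X -> Y ==> Y \<in> Obj C"
 using is_cat by (auto simp: Hom_def is_category_def)

lemma comp_Hom [intro]: "g \<in> Y -> Z ==> f \<in> X -> Y ==> g \<cdot> f \<in> X -> Z"
 using is_cat unfolding is_category_def Hom_def by simp

lemma assoc:
 "h \<in> Z -> W ==> g \<in> Y -> Z ==> f \<in> X -> Y ==> (h \<cdot> g) \<cdot> f = h \<cdot> (g \<cdot> f)"
 using is_cat unfolding is_category_def Hom_def by simp

lemma Idm_Hom [intro]: "X \<in> Obj C ==> Idm C X \<in> X -> X"
 using is_cat unfolding is_category_def by simp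

lemma comp_Idm [simp]: "f \<in> X -> Y ==> f \<cdot> Idm C X = f"
 and Idm_comp [simp]: "f \<in> X -> Y ==> Idm C Y \<cdot> f = f"
 using is_cat unfolding is_category_def Hom_def by auto

lemma is_isoI:
 "f \<in> X -> Y ==> g \<in> Y -> X ==> g \<cdot> f = Idm C X ==> f \<cdot> g = Idm C Y ==> is_iso C f"
 unfolding is_iso_def by (intro conjI bexI[of _ g]) (simp_all add: Hom_def)

lemma is_isoE:
 assumes "is_iso C f" "f \<in> X -> Y"
 obtains g where "g \<in> Y -> X" "g \<cdot> f = Idm C X" "f \<cdot> g = Idm C Y" "is_iso C g"
 using assms unfolding is_iso_def Hom_def by auto

lemma pullbackI:
 assumes "f \<in> X -> Z" "g \<in> Y -> Z" "p \<in> P -> X" "q \<in> P -> Y" "f \<cdot> p = g \<cdot> q"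
  and "\<And>T a b. a \<in> T -> X ==> b \<in> T -> Y ==> f \<cdot> a = g \<cdot> b ==>
   \<exists>u\<in>Hom C T P. p \<cdot> u = a \<and> q \<cdot> u = b"
  and "\<And>T u u'. u \<in> T -> P ==> u' \<in> T -> P ==> p \<cdot> u = p \<cdot> u' ==> q \<cdot> u = q \<cdot> u' ==> u = u'"
 shows "is_pullback C f g p q"
 unfolding is_pullback_def
proof (intro conjI ballI impI)
 fix T a b assume "a \<in> T -> (Dom C f)" "b \<in> T -> (Dom C g)" "f \<cdot> a = g \<cdot> b"
 then obtain u where "u \<in> T -> P" "p \<cdot> u = a" "q \<cdot> u = b"
  using assms(6)[of a T b] HomD(2)[OF assms(1)] HomD(2)[OF assms(2)] by auto
 then show "\<exists>!u. u \<in> T -> (Dom C p) \<and> p \<cdot> u = a \<and> q \<cdot> u = b"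
  unfolding HomD(2)[OF assms(3)] by (intro ex1I[of _ u]) (auto intro: assms(7))
qed (use assms(1-5) in \<open>simp_all add: Hom_def\<close>)

lemma pullback_Hom:
 assumes "is_pullback C f g p q"
 shows "f \<in> (Cod C p) -> (Cod C f)" "g \<in> (Cod C q) -> (Cod C f)"
  "p \<in> (Dom C p) -> (Cod C p)" "q \<in> (Dom C p) -> (Cod C q)"
  "f \<cdot> p = g \<cdot> q"
 using assms by (auto simp: is_pullback_def Hom_def)

lemma pullback_lift:
 assumes "is_pullback C f g p q" "a \<in> T -> (Cod C p)" "b \<in> T -> (Cod C q)" "f \<cdot> a = g \<cdot> b"
 obtains u where "u \<in> T -> (Dom C p)" "p \<cdot> u = a" "q \<cdot> u = b"
proof -
 have "T \<in> Obj C" using Hom_Obj assms(2) by blast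
 then have "\<exists>!u. u \<in> T -> (Dom C p) \<and> p \<cdot> u = a \<and> q \<cdot> u = b"
  using assms unfolding is_pullback_def by metis
 then show thesis using that by blast
qed

lemma pullback_unique:
 assumes pb: "is_pullback C f g p q" and u: "u \<in> T -> (Dom C p)" "u' \<in> T -> (Dom C p)"
  and e: "p \<cdot> u = p \<cdot> u'" "q \<cdot> u = q \<cdot> u'"
 shows "u = u'"
proof -
 note h = pullback_Hom[OF pb]
 have 1: "p \<cdot> u \<in> T -> (Dom C f)" "q \<cdot> u \<in> T -> (Dom C g)"
  using h u HomD(2)[OF h(1)] HomD(2)[OF h(2)] by auto
 have 2: "f \<cdot> (p \<cdot> u) = g \<cdot> (q \<cdot> u)"
  using assoc[OF h(1,3) u(1)] assoc[OF h(2,4) u(1)] h(5) by simp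
 have "T \<in> Obj C" using Hom_Obj u by blast
 then have "\<exists>!w. w \<in> T -> (Dom C p) \<and> p \<cdot> w = p \<cdot> u \<and> q \<cdot> w = q \<cdot> u"
  using pb 1 2 unfolding is_pullback_def by blast
 then show ?thesis using u e by metis
qed

lemma pullback_sym: "is_pullback C f g p q ==> is_pullback C g f q p"
proof -
 assume pb: "is_pullback C f g p q"
 note h = pullback_Hom[OF pb]
 show ?thesis
 proof (rule pullbackI[OF h(2,1,4,3) h(5)[symmetric]])
  fix T a b assume "a \<in> T -> (Cod C q)" "b \<in> T -> (Cod C p)" "g \<cdot> a = f \<cdot> b"
  then show "\<exists>u\<in>Hom C T (Dom C p). q \<cdot> u = a \<and> p \<cdot> u = b"
   using pullback_lift[OF pb, of b T a] by metis
 qed (use pullback_unique[OF pb] in blast)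
qed

text \<open>The identity of X is a base change of the identity of Y along any arrow from X to Y. In
  a descent category this spreads identity covers from the terminal object to all objects.\<close>

lemma pullback_id:
 assumes "f \<in> X -> Y"
 shows "is_pullback C (Idm C Y) f f (Idm C X)"
proof (rule pullbackI)
 have "X \<in> Obj C" "Y \<in> Obj C" using Hom_Obj assms by auto
 then show "Idm C Y \<in> Y -> Y" "f \<in> X -> Y" "f \<in> X -> Y" "Idm C X \<in> X -> X"
  using assms by auto
 fix T a b assume "a \<in> T -> Y" "b \<in> T -> X" "Idm C Y \<cdot> a = f \<cdot> b"
 then show "\<exists>u\<in>Hom C T X. f \<cdot> u = a \<and> Idm C X \<cdot> u = b"
  by (intro bexI[of _ b]) simp_all
qed (use assms in simp_all)

text \<open>Makes every isomorphism a base change of an identity, hence a cover.\<close>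

lemma pullback_id_iso:
 assumes "is_iso C f" "f \<in> X -> Y"
 shows "is_pullback C (Idm C Y) (Idm C Y) f f"
proof -
 have o: "X \<in> Obj C" "Y \<in> Obj C" using Hom_Obj assms by auto
 obtain g where g: "g \<in> Y -> X" "g \<cdot> f = Idm C X" "f \<cdot> g = Idm C Y"
  using is_isoE[OF assms] by metis
 show ?thesis
 proof (rule pullbackI)
  show "Idm C Y \<in> Y -> Y" "Idm C Y \<in> Y -> Y" "f \<in> X -> Y" "f \<in> X -> Y"
   using o assms by auto
  fix T a b assume "a \<in> T -> Y" "b \<in> T -> Y" "Idm C Y \<cdot> a = Idm C Y \<cdot> b"
  then show "\<exists>u\<in>Hom C T X. f \<cdot> u = a \<and> f \<cdot> u = b"
   using g assoc[OF assms(2) g(1), of a T] by (intro bexI[of _ "g \<cdot> a"]) auto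
 next
  fix T u u' assume "u \<in> T -> X" "u' \<in> T -> X" "f \<cdot> u = f \<cdot> u'"
  then show "u = u'"
   using g assoc[OF g(1) assms(2)] by (metis Idm_comp)
 qed simp
qed

end

definition hset :: "('o, 'm) cat => ('o, 'm) sobj => 'o => 'm sset" where
 "hset C X T = \<lparr>pts = (\<lambda>n. Hom C T (level X n)), fc = (\<lambda>n i x. face X n i \<cdot>\<^bsub>C\<^esub> x),
         dg = (\<lambda>n i x. degen X n i \<cdot>\<^bsub>C\<^esub> x)\<rparr>"

lemma hset_simps [simp]:
 "pts (hset C X T) n = Hom C T (level X n)"
 "fc (hset C X T) n i x = face X n i \<cdot>\<^bsub>C\<^esub> x"
 "dg (hset C X T) n i x = degen X n i \<cdot>\<^bsub>C\<^esub> x"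
 by (simp_all add: hset_def)

lemma is_point_iff: "is_point C K X T x \<longleftrightarrow> spoint K (hset C X T) x"
 by (simp add: is_point_def spoint_def)

text \<open>The operator arrow is the action on the universal element, so facts about simplicial
  sets turn into facts about arrows.\<close>

lemma sop_eq_sact: "sop C X n \<mu> = sact (hset C X (level X n)) n \<mu> (Idm C (level X n))"
 by (simp add: sop_def sact_def is_point_iff del: upt_Suc)

lemma sobj_level: "is_sobj C X ==> level X n \<in> Obj C"
 and sobj_face: "is_sobj C X ==> i \<le> Suc n ==> face X n i \<in> Hom C (level X (Suc n)) (level X n)"
 and sobj_degen: "is_sobj C X ==> i \<le> n ==> degen X n i \<in> Hom C (level X n) (level X (Suc n))"
 by (simp_all add: is_sobj_def)

lemma sobj_identities:
 "is_sobj C X ==> i < j ==> j \<le> Suc (Suc n) ==>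
  face X n i \<cdot>\<^bsub>C\<^esub> face X (Suc n) j = face X n (j - 1) \<cdot>\<^bsub>C\<^esub> face X (Suc n) i"
 "is_sobj C X ==> i \<le> j ==> j \<le> n ==>
  degen X (Suc n) i \<cdot>\<^bsub>C\<^esub> degen X n j = degen X (Suc n) (Suc j) \<cdot>\<^bsub>C\<^esub> degen X n i"
 "is_sobj C X ==> i < j ==> j \<le> Suc n ==>
  face X (Suc n) i \<cdot>\<^bsub>C\<^esub> degen X (Suc n) j = degen X n (j - 1) \<cdot>\<^bsub>C\<^esub> face X n i"
 "is_sobj C X ==> i = j \<or> i = Suc j ==> j \<le> n ==>
  face X n i \<cdot>\<^bsub>C\<^esub> degen X n j = Idm C (level X n)"
 "is_sobj C X ==> Suc j < i ==> i \<le> Suc (Suc n) ==>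
  face X (Suc n) i \<cdot>\<^bsub>C\<^esub> degen X (Suc n) j = degen X n j \<cdot>\<^bsub>C\<^esub> face X n (i - 1)"
 unfolding is_sobj_def by (elim conjE, (erule allE)+, (erule (1) impE)+, assumption)+

lemma smap_Hom: "is_smap C X Y \<phi> ==> \<phi> n \<in> Hom C (level X n) (level Y n)"
 and smap_face: "is_smap C X Y \<phi> ==> i \<le> Suc n ==> \<phi> n \<cdot>\<^bsub>C\<^esub> face X n i = face Y n i \<cdot>\<^bsub>C\<^esub> \<phi> (Suc n)"
 and smap_degen: "is_smap C X Y \<phi> ==> i \<le> n ==> \<phi> (Suc n) \<cdot>\<^bsub>C\<^esub> degen X n i = degen Y n i \<cdot>\<^bsub>C\<^esub> \<phi> n"
 by (simp_all add: is_smap_def)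

context category
begin

lemma simplicial_set_hset:
 assumes X: "is_sobj C X"
 shows "simplicial_set (hset C X T)"
proof
 note f = sobj_face[OF X] and d = sobj_degen[OF X]
 fix n i j x
 show "fc (hset C X T) n i x \<in> pts (hset C X T) n" if "i \<le> Suc n" "x \<in> pts (hset C X T) (Suc n)"
  using f that by auto
 show "dg (hset C X T) n i x \<in> pts (hset C X T) (Suc n)" if "i \<le> n" "x \<in> pts (hset C X T) n"
  using d that by auto
 show "fc (hset C X T) n i (fc (hset C X T) (Suc n) j x) = fc (hset C X T) n (j - 1) (fc (hset C X T) (Suc n) i x)"
  if h: "i < j" "j \<le> Suc (Suc n)" "x \<in> pts (hset C X T) (Suc (Suc n))"
 proof -
  have "face X n i \<cdot> face X (Suc n) j = face X n (j - 1) \<cdot> face X (Suc n) i"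
   using X h by (simp add: sobj_identities)
  then show ?thesis using h assoc[OF f f, of i n j x T] assoc[OF f f, of "j - 1" n i x T] by simp
 qed
 show "dg (hset C X T) (Suc n) i (dg (hset C X T) n j x) = dg (hset C X T) (Suc n) (Suc j) (dg (hset C X T) n i x)"
  if h: "i \<le> j" "j \<le> n" "x \<in> pts (hset C X T) n"
 proof -
  have "degen X (Suc n) i \<cdot> degen X n j = degen X (Suc n) (Suc j) \<cdot> degen X n i"
   using X h by (simp add: sobj_identities)
  then show ?thesis using h assoc[OF d d, of i n j x T] assoc[OF d d, of "Suc j" n i x T] by simp
 qed
 show "fc (hset C X T) (Suc n) i (dg (hset C X T) (Suc n) j x) = dg (hset C X T) n (j - 1) (fc (hset C X T) n i x)"
  if h: "i < j" "j \<le> Suc n" "x \<in> pts (hset C X T) (Suc n)"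
 proof -
  have "face X (Suc n) i \<cdot> degen X (Suc n) j = degen X n (j - 1) \<cdot> face X n i"
   using X h by (simp add: sobj_identities)
  then show ?thesis using h assoc[OF f d, of i "Suc n" j x T] assoc[OF d f, of "j - 1" n i x T] by simp
 qed
 show "fc (hset C X T) n i (dg (hset C X T) n j x) = x"
  if h: "i = j \<or> i = Suc j" "j \<le> n" "x \<in> pts (hset C X T) n"
 proof -
  have "face X n i \<cdot> degen X n j = Idm C (level X n)"
   using X h by (simp add: sobj_identities)
  then show ?thesis using h assoc[OF f d, of i n j x T] by auto
 qed
 show "fc (hset C X T) (Suc n) i (dg (hset C X T) (Suc n) j x) = dg (hset C X T) n j (fc (hset C X T) n (i - 1) x)"
  if h: "Suc j < i" "i \<le> Suc (Suc n)" "x \<in> pts (hset C X T) (Suc n)"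
 proof -
  have "face X (Suc n) i \<cdot> degen X (Suc n) j = degen X n j \<cdot> face X n (i - 1)"
   using X h by (simp add: sobj_identities)
  then show ?thesis using h assoc[OF f d, of i "Suc n" j x T] assoc[OF d f, of j n "i - 1" x T] by simp
 qed
qed

lemma ssmap_precomp:
 assumes "is_sobj C X" "u \<in> T' -> T"
 shows "ssmap (hset C X T) (hset C X T') (\<lambda>n x. x \<cdot> u)"
 unfolding ssmap_def
 using assms assoc[OF sobj_face[OF assms(1)] _ assms(2)]
  assoc[OF sobj_degen[OF assms(1)] _ assms(2)] by auto

lemma ssmap_postcomp:
 assumes "is_sobj C X" "is_sobj C Y" "is_smap C X Y \<phi>"
 shows "ssmap (hset C X T) (hset C Y T) (\<lambda>n x. \<phi> n \<cdot> x)"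
 unfolding ssmap_def hset_simps
proof (intro conjI allI ballI impI)
 note h = smap_Hom[OF assms(3)]
 fix n x assume "x \<in> T -> (level X n)"
 then show "\<phi> n \<cdot> x \<in> T -> (level Y n)" using h by auto
next
 note h = smap_Hom[OF assms(3)]
 fix n i x assume "i \<le> Suc n" "x \<in> T -> (level X (Suc n))"
 then show "\<phi> n \<cdot> (face X n i \<cdot> x) = face Y n i \<cdot> (\<phi> (Suc n) \<cdot> x)"
  using assoc[OF h sobj_face[OF assms(1)], of i n x] assoc[OF sobj_face[OF assms(2)] h, of i n x]
   smap_face[OF assms(3)] by simp
next
 note h = smap_Hom[OF assms(3)]
 fix n i x assume "i \<le> n" "x \<in> T -> (level X n)"
 then show "\<phi> (Suc n) \<cdot> (degen X n i \<cdot> x) = degen Y n i \<cdot> (\<phi> n \<cdot> x)"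
  using assoc[OF h sobj_degen[OF assms(1)], of i n x] assoc[OF sobj_degen[OF assms(2)] h, of i n x]
   smap_degen[OF assms(3)] by simp
qed

lemma sop_Hom:
 assumes "is_sobj C X" "\<mu> \<in> std_simplex n"
 shows "sop C X n \<mu> \<in> (level X n) -> (level X (dim \<mu>))"
 using simplicial_set.sact_pts[OF simplicial_set_hset[OF assms(1)], of "Idm C (level X n)" "level X n" n \<mu>]
  assms sobj_level[OF assms(1)] unfolding sop_eq_sact by auto

text \<open>Precomposition with \<open>x\<close> is a map of simplicial sets that takes the
  universal element to \<open>x\<close>.\<close>

lemma sact_hset:
 assumes "is_sobj C X" "\<mu> \<in> std_simplex n" "x \<in> T -> (level X n)"
 shows "sact (hset C X T) n \<mu> x = sop C X n \<mu> \<cdot> x"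
 using simplicial_set.sact_ssmap[OF simplicial_set_hset[OF assms(1)] ssmap_precomp[OF assms(1,3)], of "Idm C (level X n)" n \<mu>]
  assms sobj_level[OF assms(1)] unfolding sop_eq_sact by auto

lemma sop_upt: "is_sobj C X ==> sop C X n [0..<Suc n] = Idm C (level X n)"
 using simplicial_set.sact_upt[OF simplicial_set_hset, of X "Idm C (level X n)" "level X n" n] sobj_level
 unfolding sop_eq_sact by (auto simp del: upt_Suc)

lemma sop_lcomp:
 assumes "is_sobj C X" "\<mu> \<in> std_simplex n" "\<nu> \<in> std_simplex (dim \<mu>)"
 shows "sop C X n (lcomp \<mu> \<nu>) = sop C X (dim \<mu>) \<nu> \<cdot> sop C X n \<mu>"
 using simplicial_set.sact_lcomp[OF simplicial_set_hset[OF assms(1)] _ assms(2,3), of "Idm C (level X n)" "level X n"]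
  sobj_level[OF assms(1)] sact_hset[OF assms(1,3) sop_Hom[OF assms(1,2)]]
 unfolding sop_eq_sact[symmetric] by auto

lemma sop_natural:
 assumes "is_sobj C X" "is_sobj C Y" "is_smap C X Y \<phi>" "\<mu> \<in> std_simplex n"
 shows "\<phi> (dim \<mu>) \<cdot> sop C X n \<mu> = sop C Y n \<mu> \<cdot> \<phi> n"
 using simplicial_set.sact_ssmap[OF simplicial_set_hset[OF assms(1)] ssmap_postcomp[OF assms(1-3)] _ assms(4), of "Idm C (level X n)" "level X n"]
  Idm_Hom[OF sobj_level[OF assms(1)], of n] sact_hset[OF assms(2,4) smap_Hom[OF assms(3)]] smap_Hom[OF assms(3), of n]
 unfolding sop_eq_sact[symmetric] by auto

lemma spoint_hset_lcomp:
 assumes "is_sobj C X" "ssubset n K" "\<mu> \<in> K" "spoint K (hset C X T) x" "\<nu> \<in> std_simplex (dim \<mu>)"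
 shows "x (lcomp \<mu> \<nu>) = sop C X (dim \<mu>) \<nu> \<cdot> x \<mu>"
 using spoint_sact[OF assms(2-5)] sact_hset[OF assms(1,5)] spoint_pts[OF assms(4,3)] by simp

lemma spoint_sop:
 assumes "is_sobj C X" "x \<in> T -> (level X n)"
 shows "spoint (std_simplex n) (hset C X T) (\<lambda>\<mu>. sop C X n \<mu> \<cdot> x)"
proof -
 have "spoint (std_simplex n) (hset C X T) (\<lambda>\<mu>. sact (hset C X T) n \<mu> x)"
  using simplicial_set.spoint_std_sact(1)[OF simplicial_set_hset[OF assms(1)]] assms by simp
 moreover have "sact (hset C X T) n \<mu> x = sop C X n \<mu> \<cdot> x" if "\<mu> \<in> std_simplex n" for \<mu>
  using sact_hset that assms by simp
 ultimately show ?thesis unfolding spoint_def by (simp add: std_simplex_del_nth std_simplex_dup_nth)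
qed

lemma spoint_precomp:
 assumes "[] \<notin> K" "is_sobj C X" "spoint K (hset C X T) x" "u \<in> T' -> T"
 shows "spoint K (hset C X T') (\<lambda>\<mu>. x \<mu> \<cdot> u)"
 using ssmap_spoint[OF assms(1) ssmap_precomp[OF assms(2,4)] assms(3)] .

end


section \<open>Gluing a point of a simplicial subset with one further cell\<close>

section \<open>Attaching a simplex\<close>

text \<open>Replaces each vertex by its position in \<open>s\<close>. For distinct \<open>s\<close>
  this inverts \<open>lcomp s\<close> on the simplices with vertices in \<open>s\<close>.\<close>

definition rank_list :: "nat list => nat list => nat list" where
 "rank_list s \<mu> = map (inv_into {..<length s} ((!) s)) \<mu>"

lemma rank_list:
 assumes "s \<in> std_simplex n" "distinct s" "\<mu> \<in> std_simplex n" "set \<mu> \<subseteq> set s"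
 shows "rank_list s \<mu> \<in> std_simplex (dim s)" "lcomp s (rank_list s \<mu>) = \<mu>"
proof -
 let ?r = "inv_into {..<length s} ((!) s)"
 have im: "set s = (!) s ` {..<length s}" by (auto simp: set_conv_nth)
 have r: "?r v < length s" "s ! ?r v = v" if "v \<in> set s" for v
  using inv_into_into[of v "(!) s" "{..<length s}"] f_inv_into_f[of v "(!) s" "{..<length s}"] that im by auto
 have ss: "sorted s" "sorted \<mu>" using assms by (auto simp: std_simplex_def)
 have mono: "?r u \<le> ?r v" if uv: "u \<in> set s" "v \<in> set s" "u \<le> v" for u v
 proof (rule ccontr)
  assume n: "\<not> ?r u \<le> ?r v"
  then have "s ! ?r v \<le> s ! ?r u" using ss(1) r(1)[OF uv(1)] by (simp add: sorted_nth_mono)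
  then show False using n uv r by auto
 qed
 have "sorted (rank_list s \<mu>)" unfolding rank_list_def sorted_map
  by (rule sorted_wrt_mono_rel[OF _ ss(2)]) (use assms(4) mono in blast)
 moreover have "set (rank_list s \<mu>) \<subseteq> {..dim s}"
  using r(1) assms(4) by (fastforce simp: rank_list_def dim_def)
 ultimately show "rank_list s \<mu> \<in> std_simplex (dim s)"
  using assms(3) by (auto simp: std_simplex_def rank_list_def)
 show "lcomp s (rank_list s \<mu>) = \<mu>"
  unfolding lcomp_def rank_list_def map_map using r(2) assms(4) by (auto intro!: map_idI)
qed

lemma rank_list_lcomp:
 assumes "s \<in> std_simplex n" "distinct s" "\<nu> \<in> std_simplex (dim s)"
 shows "rank_list s (lcomp s \<nu>) = \<nu>"
 unfolding lcomp_def rank_list_def map_map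
proof (rule map_idI)
 fix v assume "v \<in> set \<nu>"
 then have "v < length s" using assms by (cases s) (force simp: std_simplex_def)+
 moreover have "inj_on ((!) s) {..<length s}" using assms(2) by (simp add: inj_on_nth)
 ultimately show "(inv_into {..<length s} ((!) s) \<circ> (!) s) v = v" by simp
qed

text \<open>All simplices on the vertices of \<open>s\<close> are added, so a closed cell and not
  \<open>s\<close> alone.\<close>

definition attach :: "nat => nat list set => nat list => nat list set" where
 "attach n K s = K \<union> {\<mu> \<in> std_simplex n. set \<mu> \<subseteq> set s}"

lemma ssubset_attach: "ssubset n K ==> ssubset n (attach n K s)"
 unfolding ssubset_def attach_def by blast

lemma ssubset_Nil: "ssubset n K ==> [] \<notin> K"
 by (auto simp: ssubset_def std_simplex_def)

lemma ssubset_std: "ssubset n K ==> \<mu> \<in> K ==> \<mu> \<in> std_simplex n"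
 by (auto simp: ssubset_def)

text \<open>On the overlap the value is taken from \<open>x\<close>; under the compatibility assumed
  in \<open>spoint_glue\<close> the other branch would give the same.\<close>

definition glue :: "'a sset => nat list set => nat list => (nat list => 'a) => 'a => nat list => 'a" where
 "glue X K s x z \<mu> = (if \<mu> \<in> K then x \<mu> else sact X (dim s) (rank_list s \<mu>) z)"

lemma attach_cases:
 assumes "s \<in> std_simplex n" "distinct s" "\<mu> \<in> attach n K s"
 obtains "\<mu> \<in> K" | \<nu> where "\<mu> \<notin> K" "\<nu> \<in> std_simplex (dim s)" "\<mu> = lcomp s \<nu>"
 using assms rank_list[OF assms(1,2), of \<mu>] unfolding attach_def by (cases "\<mu> \<in> K") force+

lemma glue_lcomp:
 assumes "s \<in> std_simplex n" "distinct s"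
  and "\<And>\<alpha>. \<alpha> \<in> std_simplex (dim s) ==> lcomp s \<alpha> \<in> K ==> x (lcomp s \<alpha>) = sact X (dim s) \<alpha> z"
  and "\<nu> \<in> std_simplex (dim s)"
 shows "glue X K s x z (lcomp s \<nu>) = sact X (dim s) \<nu> z"
 using assms rank_list_lcomp[OF assms(1,2,4)] by (simp add: glue_def)

text \<open>Every simplex either lies in \<open>K\<close> or has the form
  \<open>lcomp s \<nu>\<close>, and both kinds are closed under faces and degeneracies. The
  hypothesis \<open>xz\<close> reconciles the two prescriptions where a face passes from the cell
  into \<open>K\<close>.\<close>

lemma spoint_glue:
 assumes X: "simplicial_set X" and K: "ssubset n K" and s: "s \<in> std_simplex n" "distinct s"
  and x: "spoint K X x" and z: "z \<in> pts X (dim s)"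
  and xz: "\<And>\<alpha>. \<alpha> \<in> std_simplex (dim s) ==> lcomp s \<alpha> \<in> K ==> x (lcomp s \<alpha>) = sact X (dim s) \<alpha> z"
 shows "spoint (attach n K s) X (glue X K s x z)"
proof -
 interpret simplicial_set X by (rule X)
 note l = glue_lcomp[OF s xz]
 have K': "del_nth i \<mu> \<in> K" if "\<mu> \<in> K" "dim \<mu> = Suc m" "i \<le> Suc m" for \<mu> m i
  using K that set_del_nth[of i \<mu>] std_simplex_del_nth unfolding ssubset_def by blast
 have K'': "dup_nth i \<mu> \<in> K" if "\<mu> \<in> K" "i \<le> dim \<mu>" for \<mu> i
  using K that set_dup_nth[of i \<mu>] std_simplex_dup_nth unfolding ssubset_def by blast
 show ?thesis
  unfolding spoint_def
 proof (intro conjI ballI allI impI)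
  fix \<mu> assume "\<mu> \<in> attach n K s"
  with s show "glue X K s x z \<mu> \<in> pts X (dim \<mu>)"
  proof (cases rule: attach_cases)
   case 1
   then show ?thesis using spoint_pts[OF x] by (simp add: glue_def)
  next
   case (2 \<nu>)
   then show ?thesis using sact_pts[OF z 2(2)] l by (simp add: lcomp_def)
  qed
 next
  fix \<mu> m i assume "\<mu> \<in> attach n K s" "dim \<mu> = Suc m" "i \<le> Suc m"
  with s(1,2) \<open>\<mu> \<in> _\<close> show "glue X K s x z (del_nth i \<mu>) = fc X m i (glue X K s x z \<mu>)"
  proof (cases rule: attach_cases)
   case 1
   then show ?thesis using spoint_del[OF x] K' \<open>dim \<mu> = _\<close> \<open>i \<le> _\<close> by (simp add: glue_def)
  next
   case (2 \<nu>)
   then have d: "dim \<nu> = Suc m" using \<open>dim \<mu> = _\<close> by (simp add: lcomp_def)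
   have "del_nth i \<mu> = lcomp s (del_nth i \<nu>)" using 2 by (simp add: lcomp_def del_nth_map)
   then show ?thesis
    using l 2 sact_del_nth[OF z 2(2) d \<open>i \<le> _\<close>] std_simplex_del_nth[OF 2(2) d \<open>i \<le> _\<close>] by simp
  qed
 next
  fix \<mu> m i assume "\<mu> \<in> attach n K s" "dim \<mu> = m" "i \<le> m"
  with s(1,2) \<open>\<mu> \<in> _\<close> show "glue X K s x z (dup_nth i \<mu>) = dg X m i (glue X K s x z \<mu>)"
  proof (cases rule: attach_cases)
   case 1
   then show ?thesis using spoint_dup[OF x] K'' \<open>dim \<mu> = _\<close> \<open>i \<le> _\<close> by (auto simp add: glue_def)
  next
   case (2 \<nu>)
   then have d: "dim \<nu> = m" using \<open>dim \<mu> = _\<close> by (simp add: lcomp_def)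
   have "dup_nth i \<mu> = lcomp s (dup_nth i \<nu>)" using 2 by (simp add: lcomp_def dup_nth_map)
   then show ?thesis
    using l 2 sact_dup_nth[OF z 2(2)] std_simplex_dup_nth[OF 2(2)] d \<open>i \<le> _\<close> by simp
  qed
 qed
qed

section \<open>The category of simplicial objects and the induced functor\<close>

section \<open>Functors on simplicial objects\<close>

lemma sCat_simps [simp]:
 "X \<in> Obj (sCat C) \<longleftrightarrow> is_sobj C X"
 "(X, Y, \<phi>) \<in> Arr (sCat C) \<longleftrightarrow> is_sobj C X \<and> is_sobj C Y \<and> is_smap C X Y \<phi>"
 "Dom (sCat C) f = fst f" "Cod (sCat C) f = fst (snd f)"
 "Idm (sCat C) X = (X, X, \<lambda>n. Idm C (level X n))"
 "g \<cdot>\<^bsub>sCat C\<^esub> f = (fst f, fst (snd g), \<lambda>n. comps g n \<cdot>\<^bsub>C\<^esub> comps f n)"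
 by (simp_all add: sCat_def)

lemma comps_simps [simp]: "comps (X, Y, \<phi>) = \<phi>"
 by (simp add: comps_def)

lemma sCat_Hom: "f \<in> Hom (sCat C) X Y \<longleftrightarrow>
  fst f = X \<and> fst (snd f) = Y \<and> is_sobj C X \<and> is_sobj C Y \<and> is_smap C X Y (comps f)"
 by (cases f) (auto simp: Hom_def)

lemma sCat_HomE:
 assumes "f \<in> Hom (sCat C) X Y"
 obtains \<phi> where "f = (X, Y, \<phi>)" "is_sobj C X" "is_sobj C Y" "is_smap C X Y \<phi>"
 using assms by (cases f) (auto simp: sCat_Hom)

lemma sFun_simps [simp]:
 "level (OMap (sFun F) X) n = OMap F (level X n)"
 "face (OMap (sFun F) X) n i = AMap F (face X n i)"
 "degen (OMap (sFun F) X) n i = AMap F (degen X n i)"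
 "AMap (sFun F) (X, Y, \<phi>) = (OMap (sFun F) X, OMap (sFun F) Y, \<lambda>n. AMap F (\<phi> n))"
 by (simp_all add: sFun_def Let_def)

lemma sFun_AMap_projs [simp]:
 "fst (AMap (sFun F) f) = OMap (sFun F) (fst f)"
 "fst (snd (AMap (sFun F) f)) = OMap (sFun F) (fst (snd f))"
 "comps (AMap (sFun F) f) n = AMap F (comps f n)"
 by (cases f; simp)+

context category
begin

lemma smap_comp:
 assumes "is_sobj C X" "is_sobj C Y" "is_sobj C Z" "is_smap C X Y \<phi>" "is_smap C Y Z \<psi>"
 shows "is_smap C X Z (\<lambda>n. \<psi> n \<cdot> \<phi> n)"
 unfolding is_smap_def
proof (intro conjI allI impI)
 note h1 = smap_Hom[OF assms(4)] and h2 = smap_Hom[OF assms(5)]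
 fix n show "\<psi> n \<cdot> \<phi> n \<in> (level X n) -> (level Z n)" using h1 h2 by blast
 fix i
 show "(\<psi> n \<cdot> \<phi> n) \<cdot> face X n i = face Z n i \<cdot> (\<psi> (Suc n) \<cdot> \<phi> (Suc n))" if i: "i \<le> Suc n"
 proof -
  have "(\<psi> n \<cdot> \<phi> n) \<cdot> face X n i = \<psi> n \<cdot> (face Y n i \<cdot> \<phi> (Suc n))"
   using assoc[OF h2 h1 sobj_face[OF assms(1) i]] smap_face[OF assms(4) i] by simp
  also have "\<dots> = (face Z n i \<cdot> \<psi> (Suc n)) \<cdot> \<phi> (Suc n)"
   using assoc[OF h2 sobj_face[OF assms(2) i] h1] smap_face[OF assms(5) i] by simp
  finally show ?thesis using assoc[OF sobj_face[OF assms(3) i] h2 h1] by simp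
 qed
 show "(\<psi> (Suc n) \<cdot> \<phi> (Suc n)) \<cdot> degen X n i = degen Z n i \<cdot> (\<psi> n \<cdot> \<phi> n)" if i: "i \<le> n"
 proof -
  have "(\<psi> (Suc n) \<cdot> \<phi> (Suc n)) \<cdot> degen X n i = \<psi> (Suc n) \<cdot> (degen Y n i \<cdot> \<phi> n)"
   using assoc[OF h2 h1 sobj_degen[OF assms(1) i]] smap_degen[OF assms(4) i] by simp
  also have "\<dots> = (degen Z n i \<cdot> \<psi> n) \<cdot> \<phi> n"
   using assoc[OF h2 sobj_degen[OF assms(2) i] h1] smap_degen[OF assms(5) i] by simp
  finally show ?thesis using assoc[OF sobj_degen[OF assms(3) i] h2 h1] by simp
 qed
qed

lemma smap_Idm: "is_sobj C X ==> is_smap C X X (\<lambda>n. Idm C (level X n))"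
 unfolding is_smap_def
 using sobj_level[of C X] comp_Idm[OF sobj_face] Idm_comp[OF sobj_face]
  comp_Idm[OF sobj_degen] Idm_comp[OF sobj_degen] by auto

lemma is_category_sCat: "is_category (sCat C)"
 unfolding is_category_def
proof (intro conjI ballI impI)
 fix f assume f: "f \<in> Arr (sCat C)"
 obtain X Y \<phi> where e: "f = (X, Y, \<phi>)" by (cases f)
 have s: "is_sobj C X" "is_sobj C Y" "is_smap C X Y \<phi>" using f e by auto
 show "Dom (sCat C) f \<in> Obj (sCat C)" "Cod (sCat C) f \<in> Obj (sCat C)" using s e by auto
 show "f \<cdot>\<^bsub>sCat C\<^esub> Idm (sCat C) (Dom (sCat C) f) = f" "Idm (sCat C) (Cod (sCat C) f) \<cdot>\<^bsub>sCat C\<^esub> f = f"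
  using e comp_Idm[OF smap_Hom[OF s(3)]] Idm_comp[OF smap_Hom[OF s(3)]] by auto
 fix g assume g: "g \<in> Arr (sCat C)" "Cod (sCat C) f = Dom (sCat C) g"
 obtain Z \<psi> where e': "g = (Y, Z, \<psi>)" using g(2) e by (cases g) auto
 have s': "is_sobj C Z" "is_smap C Y Z \<psi>" using g e' by auto
 show "g \<cdot>\<^bsub>sCat C\<^esub> f \<in> Hom (sCat C) (Dom (sCat C) f) (Cod (sCat C) g)"
  using smap_comp[OF s(1,2) s'(1) s(3) s'(2)] s s' e e' by (simp add: sCat_Hom)
 fix h assume h: "h \<in> Arr (sCat C)" "Cod (sCat C) g = Dom (sCat C) h"
 obtain W \<chi> where e'': "h = (Z, W, \<chi>)" using h(2) e' by (cases h) auto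
 have s'': "is_smap C Z W \<chi>" using h e'' by auto
 show "h \<cdot>\<^bsub>sCat C\<^esub> (g \<cdot>\<^bsub>sCat C\<^esub> f) = (h \<cdot>\<^bsub>sCat C\<^esub> g) \<cdot>\<^bsub>sCat C\<^esub> f"
  using e e' e'' assoc[OF smap_Hom[OF s''] smap_Hom[OF s'(2)] smap_Hom[OF s(3)]] by simp
next
 fix X assume "X \<in> Obj (sCat C)"
 then show "Idm (sCat C) X \<in> Hom (sCat C) X X" using smap_Idm by (simp add: sCat_Hom)
qed

lemma category_sCat: "category (sCat C)"
 using is_category_sCat by unfold_locales

end

locale functor_between = C: category C + D: category D
 for C :: "('o, 'm) cat" (structure) and D :: "('p, 'n) cat" +
 fixes F :: "('o, 'm, 'p, 'n) func"
 assumes is_fun: "is_functor C D F"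
begin

lemma F_Obj: "X \<in> Obj C ==> OMap F X \<in> Obj D"
 using is_fun by (simp add: is_functor_def)

lemma F_Hom: "f \<in> X -> Y ==> AMap F f \<in> Hom D (OMap F X) (OMap F Y)"
 using is_fun by (auto simp: is_functor_def Hom_def)

lemma F_Idm: "X \<in> Obj C ==> AMap F (Idm C X) = Idm D (OMap F X)"
 using is_fun by (simp add: is_functor_def)

lemma F_comp: "g \<in> Y -> Z ==> f \<in> X -> Y ==> AMap F (g \<cdot> f) = AMap F g \<cdot>\<^bsub>D\<^esub> AMap F f"
 using is_fun by (simp add: is_functor_def Hom_def)

lemma F_iso:
 assumes "is_iso C f" "f \<in> X -> Y"
 shows "is_iso D (AMap F f)"
proof -
 obtain g where g: "g \<in> Y -> X" "g \<cdot> f = Idm C X" "f \<cdot> g = Idm C Y"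
  using C.is_isoE[OF assms] by metis
 have "X \<in> Obj C" "Y \<in> Obj C" using C.Hom_Obj assms by auto
 then show ?thesis
  using g F_comp[OF g(1) assms(2)] F_comp[OF assms(2) g(1)] F_Idm
  by (intro D.is_isoI[OF F_Hom[OF assms(2)] F_Hom[OF g(1)]]) simp_all
qed

lemma sFun_sobj:
 assumes X: "is_sobj C X"
 shows "is_sobj D (OMap (sFun F) X)"
proof -
 note f = sobj_face[OF X] and d = sobj_degen[OF X] and l = sobj_level[OF X]
 have id1: "AMap F (face X n i) \<cdot>\<^bsub>D\<^esub> AMap F (face X (Suc n) j) = AMap F (face X n (j - 1)) \<cdot>\<^bsub>D\<^esub> AMap F (face X (Suc n) i)"
  if "i < j" "j \<le> Suc (Suc n)" for n i j
  using sobj_identities(1)[OF X that] F_comp[OF f f, of i n j] F_comp[OF f f, of "j - 1" n i] that by simp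
 have id2: "AMap F (degen X (Suc n) i) \<cdot>\<^bsub>D\<^esub> AMap F (degen X n j) = AMap F (degen X (Suc n) (Suc j)) \<cdot>\<^bsub>D\<^esub> AMap F (degen X n i)"
  if "i \<le> j" "j \<le> n" for n i j
  using sobj_identities(2)[OF X that] F_comp[OF d d, of i n j] F_comp[OF d d, of "Suc j" n i] that by simp
 have id3: "AMap F (face X (Suc n) i) \<cdot>\<^bsub>D\<^esub> AMap F (degen X (Suc n) j) = AMap F (degen X n (j - 1)) \<cdot>\<^bsub>D\<^esub> AMap F (face X n i)"
  if "i < j" "j \<le> Suc n" for n i j
  using sobj_identities(3)[OF X that] F_comp[OF f d, of i "Suc n" j] F_comp[OF d f, of "j - 1" n i] that by simp
 have id4: "AMap F (face X n i) \<cdot>\<^bsub>D\<^esub> AMap F (degen X n j) = Idm D (OMap F (level X n))"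
  if "i = j \<or> i = Suc j" "j \<le> n" for n i j
  using sobj_identities(4)[OF X that] F_comp[OF f d, of i n j] F_Idm[OF l] that by auto
 have id5: "AMap F (face X (Suc n) i) \<cdot>\<^bsub>D\<^esub> AMap F (degen X (Suc n) j) = AMap F (degen X n j) \<cdot>\<^bsub>D\<^esub> AMap F (face X n (i - 1))"
  if "Suc j < i" "i \<le> Suc (Suc n)" for n i j
  using sobj_identities(5)[OF X that] F_comp[OF f d, of i "Suc n" j] F_comp[OF d f, of j n "i - 1"] that by simp
 show ?thesis
  unfolding is_sobj_def sFun_simps
  by (intro conjI allI impI)
   (rule F_Obj[OF l] F_Hom[OF f] F_Hom[OF d] id1 id2 id3 id4 id5; assumption?; assumption?)+
qed

lemma sFun_smap:
 assumes "is_sobj C X" "is_sobj C Y" "is_smap C X Y \<phi>"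
 shows "is_smap D (OMap (sFun F) X) (OMap (sFun F) Y) (\<lambda>n. AMap F (\<phi> n))"
 unfolding is_smap_def sFun_simps
proof (intro conjI allI impI)
 note h = smap_Hom[OF assms(3)]
 fix n show "AMap F (\<phi> n) \<in> Hom D (OMap F (level X n)) (OMap F (level Y n))" using F_Hom[OF h] .
 fix i
 show "AMap F (\<phi> n) \<cdot>\<^bsub>D\<^esub> AMap F (face X n i) = AMap F (face Y n i) \<cdot>\<^bsub>D\<^esub> AMap F (\<phi> (Suc n))" if "i \<le> Suc n"
  using F_comp[OF h sobj_face[OF assms(1) that]] F_comp[OF sobj_face[OF assms(2) that] h] smap_face[OF assms(3) that] by simp
 show "AMap F (\<phi> (Suc n)) \<cdot>\<^bsub>D\<^esub> AMap F (degen X n i) = AMap F (degen Y n i) \<cdot>\<^bsub>D\<^esub> AMap F (\<phi> n)" if "i \<le> n"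
  using F_comp[OF h sobj_degen[OF assms(1) that]] F_comp[OF sobj_degen[OF assms(2) that] h] smap_degen[OF assms(3) that] by simp
qed

lemma is_functor_sFun: "is_functor (sCat C) (sCat D) (sFun F)"
 unfolding is_functor_def
proof (intro conjI ballI impI C.is_category_sCat D.is_category_sCat)
 fix X assume "X \<in> Obj (sCat C)"
 then show "OMap (sFun F) X \<in> Obj (sCat D)"
  "AMap (sFun F) (Idm (sCat C) X) = Idm (sCat D) (OMap (sFun F) X)"
  using sFun_sobj F_Idm[OF sobj_level] by auto
next
 fix f assume f: "f \<in> Arr (sCat C)"
 obtain X Y \<phi> where e: "f = (X, Y, \<phi>)" by (cases f)
 have s: "is_sobj C X" "is_sobj C Y" "is_smap C X Y \<phi>" using f e by auto
 show "AMap (sFun F) f \<in> Hom (sCat D) (OMap (sFun F) (Dom (sCat C) f)) (OMap (sFun F) (Cod (sCat C) f))"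
  using sFun_sobj sFun_smap s by (simp add: e sCat_Hom)
 fix g assume g: "g \<in> Arr (sCat C)" "Cod (sCat C) f = Dom (sCat C) g"
 obtain Z \<psi> where e': "g = (Y, Z, \<psi>)" using g(2) e by (cases g) auto
 have "is_smap C Y Z \<psi>" using g e' by auto
 then show "AMap (sFun F) (g \<cdot>\<^bsub>sCat C\<^esub> f) = AMap (sFun F) g \<cdot>\<^bsub>sCat D\<^esub> AMap (sFun F) f"
  using F_comp[OF smap_Hom smap_Hom[OF s(3)]] by (simp add: e e')
qed

text \<open>The images of all operators form a point of the standard simplex with an identity at the
  top, and such a point is unique.\<close>

lemma F_sop:
 assumes X: "is_sobj C X" and k: "\<mu> \<in> std_simplex n"
 shows "AMap F (sop C X n \<mu>) = sop D (OMap (sFun F) X) n \<mu>"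
proof -
 let ?l = "level X n"
 note l = sobj_level[OF X, of n]
 have p: "spoint (std_simplex n) (hset C X ?l) (\<lambda>\<mu>. sop C X n \<mu>)"
  using simplicial_set.spoint_std_sact(1)[OF C.simplicial_set_hset[OF X], of "Idm C ?l" ?l n] l
  unfolding sop_eq_sact by auto
 have "spoint (std_simplex n) (hset D (OMap (sFun F) X) (OMap F ?l)) (\<lambda>\<mu>. AMap F (sop C X n \<mu>))"
  unfolding spoint_def hset_simps sFun_simps
 proof (intro conjI ballI allI impI)
  fix \<mu> assume k: "\<mu> \<in> std_simplex n"
  note h = C.sop_Hom[OF X k]
  then show "AMap F (sop C X n \<mu>) \<in> Hom D (OMap F ?l) (OMap F (level X (dim \<mu>)))" by (rule F_Hom)
  fix m i
  show "AMap F (sop C X n (del_nth i \<mu>)) = AMap F (face X m i) \<cdot>\<^bsub>D\<^esub> AMap F (sop C X n \<mu>)" if "dim \<mu> = Suc m" "i \<le> Suc m"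
   using spoint_del[OF p k that] F_comp[OF sobj_face[OF X that(2)], of "sop C X n \<mu>" ?l] h that by simp
  show "AMap F (sop C X n (dup_nth i \<mu>)) = AMap F (degen X m i) \<cdot>\<^bsub>D\<^esub> AMap F (sop C X n \<mu>)" if "dim \<mu> = m" "i \<le> m"
   using spoint_dup[OF p k, of i] F_comp[OF sobj_degen[OF X that(2)], of "sop C X n \<mu>" ?l] h that by simp
 qed
 from sact_eq[OF this k] show ?thesis
  using C.sop_upt[OF X, of n] F_Idm[OF l] by (simp add: sop_eq_sact[of D] del: upt_Suc)
qed

end


section \<open>Matching objects over a base, and their extension by one cell\<close>

section \<open>Relative matching objects\<close>

lemma is_rel_point_iff: "is_rel_point C K n (X, Y, \<phi>) T x y \<longleftrightarrow>
  spoint K (hset C X T) x \<and> y \<in> Hom C T (level Y n) \<and>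
  (\<forall>\<mu>\<in>K. \<phi> (dim \<mu>) \<cdot>\<^bsub>C\<^esub> x \<mu> = sop C Y n \<mu> \<cdot>\<^bsub>C\<^esub> y)"
 by (simp add: is_rel_point_def is_point_iff)

lemma ssubset_del: "ssubset n K ==> \<mu> \<in> K ==> dim \<mu> = Suc m ==> i \<le> Suc m ==> del_nth i \<mu> \<in> K"
 using set_del_nth[of i \<mu>] std_simplex_del_nth unfolding ssubset_def by blast

lemma ssubset_dup: "ssubset n K ==> \<mu> \<in> K ==> i \<le> dim \<mu> ==> dup_nth i \<mu> \<in> K"
 using set_dup_nth[of i \<mu>] std_simplex_dup_nth unfolding ssubset_def by blast

text \<open>A simplicial subset is closed under deletion and duplication, so values outside
  \<open>K\<close> never enter.\<close>

lemma spoint_cong: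
 assumes "ssubset n K" "\<And>\<mu>. \<mu> \<in> K ==> x \<mu> = x' \<mu>"
 shows "spoint K X x \<longleftrightarrow> spoint K X x'"
 unfolding spoint_def by (simp add: assms(2) ssubset_del[OF assms(1)] ssubset_dup[OF assms(1)])

lemma is_rel_matching_cong:
 assumes K: "ssubset n K" and x: "\<And>\<mu>. \<mu> \<in> K ==> x \<mu> = x' \<mu>"
 shows "is_rel_matching C K n f L x y \<longleftrightarrow> is_rel_matching C K n f L x' y"
proof -
 obtain X Y \<phi> where f: "f = (X, Y, \<phi>)" by (cases f)
 have "is_rel_point C K n f L x y \<longleftrightarrow> is_rel_point C K n f L x' y"
  unfolding f is_rel_point_iff using spoint_cong[OF K x] x by simp
 then show ?thesis unfolding is_rel_matching_def using x by simp
qed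

locale simplicial_map = category C for C :: "('o, 'm) cat" (structure) +
 fixes X Y :: "('o, 'm) sobj" and \<phi> :: "nat => 'm"
 assumes sobj_X: "is_sobj C X" and sobj_Y: "is_sobj C Y" and smap: "is_smap C X Y \<phi>"
begin

abbreviation f :: "('o, 'm) sarr" where "f \<equiv> (X, Y, \<phi>)"

lemma phi_Hom: "\<phi> n \<in> (level X n) -> (level Y n)"
 using smap_Hom[OF smap] .

lemma rel_point_precomp:
 assumes K: "ssubset n K" and p: "is_rel_point C K n f T x y" and u: "u \<in> T' -> T"
 shows "is_rel_point C K n f T' (\<lambda>\<mu>. x \<mu> \<cdot> u) (y \<cdot> u)"
 unfolding is_rel_point_iff
proof (intro conjI ballI)
 have p': "spoint K (hset C X T) x" "y \<in> T -> (level Y n)"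
  using p by (auto simp: is_rel_point_iff)
 show "spoint K (hset C X T') (\<lambda>\<mu>. x \<mu> \<cdot> u)"
  using spoint_precomp[OF ssubset_Nil[OF K] sobj_X p'(1) u] .
 show "y \<cdot> u \<in> T' -> (level Y n)" using p' u by blast
 fix \<mu> assume k: "\<mu> \<in> K"
 have "x \<mu> \<in> T -> (level X (dim \<mu>))" using spoint_pts[OF p'(1) k] by simp
 then show "\<phi> (dim \<mu>) \<cdot> (x \<mu> \<cdot> u) = sop C Y n \<mu> \<cdot> (y \<cdot> u)"
  using assoc[OF phi_Hom _ u] assoc[OF sop_Hom[OF sobj_Y ssubset_std[OF K k]] p'(2) u]
   p k unfolding is_rel_point_iff by metis
qed

lemma rel_point_sop:
 assumes K: "ssubset n K"
 shows "is_rel_point C K n f (level X n) (sop C X n) (\<phi> n)"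
 unfolding is_rel_point_iff
proof (intro conjI ballI)
 have l: "level X n \<in> Obj C" using sobj_level[OF sobj_X] .
 have "spoint (std_simplex n) (hset C X (level X n)) (\<lambda>\<mu>. sop C X n \<mu> \<cdot> Idm C (level X n))"
  using spoint_sop[OF sobj_X Idm_Hom[OF l]] .
 then have "spoint K (hset C X (level X n)) (\<lambda>\<mu>. sop C X n \<mu> \<cdot> Idm C (level X n))"
  using K spoint_subset unfolding ssubset_def by blast
 then show "spoint K (hset C X (level X n)) (sop C X n)"
  by (subst spoint_cong[OF K]) (simp_all add: comp_Idm[OF sop_Hom[OF sobj_X ssubset_std[OF K]]])
 fix \<mu> assume "\<mu> \<in> K"
 then show "\<phi> (dim \<mu>) \<cdot> sop C X n \<mu> = sop C Y n \<mu> \<cdot> \<phi> n"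
  using sop_natural[OF sobj_X sobj_Y smap] ssubset_std[OF K] by simp
qed (rule phi_Hom)

lemma rel_matching_lift:
 assumes "is_rel_matching C K n f L x y" "is_rel_point C K n f T x' y'"
 obtains u where "u \<in> T -> L" "\<And>\<mu>. \<mu> \<in> K ==> x \<mu> \<cdot> u = x' \<mu>" "y \<cdot> u = y'"
proof -
 have "T \<in> Obj C" using assms(2) Hom_Obj unfolding is_rel_point_iff by blast
 then show thesis using assms that unfolding is_rel_matching_def by blast
qed

lemma rel_matching_point: "is_rel_matching C K n f L x y ==> is_rel_point C K n f L x y"
 by (simp add: is_rel_matching_def)

lemma rel_matching_unique:
 assumes K: "ssubset n K" and L: "is_rel_matching C K n f L x y"
  and u: "u \<in> T -> L" "u' \<in> T -> L"
  and e: "\<And>\<mu>. \<mu> \<in> K ==> x \<mu> \<cdot> u = x \<mu> \<cdot> u'" "y \<cdot> u = y \<cdot> u'"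
 shows "u = u'"
proof -
 have "is_rel_point C K n f T (\<lambda>\<mu>. x \<mu> \<cdot> u) (y \<cdot> u)"
  using rel_point_precomp[OF K rel_matching_point[OF L] u(1)] .
 moreover have "T \<in> Obj C" using Hom_Obj u by blast
 ultimately have "\<exists>!w. w \<in> T -> L \<and> (\<forall>\<mu>\<in>K. x \<mu> \<cdot> w = x \<mu> \<cdot> u) \<and> y \<cdot> w = y \<cdot> u"
  using L unfolding is_rel_matching_def by blast
 then obtain w where w: "\<And>w'. w' \<in> T -> L \<and> (\<forall>\<mu>\<in>K. x \<mu> \<cdot> w' = x \<mu> \<cdot> u) \<and> y \<cdot> w' = y \<cdot> u ==> w' = w"
  by (rule ex1E) blast
 have "u = w" "u' = w" using u e by (auto intro!: w)
 then show ?thesis by simp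
qed

lemma rel_matchingI:
 assumes "is_rel_point C K n f L x y"
  and "\<And>T x' y'. is_rel_point C K n f T x' y' ==> \<exists>u\<in>Hom C T L. (\<forall>\<mu>\<in>K. x \<mu> \<cdot> u = x' \<mu>) \<and> y \<cdot> u = y'"
  and "\<And>T u u'. u \<in> T -> L ==> u' \<in> T -> L ==> (\<And>\<mu>. \<mu> \<in> K ==> x \<mu> \<cdot> u = x \<mu> \<cdot> u') ==>
   y \<cdot> u = y \<cdot> u' ==> u = u'"
 shows "is_rel_matching C K n f L x y"
 unfolding is_rel_matching_def
proof (intro conjI ballI allI impI assms(1))
 show "L \<in> Obj C" using assms(1) Hom_Obj unfolding is_rel_point_iff by blast
 fix T x' y' assume "is_rel_point C K n f T x' y'"
 then obtain u where u: "u \<in> T -> L" "\<forall>\<mu>\<in>K. x \<mu> \<cdot> u = x' \<mu>" "y \<cdot> u = y'"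
  using assms(2) by blast
 then show "\<exists>!u. u \<in> T -> L \<and> (\<forall>\<mu>\<in>K. x \<mu> \<cdot> u = x' \<mu>) \<and> y \<cdot> u = y'"
  proof (intro ex1I[of _ u])
   fix u' assume "u' \<in> T -> L \<and> (\<forall>\<mu>\<in>K. x \<mu> \<cdot> u' = x' \<mu>) \<and> y \<cdot> u' = y'"
   with u show "u' = u" by (rule_tac assms(3)) auto
  qed (use u in blast)
qed

text \<open>A matching object for \<open>K\<close> with a simplex attached is a fibre product over the matching
 object of the part of \<open>K\<close> lying on that simplex.\<close>

lemma rel_matching_attach:
 assumes K: "ssubset n K" and s: "s \<in> std_simplex n" "distinct s"
  and A: "A = {\<alpha> \<in> std_simplex (dim s). lcomp s \<alpha> \<in> K}"
  and L: "is_rel_matching C K n f L x y" and L': "is_rel_matching C A (dim s) f L' x' y'"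
  and c: "c \<in> (level X (dim s)) -> L'"
   "\<And>\<alpha>. \<alpha> \<in> A ==> x' \<alpha> \<cdot> c = sop C X (dim s) \<alpha>" "y' \<cdot> c = \<phi> (dim s)"
  and v: "v \<in> L -> L'"
   "\<And>\<alpha>. \<alpha> \<in> A ==> x' \<alpha> \<cdot> v = x (lcomp s \<alpha>)" "y' \<cdot> v = sop C Y n s \<cdot> y"
  and pb: "is_pullback C c v p q"
 defines "z \<equiv> \<lambda>\<mu>. if \<mu> \<in> K then x \<mu> \<cdot> q else sop C X (dim s) (rank_list s \<mu>) \<cdot> p"
 shows "is_rel_matching C (attach n K s) n f (Dom C p) z (y \<cdot> q)"
proof -
 let ?P = "Dom C p" and ?m = "dim s"
 have p: "p \<in> ?P -> (level X ?m)" and q: "q \<in> ?P -> L"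
  using pullback_Hom(1-4)[OF pb] c(1) v(1) HomD(2) by metis+
 have Cpq: "Cod C p = level X ?m" "Cod C q = L" using p q HomD(3) by metis+
 have ssK': "ssubset n (attach n K s)" using ssubset_attach[OF K] .
 have ssA: "ssubset ?m A" unfolding ssubset_def A
 proof (intro conjI ballI impI CollectI)
  fix \<alpha> \<alpha>' assume a: "\<alpha> \<in> {\<alpha> \<in> std_simplex ?m. lcomp s \<alpha> \<in> K}" "\<alpha>' \<in> std_simplex ?m" "set \<alpha>' \<subseteq> set \<alpha>"
  then have "set (lcomp s \<alpha>') \<subseteq> set (lcomp s \<alpha>)" "lcomp s \<alpha>' \<in> std_simplex n"
   using lcomp_in_std_simplex[OF s(1)] by (auto simp: lcomp_def)
  then show "lcomp s \<alpha>' \<in> K" using a K unfolding ssubset_def by blast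
 qed auto
 have s_att: "s \<in> attach n K s" using s by (simp add: attach_def)
 have pL: "is_rel_point C K n f L x y" using rel_matching_point[OF L] .
 have pL': "is_rel_point C A ?m f L' x' y'" using rel_matching_point[OF L'] .
 have x: "spoint K (hset C X L) x" "y \<in> L -> (level Y n)" using pL by (auto simp: is_rel_point_iff)
 have x': "spoint A (hset C X L') x'" "y' \<in> L' -> (level Y ?m)" using pL' by (auto simp: is_rel_point_iff)
 have xH: "x \<mu> \<in> L -> (level X (dim \<mu>))" if "\<mu> \<in> K" for \<mu> using spoint_pts[OF x(1) that] by simp
 have x'H: "x' \<mu> \<in> L' -> (level X (dim \<mu>))" if "\<mu> \<in> A" for \<mu> using spoint_pts[OF x'(1) that] by simp
 have sopH: "sop C X ?m \<nu> \<in> (level X ?m) -> (level X (dim \<nu>))" if "\<nu> \<in> std_simplex ?m" for \<nu>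
  using sop_Hom[OF sobj_X that] .
 have sYH: "sop C Y n s \<in> (level Y n) -> (level Y ?m)" using sop_Hom[OF sobj_Y s(1)] .
 have sx: "spoint K (hset C X ?P) (\<lambda>\<mu>. x \<mu> \<cdot> q)"
  using spoint_precomp[OF ssubset_Nil[OF K] sobj_X x(1) q] .
 \<comment> \<open>A point over the enlarged subset amounts to a point over \<open>K\<close> and one
   simplex \<open>w\<close> of X that agrees with it on the overlap \<open>A\<close> and lies over
   the right simplex of Y.\<close>
 have glue_pt: "is_rel_point C (attach n K s) n f T
   (\<lambda>\<mu>. if \<mu> \<in> K then a \<mu> else sop C X ?m (rank_list s \<mu>) \<cdot> w) b"
  if a: "is_rel_point C K n f T a b" and w: "w \<in> T -> (level X ?m)"
   and aw: "\<And>\<alpha>. \<alpha> \<in> A ==> a (lcomp s \<alpha>) = sop C X ?m \<alpha> \<cdot> w"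
   and wb: "\<phi> ?m \<cdot> w = sop C Y n s \<cdot> b" for T a b w
  unfolding is_rel_point_iff
 proof (intro conjI ballI)
  have a': "spoint K (hset C X T) a" "b \<in> T -> (level Y n)" using a by (auto simp: is_rel_point_iff)
  show "b \<in> T -> (level Y n)" by fact
  have "spoint (attach n K s) (hset C X T) (glue (hset C X T) K s a w)"
   by (rule spoint_glue[OF simplicial_set_hset[OF sobj_X] K s a'(1)])
    (use w aw sact_hset[OF sobj_X _ w] in \<open>auto simp: A\<close>)
  moreover have "glue (hset C X T) K s a w \<mu> = (if \<mu> \<in> K then a \<mu> else sop C X ?m (rank_list s \<mu>) \<cdot> w)"
   if "\<mu> \<in> attach n K s" for \<mu>
   unfolding glue_def using that sact_hset[OF sobj_X _ w] rank_list[OF s, of \<mu>] by (auto simp: attach_def)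
  ultimately show "spoint (attach n K s) (hset C X T)
    (\<lambda>\<mu>. if \<mu> \<in> K then a \<mu> else sop C X ?m (rank_list s \<mu>) \<cdot> w)"
   by (subst spoint_cong[OF ssK', symmetric]) auto
  fix \<mu> assume "\<mu> \<in> attach n K s"
  with s show "\<phi> (dim \<mu>) \<cdot> (if \<mu> \<in> K then a \<mu> else sop C X ?m (rank_list s \<mu>) \<cdot> w) = sop C Y n \<mu> \<cdot> b"
  proof (cases rule: attach_cases)
   case 1
   then show ?thesis using a by (simp add: is_rel_point_iff)
  next
   case (2 \<nu>)
   have d: "dim \<mu> = dim \<nu>" using 2 by (simp add: lcomp_def)
   have "\<phi> (dim \<nu>) \<cdot> (sop C X ?m \<nu> \<cdot> w) = sop C Y ?m \<nu> \<cdot> (\<phi> ?m \<cdot> w)"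
    using assoc[OF phi_Hom sopH[OF 2(2)] w] assoc[OF sop_Hom[OF sobj_Y 2(2)] phi_Hom w]
     sop_natural[OF sobj_X sobj_Y smap 2(2)] by simp
   also have "\<dots> = sop C Y n \<mu> \<cdot> b"
    using assoc[OF sop_Hom[OF sobj_Y 2(2)] sYH a'(2)] wb sop_lcomp[OF sobj_Y s(1) 2(2)] 2(3) by simp
   finally show ?thesis using 2 d rank_list_lcomp[OF s 2(2)] by simp
  qed
 qed
 have zp: "sop C X ?m \<alpha> \<cdot> p = x (lcomp s \<alpha>) \<cdot> q" if a: "\<alpha> \<in> A" for \<alpha>
  using assoc[OF x'H[OF a] c(1) p] assoc[OF x'H[OF a] v(1) q] c(2)[OF a] v(2)[OF a]
   pullback_Hom(5)[OF pb] by simp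
 have yp: "\<phi> ?m \<cdot> p = sop C Y n s \<cdot> (y \<cdot> q)"
  using assoc[OF x'(2) c(1) p] assoc[OF x'(2) v(1) q] c(3) v(3)
   pullback_Hom(5)[OF pb] assoc[OF sYH x(2) q] by simp
 have zs: "z (lcomp s \<nu>) \<cdot> u = sop C X ?m \<nu> \<cdot> (p \<cdot> u)"
  if t: "\<nu> \<in> std_simplex ?m" and u: "u \<in> T -> ?P" for \<nu> u T
 proof (cases "lcomp s \<nu> \<in> K")
  case True
  then show ?thesis
   using zp[of \<nu>] t assoc[OF sopH[OF t] p u] by (simp add: A z_def)
 next
  case False
  then show ?thesis
   using rank_list_lcomp[OF s t] assoc[OF sopH[OF t] p u] by (simp add: z_def)
 qed
 have zK: "z \<mu> \<cdot> u = x \<mu> \<cdot> (q \<cdot> u)" if "\<mu> \<in> K" "u \<in> T -> ?P" for \<mu> u T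
  using assoc[OF xH[OF that(1)] q that(2)] that by (simp add: z_def)
 have sid: "lcomp s [0..<Suc ?m] = s" using std_simplex_upt_dim[OF s(1)] by (simp del: upt_Suc)
 show ?thesis
 proof (rule rel_matchingI)
  show "is_rel_point C (attach n K s) n f ?P z (y \<cdot> q)"
   unfolding z_def by (rule glue_pt[OF rel_point_precomp[OF K pL q] p zp[symmetric] yp])
 next
  fix T a b assume ab: "is_rel_point C (attach n K s) n f T a b"
  have a: "spoint (attach n K s) (hset C X T) a" "b \<in> T -> (level Y n)"
   using ab by (auto simp: is_rel_point_iff)
  have abK: "is_rel_point C K n f T a b"
   using ab spoint_subset[OF a(1), of K] by (auto simp: is_rel_point_iff attach_def)
  obtain u1 where u1: "u1 \<in> T -> L" "\<And>\<mu>. \<mu> \<in> K ==> x \<mu> \<cdot> u1 = a \<mu>" "y \<cdot> u1 = b"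
   using rel_matching_lift[OF L abK] by blast
  have w: "a s \<in> T -> (level X ?m)" using spoint_pts[OF a(1) s_att] by simp
  have as: "a (lcomp s \<nu>) = sop C X ?m \<nu> \<cdot> a s" if "\<nu> \<in> std_simplex ?m" for \<nu>
   using spoint_hset_lcomp[OF sobj_X ssK' s_att a(1) that] .
  \<comment> \<open>Arrows into \<open>L'\<close> are compared on its coordinates, where both sides
    give the restriction of the same point to the overlap \<open>A\<close>.\<close>
  have "c \<cdot> a s = v \<cdot> u1"
  proof (rule rel_matching_unique[OF ssA L'])
   show "c \<cdot> a s \<in> T -> L'" "v \<cdot> u1 \<in> T -> L'" using c v w u1 by auto
   show "y' \<cdot> (c \<cdot> a s) = y' \<cdot> (v \<cdot> u1)"
    using assoc[OF x'(2) c(1) w] assoc[OF x'(2) v(1) u1(1)] c(3) v(3)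
     assoc[OF sYH x(2) u1(1)] u1(3) ab s_att unfolding is_rel_point_iff by metis
   fix \<alpha> assume al: "\<alpha> \<in> A"
   then have al': "\<alpha> \<in> std_simplex ?m" "lcomp s \<alpha> \<in> K" by (auto simp: A)
   have "x' \<alpha> \<cdot> (c \<cdot> a s) = a (lcomp s \<alpha>)"
    using assoc[OF x'H[OF al] c(1) w] c(2)[OF al] as[OF al'(1)] by simp
   also have "\<dots> = x' \<alpha> \<cdot> (v \<cdot> u1)"
    using assoc[OF x'H[OF al] v(1) u1(1)] v(2)[OF al] u1(2)[OF al'(2)] by simp
   finally show "x' \<alpha> \<cdot> (c \<cdot> a s) = x' \<alpha> \<cdot> (v \<cdot> u1)" .
  qed
  then obtain u where u: "u \<in> T -> ?P" "p \<cdot> u = a s" "q \<cdot> u = u1"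
   using pullback_lift[OF pb, of "a s" T u1] w u1(1) Cpq by metis
  have "z \<mu> \<cdot> u = a \<mu>" if "\<mu> \<in> attach n K s" for \<mu>
   using s that
  proof (cases rule: attach_cases)
   case 1
   then show ?thesis using zK u u1(2) by simp
  next
   case (2 \<nu>)
   then show ?thesis using zs[OF 2(2) u(1)] u(2) as by simp
  qed
  then show "\<exists>u\<in>Hom C T ?P. (\<forall>\<mu>\<in>attach n K s. z \<mu> \<cdot> u = a \<mu>) \<and> (y \<cdot> q) \<cdot> u = b"
   using u u1(3) assoc[OF x(2) q u(1)] by (intro bexI[of _ u]) auto
 next
  fix T u u' assume u: "u \<in> T -> ?P" "u' \<in> T -> ?P"
   and e: "\<And>\<mu>. \<mu> \<in> attach n K s ==> z \<mu> \<cdot> u = z \<mu> \<cdot> u'"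
   and ey: "(y \<cdot> q) \<cdot> u = (y \<cdot> q) \<cdot> u'"
  show "u = u'"
  proof (rule pullback_unique[OF pb u])
   \<comment> \<open>The coordinate at \<open>s\<close> itself recovers \<open>p\<close>, because
     the operator of the top simplex is an identity.\<close>
   have "sop C X ?m [0..<Suc ?m] \<cdot> (p \<cdot> u) = sop C X ?m [0..<Suc ?m] \<cdot> (p \<cdot> u')"
    using zs[OF upt_in_std_simplex u(1)] zs[OF upt_in_std_simplex u(2)] e[OF s_att] by (simp only: sid)
   then show "p \<cdot> u = p \<cdot> u'"
    unfolding sop_upt[OF sobj_X] using Idm_comp[OF comp_Hom[OF p u(1)]] Idm_comp[OF comp_Hom[OF p u(2)]] by simp
   show "q \<cdot> u = q \<cdot> u'"
   proof (rule rel_matching_unique[OF K L])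
    show "q \<cdot> u \<in> T -> L" "q \<cdot> u' \<in> T -> L" using q u by auto
    show "y \<cdot> (q \<cdot> u) = y \<cdot> (q \<cdot> u')"
     using ey assoc[OF x(2) q u(1)] assoc[OF x(2) q u(2)] by simp
    fix \<mu> assume "\<mu> \<in> K"
    then show "x \<mu> \<cdot> (q \<cdot> u) = x \<mu> \<cdot> (q \<cdot> u')"
     using e[of \<mu>] zK u by (auto simp: attach_def)
   qed
  qed
 qed
qed

end

section \<open>Closure properties of covers; independence of the representing object\<close>

section \<open>Covers\<close>

text \<open>Properties available on both sides of F. \<open>S_Idm\<close> is stated in neither
  definition and is derived in \<open>cover_categoryI\<close> and
  \<open>covers_descent\<close>.\<close>

locale covers = category C for C :: "('o, 'm) cat" (structure) +
 fixes S :: "'m set"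
 assumes S_subcategory: "is_subcategory C S"
  and S_base: "\<And>f g p q. f \<in> S ==> is_pullback C f g p q ==> q \<in> S"
  and S_cancel: "right_cancellative C S"
  and S_Idm: "\<And>X. X \<in> Obj C ==> Idm C X \<in> S"
begin

lemma S_comp: "g \<in> S ==> g \<in> Y -> Z ==> f \<in> S ==> f \<in> X -> Y ==> g \<cdot> f \<in> S"
 using S_subcategory by (auto simp: is_subcategory_def Hom_def)

lemma S_iso: "is_iso C f ==> f \<in> S"
proof -
 assume i: "is_iso C f"
 then have f: "f \<in> (Dom C f) -> (Cod C f)" by (simp add: is_iso_def Hom_def)
 show ?thesis using S_base[OF S_Idm pullback_id_iso[OF i f]] Hom_Obj f by blast
qed

lemma S_cancelD: "f \<in> X -> Y ==> g \<in> Y -> Z ==> f \<in> S ==> g \<cdot> f \<in> S ==> g \<in> S"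
 using S_cancel by (auto simp: right_cancellative_def Hom_def)

end

locale cover_category = covers +
 assumes terminal_cover: "\<exists>t. is_terminal C t \<and> (\<forall>f\<in>Arr C. Cod C f = t --> f \<in> S)"
  and S_pullback: "\<And>f g. f \<in> S ==> g \<in> Arr C ==> Cod C g = Cod C f ==> \<exists>p q. is_pullback C f g p q"

text \<open>An identity is a cover because the arrow from its object to the terminal one is, and a
  subcategory contains the identities at both ends of its arrows.\<close>

lemma cover_categoryI:
 assumes "category_with_covers C S"
 shows "cover_category C S"
proof -
 interpret category C using assms by unfold_locales (simp add: category_with_covers_def)
 obtain t where t: "is_terminal C t" "\<forall>f\<in>Arr C. Cod C f = t --> f \<in> S"
  using assms by (auto simp: category_with_covers_def)
 have "Idm C X \<in> S" if X: "X \<in> Obj C" for X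
 proof -
  obtain u where "u \<in> Hom C X t" using t(1) X unfolding is_terminal_def by blast
  then have "u \<in> S" "Dom C u = X" using t(2) by (auto simp: Hom_def)
  then show ?thesis using assms by (auto simp: category_with_covers_def is_subcategory_def)
 qed
 moreover have "q \<in> S" if "f \<in> S" "is_pullback C f g p q" for f g p q
  using assms that unfolding category_with_covers_def by blast
 moreover have "\<exists>p q. is_pullback C f g p q" if "f \<in> S" "g \<in> Arr C" "Cod C g = Cod C f" for f g
  using assms that unfolding category_with_covers_def by blast
 ultimately show ?thesis
  using assms t unfolding cover_category_def covers_def cover_category_axioms_def covers_axioms_def
  by (simp add: category_with_covers_def category_axioms)
qed

text \<open>Every identity is a base change of the identity of the terminal object.\<close>

lemma covers_descent:
 assumes "descent_category D S"
 shows "covers D S"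
proof -
 interpret category D using assms by unfold_locales (simp add: descent_category_def)
 obtain t where t: "is_terminal D t" "Idm D t \<in> S"
  using assms by (auto simp: descent_category_def)
 have base: "q \<in> S" if "f \<in> S" "is_pullback D f g p q" for f g p q
  using assms that unfolding descent_category_def by blast
 have "Idm D X \<in> S" if X: "X \<in> Obj D" for X
 proof -
  obtain u where "u \<in> Hom D X t" using t(1) X unfolding is_terminal_def by blast
  then show ?thesis using base[OF t(2) pullback_id] by blast
 qed
 then show ?thesis
  using assms base by unfold_locales (simp_all add: descent_category_def)
qed

context simplicial_map
begin

lemma rel_point_Hom:
 "is_rel_point C K n f T x y ==> \<mu> \<in> K ==> x \<mu> \<in> T -> (level X (dim \<mu>))"
 "is_rel_point C K n f T x y ==> y \<in> T -> (level Y n)"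
 using spoint_pts[of K "hset C X T" x \<mu>] by (simp_all add: is_rel_point_iff)

lemma rel_matching_comparison:
 assumes "is_rel_matching C K n f L x y" "ssubset n K"
 obtains c where "c \<in> (level X n) -> L" "\<And>\<mu>. \<mu> \<in> K ==> x \<mu> \<cdot> c = sop C X n \<mu>" "y \<cdot> c = \<phi> n"
 using rel_matching_lift[OF assms(1) rel_point_sop[OF assms(2)]] by blast

lemma rel_matching_coverI:
 assumes "is_rel_matching C K n f L x y" "c \<in> S" "c \<in> (level X n) -> L"
  "\<And>\<mu>. \<mu> \<in> K ==> x \<mu> \<cdot> c = sop C X n \<mu>" "y \<cdot> c = \<phi> n"
 shows "rel_matching_cover C S K n f"
 unfolding rel_matching_cover_def using assms by fastforce

text \<open>Two representing objects are canonically isomorphic, isomorphisms are covers, and the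
  comparison maps correspond; so the witness in \<open>rel_matching_cover\<close> may be replaced by
  any other.\<close>

lemma rel_matching_coverD:
 assumes cov: "covers C S" and K: "ssubset n K" and r: "rel_matching_cover C S K n f"
  and L: "is_rel_matching C K n f L x y" and c: "c \<in> (level X n) -> L"
   "\<And>\<mu>. \<mu> \<in> K ==> x \<mu> \<cdot> c = sop C X n \<mu>" "y \<cdot> c = \<phi> n"
 shows "c \<in> S"
proof -
 interpret covers C S by fact
 obtain L' x' y' c' where L': "is_rel_matching C K n f L' x' y'"
  and c': "c' \<in> S" "c' \<in> (level X n) -> L'" "\<And>\<mu>. \<mu> \<in> K ==> x' \<mu> \<cdot> c' = sop C X n \<mu>" "y' \<cdot> c' = \<phi> n"
  using r unfolding rel_matching_cover_def sCat_simps fst_conv snd_conv comps_simps by blast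
 obtain u where u: "u \<in> L' -> L" "\<And>\<mu>. \<mu> \<in> K ==> x \<mu> \<cdot> u = x' \<mu>" "y \<cdot> u = y'"
  using rel_matching_lift[OF L rel_matching_point[OF L']] by blast
 obtain w where w: "w \<in> L -> L'" "\<And>\<mu>. \<mu> \<in> K ==> x' \<mu> \<cdot> w = x \<mu>" "y' \<cdot> w = y"
  using rel_matching_lift[OF L' rel_matching_point[OF L]] by blast
 have H: "x \<mu> \<in> L -> (level X (dim \<mu>))" "x' \<mu> \<in> L' -> (level X (dim \<mu>))" if "\<mu> \<in> K" for \<mu>
  using rel_point_Hom(1)[OF rel_matching_point[OF L] that] rel_point_Hom(1)[OF rel_matching_point[OF L'] that] by auto
 have Hy: "y \<in> L -> (level Y n)" "y' \<in> L' -> (level Y n)"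
  using rel_point_Hom(2)[OF rel_matching_point[OF L]] rel_point_Hom(2)[OF rel_matching_point[OF L']] by auto
 have o: "L \<in> Obj C" "L' \<in> Obj C" using Hom_Obj u by auto
 have "u \<cdot> w = Idm C L"
  by (rule rel_matching_unique[OF K L comp_Hom[OF u(1) w(1)] Idm_Hom[OF o(1)]])
   (use assoc[OF H(1) u(1) w(1)] assoc[OF Hy(1) u(1) w(1)] u(2,3) w(2,3) in \<open>simp_all add: comp_Idm[OF H(1)] comp_Idm[OF Hy(1)]\<close>)
 moreover have "w \<cdot> u = Idm C L'"
  by (rule rel_matching_unique[OF K L' comp_Hom[OF w(1) u(1)] Idm_Hom[OF o(2)]])
   (use assoc[OF H(2) w(1) u(1)] assoc[OF Hy(2) w(1) u(1)] u(2,3) w(2,3) in \<open>simp_all add: comp_Idm[OF H(2)] comp_Idm[OF Hy(2)]\<close>)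
 ultimately have "u \<in> S" using S_iso[OF is_isoI[OF u(1) w(1)]] by simp
 moreover have "c = u \<cdot> c'"
  by (rule rel_matching_unique[OF K L c(1) comp_Hom[OF u(1) c'(2)]])
   (use assoc[OF H(1) u(1) c'(2)] assoc[OF Hy(1) u(1) c'(2)] u(2,3) c(2,3) c'(3,4) in simp_all)
 ultimately show ?thesis using S_comp u(1) c' by blast
qed

end


section \<open>Boundaries and horns built cell by cell, simultaneously in C and D\<close>

section \<open>Geometric functors preserve cellular matching objects\<close>

locale geometric = functor_between C D F + C: cover_category C S + D: covers D S'
 for C :: "('o, 'm) cat" (structure) and S and D :: "('p, 'n) cat" and S' and F +
 assumes F_S: "\<And>f. f \<in> S ==> AMap F f \<in> S'"
  and F_pullback: "\<And>f g p q. f \<in> S ==> is_pullback C f g p q ==>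
   is_pullback D (AMap F f) (AMap F g) (AMap F p) (AMap F q)"

locale geometric_map = geometric C S D S' F + simplicial_map C X Y \<phi>
 for C :: "('o, 'm) cat" (structure) and S and D :: "('p, 'n) cat" and S' and F and X Y \<phi>
begin

abbreviation FX where "FX \<equiv> OMap (sFun F) X"
abbreviation FY where "FY \<equiv> OMap (sFun F) Y"
abbreviation F\<phi> where "F\<phi> \<equiv> \<lambda>n. AMap F (\<phi> n)"

sublocale Ff: simplicial_map D FX FY F\<phi>
 using sFun_sobj sobj_X sobj_Y sFun_smap smap by unfold_locales auto

text \<open>The invariant of the cellular construction. F is only known to preserve pullbacks of
  covers, so preservation of the matching object has to be carried along while it is built.\<close>

definition matched :: "nat list set => nat => 'o => (nat list => 'm) => 'm => bool" where
 "matched K n L x y \<longleftrightarrow> is_rel_matching C K n (X, Y, \<phi>) L x y \<and>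
   is_rel_matching D K n (FX, FY, F\<phi>) (OMap F L) (\<lambda>\<mu>. AMap F (x \<mu>)) (AMap F y)"

lemma matched_point:
 assumes "matched K n L x y"
 shows "\<And>\<mu>. \<mu> \<in> K ==> x \<mu> \<in> L -> (level X (dim \<mu>))" "y \<in> L -> (level Y n)" "L \<in> Obj C"
  "is_rel_point C K n (X, Y, \<phi>) L x y"
proof -
 show p: "is_rel_point C K n (X, Y, \<phi>) L x y"
  using assms by (simp add: matched_def is_rel_matching_def)
 then show "\<And>\<mu>. \<mu> \<in> K ==> x \<mu> \<in> L -> (level X (dim \<mu>))" "y \<in> L -> (level Y n)"
  using rel_point_Hom by blast+
 then show "L \<in> Obj C" using C.Hom_Obj by blast
qed

text \<open>Both pullback squares are hypotheses because the leg that is a cover varies: it is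
  \<open>c\<close> for a general cell, but \<open>v\<close> for the apex of a horn.\<close>

lemma matched_attach:
 assumes K: "ssubset n K" and s: "s \<in> std_simplex n" "distinct s"
  and A: "A = {\<alpha> \<in> std_simplex (dim s). lcomp s \<alpha> \<in> K}"
  and L: "matched K n L x y" and L': "matched A (dim s) L' x' y'"
  and c: "c \<in> (level X (dim s)) -> L'"
   "\<And>\<alpha>. \<alpha> \<in> A ==> x' \<alpha> \<cdot> c = sop C X (dim s) \<alpha>" "y' \<cdot> c = \<phi> (dim s)"
  and v: "v \<in> L -> L'"
   "\<And>\<alpha>. \<alpha> \<in> A ==> x' \<alpha> \<cdot> v = x (lcomp s \<alpha>)" "y' \<cdot> v = sop C Y n s \<cdot> y"
  and pb: "is_pullback C c v p q" "is_pullback D (AMap F c) (AMap F v) (AMap F p) (AMap F q)"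
 defines "z \<equiv> \<lambda>\<mu>. if \<mu> \<in> K then x \<mu> \<cdot> q else sop C X (dim s) (rank_list s \<mu>) \<cdot> p"
 shows "matched (attach n K s) n (Dom C p) z (y \<cdot> q)"
proof -
 let ?m = "dim s"
 have p: "p \<in> (Dom C p) -> (level X ?m)" and q: "q \<in> (Dom C p) -> L"
  using C.pullback_Hom(1-4)[OF pb(1)] c(1) v(1) HomD(2) by metis+
 note LH = matched_point[OF L] and LH' = matched_point[OF L']
 have C: "is_rel_matching C (attach n K s) n (X, Y, \<phi>) (Dom C p) z (y \<cdot> q)"
  unfolding z_def
  by (rule rel_matching_attach[OF K s A _ _ c v pb(1)]) (use L L' in \<open>auto simp: matched_def\<close>)
 let ?z = "\<lambda>\<mu>. if \<mu> \<in> K then AMap F (x \<mu>) \<cdot>\<^bsub>D\<^esub> AMap F q else sop D FX ?m (rank_list s \<mu>) \<cdot>\<^bsub>D\<^esub> AMap F p"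
 have "is_rel_matching D (attach n K s) n (FX, FY, F\<phi>) (Dom D (AMap F p)) ?z (AMap F y \<cdot>\<^bsub>D\<^esub> AMap F q)"
 proof (rule Ff.rel_matching_attach[OF K s A _ _ _ _ _ _ _ _ pb(2)])
  show "is_rel_matching D K n (FX, FY, F\<phi>) (OMap F L) (\<lambda>\<mu>. AMap F (x \<mu>)) (AMap F y)"
   "is_rel_matching D A ?m (FX, FY, F\<phi>) (OMap F L') (\<lambda>\<mu>. AMap F (x' \<mu>)) (AMap F y')"
   using L L' by (auto simp: matched_def)
  show "AMap F c \<in> Hom D (level FX ?m) (OMap F L')" "AMap F v \<in> Hom D (OMap F L) (OMap F L')"
   using F_Hom[OF c(1)] F_Hom[OF v(1)] by simp_all
  show "AMap F y' \<cdot>\<^bsub>D\<^esub> AMap F c = AMap F (\<phi> ?m)"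
   using F_comp[OF LH'(2) c(1)] c(3) by simp
  show "AMap F y' \<cdot>\<^bsub>D\<^esub> AMap F v = sop D FY n s \<cdot>\<^bsub>D\<^esub> AMap F y"
   using F_comp[OF LH'(2) v(1)] v(3) F_comp[OF C.sop_Hom[OF sobj_Y s(1)] LH(2)] F_sop[OF sobj_Y s(1)] by simp
  fix \<alpha> assume a: "\<alpha> \<in> A"
  then show "AMap F (x' \<alpha>) \<cdot>\<^bsub>D\<^esub> AMap F c = sop D FX ?m \<alpha>"
   using F_comp[OF LH'(1)[OF a] c(1)] c(2) F_sop[OF sobj_X, of \<alpha> ?m] by (simp add: A)
  show "AMap F (x' \<alpha>) \<cdot>\<^bsub>D\<^esub> AMap F v = AMap F (x (lcomp s \<alpha>))"
   using F_comp[OF LH'(1)[OF a] v(1)] v(2)[OF a] by simp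
 qed
 moreover have "Dom D (AMap F p) = OMap F (Dom C p)" using F_Hom[OF p] HomD(2) by metis
 moreover have "AMap F y \<cdot>\<^bsub>D\<^esub> AMap F q = AMap F (y \<cdot> q)" using F_comp[OF LH(2) q] by simp
 moreover have "?z \<mu> = AMap F (z \<mu>)" if k: "\<mu> \<in> attach n K s" for \<mu>
 proof (cases "\<mu> \<in> K")
  case True
  then show ?thesis using F_comp[OF LH(1)[OF True] q] by (simp add: z_def)
 next
  case False
  then have r: "rank_list s \<mu> \<in> std_simplex ?m"
   using k rank_list(1)[OF s, of \<mu>] by (auto simp: attach_def)
  show ?thesis using False F_comp[OF C.sop_Hom[OF sobj_X r] p] F_sop[OF sobj_X r] by (simp add: z_def)
 qed
 ultimately have "is_rel_matching D (attach n K s) n (FX, FY, F\<phi>) (OMap F (Dom C p)) (\<lambda>\<mu>. AMap F (z \<mu>)) (AMap F (y \<cdot> q))"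
  by (subst is_rel_matching_cong[OF ssubset_attach[OF K], where x' = ?z]) simp_all
 with C show ?thesis by (simp add: matched_def)
qed

end

text \<open>A simplicial subset is recorded by the vertex sets of its cells, each enlarged by
  \<open>E\<close>. Taking \<open>E = {}\<close> covers arbitrary subsets and \<open>E = {k}\<close>
  the cones with apex \<open>k\<close>, so boundaries and horns are treated alike.\<close>

definition family :: "nat => nat set => nat set set => bool" where
 "family n E \<A> \<longleftrightarrow> (\<forall>A\<in>\<A>. A \<subseteq> {..n} \<and> A \<noteq> {} \<and> E \<subseteq> A \<and> (\<forall>B. E \<subseteq> B --> B \<subseteq> A --> B \<noteq> {} --> B \<in> \<A>))"

definition family_simplices :: "nat => nat set => nat set set => nat list set" where
 "family_simplices n E \<A> = {\<mu> \<in> std_simplex n. E \<union> set \<mu> \<in> \<A>}"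

definition shell :: "nat => nat set => nat list set" where
 "shell n E = {\<mu> \<in> std_simplex n. E \<union> set \<mu> \<noteq> {..n}}"

lemma bdry_eq_shell: "bdry n = shell n {}" and horn_eq_shell: "horn n k = shell n {k}"
 by (simp_all add: bdry_def horn_def shell_def)

lemma std_simplex_set: "\<mu> \<in> std_simplex n ==> set \<mu> \<subseteq> {..n}" "\<mu> \<in> std_simplex n ==> set \<mu> \<noteq> {}"
 by (auto simp: std_simplex_def)

lemma ssubset_shell: "E \<subseteq> {..n} ==> ssubset n (shell n E)"
 unfolding ssubset_def shell_def using std_simplex_set(1) by blast

lemma ssubset_family_simplices: "family n E \<A> ==> ssubset n (family_simplices n E \<A>)"
 unfolding ssubset_def
proof (intro conjI ballI impI)
 fix \<mu> \<mu>' assume f: "family n E \<A>" and k: "\<mu> \<in> family_simplices n E \<A>" "\<mu>' \<in> std_simplex n" "set \<mu>' \<subseteq> set \<mu>"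
 then have "E \<union> set \<mu>' \<subseteq> E \<union> set \<mu>" "E \<union> set \<mu>' \<noteq> {}" "E \<union> set \<mu> \<in> \<A>"
  using std_simplex_set(2)[OF k(2)] by (auto simp: family_simplices_def)
 then have "E \<union> set \<mu>' \<in> \<A>" using f unfolding family_def by (metis Un_upper1)
 then show "\<mu>' \<in> family_simplices n E \<A>" using k(2) by (simp add: family_simplices_def)
qed (auto simp: family_simplices_def)

lemma family_shell:
 assumes "E \<subseteq> {..n}"
 shows "family n E {A. E \<subseteq> A \<and> A \<noteq> {} \<and> A \<subset> {..n}}"
  and "family_simplices n E {A. E \<subseteq> A \<and> A \<noteq> {} \<and> A \<subset> {..n}} = shell n E"
 using assms std_simplex_set unfolding family_def family_simplices_def shell_def by blast+

lemma enum_simplex: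
 assumes "\<sigma> \<subseteq> {..n}" "\<sigma> \<noteq> {}"
 defines "s \<equiv> sorted_list_of_set \<sigma>"
 shows "s \<in> std_simplex n" "distinct s" "set s = \<sigma>" "dim s = card \<sigma> - 1" "length s = card \<sigma>"
  "bij_betw ((!) s) {..dim s} \<sigma>"
proof -
 have fin: "finite \<sigma>" using assms(1) finite_subset by blast
 then show s: "set s = \<sigma>" "distinct s" "length s = card \<sigma>" "dim s = card \<sigma> - 1"
  by (simp_all add: s_def dim_def)
 show "s \<in> std_simplex n" using assms(1,2) fin by (auto simp: std_simplex_def s_def)
 have "card \<sigma> > 0" using fin assms(2) by (simp add: card_gt_0_iff)
 then have "{..dim s} = {..<length s}" using s by auto
 then show "bij_betw ((!) s) {..dim s} \<sigma>" using bij_betw_nth[OF s(2)] s(1) by simp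
qed

text \<open>All proper faces of \<open>\<sigma>\<close> that contain \<open>E\<close> are already
  present, so the new cell meets the old part in its own shell: its boundary if \<open>E\<close> is
  empty, its horn at the position of \<open>k\<close> if \<open>E = {k}\<close>.\<close>

lemma family_attach:
 assumes f: "family n E (insert \<sigma> \<A>)" "family n E \<A>" and \<sigma>: "\<sigma> \<notin> \<A>"
 defines "s \<equiv> sorted_list_of_set \<sigma>"
 shows "family_simplices n E (insert \<sigma> \<A>) = attach n (family_simplices n E \<A>) s"
  and "{\<alpha> \<in> std_simplex (dim s). lcomp s \<alpha> \<in> family_simplices n E \<A>} = shell (dim s) {j. j \<le> dim s \<and> s ! j \<in> E}"
proof -
 have ss: "\<sigma> \<subseteq> {..n}" "\<sigma> \<noteq> {}" "E \<subseteq> \<sigma>"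
  and dc: "\<And>B. E \<subseteq> B ==> B \<subseteq> \<sigma> ==> B \<noteq> {} ==> B \<in> insert \<sigma> \<A>"
  using f(1) unfolding family_def by auto
 note e = enum_simplex[OF ss(1,2), folded s_def]
 show "family_simplices n E (insert \<sigma> \<A>) = attach n (family_simplices n E \<A>) s"
 proof (intro set_eqI iffI)
  fix \<mu> assume "\<mu> \<in> family_simplices n E (insert \<sigma> \<A>)"
  then show "\<mu> \<in> attach n (family_simplices n E \<A>) s"
   unfolding family_simplices_def attach_def e(3) by auto
 next
  fix \<mu> assume k: "\<mu> \<in> attach n (family_simplices n E \<A>) s"
  show "\<mu> \<in> family_simplices n E (insert \<sigma> \<A>)"
  proof (cases "\<mu> \<in> family_simplices n E \<A>")
   case False
   then have k': "\<mu> \<in> std_simplex n" "set \<mu> \<subseteq> \<sigma>" using k e(3) by (auto simp: attach_def)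
   then have "E \<union> set \<mu> \<in> insert \<sigma> \<A>"
    using std_simplex_set(2)[OF k'(1)] ss(3) by (intro dc) auto
   then show ?thesis using k'(1) by (simp add: family_simplices_def)
  qed (auto simp: family_simplices_def)
 qed
 have b: "inj_on ((!) s) {..dim s}" "(!) s ` {..dim s} = \<sigma>" using e(6) by (auto simp: bij_betw_def)
 let ?E = "{j. j \<le> dim s \<and> s ! j \<in> E}"
 have iE: "(!) s ` ?E = E" using b(2) ss(3) by (auto simp: image_iff)
 show "{\<alpha> \<in> std_simplex (dim s). lcomp s \<alpha> \<in> family_simplices n E \<A>} = shell (dim s) ?E"
  unfolding shell_def
 proof (intro Collect_cong conj_cong refl)
  fix \<alpha> assume a: "\<alpha> \<in> std_simplex (dim s)"
  have l: "lcomp s \<alpha> \<in> std_simplex n" "set (lcomp s \<alpha>) \<subseteq> \<sigma>"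
   using lcomp_in_std_simplex[OF e(1) a] e(3) by auto
  have "E \<union> set (lcomp s \<alpha>) = (!) s ` (?E \<union> set \<alpha>)"
   using iE by (simp add: lcomp_def image_Un)
  moreover have "?E \<union> set \<alpha> \<subseteq> {..dim s}" using std_simplex_set(1)[OF a] by auto
  ultimately have "E \<union> set (lcomp s \<alpha>) = \<sigma> \<longleftrightarrow> ?E \<union> set \<alpha> = {..dim s}"
   using inj_on_image_eq_iff[OF b(1), of "?E \<union> set \<alpha>" "{..dim s}"] b(2) by auto
  moreover have "E \<union> set (lcomp s \<alpha>) \<in> insert \<sigma> \<A>"
   using l std_simplex_set(2)[OF l(1)] ss(3) by (intro dc) auto
  ultimately show "lcomp s \<alpha> \<in> family_simplices n E \<A> \<longleftrightarrow> ?E \<union> set \<alpha> \<noteq> {..dim s}"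
   using \<sigma> l(1) unfolding family_simplices_def by auto
 qed
qed

context geometric_map
begin

text \<open>Induction on the number of missing cells. The comparison map of each cell is a cover, so
  the pullback attaching it exists and is preserved by F. The projection \<open>e\<close> is a
  composite of base changes of such covers; for horns it becomes the cover onto the pullback at the
  apex.\<close>

lemma matched_family:
 assumes f0: "family n E \<A>0" and L0: "matched (family_simplices n E \<A>0) n L0 x0 y0"
  and "family n E \<A>" "\<A>0 \<subseteq> \<A>"
  and cells: "\<And>\<sigma>. \<sigma> \<in> \<A> - \<A>0 ==>
   let m = card \<sigma> - 1; A = shell m {j. j \<le> m \<and> sorted_list_of_set \<sigma> ! j \<in> E}
   in rel_matching_cover C S A m (X, Y, \<phi>) \<and> (\<exists>L x y. matched A m L x y)"
 shows "\<exists>L x y. matched (family_simplices n E \<A>) n L x y \<and>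
  (\<exists>e\<in>S. e \<in> L -> L0 \<and> (\<forall>\<mu>\<in>family_simplices n E \<A>0. x \<mu> = x0 \<mu> \<cdot> e) \<and> y = y0 \<cdot> e)"
 using assms(3-5)
proof (induction "card (\<A> - \<A>0)" arbitrary: \<A>)
 case 0
 have "\<A> \<subseteq> Pow {..n}" using 0(2) unfolding family_def by blast
 then have "finite \<A>" using finite_subset by blast
 then have e: "\<A> = \<A>0" using 0(1,3) by auto
 have o: "L0 \<in> Obj C" using matched_point(3)[OF L0] .
 show ?case unfolding e
  using L0 C.S_Idm[OF o] C.Idm_Hom[OF o] C.comp_Idm[OF matched_point(1)[OF L0]] C.comp_Idm[OF matched_point(2)[OF L0]]
  by (intro exI conjI bexI[of _ "Idm C L0"]) auto
next
 case (Suc k)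
 have "\<A> \<subseteq> Pow {..n}" using Suc.prems(1) unfolding family_def by blast
 then have fin: "finite \<A>" using finite_subset by blast
 have ne: "\<A> - \<A>0 \<noteq> {}" using Suc.hyps(2) by (metis card.empty nat.distinct(1))
 \<comment> \<open>A set of largest size among the new ones lies in no other new one, nor in an old
   one, as the old family is downward closed. Removing it keeps the family downward closed.\<close>
 have "Max (card ` (\<A> - \<A>0)) \<in> card ` (\<A> - \<A>0)" using fin ne by (intro Max_in) auto
 then obtain \<sigma> where \<sigma>0: "\<sigma> \<in> \<A> - \<A>0" "card \<sigma> = Max (card ` (\<A> - \<A>0))" by auto
 then have \<sigma>: "\<sigma> \<in> \<A> - \<A>0" "\<And>B. B \<in> \<A> - \<A>0 ==> card B \<le> card \<sigma>"
  using fin by auto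
 let ?B = "\<A> - {\<sigma>}"
 have fB: "family n E ?B"
  unfolding family_def
 proof (intro ballI conjI allI impI)
  fix A assume A: "A \<in> ?B"
  then show "A \<subseteq> {..n}" "A \<noteq> {}" "E \<subseteq> A" using Suc.prems(1) by (auto simp: family_def)
  fix B assume B: "E \<subseteq> B" "B \<subseteq> A" "B \<noteq> {}"
  then have "B \<in> \<A>" using A Suc.prems(1) unfolding family_def by blast
  moreover have "B \<noteq> \<sigma>"
  proof
   assume "B = \<sigma>"
   then have "\<sigma> \<subset> A" using A B by auto
   then have "card \<sigma> < card A"
    using psubset_card_mono[of A \<sigma>] finite_subset[OF \<open>A \<subseteq> {..n}\<close>] by auto
   then have "A \<in> \<A>0" using \<sigma>(2)[of A] A by auto
   then show False using f0 B \<open>B = \<sigma>\<close> \<sigma>(1) unfolding family_def by blast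
  qed
  ultimately show "B \<in> ?B" by blast
 qed
 have "card (?B - \<A>0) = k"
 proof -
  have "?B - \<A>0 = (\<A> - \<A>0) - {\<sigma>}" by auto
  then show ?thesis using Suc.hyps(2) \<sigma>(1) fin by simp
 qed
 moreover have "\<A>0 \<subseteq> ?B" using Suc.prems(2) \<sigma>(1) by auto
 ultimately obtain L x y e where L: "matched (family_simplices n E ?B) n L x y"
  and e: "e \<in> S" "e \<in> L -> L0" "\<And>\<mu>. \<mu> \<in> family_simplices n E \<A>0 ==> x \<mu> = x0 \<mu> \<cdot> e" "y = y0 \<cdot> e"
  using Suc.hyps(1)[of ?B] fB Suc.prems(3) by blast
 let ?s = "sorted_list_of_set \<sigma>" and ?K = "family_simplices n E ?B"
 have A: "\<A> = insert \<sigma> ?B" using \<sigma>(1) by auto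
 have ss: "\<sigma> \<subseteq> {..n}" "\<sigma> \<noteq> {}" using Suc.prems(1) \<sigma>(1) by (auto simp: family_def)
 note en = enum_simplex[OF ss]
 have att: "family_simplices n E \<A> = attach n ?K ?s"
  "{\<alpha> \<in> std_simplex (dim ?s). lcomp ?s \<alpha> \<in> ?K} = shell (dim ?s) {j. j \<le> dim ?s \<and> ?s ! j \<in> E}"
  using family_attach[of n E \<sigma> ?B] Suc.prems(1) fB A by simp_all
 define A where "A = shell (dim ?s) {j. j \<le> dim ?s \<and> ?s ! j \<in> E}"
 have ssA: "ssubset (dim ?s) A" unfolding A_def by (rule ssubset_shell) auto
 obtain L' x' y' where L': "matched A (dim ?s) L' x' y'" and cov: "rel_matching_cover C S A (dim ?s) (X, Y, \<phi>)"
  using Suc.prems(3)[OF \<sigma>(1)] unfolding A_def en(4) Let_def by blast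
 have M': "is_rel_matching C A (dim ?s) (X, Y, \<phi>) L' x' y'" using L' by (simp add: matched_def)
 obtain c where c: "c \<in> (level X (dim ?s)) -> L'"
   "\<And>\<alpha>. \<alpha> \<in> A ==> x' \<alpha> \<cdot> c = sop C X (dim ?s) \<alpha>" "y' \<cdot> c = \<phi> (dim ?s)"
  using rel_matching_comparison[OF M' ssA] by blast
 have cS: "c \<in> S" using rel_matching_coverD[OF C.covers_axioms ssA cov M' c] .
 have ssK: "ssubset n ?K" using ssubset_family_simplices[OF fB] .
 have Lp: "is_rel_point C ?K n (X, Y, \<phi>) L x y" using matched_point(4)[OF L] .
 \<comment> \<open>The part of the universal point of \<open>L\<close> that lies on the new cell,
   reindexed by positions in \<open>?s\<close>. It classifies the arrow \<open>v\<close>.\<close>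
 have "is_rel_point C A (dim ?s) (X, Y, \<phi>) L (\<lambda>\<alpha>. x (lcomp ?s \<alpha>)) (sop C Y n ?s \<cdot> y)"
  unfolding is_rel_point_iff
 proof (intro conjI ballI)
  note sY = C.sop_Hom[OF sobj_Y en(1)]
  show "sop C Y n ?s \<cdot> y \<in> L -> (level Y (dim ?s))"
   using sY matched_point(2)[OF L] by blast
  have lA: "\<alpha> \<in> std_simplex (dim ?s)" "lcomp ?s \<alpha> \<in> ?K" if "\<alpha> \<in> A" for \<alpha>
   using att(2) that unfolding A_def by blast+
  show "spoint A (hset C X L) (\<lambda>\<alpha>. x (lcomp ?s \<alpha>))"
   unfolding spoint_def
  proof (intro conjI ballI allI impI)
   fix \<alpha> assume a: "\<alpha> \<in> A"
   have xp: "spoint ?K (hset C X L) x" using Lp by (simp add: is_rel_point_iff)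
   have d: "dim (lcomp ?s \<alpha>) = dim \<alpha>" by (simp add: lcomp_def)
   show "x (lcomp ?s \<alpha>) \<in> pts (hset C X L) (dim \<alpha>)"
    using spoint_pts[OF xp lA(2)[OF a]] d by simp
   fix m i
   show "x (lcomp ?s (del_nth i \<alpha>)) = fc (hset C X L) m i (x (lcomp ?s \<alpha>))" if "dim \<alpha> = Suc m" "i \<le> Suc m"
    using spoint_del[OF xp lA(2)[OF a], of m i] d that by (simp add: lcomp_def del_nth_map)
   show "x (lcomp ?s (dup_nth i \<alpha>)) = dg (hset C X L) m i (x (lcomp ?s \<alpha>))" if "dim \<alpha> = m" "i \<le> m"
    using spoint_dup[OF xp lA(2)[OF a], of i] d that by (simp add: lcomp_def dup_nth_map)
  qed
  fix \<alpha> assume a: "\<alpha> \<in> A"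
  then show "\<phi> (dim \<alpha>) \<cdot> x (lcomp ?s \<alpha>) = sop C Y (dim ?s) \<alpha> \<cdot> (sop C Y n ?s \<cdot> y)"
   using Lp lA[OF a] C.assoc[OF C.sop_Hom[OF sobj_Y lA(1)[OF a]] sY matched_point(2)[OF L]]
    C.sop_lcomp[OF sobj_Y en(1) lA(1)[OF a]] dim_map[of "(!) ?s" \<alpha>]
   unfolding is_rel_point_iff lcomp_def by metis
 qed
 then obtain v where v: "v \<in> L -> L'"
   "\<And>\<alpha>. \<alpha> \<in> A ==> x' \<alpha> \<cdot> v = x (lcomp ?s \<alpha>)" "y' \<cdot> v = sop C Y n ?s \<cdot> y"
  using rel_matching_lift[OF M'] by blast
 obtain p q where pb: "is_pullback C c v p q"
  using C.S_pullback[OF cS, of v] c(1) v(1) HomD by metis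
 \<comment> \<open>The new projection is a base change of the comparison map of the cell, so
   composing it with \<open>e\<close> gives a cover again.\<close>
 have q: "q \<in> S" "q \<in> (Dom C p) -> L"
  using C.S_base[OF cS pb] C.pullback_Hom(2,4)[OF pb] v(1) HomD(2) by metis+
 let ?z = "\<lambda>\<mu>. if \<mu> \<in> ?K then x \<mu> \<cdot> q else sop C X (dim ?s) (rank_list ?s \<mu>) \<cdot> p"
 have "matched (attach n ?K ?s) n (Dom C p) ?z (y \<cdot> q)"
  by (rule matched_attach[OF ssK en(1,2) _ L L' c v pb F_pullback[OF cS pb]])
   (simp add: A_def att(2))
 moreover have "e \<cdot> q \<in> S" "e \<cdot> q \<in> (Dom C p) -> L0"
  using C.S_comp e q by blast+
 moreover have "?z \<mu> = x0 \<mu> \<cdot> (e \<cdot> q)" if k: "\<mu> \<in> family_simplices n E \<A>0" for \<mu>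
 proof -
  have "\<mu> \<in> ?K" using k Suc.prems(2) \<sigma>(1) unfolding family_simplices_def by blast
  then show ?thesis using C.assoc[OF matched_point(1)[OF L0 k] e(2) q(2)] e(3)[OF k] by simp
 qed
 moreover have "y \<cdot> q = y0 \<cdot> (e \<cdot> q)"
  using C.assoc[OF matched_point(2)[OF L0] e(2) q(2)] e(4) by simp
 ultimately show ?case unfolding att(1) by blast
qed

text \<open>Starting point of the construction: with nothing prescribed in X, the fibre product is
  the level of Y, and its universal property is preserved trivially.\<close>

lemma matched_empty: "matched {} n (level Y n) x (Idm C (level Y n))"
proof -
 have o: "level Y n \<in> Obj C" "level FY n \<in> Obj D" using sobj_level[OF sobj_Y] sobj_level[OF Ff.sobj_Y, of n] by auto
 have "is_rel_matching C {} n (X, Y, \<phi>) (level Y n) x (Idm C (level Y n))"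
  by (rule rel_matchingI) (use o C.Idm_Hom[OF o(1)] in \<open>auto simp: is_rel_point_iff spoint_def\<close>)
 moreover have "is_rel_matching D {} n (FX, FY, F\<phi>) (level FY n) (\<lambda>\<mu>. AMap F (x \<mu>)) (Idm D (level FY n))"
  by (rule Ff.rel_matchingI) (use o D.Idm_Hom[OF o(2)] in \<open>auto simp: is_rel_point_iff spoint_def\<close>)
 ultimately show ?thesis using F_Idm[OF o(1)] by (simp add: matched_def)
qed

text \<open>Every cell of the boundary has dimension below \<open>n\<close> and is attached along
  its own boundary, whose matching object comes from the induction and whose comparison map is a
  cover by assumption.\<close>

lemma matched_bdry:
 assumes "\<And>j. j < n ==> rel_matching_cover C S (bdry j) j (X, Y, \<phi>)"
 shows "\<exists>L x y. matched (bdry n) n L x y"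
 using assms
proof (induction n rule: less_induct)
 case (less n)
 let ?A = "{A. {} \<subseteq> A \<and> A \<noteq> {} \<and> A \<subset> {..n}}"
 have "\<exists>L x y. matched (family_simplices n {} ?A) n L x y \<and>
  (\<exists>e\<in>S. e \<in> L -> (level Y n) \<and> (\<forall>\<mu>\<in>family_simplices n {} {}. x \<mu> = undefined \<mu> \<cdot> e) \<and> y = Idm C (level Y n) \<cdot> e)"
 proof (rule matched_family)
  show "family n {} {}" by (simp add: family_def)
  show "matched (family_simplices n {} {}) n (level Y n) undefined (Idm C (level Y n))"
   using matched_empty by (simp add: family_simplices_def)
  show "family n {} ?A" by (rule family_shell(1)) simp
  fix \<sigma> assume s: "\<sigma> \<in> ?A - {}"
  then have "card \<sigma> < card {..n}" "card \<sigma> \<noteq> 0"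
   using psubset_card_mono[of "{..n}" \<sigma>] finite_subset[of \<sigma> "{..n}"] by auto
  then have "card \<sigma> - 1 < n" by auto
  then show "let m = card \<sigma> - 1; A = shell m {j. j \<le> m \<and> sorted_list_of_set \<sigma> ! j \<in> {}}
   in rel_matching_cover C S A m (X, Y, \<phi>) \<and> (\<exists>L x y. matched A m L x y)"
   using less.IH[of "card \<sigma> - 1"] less.prems[of "card \<sigma> - 1"] less.prems
   by (simp add: bdry_eq_shell Let_def)
 qed simp
 moreover have "family_simplices n {} ?A = bdry n"
  unfolding bdry_eq_shell by (rule family_shell(2)) simp
 ultimately show ?case by metis
qed

text \<open>A horn is obtained from its apex by filling smaller horns.\<close>

lemma matched_horn:
 assumes vertex: "\<And>m j. j \<le> m ==> sop C Y m [j] \<in> S" and "1 \<le> n" "k \<le> n"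
  and "\<And>m j. 1 \<le> m ==> m < n ==> j \<le> m ==> rel_matching_cover C S (horn m j) m (X, Y, \<phi>)"
 shows "\<exists>L x y p q e. matched (horn n k) n L x y \<and> is_pullback C (\<phi> 0) (sop C Y n [k]) p q \<and>
  e \<in> S \<and> e \<in> L -> (Dom C p) \<and> p \<cdot> e = x [k] \<and> q \<cdot> e = y"
 using assms(2-4)
proof (induction n arbitrary: k rule: less_induct)
 case (less n)
 let ?A = "{A. {k} \<subseteq> A \<and> A \<noteq> {} \<and> A \<subset> {..n}}" and ?v = "sop C Y n [k]"
 have k: "[k] \<in> std_simplex n" using less.prems(2) by (simp add: std_simplex_def)
 have v: "?v \<in> (level Y n) -> (level Y 0)" using C.sop_Hom[OF sobj_Y k] by simp
 have vS: "?v \<in> S" using vertex less.prems(2) .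
 \<comment> \<open>Here the vertex operator of Y is the cover and \<open>\<phi> 0\<close> is
   arbitrary, so the square is formed with exchanged roles and then transposed.\<close>
 obtain p q where pb': "is_pullback C ?v (\<phi> 0) q p"
  using C.S_pullback[OF vS, of "\<phi> 0"] phi_Hom[of 0] v HomD by metis
 note pb = C.pullback_sym[OF pb']
 have p: "p \<in> (Dom C p) -> (level X 0)" and q: "q \<in> (Dom C p) -> (level Y n)"
  using C.pullback_Hom(1-4)[OF pb] phi_Hom[of 0] v HomD(2) by metis+
 let ?z = "\<lambda>\<mu>. if \<mu> \<in> {} then undefined \<mu> \<cdot> q else sop C X (dim [k]) (rank_list [k] \<mu>) \<cdot> p"
 have base: "matched (attach n {} [k]) n (Dom C p) ?z (Idm C (level Y n) \<cdot> q)"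
 proof (rule matched_attach[OF _ k _ refl matched_empty _ _ _ _ _ _ _ pb])
  show "matched {\<alpha> \<in> std_simplex (dim [k]). lcomp [k] \<alpha> \<in> {}} (dim [k]) (level Y 0) undefined (Idm C (level Y 0))"
   using matched_empty by simp
  show "is_pullback D (AMap F (\<phi> 0)) (AMap F ?v) (AMap F p) (AMap F q)"
   by (rule D.pullback_sym[OF F_pullback[OF vS pb']])
 qed (use v phi_Hom[of 0] in \<open>auto simp: ssubset_def\<close>)
 have base_eq: "family_simplices n {k} {{k}} = attach n {} [k]"
  using std_simplex_set(2) unfolding family_simplices_def attach_def by fastforce
 have kb: "[k] \<in> family_simplices n {k} {{k}}" using k by (simp add: family_simplices_def)
 have "\<exists>L x y. matched (family_simplices n {k} ?A) n L x y \<and>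
  (\<exists>e\<in>S. e \<in> L -> (Dom C p) \<and> (\<forall>\<mu>\<in>family_simplices n {k} {{k}}. x \<mu> = ?z \<mu> \<cdot> e) \<and> y = (Idm C (level Y n) \<cdot> q) \<cdot> e)"
 proof (rule matched_family)
  show "family n {k} {{k}}" using less.prems(2) by (auto simp: family_def)
  show "matched (family_simplices n {k} {{k}}) n (Dom C p) ?z (Idm C (level Y n) \<cdot> q)"
   using base unfolding base_eq .
  show "family n {k} ?A" by (rule family_shell(1)) (use less.prems in simp)
  have "card {k} \<noteq> card {..n}" using less.prems(1) by simp
  then have "{k} \<noteq> {..n}" by metis
  then show "{{k}} \<subseteq> ?A" using less.prems(2) by auto
  fix \<sigma> assume s: "\<sigma> \<in> ?A - {{k}}"
  let ?m = "card \<sigma> - 1"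
  have fin: "finite \<sigma>" using s finite_subset[of \<sigma> "{..n}"] by auto
  have "card \<sigma> < card {..n}" using s psubset_card_mono[of "{..n}" \<sigma>] by auto
  moreover have "card {k} < card \<sigma>" using s fin by (intro psubset_card_mono) auto
  \<comment> \<open>A cell beyond the apex has at least two and at most \<open>n\<close> vertices,
    so only horns of dimension 1 to \<open>n - 1\<close> occur.\<close>
  ultimately have m: "1 \<le> ?m" "?m < n" by auto
  note en = enum_simplex[of \<sigma> n]
  have ss: "\<sigma> \<subseteq> {..n}" "\<sigma> \<noteq> {}" "k \<in> \<sigma>" using s by auto
  have "\<exists>j\<le>?m. sorted_list_of_set \<sigma> ! j = k"
   using en(6)[OF ss(1,2)] ss(3) unfolding en(4)[OF ss(1,2)] bij_betw_def by (metis atMost_iff imageE)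
  then obtain j where j: "j \<le> ?m" "sorted_list_of_set \<sigma> ! j = k" by blast
  \<comment> \<open>The shell along which the cell is attached is its horn at the position
    \<open>j\<close> of the apex.\<close>
  have "{j. j \<le> ?m \<and> sorted_list_of_set \<sigma> ! j \<in> {k}} = {j}"
   using j en(6)[OF ss(1,2)] unfolding en(4)[OF ss(1,2)] bij_betw_def inj_on_def by auto
  then show "let m = card \<sigma> - 1; A = shell m {j. j \<le> m \<and> sorted_list_of_set \<sigma> ! j \<in> {k}}
   in rel_matching_cover C S A m (X, Y, \<phi>) \<and> (\<exists>L x y. matched A m L x y)"
   using less.IH[OF m(2,1) j(1)] less.prems(3)[OF m j(1)] less.prems(3) m(2)
   unfolding horn_eq_shell[symmetric] Let_def by (metis (no_types, lifting) horn_eq_shell less_trans)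
 qed
 moreover have "family_simplices n {k} ?A = horn n k"
  unfolding horn_eq_shell by (rule family_shell(2)) (use less.prems in simp)
 ultimately obtain L x y where L: "matched (horn n k) n L x y"
  and "\<exists>e\<in>S. e \<in> L -> (Dom C p) \<and> (\<forall>\<mu>\<in>family_simplices n {k} {{k}}. x \<mu> = ?z \<mu> \<cdot> e) \<and>
   y = (Idm C (level Y n) \<cdot> q) \<cdot> e" by auto
 then obtain e where e: "e \<in> S" "e \<in> L -> (Dom C p)"
  "\<forall>\<mu>\<in>family_simplices n {k} {{k}}. x \<mu> = ?z \<mu> \<cdot> e" "y = (Idm C (level Y n) \<cdot> q) \<cdot> e" by blast
 have "rank_list [k] [k] = [0]" using rank_list_lcomp[OF k, of "[0]"] by (simp add: lcomp_def std_simplex_def)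
 then have "?z [k] = p" using C.sop_upt[OF sobj_X, of 0] C.Idm_comp[OF p] by simp
 then have "p \<cdot> e = x [k]" "q \<cdot> e = y" using bspec[OF e(3) kb] e(4) C.Idm_comp[OF q] by simp_all
 then show ?case using L e(1,2) pb by blast
qed

end

section \<open>Kan conditions over terminal bases; preservation and reflection\<close>

section \<open>Infinity-groupoids\<close>

lemma terminal_Hom_unique:
 "is_terminal C t ==> category C ==> a \<in> Hom C T t ==> b \<in> Hom C T t ==> a = b"
 using category.Hom_Obj(1)[of C a T t] unfolding is_terminal_def by blast

lemma terminal_Hom_ex:
 assumes "is_terminal C t" "T \<in> Obj C"
 obtains u where "u \<in> Hom C T t"
 using assms unfolding is_terminal_def by blast

definition const_sobj :: "('o, 'm) cat => 'o => ('o, 'm) sobj" where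
 "const_sobj C t = \<lparr>level = (\<lambda>_. t), face = (\<lambda>_ _. Idm C t), degen = (\<lambda>_ _. Idm C t)\<rparr>"

lemma level_const_sobj [simp]: "level (const_sobj C t) n = t"
 by (simp add: const_sobj_def)

context category
begin

lemma terminal_iso:
 assumes "is_terminal C t" "is_terminal C t'" "f \<in> t -> t'"
 shows "is_iso C f"
proof -
 have o: "t \<in> Obj C" "t' \<in> Obj C" using Hom_Obj assms(3) by auto
 obtain g where g: "g \<in> t' -> t" using terminal_Hom_ex[OF assms(1) o(2)] by blast
 show ?thesis
  by (rule is_isoI[OF assms(3) g])
   (use terminal_Hom_unique[OF _ category_axioms] assms g o comp_Hom Idm_Hom in blast)+
qed

lemma iso_cancel:
 assumes "is_iso C f" "f \<in> X -> Y" "a \<in> T -> X" "b \<in> T -> X" "f \<cdot> a = f \<cdot> b"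
 shows "a = b"
proof -
 obtain g where g: "g \<in> Y -> X" "g \<cdot> f = Idm C X" using is_isoE[OF assms(1,2)] by metis
 have "(g \<cdot> f) \<cdot> a = (g \<cdot> f) \<cdot> b"
  using assoc[OF g(1) assms(2,3)] assoc[OF g(1) assms(2,4)] assms(5) by simp
 then show ?thesis using assms(3,4) by (simp add: g(2))
qed

lemma is_sobj_const: "t \<in> Obj C ==> is_sobj C (const_sobj C t)"
 unfolding is_sobj_def const_sobj_def using Idm_Hom[of t] Idm_comp[OF Idm_Hom[of t]] by simp

lemma terminal_sCatI:
 assumes Z: "is_sobj C Z" and t: "\<And>n. is_terminal C (level Z n)"
 shows "is_terminal (sCat C) Z"
 unfolding is_terminal_def
proof (intro conjI ballI)
 show c: "Z \<in> Obj (sCat C)" using Z by simp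
 fix T assume "T \<in> Obj (sCat C)"
 then have T: "is_sobj C T" by simp
 define u where "u = (\<lambda>n. SOME u. u \<in> (level T n) -> (level Z n))"
 have u: "u n \<in> (level T n) -> (level Z n)" for n
  unfolding u_def using terminal_Hom_ex[OF t sobj_level[OF T]] by (metis someI)
 have "is_smap C T Z u"
  unfolding is_smap_def
 proof (intro conjI allI impI)
  note tu = terminal_Hom_unique[OF t category_axioms]
  fix n show "u n \<in> (level T n) -> (level Z n)" using u by simp
  fix i
  show "u n \<cdot> face T n i = face Z n i \<cdot> u (Suc n)" if "i \<le> Suc n"
   by (rule tu[OF comp_Hom[OF u sobj_face[OF T that]] comp_Hom[OF sobj_face[OF Z that] u]])
  show "u (Suc n) \<cdot> degen T n i = degen Z n i \<cdot> u n" if "i \<le> n"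
   by (rule tu[OF comp_Hom[OF u sobj_degen[OF T that]] comp_Hom[OF sobj_degen[OF Z that] u]])
 qed
 then have "(T, Z, u) \<in> Hom (sCat C) T Z"
  using T c by (simp add: sCat_Hom)
 moreover have "f = g" if h: "f \<in> Hom (sCat C) T Z" "g \<in> Hom (sCat C) T Z" for f g
 proof -
  obtain a where a: "f = (T, Z, a)" "is_smap C T Z a" using sCat_HomE[OF h(1)] by metis
  obtain b where b: "g = (T, Z, b)" "is_smap C T Z b" using sCat_HomE[OF h(2)] by metis
  have "a n = b n" for n
   using smap_Hom[OF a(2), of n] smap_Hom[OF b(2), of n] terminal_Hom_unique[OF t category_axioms]
   by simp
  then show ?thesis using a b by auto
 qed
 ultimately show "\<exists>!u. u \<in> Hom (sCat C) T Z" by blast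
qed

lemma terminal_const_sobj: "is_terminal C t ==> is_terminal (sCat C) (const_sobj C t)"
 using is_sobj_const by (intro terminal_sCatI) (simp_all add: is_terminal_def)

text \<open>\<open>inf_groupoid\<close> speaks of an arbitrary terminal simplicial object. It is
  isomorphic to a constant one, and the isomorphism is levelwise.\<close>

lemma terminal_level:
 assumes t: "is_terminal C t" and Z: "is_terminal (sCat C) Z"
 shows "is_terminal C (level Z n)"
proof -
 interpret s: category "sCat C" by (rule category_sCat)
 have c: "is_terminal (sCat C) (const_sobj C t)" using terminal_const_sobj[OF t] .
 have Zo: "Z \<in> Obj (sCat C)" "const_sobj C t \<in> Obj (sCat C)" using Z c by (auto simp: is_terminal_def)
 obtain h where h: "h \<in> Hom (sCat C) (const_sobj C t) Z" using terminal_Hom_ex[OF Z Zo(2)] .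
 obtain k where k: "k \<in> Hom (sCat C) Z (const_sobj C t)" using terminal_Hom_ex[OF c Zo(1)] .
 have "h \<cdot>\<^bsub>sCat C\<^esub> k = Idm (sCat C) Z"
  using terminal_Hom_unique[OF Z category_sCat s.comp_Hom[OF h k] s.Idm_Hom[OF Zo(1)]] .
 then have e: "comps h n \<cdot> comps k n = Idm C (level Z n)"
  by (auto simp: fun_eq_iff)
 have hk: "comps h n \<in> t -> (level Z n)" "comps k n \<in> (level Z n) -> t"
  using h k smap_Hom[of C "const_sobj C t" Z "comps h" n] smap_Hom[of C Z "const_sobj C t" "comps k" n]
  by (auto simp: sCat_Hom)
 show ?thesis
  unfolding is_terminal_def
 proof (intro conjI ballI)
  show "level Z n \<in> Obj C" using Hom_Obj hk by blast
  fix T assume "T \<in> Obj C"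
  then obtain u where u: "u \<in> T -> t" using terminal_Hom_ex[OF t] by blast
  have "a = b" if a: "a \<in> T -> (level Z n)" "b \<in> T -> (level Z n)" for a b
  proof -
   have "comps k n \<cdot> a = comps k n \<cdot> b"
    using terminal_Hom_unique[OF t category_axioms] hk(2) a by blast
   then show ?thesis
    using assoc[OF hk a(1)] assoc[OF hk a(2)] e a by simp
  qed
  then show "\<exists>!u. u \<in> T -> (level Z n)" using comp_Hom[OF hk(1) u] by blast
 qed
qed

end

lemma (in category) terminal_smap:
 assumes X: "is_sobj C X" and Z: "is_sobj C Z" "\<And>n. is_terminal C (level Z n)"
 obtains \<psi> where "simplicial_map C X Z \<psi>"
proof -
 have "X \<in> Obj (sCat C)" using X by simp
 from terminal_Hom_ex[OF terminal_sCatI[OF Z] this] obtain u where u: "u \<in> Hom (sCat C) X Z" .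
 obtain \<psi> where "is_smap C X Z \<psi>" using sCat_HomE[OF u] by metis
 then show thesis using X Z(1) by (intro that[of \<psi>]) unfold_locales
qed

text \<open>The axiom concerns one terminal object; an isomorphism, being a cover, transfers it to
  all others.\<close>

lemma (in cover_category) terminal_S:
 assumes L: "is_terminal C L" and f: "f \<in> X -> L"
 shows "f \<in> S"
proof -
 obtain t where t: "is_terminal C t" "\<forall>f\<in>Arr C. Cod C f = t --> f \<in> S" using terminal_cover by blast
 obtain i where i: "i \<in> t -> L" using terminal_Hom_ex[OF L] t(1) unfolding is_terminal_def by blast
 obtain g where g: "g \<in> X -> t" using terminal_Hom_ex[OF t(1) Hom_Obj(1)[OF f]] .
 have "g \<in> S" "i \<in> S" using g t(2) S_iso[OF terminal_iso[OF t(1) L i]] by (auto simp: Hom_def)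
 then have "i \<cdot> g \<in> S" using S_comp i g by blast
 then show ?thesis using terminal_Hom_unique[OF L category_axioms f comp_Hom[OF i g]] by simp
qed

lemma vertex_std: "j \<le> n ==> [j] \<in> std_simplex n"
 by (simp add: std_simplex_def)

lemma ssubset_horn: "k \<le> n ==> ssubset n (horn n k)"
 unfolding horn_eq_shell by (rule ssubset_shell) simp

lemma ssubset_bdry: "ssubset n (bdry n)"
 unfolding bdry_eq_shell by (rule ssubset_shell) simp

lemma apex_in_horn: "1 \<le> n ==> k \<le> n ==> [k] \<in> horn n k"
proof -
 assume n: "1 \<le> n" "k \<le> n"
 then have "card {k} \<noteq> card {..n}" by simp
 then have "{k} \<noteq> {..n}" by metis
 then show ?thesis using vertex_std[OF n(2)] by (simp add: horn_def)
qed

context simplicial_map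
begin

text \<open>If the vertex operators of Y are invertible, this makes the image of a simplex under
  \<open>\<phi>\<close> depend on the image of any one of its vertices.\<close>

lemma phi_vertex:
 assumes "ssubset n K" "\<mu> \<in> K" "spoint K (hset C X T) x" "j \<le> dim \<mu>"
 shows "\<phi> 0 \<cdot> x [\<mu> ! j] = sop C Y (dim \<mu>) [j] \<cdot> (\<phi> (dim \<mu>) \<cdot> x \<mu>)"
proof -
 note j = vertex_std[OF assms(4)]
 have xH: "x \<mu> \<in> T -> (level X (dim \<mu>))" using spoint_pts[OF assms(3,2)] by simp
 have "x [\<mu> ! j] = sop C X (dim \<mu>) [j] \<cdot> x \<mu>"
  using spoint_hset_lcomp[OF sobj_X assms(1-3) j] by (simp add: lcomp_def)
 moreover have "\<phi> 0 \<cdot> (sop C X (dim \<mu>) [j] \<cdot> x \<mu>) = (\<phi> 0 \<cdot> sop C X (dim \<mu>) [j]) \<cdot> x \<mu>"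
  using assoc[OF phi_Hom _ xH] sop_Hom[OF sobj_X j] by simp
 moreover have "(sop C Y (dim \<mu>) [j] \<cdot> \<phi> (dim \<mu>)) \<cdot> x \<mu> = sop C Y (dim \<mu>) [j] \<cdot> (\<phi> (dim \<mu>) \<cdot> x \<mu>)"
  using assoc[OF sop_Hom[OF sobj_Y j] phi_Hom xH] .
 ultimately show ?thesis
  using sop_natural[OF sobj_X sobj_Y smap j] by simp
qed

text \<open>A horn is connected, so a map to an object whose vertex operators are invertible is
 determined on it by its value at the apex.\<close>

lemma horn_point_extends:
 assumes iso: "\<And>m j. j \<le> m ==> is_iso C (sop C Y m [j])"
  and n: "1 \<le> n" "k \<le> n" and x: "spoint (horn n k) (hset C X T) x"
 shows "\<exists>y. is_rel_point C (horn n k) n (X, Y, \<phi>) T x y"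
proof -
 let ?K = "horn n k"
 note K = ssubset_horn[OF n(2)]
 have xH: "x \<mu> \<in> T -> (level X (dim \<mu>))" if "\<mu> \<in> ?K" for \<mu> using spoint_pts[OF x that] by simp
 have sv: "sop C Y m [j] \<in> (level Y m) -> (level Y 0)" if "j \<le> m" for m j
  using sop_Hom[OF sobj_Y vertex_std[OF that]] by simp
 \<comment> \<open>The simplex \<open>y\<close> is forced: its \<open>k\<close>-th vertex must be
   the image of the apex, so it is found by inverting the vertex operator at
   \<open>k\<close>.\<close>
 obtain g where g: "g \<in> (level Y 0) -> (level Y n)" "sop C Y n [k] \<cdot> g = Idm C (level Y 0)"
  using is_isoE[OF iso[OF n(2)] sv[OF n(2)]] by metis
 define y where "y = g \<cdot> (\<phi> 0 \<cdot> x [k])"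
 note ka = apex_in_horn[OF n]
 have w: "\<phi> 0 \<cdot> x [k] \<in> T -> (level Y 0)" using phi_Hom[of 0] xH[OF ka] by auto
 have y: "y \<in> T -> (level Y n)" unfolding y_def using g(1) w by blast
 have yk: "sop C Y n [k] \<cdot> y = \<phi> 0 \<cdot> x [k]"
  unfolding y_def using assoc[OF sv[OF n(2)] g(1) w] g(2) w by simp
 have vl: "sop C Y (dim \<mu>) [j] \<cdot> (sop C Y n \<mu> \<cdot> y) = sop C Y n [\<mu> ! j] \<cdot> y"
  if k: "\<mu> \<in> std_simplex n" and j: "j \<le> dim \<mu>" for \<mu> j
  using sop_lcomp[OF sobj_Y k vertex_std[OF j]] assoc[OF sv[OF j] sop_Hom[OF sobj_Y k] y]
  by (simp add: lcomp_def)
 have spread: "\<phi> (dim \<mu>) \<cdot> x \<mu> = sop C Y n \<mu> \<cdot> y"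
  if k: "\<mu> \<in> ?K" and j: "j \<le> dim \<mu>" and e: "\<phi> 0 \<cdot> x [\<mu> ! j] = sop C Y n [\<mu> ! j] \<cdot> y" for \<mu> j
 proof (rule iso_cancel[OF iso[OF j] sv[OF j]])
  show "\<phi> (dim \<mu>) \<cdot> x \<mu> \<in> T -> (level Y (dim \<mu>))" using phi_Hom xH[OF k] by blast
  show "sop C Y n \<mu> \<cdot> y \<in> T -> (level Y (dim \<mu>))"
   using sop_Hom[OF sobj_Y ssubset_std[OF K k]] y by blast
  show "sop C Y (dim \<mu>) [j] \<cdot> (\<phi> (dim \<mu>) \<cdot> x \<mu>) = sop C Y (dim \<mu>) [j] \<cdot> (sop C Y n \<mu> \<cdot> y)"
   using phi_vertex[OF K k x j] vl[OF ssubset_std[OF K k] j] e by simp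
 qed
 have vertex: "\<phi> 0 \<cdot> x [v] = sop C Y n [v] \<cdot> y" if v: "[v] \<in> ?K" for v
 proof -
  have vn: "v \<le> n" using v by (simp add: horn_def std_simplex_def)
  \<comment> \<open>The edge between \<open>v\<close> and the apex lies in the horn, because it adds
    only \<open>k\<close> to the vertices of \<open>[v]\<close>. It carries the equation from the
    apex to \<open>v\<close>.\<close>
  define e where "e = (if v \<le> k then [v, k] else [k, v])"
  have "set e = {v, k}" "sorted e" "e \<noteq> []" "dim e = 1" by (auto simp: e_def)
  then have eK: "e \<in> ?K" using v vn n(2) by (auto simp: horn_def std_simplex_def insert_commute)
  obtain i j where ij: "i \<le> dim e" "e ! i = k" "j \<le> dim e" "e ! j = v"
   using that[of 1 0] that[of 0 1] by (cases "v \<le> k") (auto simp: e_def)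
  have "\<phi> (dim e) \<cdot> x e = sop C Y n e \<cdot> y"
   using spread[OF eK ij(1)] ij(2) yk by simp
  then show ?thesis
   using phi_vertex[OF K eK x ij(3)] vl[OF ssubset_std[OF K eK] ij(3)] ij(4) by simp
 qed
 have "\<phi> (dim \<mu>) \<cdot> x \<mu> = sop C Y n \<mu> \<cdot> y" if k: "\<mu> \<in> ?K" for \<mu>
 proof (rule spread[OF k le0 vertex])
  have "\<mu> \<noteq> []" using ssubset_std[OF K k] by (auto simp: std_simplex_def)
  then show "[\<mu> ! 0] \<in> ?K"
   using ssubset_lcomp[OF K k, of "[0]"] by (simp add: lcomp_def std_simplex_def)
 qed
 then show ?thesis using x y unfolding is_rel_point_iff by blast
qed

text \<open>A horn in X determines its simplex in Y when the vertex operators of Y are invertible,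
  and trivially determines one in a terminal Z. Hence the same object \<open>L\<close> represents
  both fibre products and the comparison map is unchanged. This is what replaces the image of a
  terminal base, which need not be terminal in D.\<close>

lemma rel_matching_cover_terminal:
 assumes iso: "\<And>m j. j \<le> m ==> is_iso C (sop C Y m [j])"
  and n: "1 \<le> n" "k \<le> n" and r: "rel_matching_cover C S (horn n k) n (X, Y, \<phi>)"
  and Z: "simplicial_map C X Z \<psi>" "\<And>n. is_terminal C (level Z n)"
 shows "rel_matching_cover C S (horn n k) n (X, Z, \<psi>)"
proof -
 let ?K = "horn n k"
 note K = ssubset_horn[OF n(2)]
 interpret Z: simplicial_map C X Z \<psi> by (rule Z(1))
 obtain L x y c where L: "is_rel_matching C ?K n (X, Y, \<phi>) L x y"
  and c: "c \<in> S" "c \<in> (level X n) -> L" "\<And>\<mu>. \<mu> \<in> ?K ==> x \<mu> \<cdot> c = sop C X n \<mu>"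
  using r unfolding rel_matching_cover_def sCat_simps fst_conv snd_conv comps_simps by blast
 note p = rel_matching_point[OF L]
 have Lo: "L \<in> Obj C" using Hom_Obj c(2) by blast
 note tu = terminal_Hom_unique[OF Z(2) category_axioms]
 obtain y' where y': "y' \<in> L -> (level Z n)" using terminal_Hom_ex[OF Z(2) Lo] by blast
 have pt: "is_rel_point C ?K n (X, Z, \<psi>) T x' z" if x': "spoint ?K (hset C X T) x'" "z \<in> T -> (level Z n)" for T x' z
  unfolding is_rel_point_iff
 proof (intro conjI ballI x')
  fix \<mu> assume k: "\<mu> \<in> ?K"
  have "x' \<mu> \<in> T -> (level X (dim \<mu>))" using spoint_pts[OF x'(1) k] by simp
  then show "\<psi> (dim \<mu>) \<cdot> x' \<mu> = sop C Z n \<mu> \<cdot> z"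
   by (intro tu[of _ T "dim \<mu>"] comp_Hom[OF Z.phi_Hom] comp_Hom[OF sop_Hom[OF Z.sobj_Y ssubset_std[OF K k]] x'(2)])
 qed
 have "is_rel_matching C ?K n (X, Z, \<psi>) L x y'"
 proof (rule Z.rel_matchingI)
  have "spoint ?K (hset C X L) x" using p by (simp add: is_rel_point_iff)
  then show "is_rel_point C ?K n (X, Z, \<psi>) L x y'" by (rule pt[OF _ y'])
 next
  fix T x' z assume "is_rel_point C ?K n (X, Z, \<psi>) T x' z"
  then have x': "spoint ?K (hset C X T) x'" "z \<in> T -> (level Z n)" by (auto simp: is_rel_point_iff)
  obtain w where "is_rel_point C ?K n (X, Y, \<phi>) T x' w"
   using horn_point_extends[OF iso n x'(1)] by blast
  then obtain u where u: "u \<in> T -> L" "\<And>\<mu>. \<mu> \<in> ?K ==> x \<mu> \<cdot> u = x' \<mu>"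
   using rel_matching_lift[OF L] by metis
  moreover have "y' \<cdot> u = z" using tu[OF comp_Hom[OF y' u(1)] x'(2)] .
  ultimately show "\<exists>u\<in>Hom C T L. (\<forall>\<mu>\<in>?K. x \<mu> \<cdot> u = x' \<mu>) \<and> y' \<cdot> u = z" by blast
 next
  fix T u u' assume u: "u \<in> T -> L" "u' \<in> T -> L"
   and e: "\<And>\<mu>. \<mu> \<in> ?K ==> x \<mu> \<cdot> u = x \<mu> \<cdot> u'"
  have yH: "y \<in> L -> (level Y n)" using p by (simp add: is_rel_point_iff)
  note sk = sop_Hom[OF sobj_Y vertex_std[OF n(2)]] and ka = apex_in_horn[OF n]
  have xk: "x [k] \<in> L -> (level X (dim [k]))" using p spoint_pts[of ?K "hset C X L" x "[k]"] ka by (simp add: is_rel_point_iff)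
  have pk: "\<phi> (dim [k]) \<cdot> x [k] = sop C Y n [k] \<cdot> y" using p ka unfolding is_rel_point_iff by blast
  have "sop C Y n [k] \<cdot> (y \<cdot> u) = sop C Y n [k] \<cdot> (y \<cdot> u')"
   using assoc[OF sk yH u(1)] assoc[OF sk yH u(2)] assoc[OF phi_Hom xk u(1)]
    assoc[OF phi_Hom xk u(2)] pk e[OF ka] by simp
  then have "y \<cdot> u = y \<cdot> u'"
   using iso_cancel[OF iso[OF n(2)] sk comp_Hom[OF yH u(1)] comp_Hom[OF yH u(2)]] by simp
  then show "u = u'" using rel_matching_unique[OF K L u e] by blast
 qed
 moreover have "y' \<cdot> c = \<psi> n" using tu[OF comp_Hom[OF y' c(2)] Z.phi_Hom] .
 ultimately show ?thesis using Z.rel_matching_coverI[OF _ c] by blast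
qed

end

context cover_category
begin

lemma inf_groupoidE:
 assumes "inf_groupoid C S X"
 obtains Z \<psi> where "simplicial_map C X Z \<psi>" "\<And>n. is_terminal C (level Z n)" "is_terminal (sCat C) Z"
  "\<And>n k. 1 \<le> n ==> k \<le> n ==> rel_matching_cover C S (horn n k) n (X, Z, \<psi>)"
proof -
 obtain Z f where Z: "is_terminal (sCat C) Z" "f \<in> Hom (sCat C) X Z" "kan_fibration C S f"
  using assms by (auto simp: inf_groupoid_def)
 obtain \<psi> where f: "f = (X, Z, \<psi>)" "is_sobj C X" "is_sobj C Z" "is_smap C X Z \<psi>"
  using sCat_HomE[OF Z(2)] by metis
 obtain t where "is_terminal C t" using terminal_cover by blast
 show thesis
 proof (rule that)
  show "simplicial_map C X Z \<psi>" using f by unfold_locales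
  show "is_terminal C (level Z n)" for n using terminal_level \<open>is_terminal C t\<close> Z(1) by blast
  show "rel_matching_cover C S (horn n k) n (X, Z, \<psi>)" if "1 \<le> n" "k \<le> n" for n k
   using Z(3) that unfolding kan_fibration_def f(1) by blast
 qed (rule Z(1))
qed

end

lemma (in category) inf_groupoidI:
 assumes t: "is_terminal C t" and X: "is_sobj C X"
  and "\<And>\<psi> n k. simplicial_map C X (const_sobj C t) \<psi> ==> 1 \<le> n ==> k \<le> n ==>
   rel_matching_cover C S (horn n k) n (X, const_sobj C t, \<psi>)"
 shows "inf_groupoid C S X"
proof -
 note T = terminal_const_sobj[OF t]
 obtain f where f: "f \<in> Hom (sCat C) X (const_sobj C t)"
  using terminal_Hom_ex[OF T, of X] X by auto
 obtain \<psi> where p: "f = (X, const_sobj C t, \<psi>)" "is_sobj C (const_sobj C t)" "is_smap C X (const_sobj C t) \<psi>"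
  using sCat_HomE[OF f] by metis
 have "simplicial_map C X (const_sobj C t) \<psi>" using X p by unfold_locales
 then have "kan_fibration C S f"
  unfolding kan_fibration_def p(1) using assms(3) X p(2,3) by simp
 then show ?thesis unfolding inf_groupoid_def using X T f
  by (intro conjI exI[of _ "const_sobj C t"] exI[of _ f]) simp_all
qed

context geometric_map
begin

text \<open>The image of the comparison map satisfies the equations that characterize the comparison
  map of the image, since F preserves operators.\<close>

lemma matched_cover:
 assumes L: "matched K n L x y" and K: "ssubset n K" and r: "rel_matching_cover C S K n (X, Y, \<phi>)"
 shows "rel_matching_cover D S' K n (FX, FY, F\<phi>)"
proof -
 have M: "is_rel_matching C K n (X, Y, \<phi>) L x y" using L by (simp add: matched_def)
 obtain c where c: "c \<in> (level X n) -> L" "\<And>\<mu>. \<mu> \<in> K ==> x \<mu> \<cdot> c = sop C X n \<mu>" "y \<cdot> c = \<phi> n"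
  using rel_matching_comparison[OF M K] by metis
 have "c \<in> S" using rel_matching_coverD[OF C.covers_axioms K r M c] .
 show "rel_matching_cover D S' K n (FX, FY, F\<phi>)"
 proof (rule Ff.rel_matching_coverI)
  show "is_rel_matching D K n (FX, FY, F\<phi>) (OMap F L) (\<lambda>\<mu>. AMap F (x \<mu>)) (AMap F y)"
   using L by (simp add: matched_def)
  show "AMap F c \<in> S'" using F_S[OF \<open>c \<in> S\<close>] .
  show "AMap F c \<in> Hom D (level FX n) (OMap F L)" using F_Hom[OF c(1)] by simp
  show "AMap F y \<cdot>\<^bsub>D\<^esub> AMap F c = AMap F (\<phi> n)" using F_comp[OF matched_point(2)[OF L] c(1)] c(3) by simp
  fix \<mu> assume k: "\<mu> \<in> K"
  show "AMap F (x \<mu>) \<cdot>\<^bsub>D\<^esub> AMap F c = sop D FX n \<mu>"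
   using F_comp[OF matched_point(1)[OF L k] c(1)] c(2)[OF k] F_sop[OF sobj_X ssubset_std[OF K k]] by simp
 qed
qed

text \<open>Once the limit exists in C and is preserved, the comparison map in D is the image of an
  arrow of C, to which reflection applies.\<close>

lemma matched_cover_reflect:
 assumes refl: "reflects_covers C S S' F"
  and L: "matched K n L x y" and K: "ssubset n K" and r: "rel_matching_cover D S' K n (FX, FY, F\<phi>)"
 shows "rel_matching_cover C S K n (X, Y, \<phi>)"
proof -
 have M: "is_rel_matching C K n (X, Y, \<phi>) L x y" using L by (simp add: matched_def)
 have M': "is_rel_matching D K n (FX, FY, F\<phi>) (OMap F L) (\<lambda>\<mu>. AMap F (x \<mu>)) (AMap F y)"
  using L by (simp add: matched_def)
 obtain c where c: "c \<in> (level X n) -> L" "\<And>\<mu>. \<mu> \<in> K ==> x \<mu> \<cdot> c = sop C X n \<mu>" "y \<cdot> c = \<phi> n"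
  using rel_matching_comparison[OF M K] by metis
 have "AMap F c \<in> S'"
 proof (rule Ff.rel_matching_coverD[OF D.covers_axioms K r M'])
  show "AMap F c \<in> Hom D (level FX n) (OMap F L)" using F_Hom[OF c(1)] by simp
  show "AMap F y \<cdot>\<^bsub>D\<^esub> AMap F c = AMap F (\<phi> n)" using F_comp[OF matched_point(2)[OF L] c(1)] c(3) by simp
  fix \<mu> assume k: "\<mu> \<in> K"
  show "AMap F (x \<mu>) \<cdot>\<^bsub>D\<^esub> AMap F c = sop D FX n \<mu>"
   using F_comp[OF matched_point(1)[OF L k] c(1)] c(2)[OF k] F_sop[OF sobj_X ssubset_std[OF K k]] by simp
 qed
 then have "c \<in> S" using refl HomD(1)[OF c(1)] unfolding reflects_covers_def by blast
 then show ?thesis using rel_matching_coverI[OF M _ c] by blast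
qed

end

context geometric
begin

lemma geometric_mapI: "simplicial_map C X Y \<phi> ==> geometric_map C S D S' F X Y \<phi>"
 by (intro geometric_map.intro geometric_axioms)

lemma terminal_sop_iso:
 assumes "is_sobj C Z" "\<And>n. is_terminal C (level Z n)" "\<mu> \<in> std_simplex n"
 shows "is_iso C (sop C Z n \<mu>)"
 using C.terminal_iso assms(2) C.sop_Hom[OF assms(1,3)] by blast

lemma inf_groupoid_sobj: "inf_groupoid C S X ==> is_sobj C X"
 by (simp add: inf_groupoid_def)

text \<open>The vertex operators of the terminal base are isomorphisms, so \<open>p\<close> is a
  base change of a cover, and evaluation of a horn at its apex is the composite of the covers
  \<open>e\<close> and \<open>p\<close>.\<close>

lemma inf_groupoid_matched:
 assumes g: "geometric_map C S D S' F X Z \<psi>" and Z: "\<And>n. is_terminal C (level Z n)"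
  and n: "1 \<le> n" "k \<le> n"
  and r: "\<And>m j. 1 \<le> m ==> m < n ==> j \<le> m ==> rel_matching_cover C S (horn m j) m (X, Z, \<psi>)"
 obtains L x y e where "geometric_map.matched C D F X Z \<psi> (horn n k) n L x y"
  "e \<in> S" "e \<in> L -> (level X 0)" "e = x [k]"
proof -
 interpret geometric_map C S D S' F X Z \<psi> by (rule g)
 have v: "sop C Z m [j] \<in> S" if "j \<le> m" for m j
  using C.S_iso[OF terminal_sop_iso[OF sobj_Y Z vertex_std[OF that]]] .
 obtain L x y p q e where L: "matched (horn n k) n L x y" and pb: "is_pullback C (\<psi> 0) (sop C Z n [k]) p q"
  and e: "e \<in> S" "e \<in> L -> (Dom C p)" "p \<cdot> e = x [k]"
  using matched_horn[OF v n r] by blast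
 have p: "p \<in> S" "p \<in> (Dom C p) -> (level X 0)"
  using C.S_base[OF v[OF n(2)] C.pullback_sym[OF pb]] C.pullback_Hom[OF pb] phi_Hom[of 0] HomD(2) by metis+
 have "p \<cdot> e \<in> S" "p \<cdot> e \<in> L -> (level X 0)" using C.S_comp p e by blast+
 then show thesis by (rule that[OF L _ _ e(3)])
qed

text \<open>The vertex operator factors as the comparison map to the horns at \<open>k\<close>
  followed by evaluation at the apex, both covers.\<close>

lemma inf_groupoid_vertex:
 assumes X: "inf_groupoid C S X" and k: "k \<le> n"
 shows "sop C X n [k] \<in> S"
proof (cases "n = 0")
 case True
 then show ?thesis
  using C.sop_upt[OF inf_groupoid_sobj[OF X], of 0] C.S_Idm sobj_level[OF inf_groupoid_sobj[OF X]] k by simp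
next
 case False
 then have n: "1 \<le> n" by simp
 obtain Z \<psi> where Z: "simplicial_map C X Z \<psi>" "\<And>n. is_terminal C (level Z n)"
  "\<And>n k. 1 \<le> n ==> k \<le> n ==> rel_matching_cover C S (horn n k) n (X, Z, \<psi>)"
  using C.inf_groupoidE[OF X] by metis
 interpret geometric_map C S D S' F X Z \<psi> by (rule geometric_mapI[OF Z(1)])
 obtain L x y e where L: "matched (horn n k) n L x y" and e: "e \<in> S" "e \<in> L -> (level X 0)" "e = x [k]"
  using inf_groupoid_matched[OF geometric_map_axioms Z(2) n k Z(3)] by blast
 have M: "is_rel_matching C (horn n k) n (X, Z, \<psi>) L x y" using L by (simp add: matched_def)
 obtain c where c: "c \<in> (level X n) -> L" "\<And>\<mu>. \<mu> \<in> horn n k ==> x \<mu> \<cdot> c = sop C X n \<mu>" "y \<cdot> c = \<psi> n"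
  using rel_matching_comparison[OF M ssubset_horn[OF k]] by metis
 have "c \<in> S" using rel_matching_coverD[OF C.covers_axioms ssubset_horn[OF k] Z(3)[OF n k] M c] .
 then show ?thesis using C.S_comp[OF e(1,2) _ c(1)] c(2)[OF apex_in_horn[OF n k]] e(3) by simp
qed

text \<open>The base being an infinity-groupoid enters through its vertex operators, which are
  covers.\<close>

lemma kan_matched:
 assumes g: "simplicial_map C X Y \<phi>" and Y: "inf_groupoid C S Y" and n: "1 \<le> n" "k \<le> n"
  and r: "\<And>m j. 1 \<le> m ==> m < n ==> j \<le> m ==> rel_matching_cover C S (horn m j) m (X, Y, \<phi>)"
 obtains L x y where "geometric_map.matched C D F X Y \<phi> (horn n k) n L x y"
 using geometric_map.matched_horn[OF geometric_mapI[OF g] inf_groupoid_vertex[OF Y] n r] by blast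

lemma kan_preserved:
 assumes "simplicial_map C X Y \<phi>" "inf_groupoid C S Y" "kan_fibration C S (X, Y, \<phi>)"
 shows "kan_fibration D S' (AMap (sFun F) (X, Y, \<phi>))"
proof -
 interpret geometric_map C S D S' F X Y \<phi> by (rule geometric_mapI[OF assms(1)])
 have r: "rel_matching_cover C S (horn n k) n (X, Y, \<phi>)" if "1 \<le> n" "k \<le> n" for n k
  using assms(3) that unfolding kan_fibration_def by blast
 have "rel_matching_cover D S' (horn n k) n (FX, FY, F\<phi>)" if n: "1 \<le> n" "k \<le> n" for n k
 proof -
  obtain L x y where "matched (horn n k) n L x y" using kan_matched[OF assms(1,2) n r] by blast
  then show ?thesis using matched_cover ssubset_horn r n by blast
 qed
 then show ?thesis unfolding kan_fibration_def using Ff.sobj_X Ff.sobj_Y Ff.smap by simp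
qed

text \<open>The matching object in C can only be built once the comparison maps of lower dimension
  are known to be covers there, so reflection proceeds by induction on the dimension.\<close>

lemma kan_reflected:
 assumes "simplicial_map C X Y \<phi>" "inf_groupoid C S Y" "reflects_covers C S S' F"
  "kan_fibration D S' (AMap (sFun F) (X, Y, \<phi>))"
 shows "kan_fibration C S (X, Y, \<phi>)"
proof -
 interpret geometric_map C S D S' F X Y \<phi> by (rule geometric_mapI[OF assms(1)])
 have r: "rel_matching_cover D S' (horn n k) n (FX, FY, F\<phi>)" if "1 \<le> n" "k \<le> n" for n k
  using assms(4) that unfolding kan_fibration_def sFun_simps by blast
 have "1 \<le> n ==> k \<le> n ==> rel_matching_cover C S (horn n k) n (X, Y, \<phi>)" for n k
 proof (induction n arbitrary: k rule: less_induct)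
  case (less n)
  obtain L x y where "matched (horn n k) n L x y"
   using kan_matched[OF assms(1,2) less.prems less.IH] by blast
  then show ?case using matched_cover_reflect[OF assms(3)] ssubset_horn r less.prems by blast
 qed
 then show ?thesis unfolding kan_fibration_def using sobj_X sobj_Y smap by simp
qed

text \<open>The image of the terminal base keeps invertible vertex operators, as images of
  isomorphisms, and is then exchanged for a constant terminal object of D.\<close>

lemma inf_groupoid_preserved:
 assumes X: "inf_groupoid C S X" and D: "is_terminal D t"
 shows "inf_groupoid D S' (OMap (sFun F) X)"
proof (rule D.inf_groupoidI[OF D])
 show "is_sobj D (OMap (sFun F) X)" using sFun_sobj[OF inf_groupoid_sobj[OF X]] .
 fix \<psi>' and n k :: nat assume s: "simplicial_map D (OMap (sFun F) X) (const_sobj D t) \<psi>'" and n: "1 \<le> n" "k \<le> n"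
 obtain Z \<psi> where Z: "simplicial_map C X Z \<psi>" "\<And>n. is_terminal C (level Z n)"
  "\<And>n k. 1 \<le> n ==> k \<le> n ==> rel_matching_cover C S (horn n k) n (X, Z, \<psi>)"
  using C.inf_groupoidE[OF X] by metis
 interpret geometric_map C S D S' F X Z \<psi> by (rule geometric_mapI[OF Z(1)])
 obtain L x y e where L: "matched (horn n k) n L x y"
  using inf_groupoid_matched[OF geometric_map_axioms Z(2) n Z(3)] by blast
 show "rel_matching_cover D S' (horn n k) n (FX, const_sobj D t, \<psi>')"
 proof (rule Ff.rel_matching_cover_terminal[OF _ n _ s])
  show "rel_matching_cover D S' (horn n k) n (FX, FY, F\<phi>)"
   using matched_cover[OF L ssubset_horn[OF n(2)] Z(3)[OF n]] by simp
  show "is_terminal D (level (const_sobj D t) n)" for n using D by simp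
  fix m j assume j: "j \<le> (m::nat)"
  have "is_iso D (AMap F (sop C Z m [j]))"
   using F_iso[OF terminal_sop_iso[OF sobj_Y Z(2) vertex_std[OF j]] C.sop_Hom[OF sobj_Y vertex_std[OF j]]] .
  then show "is_iso D (sop D FY m [j])" using F_sop[OF sobj_Y vertex_std[OF j]] by simp
 qed
qed

lemma hypercover_preserved:
 assumes "simplicial_map C X Y \<phi>" "hypercover C S (X, Y, \<phi>)"
 shows "hypercover D S' (AMap (sFun F) (X, Y, \<phi>))"
proof -
 interpret geometric_map C S D S' F X Y \<phi> by (rule geometric_mapI[OF assms(1)])
 have r: "rel_matching_cover C S (bdry n) n (X, Y, \<phi>)" for n
  using assms(2) unfolding hypercover_def by blast
 have "rel_matching_cover D S' (bdry n) n (FX, FY, F\<phi>)" for n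
  using matched_bdry[OF r] matched_cover ssubset_bdry r by blast
 then show ?thesis unfolding hypercover_def using Ff.sobj_X Ff.sobj_Y Ff.smap by simp
qed

lemma hypercover_reflected:
 assumes "simplicial_map C X Y \<phi>" "reflects_covers C S S' F"
  "hypercover D S' (AMap (sFun F) (X, Y, \<phi>))"
 shows "hypercover C S (X, Y, \<phi>)"
proof -
 interpret geometric_map C S D S' F X Y \<phi> by (rule geometric_mapI[OF assms(1)])
 have r: "rel_matching_cover D S' (bdry n) n (FX, FY, F\<phi>)" for n
  using assms(3) unfolding hypercover_def sFun_simps by blast
 have "rel_matching_cover C S (bdry n) n (X, Y, \<phi>)" for n
 proof (induction n rule: less_induct)
  case (less n)
  then show ?case using matched_bdry matched_cover_reflect[OF assms(2)] ssubset_bdry r by blast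
 qed
 then show ?thesis unfolding hypercover_def using sobj_X sobj_Y smap by simp
qed

end

lemma full_subcategory_simps [simp]:
 "X \<in> Obj (full_subcategory C P) \<longleftrightarrow> X \<in> Obj C \<and> P X"
 "f \<in> Arr (full_subcategory C P) \<longleftrightarrow> f \<in> Arr C \<and> P (Dom C f) \<and> P (Cod C f)"
 "Dom (full_subcategory C P) = Dom C" "Cod (full_subcategory C P) = Cod C"
 "Idm (full_subcategory C P) = Idm C" "Cmp (full_subcategory C P) = Cmp C"
 by (auto simp: full_subcategory_def)

lemma full_subcategory_Hom:
 "f \<in> Hom (full_subcategory C P) X Y \<longleftrightarrow> f \<in> Hom C X Y \<and> P X \<and> P Y"
 by (auto simp: Hom_def)

lemma is_category_full_subcategory: "is_category C ==> is_category (full_subcategory C P)"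
 by (simp add: is_category_def full_subcategory_Hom)

lemma is_functor_full_subcategory:
 assumes "is_functor C D F" "\<And>X. X \<in> Obj C ==> P X ==> Q (OMap F X)"
 shows "is_functor (full_subcategory C P) (full_subcategory D Q) F"
proof -
 have c: "is_category C" "is_category D" using assms(1) by (auto simp: is_functor_def)
 have o: "Dom C f \<in> Obj C \<and> Cod C f \<in> Obj C" if "f \<in> Arr C" for f
  using c(1) that by (simp add: is_category_def)
 show ?thesis
  using assms o is_category_full_subcategory[OF c(1), of P] is_category_full_subcategory[OF c(2), of Q]
  by (simp add: is_functor_def full_subcategory_Hom)
qed

lemma Gpd_ArrE:
 assumes "f \<in> Arr (Gpd C S)" "is_category C"
 obtains X Y \<phi> where "f = (X, Y, \<phi>)" "simplicial_map C X Y \<phi>" "inf_groupoid C S X" "inf_groupoid C S Y"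
proof -
 obtain X Y \<phi> where f: "f = (X, Y, \<phi>)" by (cases f)
 then have "is_sobj C X" "is_sobj C Y" "is_smap C X Y \<phi>" "inf_groupoid C S X" "inf_groupoid C S Y"
  using assms by (simp_all add: Gpd_def)
 then show thesis using assms(2) f
  by (intro that[of X Y \<phi>]) (auto simp: simplicial_map_def category_def simplicial_map_axioms_def)
qed

section \<open>Pullbacks of simplicial objects, formed and recognized level by level\<close>

section \<open>Levelwise pullbacks\<close>

text \<open>Each simplicial identity holds after either projection because it holds in X and Z, and
  the two projections together are injective.\<close>

lemma simplicial_set_jointly_injective:
 assumes X: "simplicial_set X" and Z: "simplicial_set Z"
  and fcP: "\<And>n i x. i \<le> Suc n ==> x \<in> pts P (Suc n) ==> fc P n i x \<in> pts P n"
  and dgP: "\<And>n i x. i \<le> n ==> x \<in> pts P n ==> dg P n i x \<in> pts P (Suc n)"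
  and a: "ssmap P X a" and b: "ssmap P Z b"
  and inj: "\<And>n x y. x \<in> pts P n ==> y \<in> pts P n ==> a n x = a n y ==> b n x = b n y ==> x = y"
 shows "simplicial_set P"
proof
 interpret X: simplicial_set X by (rule X)
 interpret Z: simplicial_set Z by (rule Z)
 have as: "a n x \<in> pts X n" "b n x \<in> pts Z n" if "x \<in> pts P n" for n x
  using a b that by (auto simp: ssmap_def)
 have af: "a n (fc P n i x) = fc X n i (a (Suc n) x)" "b n (fc P n i x) = fc Z n i (b (Suc n) x)"
  if "i \<le> Suc n" "x \<in> pts P (Suc n)" for n i x
  using a b that by (auto simp: ssmap_def)
 have ad: "a (Suc n) (dg P n i x) = dg X n i (a n x)" "b (Suc n) (dg P n i x) = dg Z n i (b n x)"
  if "i \<le> n" "x \<in> pts P n" for n i x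
  using a b that by (auto simp: ssmap_def)
 fix n i j x
 show "fc P n i (fc P (Suc n) j x) = fc P n (j - 1) (fc P (Suc n) i x)"
  if "i < j" "j \<le> Suc (Suc n)" "x \<in> pts P (Suc (Suc n))"
  using that by (intro inj[of _ n]) (simp_all add: fcP af as X.fc_fc Z.fc_fc)
 show "dg P (Suc n) i (dg P n j x) = dg P (Suc n) (Suc j) (dg P n i x)"
  if "i \<le> j" "j \<le> n" "x \<in> pts P n"
  using that by (intro inj[of _ "Suc (Suc n)"]) (simp_all add: dgP ad as X.dg_dg Z.dg_dg)
 show "fc P (Suc n) i (dg P (Suc n) j x) = dg P n (j - 1) (fc P n i x)"
  if "i < j" "j \<le> Suc n" "x \<in> pts P (Suc n)"
 proof -
  have "j - 1 \<le> n" "i \<le> Suc n" using that by auto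
  then show ?thesis using that
   by (intro inj[of _ "Suc n"]) (simp_all add: fcP dgP af ad as X.fc_dg_less Z.fc_dg_less)
 qed
 show "fc P n i (dg P n j x) = x" if "i = j \<or> i = Suc j" "j \<le> n" "x \<in> pts P n"
 proof -
  have "i \<le> Suc n" using that by auto
  then show ?thesis using that
   by (intro inj[of _ n]) (simp_all add: fcP dgP af ad as X.fc_dg_id Z.fc_dg_id)
 qed
 show "fc P (Suc n) i (dg P (Suc n) j x) = dg P n j (fc P n (i - 1) x)"
  if "Suc j < i" "i \<le> Suc (Suc n)" "x \<in> pts P (Suc n)"
 proof -
  have "j \<le> n" "i - 1 \<le> Suc n" using that by auto
  then show ?thesis using that
   by (intro inj[of _ "Suc n"]) (simp_all add: fcP dgP af ad as X.fc_dg_greater Z.fc_dg_greater)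
 qed
qed (use fcP dgP in auto)

context category
begin

text \<open>Evaluated at the identity of a level, the elementwise identities become identities
  between arrows.\<close>

lemma is_sobjI:
 assumes l: "\<And>n. level X n \<in> Obj C"
  and f: "\<And>n i. i \<le> Suc n ==> face X n i \<in> (level X (Suc n)) -> (level X n)"
  and d: "\<And>n i. i \<le> n ==> degen X n i \<in> (level X n) -> (level X (Suc n))"
  and h: "\<And>T. T \<in> Obj C ==> simplicial_set (hset C X T)"
 shows "is_sobj C X"
 unfolding is_sobj_def
proof (intro conjI allI impI l f d; assumption?)
 note s = simplicial_set.fc_fc simplicial_set.dg_dg
  simplicial_set.fc_dg_less simplicial_set.fc_dg_id simplicial_set.fc_dg_greater
 have id: "Idm C (level X n) \<in> pts (hset C X (level X n)) n" for n using Idm_Hom[OF l] by simp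
 fix n i j
 show "face X n i \<cdot> face X (Suc n) j = face X n (j - 1) \<cdot> face X (Suc n) i"
  if "i < j" "j \<le> Suc (Suc n)"
  using s(1)[OF h[OF l] that id] that comp_Idm[OF f] by simp
 show "degen X (Suc n) i \<cdot> degen X n j = degen X (Suc n) (Suc j) \<cdot> degen X n i"
  if "i \<le> j" "j \<le> n"
  using s(2)[OF h[OF l] that id] that comp_Idm[OF d] by simp
 show "face X (Suc n) i \<cdot> degen X (Suc n) j = degen X n (j - 1) \<cdot> face X n i"
  if "i < j" "j \<le> Suc n"
  using s(3)[OF h[OF l] that id] that comp_Idm[OF d] comp_Idm[OF f] by simp
 show "face X n i \<cdot> degen X n j = Idm C (level X n)"
  if "i = j \<or> i = Suc j" "j \<le> n"
  using s(4)[OF h[OF l] that id] that comp_Idm[OF d] by simp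
 show "face X (Suc n) i \<cdot> degen X (Suc n) j = degen X n j \<cdot> face X n (i - 1)"
  if "Suc j < i" "i \<le> Suc (Suc n)"
 proof -
  have "i - 1 \<le> Suc n" "j \<le> Suc n" using that by auto
  then show ?thesis using s(5)[OF h[OF l] that id] that comp_Idm[OF d] comp_Idm[OF f] by simp
 qed
qed

lemma pullback_comp_iso:
 assumes pb: "is_pullback C f g p q" and u: "is_iso C u" "u \<in> P -> (Dom C p)"
 shows "is_pullback C f g (p \<cdot> u) (q \<cdot> u)"
proof -
 note h = pullback_Hom[OF pb]
 obtain v where v: "v \<in> (Dom C p) -> P" "v \<cdot> u = Idm C P" "u \<cdot> v = Idm C (Dom C p)"
  using is_isoE[OF u] by metis
 show ?thesis
 proof (rule pullbackI[OF h(1,2) comp_Hom[OF h(3) u(2)] comp_Hom[OF h(4) u(2)]])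
  show "f \<cdot> (p \<cdot> u) = g \<cdot> (q \<cdot> u)"
   using assoc[OF h(1,3) u(2)] assoc[OF h(2,4) u(2)] h(5) by simp
 next
  fix T a b assume "a \<in> T -> (Cod C p)" "b \<in> T -> (Cod C q)" "f \<cdot> a = g \<cdot> b"
  then obtain w where w: "w \<in> T -> (Dom C p)" "p \<cdot> w = a" "q \<cdot> w = b"
   using pullback_lift[OF pb] by metis
  have "u \<cdot> (v \<cdot> w) = w" using assoc[OF u(2) v(1) w(1)] v(3) w(1) by simp
  then show "\<exists>w\<in>Hom C T P. (p \<cdot> u) \<cdot> w = a \<and> (q \<cdot> u) \<cdot> w = b"
   using w comp_Hom[OF v(1) w(1)] assoc[OF h(3) u(2)] assoc[OF h(4) u(2)]
   by (intro bexI[of _ "v \<cdot> w"]) simp_all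
 next
  fix T w w' assume w: "w \<in> T -> P" "w' \<in> T -> P"
   "(p \<cdot> u) \<cdot> w = (p \<cdot> u) \<cdot> w'" "(q \<cdot> u) \<cdot> w = (q \<cdot> u) \<cdot> w'"
  then have "u \<cdot> w = u \<cdot> w'"
   using assoc[OF h(3) u(2)] assoc[OF h(4) u(2)]
   by (intro pullback_unique[OF pb comp_Hom[OF u(2) w(1)] comp_Hom[OF u(2) w(2)]]) simp_all
  then show "w = w'" using iso_cancel[OF u w(1,2)] by simp
 qed
qed

lemma pullback_iso:
 assumes pb: "is_pullback C f g p q" and pb': "is_pullback C f g p' q'"
 obtains u where "u \<in> (Dom C p') -> (Dom C p)" "is_iso C u" "p \<cdot> u = p'" "q \<cdot> u = q'"
proof -
 note h = pullback_Hom[OF pb] and h' = pullback_Hom[OF pb']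
 have c: "Cod C p' = Cod C p" "Cod C q' = Cod C q"
  using pb pb' by (simp_all add: is_pullback_def)
 obtain u where u: "u \<in> (Dom C p') -> (Dom C p)" "p \<cdot> u = p'" "q \<cdot> u = q'"
  using pullback_lift[OF pb, of p' "Dom C p'" q'] h'(3-5) c by auto
 obtain v where v: "v \<in> (Dom C p) -> (Dom C p')" "p' \<cdot> v = p" "q' \<cdot> v = q"
  using pullback_lift[OF pb', of p "Dom C p" q] h(3-5) c by auto
 have o: "Dom C p \<in> Obj C" "Dom C p' \<in> Obj C" using Hom_Obj u by auto
 have "u \<cdot> v = Idm C (Dom C p)"
  using pullback_unique[OF pb comp_Hom[OF u(1) v(1)] Idm_Hom[OF o(1)]]
   assoc[OF h(3) u(1) v(1)] assoc[OF h(4) u(1) v(1)] u(2,3) v(2,3) comp_Idm[OF h(3)] comp_Idm[OF h(4)] by simp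
 moreover have "v \<cdot> u = Idm C (Dom C p')"
  using pullback_unique[OF pb' comp_Hom[OF v(1) u(1)] Idm_Hom[OF o(2)]]
   assoc[OF h'(3) v(1) u(1)] assoc[OF h'(4) v(1) u(1)] u(2,3) v(2,3) comp_Idm[OF h'(3)] comp_Idm[OF h'(4)] by simp
 ultimately show thesis using that u is_isoI[OF u(1) v(1)] by simp
qed

lemma pullback_sCatI:
 assumes "simplicial_map C X Y \<phi>" "simplicial_map C Z Y \<psi>" "simplicial_map C P X p" "simplicial_map C P Z q"
  and pb: "\<And>n. is_pullback C (\<phi> n) (\<psi> n) (p n) (q n)"
 shows "is_pullback (sCat C) (X, Y, \<phi>) (Z, Y, \<psi>) (P, X, p) (P, Z, q)"
proof -
 interpret s: category "sCat C" by (rule category_sCat)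
 interpret f: simplicial_map C X Y \<phi> by fact
 interpret g: simplicial_map C Z Y \<psi> by fact
 interpret p: simplicial_map C P X p by fact
 interpret q: simplicial_map C P Z q by fact
 have DC: "Dom C (p n) = level P n" "Cod C (p n) = level X n" "Cod C (q n) = level Z n" for n
  using p.phi_Hom q.phi_Hom HomD by metis+
 show ?thesis
 proof (rule s.pullbackI)
  show "(X, Y, \<phi>) \<in> Hom (sCat C) X Y" "(Z, Y, \<psi>) \<in> Hom (sCat C) Z Y"
   "(P, X, p) \<in> Hom (sCat C) P X" "(P, Z, q) \<in> Hom (sCat C) P Z"
   using f.sobj_X f.sobj_Y f.smap g.sobj_X g.smap p.sobj_X p.smap q.smap by (simp_all add: sCat_Hom)
  show "(X, Y, \<phi>) \<cdot>\<^bsub>sCat C\<^esub> (P, X, p) = (Z, Y, \<psi>) \<cdot>\<^bsub>sCat C\<^esub> (P, Z, q)"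
   using pullback_Hom(5)[OF pb] by simp
 next
  fix T a b assume a: "a \<in> Hom (sCat C) T X" and b: "b \<in> Hom (sCat C) T Z"
   and e: "(X, Y, \<phi>) \<cdot>\<^bsub>sCat C\<^esub> a = (Z, Y, \<psi>) \<cdot>\<^bsub>sCat C\<^esub> b"
  obtain \<alpha> where al: "a = (T, X, \<alpha>)" "is_sobj C T" "is_smap C T X \<alpha>" using sCat_HomE[OF a] by metis
  obtain \<beta> where be: "b = (T, Z, \<beta>)" "is_smap C T Z \<beta>" using sCat_HomE[OF b] by metis
  have e': "\<phi> n \<cdot> \<alpha> n = \<psi> n \<cdot> \<beta> n" for n using e al(1) be(1) by (simp add: fun_eq_iff)
  have "\<exists>u. u \<in> (level T n) -> (level P n) \<and> p n \<cdot> u = \<alpha> n \<and> q n \<cdot> u = \<beta> n" for n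
   using pullback_lift[OF pb[of n], unfolded DC, OF smap_Hom[OF al(3)] smap_Hom[OF be(2)] e'] by metis
  then obtain u where u: "\<And>n. u n \<in> (level T n) -> (level P n)"
   "\<And>n. p n \<cdot> u n = \<alpha> n" "\<And>n. q n \<cdot> u n = \<beta> n" by metis
  have "is_smap C T P u"
   unfolding is_smap_def
  proof (intro conjI allI impI)
   fix n i
   show "u n \<in> (level T n) -> (level P n)" by (rule u)
   show "u n \<cdot> face T n i = face P n i \<cdot> u (Suc n)" if i: "i \<le> Suc n"
   proof (rule pullback_unique[OF pb[of n], unfolded DC])
    note fT = sobj_face[OF al(2) i] and fP = sobj_face[OF p.sobj_X i]
    show "u n \<cdot> face T n i \<in> (level T (Suc n)) -> (level P n)" using u(1) fT by blast
    show "face P n i \<cdot> u (Suc n) \<in> (level T (Suc n)) -> (level P n)" using u(1) fP by blast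
    show "p n \<cdot> (u n \<cdot> face T n i) = p n \<cdot> (face P n i \<cdot> u (Suc n))"
     using assoc[OF p.phi_Hom u(1) fT] assoc[OF p.phi_Hom fP u(1)] u(2) smap_face[OF al(3) i]
      smap_face[OF p.smap i] assoc[OF sobj_face[OF p.sobj_Y i] p.phi_Hom u(1)] by simp
    show "q n \<cdot> (u n \<cdot> face T n i) = q n \<cdot> (face P n i \<cdot> u (Suc n))"
     using assoc[OF q.phi_Hom u(1) fT] assoc[OF q.phi_Hom fP u(1)] u(3) smap_face[OF be(2) i]
      smap_face[OF q.smap i] assoc[OF sobj_face[OF q.sobj_Y i] q.phi_Hom u(1)] by simp
   qed
   show "u (Suc n) \<cdot> degen T n i = degen P n i \<cdot> u n" if i: "i \<le> n"
   proof (rule pullback_unique[OF pb[of "Suc n"], unfolded DC])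
    note fT = sobj_degen[OF al(2) i] and fP = sobj_degen[OF p.sobj_X i]
    show "u (Suc n) \<cdot> degen T n i \<in> (level T n) -> (level P (Suc n))" using u(1) fT by blast
    show "degen P n i \<cdot> u n \<in> (level T n) -> (level P (Suc n))" using u(1) fP by blast
    show "p (Suc n) \<cdot> (u (Suc n) \<cdot> degen T n i) = p (Suc n) \<cdot> (degen P n i \<cdot> u n)"
     using assoc[OF p.phi_Hom u(1) fT] assoc[OF p.phi_Hom fP u(1)] u(2) smap_degen[OF al(3) i]
      smap_degen[OF p.smap i] assoc[OF sobj_degen[OF p.sobj_Y i] p.phi_Hom u(1)] by simp
    show "q (Suc n) \<cdot> (u (Suc n) \<cdot> degen T n i) = q (Suc n) \<cdot> (degen P n i \<cdot> u n)"
     using assoc[OF q.phi_Hom u(1) fT] assoc[OF q.phi_Hom fP u(1)] u(3) smap_degen[OF be(2) i]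
      smap_degen[OF q.smap i] assoc[OF sobj_degen[OF q.sobj_Y i] q.phi_Hom u(1)] by simp
   qed
  qed
  then have "(T, P, u) \<in> Hom (sCat C) T P" using al(2) p.sobj_X by (simp add: sCat_Hom)
  then show "\<exists>u\<in>Hom (sCat C) T P. (P, X, p) \<cdot>\<^bsub>sCat C\<^esub> u = a \<and> (P, Z, q) \<cdot>\<^bsub>sCat C\<^esub> u = b"
   using u(2,3) al(1) be(1) by (intro bexI[of _ "(T, P, u)"]) simp_all
 next
  fix T u u' assume h: "u \<in> Hom (sCat C) T P" "u' \<in> Hom (sCat C) T P"
   "(P, X, p) \<cdot>\<^bsub>sCat C\<^esub> u = (P, X, p) \<cdot>\<^bsub>sCat C\<^esub> u'" "(P, Z, q) \<cdot>\<^bsub>sCat C\<^esub> u = (P, Z, q) \<cdot>\<^bsub>sCat C\<^esub> u'"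
  obtain \<alpha> where al: "u = (T, P, \<alpha>)" "is_smap C T P \<alpha>" using sCat_HomE[OF h(1)] by metis
  obtain \<beta> where be: "u' = (T, P, \<beta>)" "is_smap C T P \<beta>" using sCat_HomE[OF h(2)] by metis
  have "p n \<cdot> \<alpha> n = p n \<cdot> \<beta> n" "q n \<cdot> \<alpha> n = q n \<cdot> \<beta> n" for n
   using h(3,4) al(1) be(1) by (simp_all add: fun_eq_iff)
  then have "\<alpha> n = \<beta> n" for n
   using pullback_unique[OF pb[of n], unfolded DC, OF smap_Hom[OF al(2)] smap_Hom[OF be(2)]] by blast
  then show "u = u'" using al(1) be(1) by auto
 qed
qed

text \<open>Faces and degeneracies are induced by the universal properties of the levels. That they
  satisfy the simplicial identities is checked on generalized elements, where the projections are
  jointly injective.\<close>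

lemma ex_levelwise_pullback:
 assumes "simplicial_map C X Y \<phi>" "simplicial_map C Z Y \<psi>"
  and ex: "\<And>n. \<exists>p q. is_pullback C (\<phi> n) (\<psi> n) p q"
 obtains P p q where "simplicial_map C P X p" "simplicial_map C P Z q"
  "\<And>n. is_pullback C (\<phi> n) (\<psi> n) (p n) (q n)"
proof -
 interpret f: simplicial_map C X Y \<phi> by fact
 interpret g: simplicial_map C Z Y \<psi> by fact
 obtain p q where pb: "\<And>n. is_pullback C (\<phi> n) (\<psi> n) (p n) (q n)" using ex by metis
 define l where "l n = Dom C (p n)" for n
 have p: "p n \<in> (l n) -> (level X n)" and q: "q n \<in> (l n) -> (level Z n)" for n
  using pullback_Hom[OF pb[of n]] HomD(2)[OF f.phi_Hom[of n]] HomD(2)[OF g.phi_Hom[of n]]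
   HomD(2)[OF pullback_Hom(1)[OF pb[of n]]] HomD(2)[OF pullback_Hom(2)[OF pb[of n]]] by (simp_all add: l_def)
 have DC: "Dom C (p n) = l n" "Cod C (p n) = level X n" "Cod C (q n) = level Z n" for n
  using p q HomD by metis+
 note lift = pullback_lift[OF pb, unfolded DC] and uniq = pullback_unique[OF pb, unfolded DC]
 have "\<exists>u. u \<in> (l (Suc n)) -> (l n) \<and> p n \<cdot> u = face X n i \<cdot> p (Suc n) \<and> q n \<cdot> u = face Z n i \<cdot> q (Suc n)"
  if i: "i \<le> Suc n" for n i
 proof -
  note fX = sobj_face[OF f.sobj_X i] and fZ = sobj_face[OF g.sobj_X i] and fY = sobj_face[OF f.sobj_Y i]
  have "\<phi> n \<cdot> (face X n i \<cdot> p (Suc n)) = \<psi> n \<cdot> (face Z n i \<cdot> q (Suc n))"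
   using assoc[OF f.phi_Hom fX p] assoc[OF g.phi_Hom fZ q] smap_face[OF f.smap i] smap_face[OF g.smap i]
    assoc[OF fY f.phi_Hom p] assoc[OF fY g.phi_Hom q] pullback_Hom(5)[OF pb] by simp
  then show ?thesis using lift[OF comp_Hom[OF fX p] comp_Hom[OF fZ q]] by metis
 qed
 note exd = this
 define d where "d n i = (SOME u. u \<in> (l (Suc n)) -> (l n) \<and>
  p n \<cdot> u = face X n i \<cdot> p (Suc n) \<and> q n \<cdot> u = face Z n i \<cdot> q (Suc n))" for n i
 have d: "\<And>n i. i \<le> Suc n ==> d n i \<in> (l (Suc n)) -> (l n)"
  "\<And>n i. i \<le> Suc n ==> p n \<cdot> d n i = face X n i \<cdot> p (Suc n)"
  "\<And>n i. i \<le> Suc n ==> q n \<cdot> d n i = face Z n i \<cdot> q (Suc n)"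
  using someI_ex[OF exd, folded d_def] by auto
 have "\<exists>u. u \<in> (l n) -> (l (Suc n)) \<and> p (Suc n) \<cdot> u = degen X n i \<cdot> p n \<and> q (Suc n) \<cdot> u = degen Z n i \<cdot> q n"
  if i: "i \<le> n" for n i
 proof -
  note fX = sobj_degen[OF f.sobj_X i] and fZ = sobj_degen[OF g.sobj_X i] and fY = sobj_degen[OF f.sobj_Y i]
  have "\<phi> (Suc n) \<cdot> (degen X n i \<cdot> p n) = \<psi> (Suc n) \<cdot> (degen Z n i \<cdot> q n)"
   using assoc[OF f.phi_Hom fX p] assoc[OF g.phi_Hom fZ q] smap_degen[OF f.smap i] smap_degen[OF g.smap i]
    assoc[OF fY f.phi_Hom p] assoc[OF fY g.phi_Hom q] pullback_Hom(5)[OF pb] by simp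
  then show ?thesis using lift[OF comp_Hom[OF fX p] comp_Hom[OF fZ q]] by metis
 qed
 note exs = this
 define s where "s n i = (SOME u. u \<in> (l n) -> (l (Suc n)) \<and>
  p (Suc n) \<cdot> u = degen X n i \<cdot> p n \<and> q (Suc n) \<cdot> u = degen Z n i \<cdot> q n)" for n i
 have s: "\<And>n i. i \<le> n ==> s n i \<in> (l n) -> (l (Suc n))"
  "\<And>n i. i \<le> n ==> p (Suc n) \<cdot> s n i = degen X n i \<cdot> p n"
  "\<And>n i. i \<le> n ==> q (Suc n) \<cdot> s n i = degen Z n i \<cdot> q n"
  using someI_ex[OF exs, folded s_def] by auto
 define P where "P = \<lparr>level = l, face = d, degen = s\<rparr>"
 have Ps: "level P = l" "face P = d" "degen P = s" by (simp_all add: P_def)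
 have sm: "is_smap C P X p" "is_smap C P Z q"
  unfolding is_smap_def Ps using p q d(2,3) s(2,3) by auto
 have "is_sobj C P"
 proof (rule is_sobjI, unfold Ps)
  fix T
  show "simplicial_set (hset C P T)"
  proof (rule simplicial_set_jointly_injective[OF simplicial_set_hset[OF f.sobj_X] simplicial_set_hset[OF g.sobj_X]])
   show "ssmap (hset C P T) (hset C X T) (\<lambda>n x. p n \<cdot> x)"
    unfolding ssmap_def hset_simps Ps
   proof (intro conjI allI ballI impI)
    fix n i x
    show "p n \<cdot> x \<in> T -> (level X n)" if "x \<in> T -> (l n)" using p that by blast
    show "p n \<cdot> (d n i \<cdot> x) = face X n i \<cdot> (p (Suc n) \<cdot> x)" if "i \<le> Suc n" "x \<in> T -> (l (Suc n))"
     using assoc[OF p d(1)[OF that(1)] that(2)] d(2)[OF that(1)] assoc[OF sobj_face[OF f.sobj_X that(1)] p that(2)] by simp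
    show "p (Suc n) \<cdot> (s n i \<cdot> x) = degen X n i \<cdot> (p n \<cdot> x)" if "i \<le> n" "x \<in> T -> (l n)"
     using assoc[OF p s(1)[OF that(1)] that(2)] s(2)[OF that(1)] assoc[OF sobj_degen[OF f.sobj_X that(1)] p that(2)] by simp
   qed
   show "ssmap (hset C P T) (hset C Z T) (\<lambda>n x. q n \<cdot> x)"
    unfolding ssmap_def hset_simps Ps
   proof (intro conjI allI ballI impI)
    fix n i x
    show "q n \<cdot> x \<in> T -> (level Z n)" if "x \<in> T -> (l n)" using q that by blast
    show "q n \<cdot> (d n i \<cdot> x) = face Z n i \<cdot> (q (Suc n) \<cdot> x)" if "i \<le> Suc n" "x \<in> T -> (l (Suc n))"
     using assoc[OF q d(1)[OF that(1)] that(2)] d(3)[OF that(1)] assoc[OF sobj_face[OF g.sobj_X that(1)] q that(2)] by simp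
    show "q (Suc n) \<cdot> (s n i \<cdot> x) = degen Z n i \<cdot> (q n \<cdot> x)" if "i \<le> n" "x \<in> T -> (l n)"
     using assoc[OF q s(1)[OF that(1)] that(2)] s(3)[OF that(1)] assoc[OF sobj_degen[OF g.sobj_X that(1)] q that(2)] by simp
   qed
  next
   fix n i x
   show "fc (hset C P T) n i x \<in> pts (hset C P T) n" if "i \<le> Suc n" "x \<in> pts (hset C P T) (Suc n)"
    using that d(1) unfolding hset_simps Ps by blast
   show "dg (hset C P T) n i x \<in> pts (hset C P T) (Suc n)" if "i \<le> n" "x \<in> pts (hset C P T) n"
    using that s(1) unfolding hset_simps Ps by blast
  next
   fix n x y assume "x \<in> pts (hset C P T) n" "y \<in> pts (hset C P T) n" "p n \<cdot> x = p n \<cdot> y" "q n \<cdot> x = q n \<cdot> y"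
   then show "x = y" unfolding hset_simps Ps using uniq by blast
  qed
 qed (use d(1) s(1) Hom_Obj(1)[OF p] in auto)
 then have "simplicial_map C P X p" "simplicial_map C P Z q"
  using f.sobj_X g.sobj_X sm by unfold_locales
 then show thesis using that pb by blast
qed

end

lemma full_subcategory_pullback:
 assumes "is_pullback C f g p q" "f \<in> Arr (full_subcategory C Q)" "g \<in> Arr (full_subcategory C Q)"
  "p \<in> Arr (full_subcategory C Q)" "q \<in> Arr (full_subcategory C Q)"
 shows "is_pullback (full_subcategory C Q) f g p q"
 unfolding is_pullback_def[of "full_subcategory C Q"]
proof (intro conjI ballI impI)
 fix T a b
 assume T: "T \<in> Obj (full_subcategory C Q)" "a \<in> Hom (full_subcategory C Q) T (Dom (full_subcategory C Q) f)"
  "b \<in> Hom (full_subcategory C Q) T (Dom (full_subcategory C Q) g)"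
  "f \<cdot>\<^bsub>full_subcategory C Q\<^esub> a = g \<cdot>\<^bsub>full_subcategory C Q\<^esub> b"
 then have "T \<in> Obj C" "a \<in> Hom C T (Dom C f)" "b \<in> Hom C T (Dom C g)" "f \<cdot>\<^bsub>C\<^esub> a = g \<cdot>\<^bsub>C\<^esub> b"
  by (simp_all add: full_subcategory_Hom)
 then have "\<exists>!u. u \<in> Hom C T (Dom C p) \<and> p \<cdot>\<^bsub>C\<^esub> u = a \<and> q \<cdot>\<^bsub>C\<^esub> u = b"
  using assms(1) unfolding is_pullback_def by blast
 moreover have "Q T" "Q (Dom C p)" using T assms(4) by simp_all
 ultimately show "\<exists>!u. u \<in> Hom (full_subcategory C Q) T (Dom (full_subcategory C Q) p) \<and>
   p \<cdot>\<^bsub>full_subcategory C Q\<^esub> u = a \<and> q \<cdot>\<^bsub>full_subcategory C Q\<^esub> u = b"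
  by (simp add: full_subcategory_Hom)
qed (use assms in \<open>simp_all add: is_pullback_def\<close>)

section \<open>Base change of Kan fibrations and preservation of the resulting pullbacks\<close>

section \<open>Pullbacks along covering fibrations\<close>

text \<open>A pullback in a full subcategory is compared with a levelwise one. This requires the
  levelwise pullback \<open>P1\<close> to lie in the subcategory, which for infinity-groupoids is a
  closure property under base change.\<close>

lemma (in category) levelwise_pullback:
 assumes f: "simplicial_map C X Y \<phi>" and g: "simplicial_map C Z Y \<psi>"
  and P1: "simplicial_map C P1 X p1" "simplicial_map C P1 Z q1" "\<And>n. is_pullback C (\<phi> n) (\<psi> n) (p1 n) (q1 n)"
  and p: "simplicial_map C P X p" and q: "simplicial_map C P Z q"
  and Q: "Q X" "Q Y" "Q Z" "Q P" "Q P1"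
  and pb0: "is_pullback (full_subcategory (sCat C) Q) (X, Y, \<phi>) (Z, Y, \<psi>) (P, X, p) (P, Z, q)"
 shows "is_pullback C (\<phi> n) (\<psi> n) (p n) (q n)"
proof -
 let ?C = "full_subcategory (sCat C) Q"
 interpret f: simplicial_map C X Y \<phi> by (rule f)
 interpret g: simplicial_map C Z Y \<psi> by (rule g)
 interpret P1: simplicial_map C P1 X p1 by (rule P1(1))
 interpret Q1: simplicial_map C P1 Z q1 by (rule P1(2))
 interpret s: category ?C
  by unfold_locales (rule is_category_full_subcategory[OF is_category_sCat])
 have pb1: "is_pullback ?C (X, Y, \<phi>) (Z, Y, \<psi>) (P1, X, p1) (P1, Z, q1)"
  by (rule full_subcategory_pullback[OF pullback_sCatI[OF f g P1]])
   (use Q f.sobj_X f.sobj_Y f.smap g.sobj_X g.smap P1.sobj_X P1.smap Q1.smap in simp_all)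
 obtain u where u: "u \<in> Hom ?C (Dom ?C (P, X, p)) (Dom ?C (P1, X, p1))" "is_iso ?C u"
  "(P1, X, p1) \<cdot>\<^bsub>?C\<^esub> u = (P, X, p)" "(P1, Z, q1) \<cdot>\<^bsub>?C\<^esub> u = (P, Z, q)"
  using s.pullback_iso[OF pb1 pb0] by metis
 have uH: "u \<in> Hom ?C P P1" using u(1) by simp
 obtain v where v: "v \<in> Hom ?C P1 P" "v \<cdot>\<^bsub>?C\<^esub> u = Idm ?C P" "u \<cdot>\<^bsub>?C\<^esub> v = Idm ?C P1"
  using s.is_isoE[OF u(2) uH] by metis
 have u': "comps u n \<in> (level P n) -> (level P1 n)"
  using uH smap_Hom unfolding full_subcategory_Hom sCat_Hom by fastforce
 have v': "comps v n \<in> (level P1 n) -> (level P n)"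
  using v(1) smap_Hom unfolding full_subcategory_Hom sCat_Hom by fastforce
 have "is_iso C (comps u n)"
  using is_isoI[OF u' v'] v(2,3) by (auto simp: fun_eq_iff)
 then have "is_pullback C (\<phi> n) (\<psi> n) (p1 n \<cdot> comps u n) (q1 n \<cdot> comps u n)"
  using pullback_comp_iso[OF P1(3)] u' HomD(2)[OF P1.phi_Hom[of n]] by metis
 moreover have "p n = p1 n \<cdot> comps u n" "q n = q1 n \<cdot> comps u n"
  using u(3,4) by auto
 ultimately show ?thesis by simp
qed

context geometric
begin

lemma matched_comparison_cover:
 assumes g: "geometric_map C S D S' F X Y \<phi>" and K: "ssubset n K"
  and L: "geometric_map.matched C D F X Y \<phi> K n L x y" and r: "rel_matching_cover C S K n (X, Y, \<phi>)"
 obtains c where "c \<in> S" "c \<in> (level X n) -> L" "\<And>\<mu>. \<mu> \<in> K ==> x \<mu> \<cdot> c = sop C X n \<mu>" "y \<cdot> c = \<phi> n"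
proof -
 interpret geometric_map C S D S' F X Y \<phi> by (rule g)
 have M: "is_rel_matching C K n (X, Y, \<phi>) L x y" using L by (simp add: matched_def)
 obtain c where c: "c \<in> (level X n) -> L" "\<And>\<mu>. \<mu> \<in> K ==> x \<mu> \<cdot> c = sop C X n \<mu>" "y \<cdot> c = \<phi> n"
  using rel_matching_comparison[OF M K] by metis
 then show thesis using that rel_matching_coverD[OF C.covers_axioms K r M c] by blast
qed

text \<open>The component in degree \<open>n\<close> factors into three covers: the comparison map
  of the horn at 0, the projection \<open>e\<close> to the pullback at the apex, and a base change
  of \<open>\<phi> 0\<close>. Hence all levelwise pullbacks along such a map exist.\<close>

lemma covering_fibration_level:
 assumes g: "simplicial_map C X Y \<phi>" and Y: "inf_groupoid C S Y" and f: "covering_fibration C S (X, Y, \<phi>)"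
 shows "\<phi> n \<in> S"
proof (cases "n = 0")
 case True
 then show ?thesis using f by (simp add: covering_fibration_def)
next
 case False
 then have n: "1 \<le> n" "0 \<le> n" by auto
 interpret geometric_map C S D S' F X Y \<phi> by (rule geometric_mapI[OF g])
 have f0: "\<phi> 0 \<in> S" using f by (simp add: covering_fibration_def)
 have r: "rel_matching_cover C S (horn n k) n (X, Y, \<phi>)" if "1 \<le> n" "k \<le> n" for n k
  using f that unfolding covering_fibration_def kan_fibration_def by blast
 obtain L x y p q e where L: "matched (horn n 0) n L x y" and pb: "is_pullback C (\<phi> 0) (sop C Y n [0]) p q"
  and e: "e \<in> S" "e \<in> L -> (Dom C p)" "q \<cdot> e = y"
  using matched_horn[OF inf_groupoid_vertex[OF Y] n r] by blast
 obtain c where c: "c \<in> S" "c \<in> (level X n) -> L" "y \<cdot> c = \<phi> n"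
  using matched_comparison_cover[OF geometric_map_axioms ssubset_horn[OF n(2)] L r[OF n]] by blast
 have q: "q \<in> S" "q \<in> (Dom C p) -> (Cod C q)"
  using C.S_base[OF f0 pb] C.pullback_Hom[OF pb] by auto
 have "y \<in> S" "y \<in> L -> (Cod C q)" using C.S_comp[OF q e(1,2)] C.comp_Hom[OF q(2) e(2)] e(3) by auto
 then show ?thesis using C.S_comp[OF _ _ c(1,2)] c(3) by metis
qed

text \<open>The comparison map of a base change of \<open>f\<close> is a base change of the comparison map of \<open>f\<close>.\<close>

lemma kan_base_change:
 assumes f: "simplicial_map C X Y \<phi>" and g: "simplicial_map C Z Y \<psi>"
  and p: "simplicial_map C P X p" and q: "simplicial_map C P Z q"
  and pb: "\<And>n. is_pullback C (\<phi> n) (\<psi> n) (p n) (q n)"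
  and Y: "inf_groupoid C S Y" and Z: "inf_groupoid C S Z"
  and kan: "\<And>n k. 1 \<le> n ==> k \<le> n ==> rel_matching_cover C S (horn n k) n (X, Y, \<phi>)"
  and n: "1 \<le> n" "k \<le> n"
 shows "rel_matching_cover C S (horn n k) n (P, Z, q)"
 using n
proof (induction n arbitrary: k rule: less_induct)
 case (less n)
 interpret f: geometric_map C S D S' F X Y \<phi> by (rule geometric_mapI[OF f])
 interpret g: simplicial_map C Z Y \<psi> by (rule g)
 interpret p: simplicial_map C P X p by (rule p)
 interpret q: geometric_map C S D S' F P Z q by (rule geometric_mapI[OF q])
 let ?K = "horn n k"
 note n = less.prems
 have K: "ssubset n ?K" using ssubset_horn n(2) .
 \<comment> \<open>The matching object of the base change exists because its lower comparison maps
   are covers by induction; that of the original map exists by hypothesis.\<close>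
 obtain N xN yN where N: "q.matched ?K n N xN yN"
  using kan_matched[OF q Z n less.IH] by blast
 obtain M xM yM where M: "f.matched ?K n M xM yM" using kan_matched[OF f Y n kan] by blast
 obtain c where c: "c \<in> S" "c \<in> (level X n) -> M" "\<And>\<mu>. \<mu> \<in> ?K ==> xM \<mu> \<cdot> c = sop C X n \<mu>" "yM \<cdot> c = \<phi> n"
  using matched_comparison_cover[OF f.geometric_map_axioms K M kan[OF n]] by blast
 have Nm: "is_rel_matching C ?K n (P, Z, q) N xN yN" using N by (simp add: q.matched_def)
 have Mm: "is_rel_matching C ?K n (X, Y, \<phi>) M xM yM" using M by (simp add: f.matched_def)
 obtain d where d: "d \<in> (level P n) -> N" "\<And>\<mu>. \<mu> \<in> ?K ==> xN \<mu> \<cdot> d = sop C P n \<mu>" "yN \<cdot> d = q n"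
  using q.rel_matching_comparison[OF Nm K] by metis
 note NH = q.matched_point[OF N] and MH = f.matched_point[OF M]
 have Np: "spoint ?K (hset C P N) xN" "\<And>\<mu>. \<mu> \<in> ?K ==> q (dim \<mu>) \<cdot> xN \<mu> = sop C Z n \<mu> \<cdot> yN"
  using NH(4) by (simp_all add: is_rel_point_iff)
 have sq: "\<phi> m \<cdot> p m = \<psi> m \<cdot> q m" for m using C.pullback_Hom(5)[OF pb] .
 have sX: "sop C X n \<mu> \<in> (level X n) -> (level X (dim \<mu>))" "sop C Y n \<mu> \<in> (level Y n) -> (level Y (dim \<mu>))"
  "sop C Z n \<mu> \<in> (level Z n) -> (level Z (dim \<mu>))" "sop C P n \<mu> \<in> (level P n) -> (level P (dim \<mu>))"
  if "\<mu> \<in> ?K" for \<mu>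
  using C.sop_Hom f.sobj_X f.sobj_Y q.sobj_X q.sobj_Y ssubset_std[OF K that] by blast+
 have "is_rel_point C ?K n (X, Y, \<phi>) N (\<lambda>\<mu>. p (dim \<mu>) \<cdot> xN \<mu>) (\<psi> n \<cdot> yN)"
  unfolding is_rel_point_iff
 proof (intro conjI ballI)
  show "spoint ?K (hset C X N) (\<lambda>\<mu>. p (dim \<mu>) \<cdot> xN \<mu>)"
   using ssmap_spoint[OF ssubset_Nil[OF K] C.ssmap_postcomp[OF p.sobj_X p.sobj_Y p.smap] Np(1)] .
  show "\<psi> n \<cdot> yN \<in> N -> (level Y n)" using g.phi_Hom NH(2) by blast
  fix \<mu> assume k: "\<mu> \<in> ?K"
  have "\<phi> (dim \<mu>) \<cdot> (p (dim \<mu>) \<cdot> xN \<mu>) = \<psi> (dim \<mu>) \<cdot> (sop C Z n \<mu> \<cdot> yN)"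
   using C.assoc[OF f.phi_Hom p.phi_Hom NH(1)[OF k]] C.assoc[OF g.phi_Hom q.phi_Hom NH(1)[OF k]] sq Np(2)[OF k] by simp
  also have "\<dots> = sop C Y n \<mu> \<cdot> (\<psi> n \<cdot> yN)"
   using C.assoc[OF g.phi_Hom sX(3)[OF k] NH(2)] C.assoc[OF sX(2)[OF k] g.phi_Hom NH(2)]
    C.sop_natural[OF g.sobj_X g.sobj_Y g.smap ssubset_std[OF K k]] by simp
  finally show "\<phi> (dim \<mu>) \<cdot> (p (dim \<mu>) \<cdot> xN \<mu>) = sop C Y n \<mu> \<cdot> (\<psi> n \<cdot> yN)" .
 qed
 then obtain w where w: "w \<in> N -> M" "\<And>\<mu>. \<mu> \<in> ?K ==> xM \<mu> \<cdot> w = p (dim \<mu>) \<cdot> xN \<mu>" "yM \<cdot> w = \<psi> n \<cdot> yN"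
  by (rule f.rel_matching_lift[OF Mm]) blast
 have DC: "Dom C (p m) = level P m" "Cod C (p m) = level X m" "Cod C (q m) = level Z m" for m
  using p.phi_Hom q.phi_Hom HomD by metis+
 \<comment> \<open>A generalized element of the fibre product consists of a simplex of X, a horn in
   P, and a filler in Z of the image of that horn. As P is levelwise a fibre product, these assemble
   to a unique simplex of P.\<close>
 have "is_pullback C c w (p n) d"
 proof (rule C.pullbackI[OF c(2) w(1) p.phi_Hom d(1)])
  show "c \<cdot> p n = w \<cdot> d"
  proof (rule f.rel_matching_unique[OF K Mm C.comp_Hom[OF c(2) p.phi_Hom] C.comp_Hom[OF w(1) d(1)]])
   show "yM \<cdot> (c \<cdot> p n) = yM \<cdot> (w \<cdot> d)"
    using C.assoc[OF MH(2) c(2) p.phi_Hom] C.assoc[OF MH(2) w(1) d(1)] c(4) w(3)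
     C.assoc[OF g.phi_Hom NH(2) d(1)] d(3) sq by simp
   fix \<mu> assume k: "\<mu> \<in> ?K"
   show "xM \<mu> \<cdot> (c \<cdot> p n) = xM \<mu> \<cdot> (w \<cdot> d)"
    using C.assoc[OF MH(1)[OF k] c(2) p.phi_Hom] C.assoc[OF MH(1)[OF k] w(1) d(1)] c(3)[OF k] w(2)[OF k]
     C.assoc[OF p.phi_Hom NH(1)[OF k] d(1)] d(2)[OF k] C.sop_natural[OF p.sobj_X p.sobj_Y p.smap ssubset_std[OF K k]] by simp
  qed
 next
  fix T a b assume a: "a \<in> T -> (level X n)" and b: "b \<in> T -> N" and e: "c \<cdot> a = w \<cdot> b"
  have yb: "yN \<cdot> b \<in> T -> (level Z n)" using NH(2) b by blast
  have "\<phi> n \<cdot> a = \<psi> n \<cdot> (yN \<cdot> b)"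
   using C.assoc[OF MH(2) c(2) a] C.assoc[OF MH(2) w(1) b] c(4) w(3) e C.assoc[OF g.phi_Hom NH(2) b] by simp
  then obtain u where u: "u \<in> T -> (level P n)" "p n \<cdot> u = a" "q n \<cdot> u = yN \<cdot> b"
   using C.pullback_lift[OF pb[of n], unfolded DC, OF a yb] by metis
  have "d \<cdot> u = b"
  proof (rule q.rel_matching_unique[OF K Nm C.comp_Hom[OF d(1) u(1)] b])
   show "yN \<cdot> (d \<cdot> u) = yN \<cdot> b" using C.assoc[OF NH(2) d(1) u(1)] d(3) u(3) by simp
   fix \<mu> assume k: "\<mu> \<in> ?K"
   have 1: "xN \<mu> \<cdot> (d \<cdot> u) = sop C P n \<mu> \<cdot> u"
    using C.assoc[OF NH(1)[OF k] d(1) u(1)] d(2)[OF k] by simp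
   have "sop C P n \<mu> \<cdot> u = xN \<mu> \<cdot> b"
   proof (rule C.pullback_unique[OF pb[of "dim \<mu>"], unfolded DC])
    show "sop C P n \<mu> \<cdot> u \<in> T -> (level P (dim \<mu>))" using sX(4)[OF k] u(1) by blast
    show "xN \<mu> \<cdot> b \<in> T -> (level P (dim \<mu>))" using NH(1)[OF k] b by blast
    have "p (dim \<mu>) \<cdot> (sop C P n \<mu> \<cdot> u) = sop C X n \<mu> \<cdot> a"
     using C.assoc[OF p.phi_Hom sX(4)[OF k] u(1)] C.assoc[OF sX(1)[OF k] p.phi_Hom u(1)]
      C.sop_natural[OF p.sobj_X p.sobj_Y p.smap ssubset_std[OF K k]] u(2) by simp
    also have "\<dots> = p (dim \<mu>) \<cdot> (xN \<mu> \<cdot> b)"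
     using C.assoc[OF MH(1)[OF k] c(2) a] C.assoc[OF MH(1)[OF k] w(1) b] c(3)[OF k] w(2)[OF k] e
      C.assoc[OF p.phi_Hom NH(1)[OF k] b] by simp
    finally show "p (dim \<mu>) \<cdot> (sop C P n \<mu> \<cdot> u) = p (dim \<mu>) \<cdot> (xN \<mu> \<cdot> b)" .
    have "q (dim \<mu>) \<cdot> (sop C P n \<mu> \<cdot> u) = sop C Z n \<mu> \<cdot> (yN \<cdot> b)"
     using C.assoc[OF q.phi_Hom sX(4)[OF k] u(1)] C.assoc[OF sX(3)[OF k] q.phi_Hom u(1)]
      C.sop_natural[OF q.sobj_X q.sobj_Y q.smap ssubset_std[OF K k]] u(3) by simp
    also have "\<dots> = q (dim \<mu>) \<cdot> (xN \<mu> \<cdot> b)"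
     using C.assoc[OF sX(3)[OF k] NH(2) b] C.assoc[OF q.phi_Hom NH(1)[OF k] b] Np(2)[OF k] by simp
    finally show "q (dim \<mu>) \<cdot> (sop C P n \<mu> \<cdot> u) = q (dim \<mu>) \<cdot> (xN \<mu> \<cdot> b)" .
   qed
   then show "xN \<mu> \<cdot> (d \<cdot> u) = xN \<mu> \<cdot> b" using 1 by simp
  qed
  then show "\<exists>u\<in>Hom C T (level P n). p n \<cdot> u = a \<and> d \<cdot> u = b" using u by blast
 next
  fix T u u' assume u: "u \<in> T -> (level P n)" "u' \<in> T -> (level P n)"
   and e: "p n \<cdot> u = p n \<cdot> u'" "d \<cdot> u = d \<cdot> u'"
  have "q n \<cdot> u = q n \<cdot> u'"
   using C.assoc[OF NH(2) d(1) u(1)] C.assoc[OF NH(2) d(1) u(2)] d(3) e(2) by simp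
  then show "u = u'" using C.pullback_unique[OF pb[of n], unfolded DC, OF u e(1)] by blast
 qed
 then have "d \<in> S" using C.S_base[OF c(1)] by blast
 then show ?case using q.rel_matching_coverI[OF Nm _ d] by blast
qed

text \<open>A Kan fibration over an infinity-groupoid has an infinity-groupoid as its source: the
 comparison map of the composite factors through the relative matching object.\<close>

lemma inf_groupoid_source:
 assumes q: "simplicial_map C P Z q" and Z: "inf_groupoid C S Z"
  and kan: "\<And>n k. 1 \<le> n ==> k \<le> n ==> rel_matching_cover C S (horn n k) n (P, Z, q)"
 shows "inf_groupoid C S P"
proof -
 obtain W \<zeta> where W: "simplicial_map C Z W \<zeta>" "\<And>n. is_terminal C (level W n)" "is_terminal (sCat C) W"
  "\<And>n k. 1 \<le> n ==> k \<le> n ==> rel_matching_cover C S (horn n k) n (Z, W, \<zeta>)"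
  using C.inf_groupoidE[OF Z] by metis
 interpret z: geometric_map C S D S' F Z W \<zeta> by (rule geometric_mapI[OF W(1)])
 interpret q: geometric_map C S D S' F P Z q by (rule geometric_mapI[OF q])
 let ?t = "\<lambda>n. \<zeta> n \<cdot> q n"
 have t: "simplicial_map C P W ?t"
  using q.sobj_X z.sobj_Y C.smap_comp[OF q.sobj_X q.sobj_Y z.sobj_Y q.smap z.smap] by unfold_locales
 interpret t: geometric_map C S D S' F P W ?t by (rule geometric_mapI[OF t])
 note tu = terminal_Hom_unique[OF W(2) C.category_axioms]
 have "1 \<le> n ==> k \<le> n ==> rel_matching_cover C S (horn n k) n (P, W, ?t)" for n k
 proof (induction n arbitrary: k rule: less_induct)
  case (less n)
  let ?K = "horn n k"
  note n = less.prems
  have K: "ssubset n ?K" using ssubset_horn n(2) .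
  obtain L xL yL where L: "t.matched ?K n L xL yL"
   using inf_groupoid_matched[OF t.geometric_map_axioms W(2) n less.IH] by blast
  obtain M xM yM where M: "z.matched ?K n M xM yM"
   using inf_groupoid_matched[OF z.geometric_map_axioms W(2) n W(4)] by blast
  obtain N xN yN where N: "q.matched ?K n N xN yN" using kan_matched[OF q Z n kan] by blast
  note NH = q.matched_point[OF N] and MH = z.matched_point[OF M] and LH = t.matched_point[OF L]
  have Nm: "is_rel_matching C ?K n (P, Z, q) N xN yN" using N by (simp add: q.matched_def)
  have Mm: "is_rel_matching C ?K n (Z, W, \<zeta>) M xM yM" using M by (simp add: z.matched_def)
  have Lm: "is_rel_matching C ?K n (P, W, ?t) L xL yL" using L by (simp add: t.matched_def)
  obtain c where c: "c \<in> S" "c \<in> (level Z n) -> M" "\<And>\<mu>. \<mu> \<in> ?K ==> xM \<mu> \<cdot> c = sop C Z n \<mu>"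
   using matched_comparison_cover[OF z.geometric_map_axioms K M W(4)[OF n]] by blast
  obtain d where d: "d \<in> S" "d \<in> (level P n) -> N" "\<And>\<mu>. \<mu> \<in> ?K ==> xN \<mu> \<cdot> d = sop C P n \<mu>"
   using matched_comparison_cover[OF q.geometric_map_axioms K N kan[OF n]] by blast
  have Np: "spoint ?K (hset C P N) xN" "\<And>\<mu>. \<mu> \<in> ?K ==> q (dim \<mu>) \<cdot> xN \<mu> = sop C Z n \<mu> \<cdot> yN"
   using NH(4) by (simp_all add: is_rel_point_iff)
  have Lp: "spoint ?K (hset C P L) xL" using LH(4) by (simp add: is_rel_point_iff)
  \<comment> \<open>Over a terminal base the compatibility condition is automatic, since parallel
    arrows into a level of \<open>W\<close> agree.\<close>
  have overW: "is_rel_point C ?K n (A, W, \<alpha>) T x y"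
   if "simplicial_map C A W \<alpha>" "spoint ?K (hset C A T) x" "y \<in> T -> (level W n)" for A \<alpha> T x y
   unfolding is_rel_point_iff
  proof (intro conjI ballI that(2,3))
   interpret a: simplicial_map C A W \<alpha> by (rule that(1))
   fix \<mu> assume k: "\<mu> \<in> ?K"
   have "x \<mu> \<in> T -> (level A (dim \<mu>))" using spoint_pts[OF that(2) k] by simp
   then show "\<alpha> (dim \<mu>) \<cdot> x \<mu> = sop C W n \<mu> \<cdot> y"
    by (intro tu[of _ T "dim \<mu>"] C.comp_Hom[OF a.phi_Hom] C.comp_Hom[OF C.sop_Hom[OF a.sobj_Y ssubset_std[OF K k]] that(3)])
  qed
  have "is_rel_point C ?K n (Z, W, \<zeta>) L (\<lambda>\<mu>. q (dim \<mu>) \<cdot> xL \<mu>) yL"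
   using overW[OF W(1) ssmap_spoint[OF ssubset_Nil[OF K] C.ssmap_postcomp[OF q.sobj_X q.sobj_Y q.smap] Lp] LH(2)] .
  then obtain r where r: "r \<in> L -> M" "\<And>\<mu>. \<mu> \<in> ?K ==> xM \<mu> \<cdot> r = q (dim \<mu>) \<cdot> xL \<mu>" "yM \<cdot> r = yL"
   by (rule z.rel_matching_lift[OF Mm]) blast
  obtain y0 where "y0 \<in> N -> (level W n)" using terminal_Hom_ex[OF W(2) NH(3)] by blast
  from overW[OF t Np(1) this]
  obtain h where h: "h \<in> N -> L" "\<And>\<mu>. \<mu> \<in> ?K ==> xL \<mu> \<cdot> h = xN \<mu>" "yL \<cdot> h = y0"
   by (rule t.rel_matching_lift[OF Lm]) blast
  have sZ: "sop C Z n \<mu> \<in> (level Z n) -> (level Z (dim \<mu>))" if "\<mu> \<in> ?K" for \<mu>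
   using C.sop_Hom q.sobj_Y ssubset_std[OF K that] by blast
  \<comment> \<open>\<open>N\<close> parametrizes horns in P with a filler in Z of their image; that
    is the fibre product of \<open>L\<close>, the horns in P, and the simplices of Z over
    \<open>M\<close>, the horns in Z. So \<open>h\<close> is a base change of the cover
    \<open>c\<close>, and the desired comparison map is \<open>h \<cdot> d\<close>.\<close>
  have "is_pullback C c r yN h"
  proof (rule C.pullbackI[OF c(2) r(1) NH(2) h(1)])
   show "c \<cdot> yN = r \<cdot> h"
   proof (rule z.rel_matching_unique[OF K Mm C.comp_Hom[OF c(2) NH(2)] C.comp_Hom[OF r(1) h(1)]])
    show "yM \<cdot> (c \<cdot> yN) = yM \<cdot> (r \<cdot> h)"
     by (rule tu[OF C.comp_Hom[OF MH(2) C.comp_Hom[OF c(2) NH(2)]] C.comp_Hom[OF MH(2) C.comp_Hom[OF r(1) h(1)]]])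
    fix \<mu> assume k: "\<mu> \<in> ?K"
    show "xM \<mu> \<cdot> (c \<cdot> yN) = xM \<mu> \<cdot> (r \<cdot> h)"
     using C.assoc[OF MH(1)[OF k] c(2) NH(2)] C.assoc[OF MH(1)[OF k] r(1) h(1)] c(3)[OF k] r(2)[OF k]
      Np(2)[OF k] C.assoc[OF q.phi_Hom LH(1)[OF k] h(1)] h(2)[OF k] by simp
   qed
  next
   fix T a b assume a: "a \<in> T -> (level Z n)" and b: "b \<in> T -> L" and e: "c \<cdot> a = r \<cdot> b"
   have "is_rel_point C ?K n (P, Z, q) T (\<lambda>\<mu>. xL \<mu> \<cdot> b) a"
    unfolding is_rel_point_iff
   proof (intro conjI ballI a)
    show "spoint ?K (hset C P T) (\<lambda>\<mu>. xL \<mu> \<cdot> b)"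
     using C.spoint_precomp[OF ssubset_Nil[OF K] q.sobj_X Lp b] .
    fix \<mu> assume k: "\<mu> \<in> ?K"
    show "q (dim \<mu>) \<cdot> (xL \<mu> \<cdot> b) = sop C Z n \<mu> \<cdot> a"
     using C.assoc[OF MH(1)[OF k] c(2) a] C.assoc[OF MH(1)[OF k] r(1) b] c(3)[OF k] r(2)[OF k] e
      C.assoc[OF q.phi_Hom LH(1)[OF k] b] by simp
   qed
   then obtain u where u: "u \<in> T -> N" "\<And>\<mu>. \<mu> \<in> ?K ==> xN \<mu> \<cdot> u = xL \<mu> \<cdot> b" "yN \<cdot> u = a"
    by (rule q.rel_matching_lift[OF Nm]) blast
   have "h \<cdot> u = b"
   proof (rule t.rel_matching_unique[OF K Lm C.comp_Hom[OF h(1) u(1)] b])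
    show "yL \<cdot> (h \<cdot> u) = yL \<cdot> b"
     by (rule tu[OF C.comp_Hom[OF LH(2) C.comp_Hom[OF h(1) u(1)]] C.comp_Hom[OF LH(2) b]])
    show "xL \<mu> \<cdot> (h \<cdot> u) = xL \<mu> \<cdot> b" if k: "\<mu> \<in> ?K" for \<mu>
     using C.assoc[OF LH(1)[OF k] h(1) u(1)] h(2)[OF k] u(2)[OF k] by simp
   qed
   then show "\<exists>u\<in>Hom C T N. yN \<cdot> u = a \<and> h \<cdot> u = b" using u by blast
  next
   fix T u u' assume u: "u \<in> T -> N" "u' \<in> T -> N"
    and e: "yN \<cdot> u = yN \<cdot> u'" "h \<cdot> u = h \<cdot> u'"
   show "u = u'"
   proof (rule q.rel_matching_unique[OF K Nm u _ e(1)])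
    show "xN \<mu> \<cdot> u = xN \<mu> \<cdot> u'" if k: "\<mu> \<in> ?K" for \<mu>
     using C.assoc[OF LH(1)[OF k] h(1) u(1)] C.assoc[OF LH(1)[OF k] h(1) u(2)] h(2)[OF k] e(2) by simp
   qed
  qed
  then have hS: "h \<in> S" using C.S_base[OF c(1)] by blast
  show ?case
  proof (rule t.rel_matching_coverI[OF Lm C.S_comp[OF hS h(1) d(1,2)] C.comp_Hom[OF h(1) d(2)]])
   show "yL \<cdot> (h \<cdot> d) = ?t n"
    by (rule tu[OF C.comp_Hom[OF LH(2) C.comp_Hom[OF h(1) d(2)]] t.phi_Hom])
   show "xL \<mu> \<cdot> (h \<cdot> d) = sop C P n \<mu>" if k: "\<mu> \<in> ?K" for \<mu>
    using C.assoc[OF LH(1)[OF k] h(1) d(2)] h(2)[OF k] d(3)[OF k] by simp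
  qed
 qed
 then have "kan_fibration C S (P, W, ?t)"
  unfolding kan_fibration_def using t.sobj_X t.sobj_Y t.smap by simp
 moreover have "(P, W, ?t) \<in> Hom (sCat C) P W" using t.sobj_X t.sobj_Y t.smap by (simp add: sCat_Hom)
 ultimately show ?thesis unfolding inf_groupoid_def using W(3) t.sobj_X
  by (intro conjI exI[of _ W] exI[of _ "(P, W, ?t)"]) simp_all
qed

lemma is_functor_Gpd:
 assumes "is_terminal D t"
 shows "is_functor (Gpd C S) (Gpd D S') (sFun F)"
 unfolding Gpd_def
 by (rule is_functor_full_subcategory[OF is_functor_sFun]) (rule inf_groupoid_preserved[OF _ assms])

text \<open>All components of \<open>f\<close> are covers, so a levelwise pullback exists and is an
  infinity-groupoid. The given pullback is isomorphic to it, hence itself levelwise, and F preserves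
  each level.\<close>

lemma pullback_preserved:
 assumes t: "is_terminal D t" and f: "covering_fibration C S f" and pb0: "is_pullback (Gpd C S) f g p q"
 shows "is_pullback (Gpd D S') (AMap (sFun F) f) (AMap (sFun F) g) (AMap (sFun F) p) (AMap (sFun F) q)"
proof -
 have A: "f \<in> Arr (Gpd C S)" "g \<in> Arr (Gpd C S)" "p \<in> Arr (Gpd C S)" "q \<in> Arr (Gpd C S)"
  using pb0 by (simp_all add: is_pullback_def)
 obtain X Y \<phi> where F: "f = (X, Y, \<phi>)" "simplicial_map C X Y \<phi>" "inf_groupoid C S X" "inf_groupoid C S Y"
  using Gpd_ArrE[OF A(1) C.is_cat] by metis
 obtain Z Y' \<psi> where G: "g = (Z, Y', \<psi>)" "simplicial_map C Z Y' \<psi>" "inf_groupoid C S Z"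
  using Gpd_ArrE[OF A(2) C.is_cat] by metis
 obtain Q X' p' where P: "p = (Q, X', p')" "simplicial_map C Q X' p'"
  using Gpd_ArrE[OF A(3) C.is_cat] by metis
 obtain Q' Z' q' where Q: "q = (Q', Z', q')" "simplicial_map C Q' Z' q'"
  using Gpd_ArrE[OF A(4) C.is_cat] by metis
 have eqs: "Y' = Y" "X' = X" "Z' = Z" "Q' = Q"
  using pb0 unfolding F(1) G(1) P(1) Q(1) by (simp_all add: is_pullback_def Gpd_def)
 note F(2)[unfolded eqs] and g = G(2)[unfolded eqs] and p = P(2)[unfolded eqs] and q = Q(2)[unfolded eqs]
 interpret g: simplicial_map C Z Y \<psi> by (rule g)
 have phiS: "\<phi> n \<in> S" for n using covering_fibration_level[OF F(2,4)] f F(1) by blast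
 have kan: "rel_matching_cover C S (horn n k) n (X, Y, \<phi>)" if "1 \<le> n" "k \<le> n" for n k
  using f that unfolding F(1) covering_fibration_def kan_fibration_def by blast
 have ex: "\<exists>p q. is_pullback C (\<phi> n) (\<psi> n) p q" for n
  using C.S_pullback[OF phiS] HomD[OF simplicial_map.phi_Hom[OF F(2), of n]] HomD[OF g.phi_Hom[of n]] by metis
 obtain P1 p1 q1 where P1: "simplicial_map C P1 X p1" "simplicial_map C P1 Z q1"
  "\<And>n. is_pullback C (\<phi> n) (\<psi> n) (p1 n) (q1 n)"
  using C.ex_levelwise_pullback[OF F(2) g ex] by metis
 have P1g: "inf_groupoid C S P1"
  using inf_groupoid_source[OF P1(2) G(3)] kan_base_change[OF F(2) g P1(1,2,3) F(4) G(3) kan] by blast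
 have lv: "is_pullback C (\<phi> n) (\<psi> n) (p' n) (q' n)" for n
  by (rule C.levelwise_pullback[OF F(2) g P1 p q, where Q = "inf_groupoid C S"])
   (use pb0 F G P Q eqs P1g A in \<open>simp_all add: Gpd_def\<close>)
 have img: "simplicial_map D (OMap (sFun F) A) (OMap (sFun F) B) (\<lambda>n. AMap F (\<alpha> n))"
  if "simplicial_map C A B \<alpha>" for A B \<alpha>
  using geometric_mapI[OF that] geometric_map.axioms unfolding simplicial_map_def simplicial_map_axioms_def
  using sFun_sobj sFun_smap that[unfolded simplicial_map_def simplicial_map_axioms_def] D.category_axioms by blast
 have "is_pullback (sCat D) (AMap (sFun F) f) (AMap (sFun F) g) (AMap (sFun F) p) (AMap (sFun F) q)"
  unfolding F(1) G(1) P(1) Q(1) eqs sFun_simps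
  by (rule D.pullback_sCatI[OF img[OF F(2)] img[OF g] img[OF p] img[OF q] F_pullback[OF phiS lv]])
 moreover have "AMap (sFun F) h \<in> Arr (Gpd D S')" if "h \<in> Arr (Gpd C S)" for h
  using is_functor_Gpd[OF t] that unfolding is_functor_def Hom_def by blast
 ultimately show ?thesis using A unfolding Gpd_def by (intro full_subcategory_pullback) auto
qed

end

section \<open>Group objects and their transport along functors that preserve products\<close>

section \<open>Binary products and group objects\<close>

text \<open>Allows two different factors, as needed for triple products and for the coordinates of
  \<open>Wbar\<close>; the indexed form in the definition of group objects is recovered by
  \<open>is_product_bool_iff\<close>.\<close>

definition bin_product :: "('o, 'm) cat => 'o => 'o => 'o => 'm => 'm => bool" where
 "bin_product C A B P p q \<longleftrightarrow> p \<in> Hom C P A \<and> q \<in> Hom C P B \<and>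
   (\<forall>T. \<forall>a\<in>Hom C T A. \<forall>b\<in>Hom C T B. \<exists>!u. u \<in> Hom C T P \<and> p \<cdot>\<^bsub>C\<^esub> u = a \<and> q \<cdot>\<^bsub>C\<^esub> u = b)"

lemma bin_product_Hom: "bin_product C A B P p q ==> p \<in> Hom C P A" "bin_product C A B P p q ==> q \<in> Hom C P B"
 by (simp_all add: bin_product_def)

lemma bin_product_ex1:
 "bin_product C A B P p q ==> a \<in> Hom C T A ==> b \<in> Hom C T B ==>
  \<exists>!u. u \<in> Hom C T P \<and> p \<cdot>\<^bsub>C\<^esub> u = a \<and> q \<cdot>\<^bsub>C\<^esub> u = b"
 by (simp add: bin_product_def)

context category
begin

lemma bin_product_unique:
 assumes P: "bin_product C A B P p q" and u: "u \<in> T -> P" "v \<in> T -> P"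
  and e: "p \<cdot> u = p \<cdot> v" "q \<cdot> u = q \<cdot> v"
 shows "u = v"
proof -
 have "\<exists>!w. w \<in> T -> P \<and> p \<cdot> w = p \<cdot> v \<and> q \<cdot> w = q \<cdot> v"
  using bin_product_ex1[OF P comp_Hom[OF bin_product_Hom(1)[OF P] u(2)] comp_Hom[OF bin_product_Hom(2)[OF P] u(2)]] .
 then show ?thesis using u e by metis
qed

lemma bin_productI:
 assumes "p \<in> P -> A" "q \<in> P -> B"
  and ex: "\<And>T a b. a \<in> T -> A ==> b \<in> T -> B ==> \<exists>u\<in>Hom C T P. p \<cdot> u = a \<and> q \<cdot> u = b"
  and un: "\<And>T u v. u \<in> T -> P ==> v \<in> T -> P ==> p \<cdot> u = p \<cdot> v ==> q \<cdot> u = q \<cdot> v ==> u = v"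
 shows "bin_product C A B P p q"
 unfolding bin_product_def
proof (intro conjI allI ballI assms(1,2))
 fix T a b assume "a \<in> T -> A" "b \<in> T -> B"
 from ex[OF this] obtain u where u: "u \<in> T -> P" "p \<cdot> u = a" "q \<cdot> u = b" by (elim bexE conjE)
 show "\<exists>!u. u \<in> T -> P \<and> p \<cdot> u = a \<and> q \<cdot> u = b"
 proof (rule ex1I[of _ u])
  fix v assume v: "v \<in> T -> P \<and> p \<cdot> v = a \<and> q \<cdot> v = b"
  show "v = u" by (rule un[OF conjunct1[OF v] u(1)]) (use u v in simp_all)
 qed (use u in simp)
qed

lemma is_product_bool_iff:
 "is_product C UNIV (\<lambda>_::bool. A) P (\<lambda>b. if b then p else q) \<longleftrightarrow> bin_product C A A P p q"
proof
 assume i: "is_product C UNIV (\<lambda>_::bool. A) P (\<lambda>b. if b then p else q)"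
 note pr = i[unfolded is_product_def, THEN conjunct2]
 have pq: "p \<in> P -> A" "q \<in> P -> A"
  using bspec[OF conjunct1[OF pr], of True] bspec[OF conjunct1[OF pr], of False] by simp_all
 have "\<exists>!u. u \<in> T -> P \<and> p \<cdot> u = a \<and> q \<cdot> u = b" if "a \<in> T -> A" "b \<in> T -> A" for T a b
 proof -
  have "\<forall>i\<in>UNIV. (if i then a else b) \<in> T -> A" "T \<in> Obj C" using that Hom_Obj by auto
  then have "\<exists>!u. u \<in> T -> P \<and> (\<forall>i\<in>UNIV. (if i then p else q) \<cdot> u = (if i then a else b))"
   using conjunct2[OF pr, rule_format, of T "\<lambda>i. if i then a else b"] by blast
  moreover have "(\<forall>i\<in>UNIV. (if i then p else q) \<cdot> u = (if i then a else b)) \<longleftrightarrow> p \<cdot> u = a \<and> q \<cdot> u = b" for u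
   by (simp add: all_bool_eq)
  ultimately show ?thesis by simp
 qed
 then show "bin_product C A A P p q" using pq by (simp add: bin_product_def)
next
 assume b: "bin_product C A A P p q"
 note h = bin_product_Hom[OF b]
 show "is_product C UNIV (\<lambda>_::bool. A) P (\<lambda>b. if b then p else q)"
  unfolding is_product_def
 proof (intro conjI ballI allI impI)
  show "P \<in> Obj C" using Hom_Obj h by blast
  show "(if i then p else q) \<in> P -> A" for i using h by simp
  fix T and a :: "bool => 'm" assume "\<forall>i\<in>UNIV. a i \<in> T -> A"
  then have "\<exists>!u. u \<in> T -> P \<and> p \<cdot> u = a True \<and> q \<cdot> u = a False"
   by (intro bin_product_ex1[OF b]) simp_all
  moreover have "(\<forall>i\<in>UNIV. (if i then p else q) \<cdot> u = a i) \<longleftrightarrow> p \<cdot> u = a True \<and> q \<cdot> u = a False" for u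
   by (simp add: all_bool_eq)
  ultimately show "\<exists>!u. u \<in> T -> P \<and> (\<forall>i\<in>UNIV. (if i then p else q) \<cdot> u = a i)" by simp
 qed
qed

text \<open>Arrows to the terminal object are covers in C, so this turns products into pullbacks of
  covers, which exist in C and are preserved by F.\<close>

lemma bin_product_iff_pullback:
 assumes t: "is_terminal C t" and a: "a \<in> A -> t" and b: "b \<in> B -> t"
 shows "bin_product C A B P p q \<longleftrightarrow> is_pullback C a b p q \<and> Dom C p = P"
proof
 note tu = terminal_Hom_unique[OF t category_axioms]
 assume P: "bin_product C A B P p q"
 note h = bin_product_Hom[OF P]
 have "is_pullback C a b p q"
 proof (rule pullbackI[OF a b h])
  show "a \<cdot> p = b \<cdot> q" using tu[OF comp_Hom[OF a h(1)] comp_Hom[OF b h(2)]] .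
  show "\<exists>u\<in>Hom C T P. p \<cdot> u = x \<and> q \<cdot> u = y" if "x \<in> T -> A" "y \<in> T -> B" for T x y
   using ex1_implies_ex[OF bin_product_ex1[OF P that]] by blast
  show "u = v" if "u \<in> T -> P" "v \<in> T -> P" "p \<cdot> u = p \<cdot> v" "q \<cdot> u = q \<cdot> v" for T u v
   using bin_product_unique[OF P that] .
 qed
 then show "is_pullback C a b p q \<and> Dom C p = P" using HomD(2)[OF h(1)] by simp
next
 note tu = terminal_Hom_unique[OF t category_axioms]
 assume pb: "is_pullback C a b p q \<and> Dom C p = P"
 have c: "Cod C p = A" "Cod C q = B"
  using pb HomD(2)[OF a] HomD(2)[OF b] by (auto simp: is_pullback_def)
 show "bin_product C A B P p q"
  unfolding bin_product_def
 proof (intro conjI allI ballI)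
  show "p \<in> P -> A" "q \<in> P -> B" using pullback_Hom[of a b p q] pb c by auto
  fix T x y assume xy: "x \<in> T -> A" "y \<in> T -> B"
  have "a \<cdot> x = b \<cdot> y" using tu[OF comp_Hom[OF a xy(1)] comp_Hom[OF b xy(2)]] .
  then obtain u where u: "u \<in> T -> P" "p \<cdot> u = x" "q \<cdot> u = y"
   using pullback_lift[of a b p q x T y] pb xy c by metis
  show "\<exists>!u. u \<in> T -> P \<and> p \<cdot> u = x \<and> q \<cdot> u = y"
  proof (rule ex1I[of _ u])
   fix v assume "v \<in> T -> P \<and> p \<cdot> v = x \<and> q \<cdot> v = y"
   then show "v = u" using u pullback_unique[of a b p q v T u] pb by metis
  qed (use u in blast)
 qed
qed

end

text \<open>The structure maps without the group laws. The calculus of products and units of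
  generalized elements needs no more, and the image of a group is first seen to be a pregroup before
  the laws are transported.\<close>

locale pregroup = category C for C :: "('o, 'm) cat" (structure) +
 fixes G :: "('o, 'm) grp"
 assumes square: "bin_product C (Gob G) (Gob G) (Gsq G) (Gfst G) (Gsnd G)"
  and point: "is_terminal C (Gpt G)"
  and mult_Hom: "Gmult G \<in> (Gsq G) -> (Gob G)"
  and unit_Hom: "Gunit G \<in> (Gpt G) -> (Gob G)"
  and inv_Hom: "Ginv G \<in> (Gob G) -> (Gob G)"
begin

lemma gpair:
 assumes "a \<in> T -> (Gob G)" "b \<in> T -> (Gob G)"
 shows "gpair C G a b \<in> T -> (Gsq G)" "Gfst G \<cdot> gpair C G a b = a" "Gsnd G \<cdot> gpair C G a b = b"
proof -
 have "Dom C a = T" using HomD(2)[OF assms(1)] .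
 then have "gpair C G a b \<in> T -> (Gsq G) \<and> Gfst G \<cdot> gpair C G a b = a \<and> Gsnd G \<cdot> gpair C G a b = b"
  using theI'[OF bin_product_ex1[OF square assms]] by (simp add: gpair_def)
 then show "gpair C G a b \<in> T -> (Gsq G)" "Gfst G \<cdot> gpair C G a b = a" "Gsnd G \<cdot> gpair C G a b = b"
  by auto
qed

lemma gpair_eqI:
 assumes "a \<in> T -> (Gob G)" "b \<in> T -> (Gob G)"
  "u \<in> T -> (Gsq G)" "Gfst G \<cdot> u = a" "Gsnd G \<cdot> u = b"
 shows "gpair C G a b = u"
 using bin_product_unique[OF square gpair(1)[OF assms(1,2)] assms(3)] gpair(2,3)[OF assms(1,2)] assms(4,5) by simp

lemma gmul_Hom: "a \<in> T -> (Gob G) ==> b \<in> T -> (Gob G) ==> gmul C G a b \<in> T -> (Gob G)"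
 unfolding gmul_def using gpair(1) mult_Hom by blast

lemma gmul_comp:
 assumes a: "a \<in> T -> (Gob G)" and b: "b \<in> T -> (Gob G)" and u: "u \<in> T' -> T"
 shows "gmul C G a b \<cdot> u = gmul C G (a \<cdot> u) (b \<cdot> u)"
proof -
 note h = bin_product_Hom[OF square] and g = gpair[OF a b]
 have "gpair C G (a \<cdot> u) (b \<cdot> u) = gpair C G a b \<cdot> u"
  using assoc[OF h(1) g(1) u] assoc[OF h(2) g(1) u] g(2,3)
  by (intro gpair_eqI[OF comp_Hom[OF a u] comp_Hom[OF b u] comp_Hom[OF g(1) u]]) simp_all
 then show ?thesis unfolding gmul_def using assoc[OF mult_Hom g(1) u] by simp
qed

lemma gone_eq: "u \<in> T -> (Gpt G) ==> gone C G T = Gunit G \<cdot> u"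
 unfolding gone_def using terminal_Hom_unique[OF point category_axioms] by (metis the_equality)

lemma gone_Hom: "T \<in> Obj C ==> gone C G T \<in> T -> (Gob G)"
 using terminal_Hom_ex[OF point, of T] gone_eq unit_Hom comp_Hom by metis

lemma gone_comp:
 assumes u: "u \<in> T' -> T"
 shows "gone C G T \<cdot> u = gone C G T'"
proof -
 obtain v where v: "v \<in> T -> (Gpt G)" using terminal_Hom_ex[OF point Hom_Obj(2)[OF u]] .
 show ?thesis using gone_eq[OF v] gone_eq[OF comp_Hom[OF v u]] assoc[OF unit_Hom v u] by simp
qed

lemma gmul_projs: "gmul C G (Gfst G) (Gsnd G) = Gmult G"
proof -
 note h = bin_product_Hom[OF square]
 have "gpair C G (Gfst G) (Gsnd G) = Idm C (Gsq G)"
  using h by (intro gpair_eqI[OF h Idm_Hom]) (auto intro: Hom_Obj)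
 then show ?thesis using mult_Hom by (simp add: gmul_def)
qed

text \<open>Every pair of generalized elements is pulled back from the two projections, at which the
  homomorphism condition is assumed.\<close>

lemma hom_gmul:
 assumes f: "f \<in> (Gob G) -> Y" "f \<cdot> Gmult G = gmul C H (f \<cdot> Gfst G) (f \<cdot> Gsnd G)"
  and H: "pregroup C H" "Gob H = Y"
  and ab: "a \<in> T -> (Gob G)" "b \<in> T -> (Gob G)"
 shows "f \<cdot> gmul C G a b = gmul C H (f \<cdot> a) (f \<cdot> b)"
proof -
 interpret H: pregroup C H by (rule H(1))
 note g = gpair[OF ab] and h = bin_product_Hom[OF square]
 have f1: "f \<in> (Gob G) -> (Gob H)" using f(1) H(2) by simp
 have "f \<cdot> gmul C G a b = gmul C H (f \<cdot> Gfst G) (f \<cdot> Gsnd G) \<cdot> gpair C G a b"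
  unfolding gmul_def[of C G] using assoc[OF f1 mult_Hom g(1)] f(2) by simp
 then show ?thesis
  using H.gmul_comp[OF comp_Hom[OF f1 h(1)] comp_Hom[OF f1 h(2)] g(1)]
   assoc[OF f1 h(1) g(1)] assoc[OF f1 h(2) g(1)] g(2,3) by simp
qed

end

locale group_object = pregroup +
 assumes gmul_assoc: "\<And>T a b c. a \<in> T -> (Gob G) ==> b \<in> T -> (Gob G) ==> c \<in> T -> (Gob G) ==>
   gmul C G (gmul C G a b) c = gmul C G a (gmul C G b c)"
  and one_gmul: "\<And>T a. a \<in> T -> (Gob G) ==> gmul C G (gone C G T) a = a"
  and gmul_one: "\<And>T a. a \<in> T -> (Gob G) ==> gmul C G a (gone C G T) = a"
  and inv_gmul: "\<And>T a. a \<in> T -> (Gob G) ==> gmul C G (Ginv G \<cdot> a) a = gone C G T"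
  and gmul_inv: "\<And>T a. a \<in> T -> (Gob G) ==> gmul C G a (Ginv G \<cdot> a) = gone C G T"

lemma (in category) is_group_object_iff: "is_group_object C G \<longleftrightarrow> group_object C G"
proof
 assume g: "is_group_object C G"
 have "pregroup C G"
  using g category_axioms
  unfolding is_group_object_def is_product_bool_iff pregroup_def pregroup_axioms_def by blast
 then show "group_object C G"
  using g Hom_Obj(1) unfolding is_group_object_def group_object_def group_object_axioms_def by blast
next
 assume "group_object C G"
 then interpret group_object C G .
 show "is_group_object C G"
  unfolding is_group_object_def is_product_bool_iff
  by (intro conjI ballI; (rule Hom_Obj(2)[OF mult_Hom] square point mult_Hom unit_Hom inv_Hom gmul_assoc
    one_gmul gmul_one inv_gmul gmul_inv; assumption))
qed

lemma Grp_simps [simp]: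
 "G \<in> Obj (Grp C) \<longleftrightarrow> is_group_object C G"
 "(G, H, f) \<in> Arr (Grp C) \<longleftrightarrow> is_group_object C G \<and> is_group_object C H \<and> f \<in> Hom C (Gob G) (Gob H) \<and>
   f \<cdot>\<^bsub>C\<^esub> Gmult G = gmul C H (f \<cdot>\<^bsub>C\<^esub> Gfst G) (f \<cdot>\<^bsub>C\<^esub> Gsnd G)"
 "Dom (Grp C) h = fst h" "Cod (Grp C) h = fst (snd h)"
 "Idm (Grp C) G = (G, G, Idm C (Gob G))"
 "k \<cdot>\<^bsub>Grp C\<^esub> h = (fst h, fst (snd k), snd (snd k) \<cdot>\<^bsub>C\<^esub> snd (snd h))"
 by (simp_all add: Grp_def)

lemma grpFun_simps [simp]:
 "Gob (OMap (grpFun F) G) = OMap F (Gob G)" "Gsq (OMap (grpFun F) G) = OMap F (Gsq G)"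
 "Gfst (OMap (grpFun F) G) = AMap F (Gfst G)" "Gsnd (OMap (grpFun F) G) = AMap F (Gsnd G)"
 "Gpt (OMap (grpFun F) G) = OMap F (Gpt G)" "Gmult (OMap (grpFun F) G) = AMap F (Gmult G)"
 "Gunit (OMap (grpFun F) G) = AMap F (Gunit G)" "Ginv (OMap (grpFun F) G) = AMap F (Ginv G)"
 "AMap (grpFun F) (G, H, f) = (OMap (grpFun F) G, OMap (grpFun F) H, AMap F f)"
 by (simp_all add: grpFun_def Let_def)

lemma (in category) Grp_ArrD:
 assumes "(G, H, f) \<in> Arr (Grp C)"
 shows "group_object C G" "group_object C H" "f \<in> (Gob G) -> (Gob H)"
  "f \<cdot> Gmult G = gmul C H (f \<cdot> Gfst G) (f \<cdot> Gsnd G)"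
  "\<And>T a b. a \<in> T -> (Gob G) ==> b \<in> T -> (Gob G) ==> f \<cdot> gmul C G a b = gmul C H (f \<cdot> a) (f \<cdot> b)"
proof -
 show *: "group_object C G" "group_object C H" "f \<in> (Gob G) -> (Gob H)"
  "f \<cdot> Gmult G = gmul C H (f \<cdot> Gfst G) (f \<cdot> Gsnd G)"
  using assms by (simp_all add: is_group_object_iff)
 show "f \<cdot> gmul C G a b = gmul C H (f \<cdot> a) (f \<cdot> b)"
  if "a \<in> T -> (Gob G)" "b \<in> T -> (Gob G)" for T a b
  using pregroup.hom_gmul[OF group_object.axioms(1)[OF *(1)] *(3,4) group_object.axioms(1)[OF *(2)] refl that] .
qed

lemma (in category) is_category_Grp: "is_category (Grp C)"
 unfolding is_category_def
proof (intro conjI ballI impI)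
 fix h assume h: "h \<in> Arr (Grp C)"
 obtain G H f where e: "h = (G, H, f)" by (cases h)
 note f = Grp_ArrD[OF h[unfolded e]]
 interpret G: group_object C G by (rule f(1))
 show "Dom (Grp C) h \<in> Obj (Grp C)" "Cod (Grp C) h \<in> Obj (Grp C)" using f by (simp_all add: e is_group_object_iff)
 show "h \<cdot>\<^bsub>Grp C\<^esub> Idm (Grp C) (Dom (Grp C) h) = h" "Idm (Grp C) (Cod (Grp C) h) \<cdot>\<^bsub>Grp C\<^esub> h = h"
  using f(3) by (simp_all add: e)
 fix k assume k: "k \<in> Arr (Grp C)" "Cod (Grp C) h = Dom (Grp C) k"
 obtain K g where e': "k = (H, K, g)" using k(2) e by (cases k) auto
 note g = Grp_ArrD[OF k(1)[unfolded e']]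
 note sq = bin_product_Hom[OF G.square]
 have "(g \<cdot> f) \<cdot> Gmult G = gmul C K ((g \<cdot> f) \<cdot> Gfst G) ((g \<cdot> f) \<cdot> Gsnd G)"
  using assoc[OF g(3) f(3) G.mult_Hom] f(4) g(5)[OF comp_Hom[OF f(3) sq(1)] comp_Hom[OF f(3) sq(2)]]
   assoc[OF g(3) f(3) sq(1)] assoc[OF g(3) f(3) sq(2)] by simp
 then show "k \<cdot>\<^bsub>Grp C\<^esub> h \<in> Hom (Grp C) (Dom (Grp C) h) (Cod (Grp C) k)"
  using f(1) g(2) comp_Hom[OF g(3) f(3)] by (simp add: e e' Hom_def[of "Grp C"] is_group_object_iff)
 fix l assume l: "l \<in> Arr (Grp C)" "Cod (Grp C) k = Dom (Grp C) l"
 obtain L m where e'': "l = (K, L, m)" using l(2) e' by (cases l) auto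
 show "l \<cdot>\<^bsub>Grp C\<^esub> (k \<cdot>\<^bsub>Grp C\<^esub> h) = (l \<cdot>\<^bsub>Grp C\<^esub> k) \<cdot>\<^bsub>Grp C\<^esub> h"
  using assoc[OF Grp_ArrD(3)[OF l(1)[unfolded e'']] g(3) f(3)] by (simp add: e e' e'')
next
 fix G assume "G \<in> Obj (Grp C)"
 then interpret group_object C G by (simp add: is_group_object_iff)
 have "group_object C G" by unfold_locales
 then show "Idm (Grp C) G \<in> Hom (Grp C) G G"
  using Idm_Hom[OF Hom_Obj(2)[OF mult_Hom]] mult_Hom bin_product_Hom[OF square] gmul_projs
  by (simp add: Hom_def[of "Grp C"] is_group_object_iff)
qed

text \<open>Instantiated by F, by the induced functor on simplicial objects, and by evaluation at a
  level.\<close>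

locale product_functor = functor_between C D F
 for C :: "('o, 'm) cat" (structure) and D :: "('p, 'n) cat" and F +
 assumes ex_product: "\<And>X Y. X \<in> Obj C ==> Y \<in> Obj C ==> \<exists>P p q. bin_product C X Y P p q"
  and F_product: "\<And>X Y P p q. bin_product C X Y P p q ==>
   bin_product D (OMap F X) (OMap F Y) (OMap F P) (AMap F p) (AMap F q)"
  and F_terminal: "\<And>t. is_terminal C t ==> is_terminal D (OMap F t)"
begin

lemma pregroup_image:
 assumes "pregroup C G"
 shows "pregroup D (OMap (grpFun F) G)"
proof -
 interpret pregroup C G by fact
 show ?thesis
  using F_product[OF square] F_terminal[OF point] F_Hom[OF mult_Hom] F_Hom[OF unit_Hom] F_Hom[OF inv_Hom]
  by unfold_locales simp_all
qed

lemma F_gmul: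
 assumes "pregroup C G" and ab: "a \<in> T -> (Gob G)" "b \<in> T -> (Gob G)"
 shows "AMap F (gmul C G a b) = gmul D (OMap (grpFun F) G) (AMap F a) (AMap F b)"
proof -
 interpret pregroup C G by fact
 interpret D: pregroup D "OMap (grpFun F) G" using pregroup_image assms(1) .
 note g = gpair[OF ab] and h = bin_product_Hom[OF square]
 have "gpair D (OMap (grpFun F) G) (AMap F a) (AMap F b) = AMap F (gpair C G a b)"
  using F_Hom[OF ab(1)] F_Hom[OF ab(2)] F_Hom[OF g(1)] F_comp[OF h(1) g(1)] F_comp[OF h(2) g(1)] g(2,3)
  by (intro D.gpair_eqI[of _ "OMap F T"]) simp_all
 then show ?thesis using F_comp[OF mult_Hom g(1)] by (simp add: gmul_def)
qed

lemma F_gone: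
 assumes "pregroup C G" "T \<in> Obj C"
 shows "AMap F (gone C G T) = gone D (OMap (grpFun F) G) (OMap F T)"
proof -
 interpret pregroup C G by fact
 interpret D: pregroup D "OMap (grpFun F) G" using pregroup_image assms(1) .
 obtain u where u: "u \<in> T -> (Gpt G)" using terminal_Hom_ex[OF point assms(2)] .
 show ?thesis using gone_eq[OF u] D.gone_eq[of "AMap F u" "OMap F T"] F_Hom[OF u] F_comp[OF unit_Hom u] by simp
qed

text \<open>Every identity between generalized elements of the image is a specialization of the image of
 the universal one, because \<open>G \<times> G \<times> G\<close> exists and is preserved.\<close>

lemma group_image:
 assumes "group_object C G"
 shows "group_object D (OMap (grpFun F) G)"
proof -
 interpret group_object C G by fact
 let ?G = "OMap (grpFun F) G"
 have pg: "pregroup C G" by unfold_locales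
 interpret D: pregroup D ?G using pregroup_image pg .
 have o: "Gob G \<in> Obj C" "Gsq G \<in> Obj C" using C.Hom_Obj(1,2)[OF mult_Hom] by simp_all
 note h = bin_product_Hom[OF square]
 show ?thesis
 proof
  fix T a b c assume abc: "a \<in> Hom D T (Gob ?G)" "b \<in> Hom D T (Gob ?G)" "c \<in> Hom D T (Gob ?G)"
  \<comment> \<open>\<open>P\<close> is the triple product. The three given elements are pulled back
    along \<open>w\<close> from the images of its projections.\<close>
  obtain P p q where P: "bin_product C (Gsq G) (Gob G) P p q" using ex_product[OF o(2,1)] by blast
  note pq = bin_product_Hom[OF P]
  have ab: "gpair D ?G a b \<in> Hom D T (OMap F (Gsq G))" using D.gpair(1)[OF abc(1,2)] by simp
  obtain w where w: "w \<in> Hom D T (OMap F P)" "AMap F p \<cdot>\<^bsub>D\<^esub> w = gpair D ?G a b" "AMap F q \<cdot>\<^bsub>D\<^esub> w = c"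
   using ex1_implies_ex[OF bin_product_ex1[OF F_product[OF P] ab abc(3)[unfolded grpFun_simps]]] by blast
  let ?a = "Gfst G \<cdot> p" and ?b = "Gsnd G \<cdot> p"
  have u: "?a \<in> P -> (Gob G)" "?b \<in> P -> (Gob G)" using h pq by blast+
  note Fu = F_Hom[OF u(1)] F_Hom[OF u(2)] F_Hom[OF pq(2)]
  have w': "AMap F ?a \<cdot>\<^bsub>D\<^esub> w = a" "AMap F ?b \<cdot>\<^bsub>D\<^esub> w = b"
   using F_comp[OF h(1) pq(1)] F_comp[OF h(2) pq(1)] D.assoc[OF F_Hom[OF h(1)] F_Hom[OF pq(1)] w(1)]
    D.assoc[OF F_Hom[OF h(2)] F_Hom[OF pq(1)] w(1)] w(2) D.gpair(2,3)[OF abc(1,2)] by simp_all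
  have "gmul D ?G (gmul D ?G (AMap F ?a) (AMap F ?b)) (AMap F q) = gmul D ?G (AMap F ?a) (gmul D ?G (AMap F ?b) (AMap F q))"
   using gmul_assoc[OF u pq(2)] F_gmul[OF pg u] F_gmul[OF pg u(2) pq(2)] F_gmul[OF pg gmul_Hom[OF u] pq(2)]
    F_gmul[OF pg u(1) gmul_Hom[OF u(2) pq(2)]] by simp
  then have "gmul D ?G (gmul D ?G (AMap F ?a) (AMap F ?b)) (AMap F q) \<cdot>\<^bsub>D\<^esub> w = gmul D ?G (AMap F ?a) (gmul D ?G (AMap F ?b) (AMap F q)) \<cdot>\<^bsub>D\<^esub> w"
   by simp
  moreover note Fu' = Fu[folded grpFun_simps(1)]
  ultimately show "gmul D ?G (gmul D ?G a b) c = gmul D ?G a (gmul D ?G b c)"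
   using D.gmul_comp[OF D.gmul_Hom[OF Fu'(1,2)] Fu'(3) w(1)] D.gmul_comp[OF Fu'(1) D.gmul_Hom[OF Fu'(2,3)] w(1)]
    D.gmul_comp[OF Fu'(1,2) w(1)] D.gmul_comp[OF Fu'(2,3) w(1)] w' w(3) by simp
 next
  fix T a assume a: "a \<in> Hom D T (Gob ?G)"
  \<comment> \<open>For laws in a single variable the identity is the universal element.\<close>
  let ?i = "Idm C (Gob G)"
  have i: "?i \<in> (Gob G) -> (Gob G)" using o by blast
  have Fi: "AMap F ?i = Idm D (Gob ?G)" using F_Idm[OF o(1)] by simp
  have Do: "Gob ?G \<in> Obj D" using D.Hom_Obj a by blast
  have ia: "Idm D (Gob ?G) \<cdot>\<^bsub>D\<^esub> a = a" using a by (rule D.Idm_comp)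
  have oH: "gone D ?G (Gob ?G) \<in> Hom D (Gob ?G) (Gob ?G)" using D.gone_Hom[OF Do] .
  have iH: "Idm D (Gob ?G) \<in> Hom D (Gob ?G) (Gob ?G)" using D.Idm_Hom[OF Do] .
  have vH: "Ginv ?G \<in> Hom D (Gob ?G) (Gob ?G)" using D.inv_Hom .
  have Fo: "AMap F (gone C G (Gob G)) = gone D ?G (Gob ?G)" using F_gone[OF pg o(1)] by simp
  have oh: "gone C G (Gob G) \<in> (Gob G) -> (Gob G)" using gone_Hom[OF o(1)] .
  have vi: "Ginv G \<cdot> ?i = Ginv G" using inv_Hom by simp
  have 1: "gmul D ?G (gone D ?G (Gob ?G)) (Idm D (Gob ?G)) = Idm D (Gob ?G)"
   "gmul D ?G (Idm D (Gob ?G)) (gone D ?G (Gob ?G)) = Idm D (Gob ?G)"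
   "gmul D ?G (Ginv ?G) (Idm D (Gob ?G)) = gone D ?G (Gob ?G)"
   "gmul D ?G (Idm D (Gob ?G)) (Ginv ?G) = gone D ?G (Gob ?G)"
   using one_gmul[OF i] gmul_one[OF i] inv_gmul[OF i] gmul_inv[OF i] vi Fo Fi
    F_gmul[OF pg oh i] F_gmul[OF pg i oh] F_gmul[OF pg inv_Hom i] F_gmul[OF pg i inv_Hom] by simp_all
  show "gmul D ?G (gone D ?G T) a = a"
   using 1(1) D.gmul_comp[OF oH iH a] D.gone_comp[OF a] ia by simp
  show "gmul D ?G a (gone D ?G T) = a"
   using 1(2) D.gmul_comp[OF iH oH a] D.gone_comp[OF a] ia by simp
  show "gmul D ?G (Ginv ?G \<cdot>\<^bsub>D\<^esub> a) a = gone D ?G T"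
   using 1(3) D.gmul_comp[OF vH iH a] D.gone_comp[OF a] ia by simp
  show "gmul D ?G a (Ginv ?G \<cdot>\<^bsub>D\<^esub> a) = gone D ?G T"
   using 1(4) D.gmul_comp[OF iH vH a] D.gone_comp[OF a] ia by simp
 qed
qed

lemma is_functor_grpFun: "is_functor (Grp C) (Grp D) (grpFun F)"
 unfolding is_functor_def
proof (intro conjI ballI impI C.is_category_Grp D.is_category_Grp)
 fix G assume "G \<in> Obj (Grp C)"
 then have G: "group_object C G" by (simp add: C.is_group_object_iff)
 then show "OMap (grpFun F) G \<in> Obj (Grp D)" using group_image by (simp add: D.is_group_object_iff)
 have "Gob G \<in> Obj C" using C.Hom_Obj(2) pregroup.mult_Hom[OF group_object.axioms(1)[OF G]] .
 then show "AMap (grpFun F) (Idm (Grp C) G) = Idm (Grp D) (OMap (grpFun F) G)" using F_Idm by simp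
next
 fix h assume h: "h \<in> Arr (Grp C)"
 obtain G H f where e: "h = (G, H, f)" by (cases h)
 note f = C.Grp_ArrD[OF h[unfolded e]]
 interpret G: group_object C G by (rule f(1))
 note sq = bin_product_Hom[OF G.square]
 have pH: "pregroup C H" using f(2) by (rule group_object.axioms)
 have "AMap F f \<cdot>\<^bsub>D\<^esub> AMap F (Gmult G) = gmul D (OMap (grpFun F) H) (AMap F f \<cdot>\<^bsub>D\<^esub> AMap F (Gfst G)) (AMap F f \<cdot>\<^bsub>D\<^esub> AMap F (Gsnd G))"
  using F_comp[OF f(3) G.mult_Hom] F_comp[OF f(3) sq(1)] F_comp[OF f(3) sq(2)] f(4)
   F_gmul[OF pH C.comp_Hom[OF f(3) sq(1)] C.comp_Hom[OF f(3) sq(2)]] by simp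
 then show "AMap (grpFun F) h \<in> Hom (Grp D) (OMap (grpFun F) (Dom (Grp C) h)) (OMap (grpFun F) (Cod (Grp C) h))"
  using F_Hom[OF f(3)] group_image f(1,2) by (simp add: e Hom_def[of "Grp D"] D.is_group_object_iff)
 fix k assume k: "k \<in> Arr (Grp C)" "Cod (Grp C) h = Dom (Grp C) k"
 obtain K g where e': "k = (H, K, g)" using k(2) e by (cases k) auto
 show "AMap (grpFun F) (k \<cdot>\<^bsub>Grp C\<^esub> h) = AMap (grpFun F) k \<cdot>\<^bsub>Grp D\<^esub> AMap (grpFun F) h"
  using F_comp[OF C.Grp_ArrD(3)[OF k(1)[unfolded e']] f(3)] by (simp add: e e')
qed

end

context cover_category
begin

lemma ex_bin_product:
 assumes "X \<in> Obj C" "Y \<in> Obj C"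
 shows "\<exists>P p q. bin_product C X Y P p q"
proof -
 obtain t where t: "is_terminal C t" using terminal_cover by blast
 obtain a where a: "a \<in> X -> t" using terminal_Hom_ex[OF t assms(1)] .
 obtain b where b: "b \<in> Y -> t" using terminal_Hom_ex[OF t assms(2)] .
 have "a \<in> S" using terminal_S[OF t a] .
 then obtain p q where "is_pullback C a b p q" using S_pullback[of a b] HomD[OF a] HomD[OF b] by metis
 then show ?thesis using bin_product_iff_pullback[OF t a b] by blast
qed

text \<open>A product in simplicial objects is the pullback over the terminal object, which is levelwise.\<close>

lemma bin_product_sCat_level:
 assumes "bin_product (sCat C) X Y P p q"
 shows "bin_product C (level X n) (level Y n) (level P n) (comps p n) (comps q n)"
proof -
 interpret s: category "sCat C" by (rule category_sCat)
 obtain t where t: "is_terminal C t" using terminal_cover by blast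
 let ?t = "const_sobj C t"
 note T = terminal_const_sobj[OF t]
 note pq = bin_product_Hom[OF assms]
 obtain p' where p: "p = (P, X, p')" "is_sobj C P" "is_sobj C X" "is_smap C P X p'" using sCat_HomE[OF pq(1)] by metis
 obtain q' where q: "q = (P, Y, q')" "is_sobj C Y" "is_smap C P Y q'" using sCat_HomE[OF pq(2)] by metis
 obtain a where a: "a \<in> Hom (sCat C) X ?t" using terminal_Hom_ex[OF T, of X] p(3) by auto
 obtain b where b: "b \<in> Hom (sCat C) Y ?t" using terminal_Hom_ex[OF T, of Y] q(2) by auto
 obtain \<alpha> where al: "a = (X, ?t, \<alpha>)" "is_sobj C ?t" "is_smap C X ?t \<alpha>" using sCat_HomE[OF a] by metis
 obtain \<beta> where be: "b = (Y, ?t, \<beta>)" "is_smap C Y ?t \<beta>" using sCat_HomE[OF b] by metis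
 have sm: "simplicial_map C X ?t \<alpha>" "simplicial_map C Y ?t \<beta>" "simplicial_map C P X p'" "simplicial_map C P Y q'"
  using p q al be by unfold_locales
 have ab: "\<alpha> n \<in> (level X n) -> t" "\<beta> n \<in> (level Y n) -> t" for n
  using smap_Hom[OF al(3), of n] smap_Hom[OF be(2), of n] by simp_all
 have "\<alpha> n \<in> S" for n using terminal_S[OF t ab(1)] .
 then have "\<exists>p q. is_pullback C (\<alpha> n) (\<beta> n) p q" for n
  using S_pullback[of "\<alpha> n" "\<beta> n"] HomD[OF ab(1)] HomD[OF ab(2)] by metis
 then obtain P1 p1 q1 where P1: "simplicial_map C P1 X p1" "simplicial_map C P1 Y q1" "\<And>n. is_pullback C (\<alpha> n) (\<beta> n) (p1 n) (q1 n)"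
  using ex_levelwise_pullback[OF sm(1,2)] by metis
 have "full_subcategory (sCat C) (\<lambda>_. True) = sCat C" by (simp add: full_subcategory_def sCat_def)
 moreover have "is_pullback (sCat C) (X, ?t, \<alpha>) (Y, ?t, \<beta>) (P, X, p') (P, Y, q')"
  using s.bin_product_iff_pullback[OF T a b] assms by (simp add: al(1) be(1) p(1) q(1))
 ultimately have "is_pullback C (\<alpha> n) (\<beta> n) (p' n) (q' n)"
  using levelwise_pullback[OF sm(1,2) P1 sm(3,4), where Q = "\<lambda>_. True"] by simp
 then show ?thesis
  using bin_product_iff_pullback[OF t ab] HomD(2)[OF smap_Hom[OF p(4), of n]] by (simp add: p(1) q(1))
qed

lemma ex_bin_product_sCat:
 assumes "X \<in> Obj (sCat C)" "Y \<in> Obj (sCat C)"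
 shows "\<exists>P p q. bin_product (sCat C) X Y P p q"
proof -
 interpret s: category "sCat C" by (rule category_sCat)
 obtain t where t: "is_terminal C t" using terminal_cover by blast
 let ?t = "const_sobj C t"
 note T = terminal_const_sobj[OF t]
 obtain a where a: "a \<in> Hom (sCat C) X ?t" using terminal_Hom_ex[OF T assms(1)] .
 obtain b where b: "b \<in> Hom (sCat C) Y ?t" using terminal_Hom_ex[OF T assms(2)] .
 obtain \<alpha> where al: "a = (X, ?t, \<alpha>)" "is_sobj C X" "is_sobj C ?t" "is_smap C X ?t \<alpha>" using sCat_HomE[OF a] by metis
 obtain \<beta> where be: "b = (Y, ?t, \<beta>)" "is_sobj C Y" "is_smap C Y ?t \<beta>" using sCat_HomE[OF b] by metis
 have sm: "simplicial_map C X ?t \<alpha>" "simplicial_map C Y ?t \<beta>" using al be by unfold_locales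
 have ab: "\<alpha> n \<in> (level X n) -> t" "\<beta> n \<in> (level Y n) -> t" for n
  using smap_Hom[OF al(4), of n] smap_Hom[OF be(3), of n] by simp_all
 have "\<alpha> n \<in> S" for n using terminal_S[OF t ab(1)] .
 then have "\<exists>p q. is_pullback C (\<alpha> n) (\<beta> n) p q" for n
  using S_pullback[of "\<alpha> n" "\<beta> n"] HomD[OF ab(1)] HomD[OF ab(2)] by metis
 then obtain P p q where P: "simplicial_map C P X p" "simplicial_map C P Y q" "\<And>n. is_pullback C (\<alpha> n) (\<beta> n) (p n) (q n)"
  using ex_levelwise_pullback[OF sm] by metis
 have "is_pullback (sCat C) a b (P, X, p) (P, Y, q)" unfolding al(1) be(1) by (rule pullback_sCatI[OF sm P])
 then show ?thesis using s.bin_product_iff_pullback[OF T a b] by blast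
qed

end

lemma (in category) bin_product_sCatI:
 assumes t: "is_terminal C t" and P: "simplicial_map C P X p" "simplicial_map C P Y q"
  and lv: "\<And>n. bin_product C (level X n) (level Y n) (level P n) (p n) (q n)"
 shows "bin_product (sCat C) X Y P (P, X, p) (P, Y, q)"
proof -
 interpret s: category "sCat C" by (rule category_sCat)
 interpret p: simplicial_map C P X p by (rule P)
 interpret q: simplicial_map C P Y q by (rule P)
 let ?t = "const_sobj C t"
 note T = terminal_const_sobj[OF t]
 obtain a where a: "a \<in> Hom (sCat C) X ?t" using terminal_Hom_ex[OF T, of X] p.sobj_Y by auto
 obtain b where b: "b \<in> Hom (sCat C) Y ?t" using terminal_Hom_ex[OF T, of Y] q.sobj_Y by auto
 obtain \<alpha> where al: "a = (X, ?t, \<alpha>)" "is_sobj C ?t" "is_smap C X ?t \<alpha>" using sCat_HomE[OF a] by metis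
 obtain \<beta> where be: "b = (Y, ?t, \<beta>)" "is_smap C Y ?t \<beta>" using sCat_HomE[OF b] by metis
 have sm: "simplicial_map C X ?t \<alpha>" "simplicial_map C Y ?t \<beta>" using p.sobj_Y q.sobj_Y al be by unfold_locales
 have ab: "\<alpha> n \<in> (level X n) -> t" "\<beta> n \<in> (level Y n) -> t" for n
  using smap_Hom[OF al(3), of n] smap_Hom[OF be(2), of n] by simp_all
 have "is_pullback C (\<alpha> n) (\<beta> n) (p n) (q n)" for n
  using bin_product_iff_pullback[OF t ab] lv by blast
 then have "is_pullback (sCat C) a b (P, X, p) (P, Y, q)"
  unfolding al(1) be(1) by (rule pullback_sCatI[OF sm P])
 then show ?thesis using s.bin_product_iff_pullback[OF T a b] by simp
qed

locale geometric_terminal = geometric +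
 assumes pres_terminal: "preserves_terminal C D F"
begin

lemma F_terminal: "is_terminal C t ==> is_terminal D (OMap F t)"
 using pres_terminal by (simp add: preserves_terminal_def)

text \<open>In C a product is a pullback of covers over a terminal object. F preserves the square
  and its terminal corner, so the image is a product again.\<close>

lemma F_bin_product:
 assumes "bin_product C X Y P p q"
 shows "bin_product D (OMap F X) (OMap F Y) (OMap F P) (AMap F p) (AMap F q)"
proof -
 obtain t where t: "is_terminal C t" using C.terminal_cover by blast
 note pq = bin_product_Hom[OF assms]
 obtain a where a: "a \<in> X -> t" using terminal_Hom_ex[OF t C.Hom_Obj(2)[OF pq(1)]] .
 obtain b where b: "b \<in> Y -> t" using terminal_Hom_ex[OF t C.Hom_Obj(2)[OF pq(2)]] .
 have "a \<in> S" using C.terminal_S[OF t a] .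
 moreover have "is_pullback C a b p q" using C.bin_product_iff_pullback[OF t a b] assms by blast
 ultimately have "is_pullback D (AMap F a) (AMap F b) (AMap F p) (AMap F q)" by (rule F_pullback)
 moreover have "Dom D (AMap F p) = OMap F P" using HomD(2)[OF F_Hom[OF pq(1)]] .
 ultimately show ?thesis using D.bin_product_iff_pullback[OF F_terminal[OF t] F_Hom[OF a] F_Hom[OF b]] by blast
qed

sublocale base: product_functor C D F
 by unfold_locales (use C.ex_bin_product F_bin_product F_terminal in auto)

lemma product_functor_sFun: "product_functor (sCat C) (sCat D) (sFun F)"
proof -
 interpret sC: category "sCat C" by (rule C.category_sCat)
 interpret sD: category "sCat D" by (rule D.category_sCat)
 obtain t where t: "is_terminal C t" using C.terminal_cover by blast
 show ?thesis
 proof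
  show "is_functor (sCat C) (sCat D) (sFun F)" by (rule is_functor_sFun)
  show "\<exists>P p q. bin_product (sCat C) X Y P p q" if "X \<in> Obj (sCat C)" "Y \<in> Obj (sCat C)" for X Y
   using C.ex_bin_product_sCat[OF that] .
  show "is_terminal (sCat D) (OMap (sFun F) Z)" if Z: "is_terminal (sCat C) Z" for Z
   using F_terminal[OF C.terminal_level[OF t Z]] Z sFun_sobj
   by (intro D.terminal_sCatI) (simp_all add: is_terminal_def[of "sCat C"])
  fix X Y P p q assume P: "bin_product (sCat C) X Y P p q"
  note pq = bin_product_Hom[OF P]
  obtain p' where p: "p = (P, X, p')" "is_sobj C P" "is_sobj C X" "is_smap C P X p'" using sCat_HomE[OF pq(1)] by metis
  obtain q' where q: "q = (P, Y, q')" "is_sobj C Y" "is_smap C P Y q'" using sCat_HomE[OF pq(2)] by metis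
  have sm: "simplicial_map D (OMap (sFun F) P) (OMap (sFun F) X) (\<lambda>n. AMap F (p' n))"
   "simplicial_map D (OMap (sFun F) P) (OMap (sFun F) Y) (\<lambda>n. AMap F (q' n))"
   using sFun_sobj[OF p(2)] sFun_sobj[OF p(3)] sFun_sobj[OF q(2)] sFun_smap[OF p(2-4)] sFun_smap[OF p(2) q(2,3)]
   by unfold_locales
  show "bin_product (sCat D) (OMap (sFun F) X) (OMap (sFun F) Y) (OMap (sFun F) P) (AMap (sFun F) p) (AMap (sFun F) q)"
   unfolding p(1) q(1) sFun_simps
   using D.bin_product_sCatI[OF F_terminal[OF t] sm] F_bin_product[OF C.bin_product_sCat_level[OF P]]
   by (simp add: p(1) q(1))
 qed
qed

end

section \<open>Pointwise multiplication of horns and Moore's filling argument\<close>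

section \<open>Simplicial groups\<close>

locale simplicial_group = simplicial_set X for X :: "'a sset" +
 fixes mul :: "nat => 'a => 'a => 'a" and one :: "nat => 'a" and inv :: "nat => 'a => 'a"
 assumes mul_pts: "\<And>n x y. x \<in> pts X n ==> y \<in> pts X n ==> mul n x y \<in> pts X n"
  and one_pts: "\<And>n. one n \<in> pts X n"
  and inv_pts: "\<And>n x. x \<in> pts X n ==> inv n x \<in> pts X n"
  and mul_assoc: "\<And>n x y z. x \<in> pts X n ==> y \<in> pts X n ==> z \<in> pts X n ==>
   mul n (mul n x y) z = mul n x (mul n y z)"
  and one_mul: "\<And>n x. x \<in> pts X n ==> mul n (one n) x = x"
  and mul_one: "\<And>n x. x \<in> pts X n ==> mul n x (one n) = x"
  and inv_mul: "\<And>n x. x \<in> pts X n ==> mul n (inv n x) x = one n"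
  and mul_inv: "\<And>n x. x \<in> pts X n ==> mul n x (inv n x) = one n"
  and fc_mul: "\<And>n i x y. i \<le> Suc n ==> x \<in> pts X (Suc n) ==> y \<in> pts X (Suc n) ==>
   fc X n i (mul (Suc n) x y) = mul n (fc X n i x) (fc X n i y)"
  and dg_mul: "\<And>n i x y. i \<le> n ==> x \<in> pts X n ==> y \<in> pts X n ==>
   dg X n i (mul n x y) = mul (Suc n) (dg X n i x) (dg X n i y)"
begin

lemma inv_mul_cancel: "x \<in> pts X n ==> y \<in> pts X n ==> mul n (inv n x) (mul n x y) = y"
 using mul_assoc[of "inv n x" n x y] by (simp add: inv_pts inv_mul one_mul)

lemma mul_inv_cancel: "x \<in> pts X n ==> y \<in> pts X n ==> mul n x (mul n (inv n x) y) = y"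
 using mul_assoc[of x n "inv n x" y] by (simp add: inv_pts mul_inv one_mul)

lemma left_cancel: "x \<in> pts X n ==> y \<in> pts X n ==> z \<in> pts X n ==> mul n x y = mul n x z ==> y = z"
 using inv_mul_cancel by metis

lemma right_cancel:
 assumes "x \<in> pts X n" "y \<in> pts X n" "z \<in> pts X n" "mul n y x = mul n z x"
 shows "y = z"
proof -
 have "mul n (mul n y x) (inv n x) = mul n (mul n z x) (inv n x)" using assms(4) by simp
 then show ?thesis using assms(1-3) by (simp add: mul_assoc inv_pts mul_inv mul_one)
qed

lemma inv_eqI: "x \<in> pts X n ==> y \<in> pts X n ==> mul n x y = one n ==> y = inv n x"
 using left_cancel[of x n y "inv n x"] by (simp add: inv_pts mul_inv)

lemma idem_one: "x \<in> pts X n ==> mul n x x = x ==> x = one n"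
 using left_cancel[of x n x "one n"] by (simp add: one_pts mul_one)

lemma fc_one: "i \<le> Suc n ==> fc X n i (one (Suc n)) = one n"
 using fc_mul[of i n "one (Suc n)" "one (Suc n)"] by (intro idem_one) (simp_all add: fc_pts one_pts one_mul)

lemma dg_one: "i \<le> n ==> dg X n i (one n) = one (Suc n)"
 using dg_mul[of i n "one n" "one n"] by (intro idem_one) (simp_all add: dg_pts one_pts one_mul)

lemma fc_inv: "i \<le> Suc n ==> x \<in> pts X (Suc n) ==> fc X n i (inv (Suc n) x) = inv n (fc X n i x)"
 using fc_mul[of i n x "inv (Suc n) x"] by (intro inv_eqI) (simp_all add: fc_pts inv_pts mul_inv fc_one)

lemma dg_inv: "i \<le> n ==> x \<in> pts X n ==> dg X n i (inv n x) = inv (Suc n) (dg X n i x)"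
 using dg_mul[of i n x "inv n x"] by (intro inv_eqI) (simp_all add: dg_pts inv_pts mul_inv dg_one)

lemma spoint_mul:
 assumes K: "ssubset n K" and x: "spoint K X x" and y: "spoint K X y"
 shows "spoint K X (\<lambda>\<mu>. mul (dim \<mu>) (x \<mu>) (y \<mu>))"
 unfolding spoint_def
proof (intro conjI ballI allI impI)
 fix \<mu> assume k: "\<mu> \<in> K"
 note p = spoint_pts[OF x k] spoint_pts[OF y k]
 show "mul (dim \<mu>) (x \<mu>) (y \<mu>) \<in> pts X (dim \<mu>)" using p mul_pts by blast
 fix m i
 show "mul (dim (del_nth i \<mu>)) (x (del_nth i \<mu>)) (y (del_nth i \<mu>)) = fc X m i (mul (dim \<mu>) (x \<mu>) (y \<mu>))"
  if d: "dim \<mu> = Suc m" "i \<le> Suc m"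
  using spoint_del[OF x k d] spoint_del[OF y k d] dim_del_nth[OF d] fc_mul[OF d(2)] p d(1) by simp
 have ne: "\<mu> \<noteq> []" using ssubset_Nil[OF K] k by blast
 show "mul (dim (dup_nth i \<mu>)) (x (dup_nth i \<mu>)) (y (dup_nth i \<mu>)) = dg X m i (mul (dim \<mu>) (x \<mu>) (y \<mu>))"
  if d: "dim \<mu> = m" "i \<le> m"
  using spoint_dup[OF x k, of i] spoint_dup[OF y k, of i] dim_dup_nth[OF ne, of i] dg_mul[OF d(2)] p d by simp
qed

lemma spoint_inv:
 assumes K: "ssubset n K" and x: "spoint K X x"
 shows "spoint K X (\<lambda>\<mu>. inv (dim \<mu>) (x \<mu>))"
 unfolding spoint_def
proof (intro conjI ballI allI impI)
 fix \<mu> assume k: "\<mu> \<in> K"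
 note p = spoint_pts[OF x k]
 show "inv (dim \<mu>) (x \<mu>) \<in> pts X (dim \<mu>)" using p inv_pts by blast
 fix m i
 show "inv (dim (del_nth i \<mu>)) (x (del_nth i \<mu>)) = fc X m i (inv (dim \<mu>) (x \<mu>))"
  if d: "dim \<mu> = Suc m" "i \<le> Suc m"
  using spoint_del[OF x k d] dim_del_nth[OF d] fc_inv[OF d(2)] p d(1) by simp
 have ne: "\<mu> \<noteq> []" using ssubset_Nil[OF K] k by blast
 show "inv (dim (dup_nth i \<mu>)) (x (dup_nth i \<mu>)) = dg X m i (inv (dim \<mu>) (x \<mu>))"
  if d: "dim \<mu> = m" "i \<le> m"
  using spoint_dup[OF x k, of i] dim_dup_nth[OF ne, of i] dg_inv[OF d(2)] p d by simp
qed

lemma sact_mul: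
 assumes "x \<in> pts X n" "y \<in> pts X n" "\<mu> \<in> std_simplex n"
 shows "sact X n \<mu> (mul n x y) = mul (dim \<mu>) (sact X n \<mu> x) (sact X n \<mu> y)"
 using sact_eq[OF spoint_mul[OF ssubset_std_simplex spoint_std_sact(1)[OF assms(1)] spoint_std_sact(1)[OF assms(2)]] assms(3)]
  sact_upt assms(1,2) by (simp del: upt_Suc)

end

lemma del_nth_del_nth:
 "i < j ==> j < length \<mu> ==> del_nth i (del_nth j \<mu>) = del_nth (j - 1) (del_nth i \<mu>)"
proof (induction \<mu> arbitrary: i j)
 case (Cons a \<mu>)
 obtain j' where j: "j = Suc j'" using Cons.prems by (cases j) auto
 show ?case
 proof (cases i)
  case 0
  then show ?thesis using j by simp
 next
  case (Suc i')
  then have "j' = Suc (j' - 1)" using Cons.prems j by auto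
  then have "del_nth j' (a # del_nth i' \<mu>) = a # del_nth (j' - 1) (del_nth i' \<mu>)" by (metis del_nth_Suc)
  then show ?thesis using Cons j Suc by simp
 qed
qed simp

lemma set_del_nth_upt: "i \<le> n ==> set (del_nth i [0..<Suc n]) = {..n} - {i}"
proof -
 assume i: "i \<le> n"
 have e: "[0..<Suc n] = [0..<i] @ i # [Suc i..<Suc n]"
  using i upt_add_eq_append[of 0 i "Suc n - i"] upt_conv_Cons[of i "Suc n"] by (simp del: upt_Suc)
 have "del_nth i [0..<Suc n] = [0..<i] @ [Suc i..<Suc n]"
  unfolding e using del_nth_append_Cons[of "[0..<i]" i "[Suc i..<Suc n]"] by (simp del: upt_Suc)
 then show ?thesis using i by (auto simp del: upt_Suc)
qed

lemma face_simplex: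
 assumes "i \<le> Suc n"
 shows "del_nth i [0..<Suc (Suc n)] \<in> std_simplex (Suc n)" "dim (del_nth i [0..<Suc (Suc n)]) = n"
  "distinct (del_nth i [0..<Suc (Suc n)])"
  "set (del_nth i [0..<Suc (Suc n)]) = {..Suc n} - {i}"
proof -
 have d: "dim [0..<Suc (Suc n)] = Suc n" by (rule dim_upt)
 show "del_nth i [0..<Suc (Suc n)] \<in> std_simplex (Suc n)"
  by (rule std_simplex_del_nth[OF upt_in_std_simplex d assms])
 show "dim (del_nth i [0..<Suc (Suc n)]) = n" by (rule dim_del_nth[OF d assms])
 show "set (del_nth i [0..<Suc (Suc n)]) = {..Suc n} - {i}" by (rule set_del_nth_upt[OF assms])
 show "distinct (del_nth i [0..<Suc (Suc n)])"
  unfolding del_nth_def distinct_append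
  using distinct_upt[of 0 "Suc (Suc n)"] set_take_disj_set_drop_if_distinct[of "[0..<Suc (Suc n)]" i "Suc i"]
  by (simp del: upt_Suc)
qed

context simplicial_set
begin

lemma sact_face: "h \<in> pts X (Suc n) ==> i \<le> Suc n ==> sact X (Suc n) (del_nth i [0..<Suc (Suc n)]) h = fc X n i h"
 using sact_del_nth[OF _ upt_in_std_simplex dim_upt] sact_upt by metis

text \<open>A simplex of the horn misses some vertex other than \<open>k\<close>, so it lies on one
  of the prescribed faces and agreement on these faces suffices.\<close>

lemma horn_eq_sact:
 assumes x: "spoint (horn (Suc n) k) X x" and k: "k \<le> Suc n" and h: "h \<in> pts X (Suc n)"
  and faces: "\<And>i. i \<le> Suc n ==> i \<noteq> k ==> fc X n i h = x (del_nth i [0..<Suc (Suc n)])"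
  and \<mu>: "\<mu> \<in> horn (Suc n) k"
 shows "sact X (Suc n) \<mu> h = x \<mu>"
proof -
 have "\<mu> \<in> std_simplex (Suc n)" "insert k (set \<mu>) \<noteq> {..Suc n}" using \<mu> by (auto simp: horn_def)
 then obtain i where i: "i \<le> Suc n" "i \<noteq> k" "i \<notin> set \<mu>"
  using std_simplex_set(1)[of \<mu> "Suc n"] k by auto
 let ?d = "del_nth i [0..<Suc (Suc n)]"
 note f = face_simplex[OF i(1)]
 have dh: "?d \<in> horn (Suc n) k" using f(1,4) i by (auto simp: horn_def simp del: upt_Suc)
 have s: "set \<mu> \<subseteq> set ?d" using std_simplex_set(1)[OF \<open>\<mu> \<in> std_simplex (Suc n)\<close>] i(3) unfolding f(4) by auto
 note r = rank_list[OF f(1,3) \<open>\<mu> \<in> std_simplex (Suc n)\<close> s]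
 have "x \<mu> = sact X n (rank_list ?d \<mu>) (x ?d)"
  using spoint_sact[OF ssubset_horn[OF k] dh x r(1)] unfolding r(2) f(2) .
 also have "\<dots> = sact X n (rank_list ?d \<mu>) (sact X (Suc n) ?d h)"
  using faces[OF i(1,2)] sact_face[OF h i(1)] by simp
 also have "\<dots> = sact X (Suc n) \<mu> h"
  using sact_lcomp[OF h f(1) r(1)] unfolding r(2) f(2) by simp
 finally show ?thesis by simp
qed

end

context simplicial_group
begin

text \<open>The correction of \<open>w\<close> by the quotient of \<open>a\<close> and
  \<open>b\<close>: a face on which \<open>a\<close> and \<open>b\<close> agree is left unchanged,
  and a face on which \<open>a\<close> agrees with \<open>w\<close> is replaced by that of
  \<open>b\<close>.\<close>

lemma adjust_face:
 assumes "w \<in> pts X (Suc n)" "a \<in> pts X (Suc n)" "b \<in> pts X (Suc n)" "j \<le> Suc n"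
 shows "mul (Suc n) w (mul (Suc n) (inv (Suc n) a) b) \<in> pts X (Suc n)"
  and "fc X n j a = fc X n j b ==> fc X n j (mul (Suc n) w (mul (Suc n) (inv (Suc n) a) b)) = fc X n j w"
  and "fc X n j a = fc X n j w ==> fc X n j (mul (Suc n) w (mul (Suc n) (inv (Suc n) a) b)) = fc X n j b"
proof -
 show "mul (Suc n) w (mul (Suc n) (inv (Suc n) a) b) \<in> pts X (Suc n)"
  using assms by (simp add: mul_pts inv_pts)
 have "fc X n j (mul (Suc n) w (mul (Suc n) (inv (Suc n) a) b)) =
   mul n (fc X n j w) (mul n (inv n (fc X n j a)) (fc X n j b))"
  using assms by (simp add: fc_mul fc_inv mul_pts inv_pts)
 then show "fc X n j a = fc X n j b ==> fc X n j (mul (Suc n) w (mul (Suc n) (inv (Suc n) a) b)) = fc X n j w"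
  "fc X n j a = fc X n j w ==> fc X n j (mul (Suc n) w (mul (Suc n) (inv (Suc n) a) b)) = fc X n j b"
  using assms by (simp_all add: fc_pts inv_mul mul_one mul_inv_cancel)
qed

text \<open>Moore's theorem: the faces of a horn are matched one at a time, correcting by degenerate
 elements, first in increasing order below \<open>k\<close> and then in decreasing order above \<open>k\<close>.\<close>

lemma horn_filler:
 assumes n: "1 \<le> n" "k \<le> n" and x: "spoint (horn n k) X x"
 shows "\<exists>h\<in>pts X n. \<forall>\<mu>\<in>horn n k. sact X n \<mu> h = x \<mu>"
proof -
 obtain N where N: "n = Suc N" using n by (cases n) auto
 define y where "y i = x (del_nth i [0..<Suc n])" for i
 note K = ssubset_horn[OF n(2)]
 have dh: "del_nth i [0..<Suc n] \<in> horn n k" if "i \<le> n" "i \<noteq> k" for i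
  using face_simplex(1,4)[of i N] that N by (auto simp: horn_def simp del: upt_Suc)
 have y: "y i \<in> pts X N" if "i \<le> n" "i \<noteq> k" for i
  using spoint_pts[OF x dh[OF that]] face_simplex(2)[of i N] that N by (simp add: y_def del: upt_Suc)
 have compat: "fc X M i (y j) = fc X M (j - 1) (y i)" if ij: "i < j" "j \<le> n" "i \<noteq> k" "j \<noteq> k" and M: "N = Suc M" for i j M
 proof -
  have i: "i \<le> Suc N" and j: "j \<le> Suc N" using ij N by auto
  have "fc X M i (y j) = x (del_nth i (del_nth j [0..<Suc n]))"
   using spoint_del[OF x dh[of j], of M i] face_simplex(2)[OF j] ij M N unfolding y_def by (simp del: upt_Suc)
  also have "\<dots> = x (del_nth (j - 1) (del_nth i [0..<Suc n]))"
   using del_nth_del_nth[OF ij(1), of "[0..<Suc n]"] ij(2) by (simp del: upt_Suc)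
  also have "\<dots> = fc X M (j - 1) (y i)"
   using spoint_del[OF x dh[of i], of M "j - 1"] face_simplex(2)[OF i] ij M N unfolding y_def by (simp del: upt_Suc)
  finally show ?thesis .
 qed
 have "m \<le> k ==> \<exists>w\<in>pts X n. \<forall>i<m. fc X N i w = y i" for m
 proof (induction m)
  case 0
  then show ?case using one_pts by blast
 next
  case (Suc m)
  then obtain w where w: "w \<in> pts X (Suc N)" "\<And>i. i < m ==> fc X N i w = y i" using N by auto
  have m: "m \<le> n" "m \<noteq> k" "m \<le> N" using Suc.prems n N by auto
  \<comment> \<open>\<open>s_m\<close> applied to the present face and to the desired face. By the
    compatibility of the horn the two agree on all faces below \<open>m\<close>, so those are not
    disturbed.\<close>
  let ?a = "dg X N m (fc X N m w)" and ?b = "dg X N m (y m)"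
  have fw: "fc X N m w \<in> pts X N" using fc_pts w(1) m(3) by simp
  have ab: "?a \<in> pts X (Suc N)" "?b \<in> pts X (Suc N)" using dg_pts m(3) fw y[OF m(1,2)] by blast+
  let ?w = "mul (Suc N) w (mul (Suc N) (inv (Suc N) ?a) ?b)"
  have "fc X N i ?w = y i" if i: "i < Suc m" for i
  proof (cases "i = m")
   case True
   have "fc X N m ?a = fc X N m w" "fc X N m ?b = y m" using fc_dg_id m(3) fw y[OF m(1,2)] by blast+
   then show ?thesis using adjust_face(3)[OF w(1) ab, of m] m(3) True by simp
  next
   case False
   then have im: "i < m" "i \<noteq> k" "i \<le> n" using i Suc.prems n by auto
   then obtain M where M: "N = Suc M" using m(3) by (cases N) auto
   have "fc X N i ?a = dg X M (m - 1) (fc X M i (fc X N m w))"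
    using fc_dg_less[OF im(1), of M "fc X N m w"] m(3) fw M by simp
   also have "fc X M i (fc X N m w) = fc X M (m - 1) (y i)"
    using fc_fc[OF im(1), of M w] w m(3) M im(1) by simp
   also have "dg X M (m - 1) (fc X M (m - 1) (y i)) = fc X N i ?b"
    using fc_dg_less[OF im(1), of M "y m"] m(3) y[OF m(1,2)] M compat[OF im(1) m(1) im(2) m(2) M] by simp
   finally show ?thesis using adjust_face(2)[OF w(1) ab, of i] w(2)[OF im(1)] im(3) N by simp
  qed
  then show ?case using adjust_face(1)[OF w(1) ab le0] N by blast
 qed
 then obtain w0 where w0: "w0 \<in> pts X n" "\<And>i. i < k ==> fc X N i w0 = y i" by blast
 have "m \<le> n - k ==> \<exists>w\<in>pts X n. \<forall>i\<le>n. i < k \<or> n - m < i --> fc X N i w = y i" for m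
 proof (induction m)
  case 0
  then show ?case using w0 by (intro bexI[of _ w0]) auto
 next
  case (Suc m)
  then obtain w where w: "w \<in> pts X (Suc N)" "\<And>i. i \<le> n ==> i < k \<or> n - m < i ==> fc X N i w = y i" using N by auto
  \<comment> \<open>The next face to correct is \<open>p + 1\<close>, by means of
    \<open>s_p\<close>, since \<open>d_(p+1) s_p\<close> is an identity; \<open>s_(p+1)\<close>
    would be out of range at the last face. Face \<open>p\<close> may be disturbed, but it is either
    \<open>k\<close> or still to be corrected.\<close>
  define p where "p = n - Suc m"
  have p: "Suc p = n - m" "k \<le> p" "p \<le> N" "Suc p \<le> n" "Suc p \<noteq> k" using Suc.prems n N by (auto simp: p_def)
  let ?a = "dg X N p (fc X N (Suc p) w)" and ?b = "dg X N p (y (Suc p))"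
  have fw: "fc X N (Suc p) w \<in> pts X N" using fc_pts w(1) p(3) by simp
  have ab: "?a \<in> pts X (Suc N)" "?b \<in> pts X (Suc N)" using dg_pts p(3) fw y[OF p(4,5)] by blast+
  let ?w = "mul (Suc N) w (mul (Suc N) (inv (Suc N) ?a) ?b)"
  have "fc X N i ?w = y i" if i: "i \<le> n" "i < k \<or> n - Suc m < i" for i
  proof -
   consider "i = Suc p" | "i < k" "i < p" "i \<noteq> k" | "Suc p < i" "i \<noteq> k"
    using i(2) p p_def by linarith
   then show ?thesis
   proof cases
    case 1
    have "fc X N (Suc p) ?a = fc X N (Suc p) w" "fc X N (Suc p) ?b = y (Suc p)"
     using fc_dg_id p(3) fw y[OF p(4,5)] by blast+
    then show ?thesis using adjust_face(3)[OF w(1) ab, of "Suc p"] p(3) 1 by simp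
   next
    case 2
    then obtain M where M: "N = Suc M" using p(3) by (cases N) auto
    have ip: "i < Suc p" using 2 by simp
    have "fc X N i ?a = dg X M (p - 1) (fc X M i (fc X N (Suc p) w))"
     using fc_dg_less[OF 2(2), of M "fc X N (Suc p) w"] p(3) fw M by simp
    also have "fc X M i (fc X N (Suc p) w) = fc X M p (y i)"
     using fc_fc[OF ip, of M w] w(1) w(2)[OF i(1)] 2(1) p(3) M by simp
    also have "dg X M (p - 1) (fc X M p (y i)) = fc X N i ?b"
     using fc_dg_less[OF 2(2), of M "y (Suc p)"] p(3) y[OF p(4,5)] M compat[OF ip p(4) 2(3) p(5) M] by simp
    finally show ?thesis using adjust_face(2)[OF w(1) ab, of i] w(2)[OF i(1)] 2(1) i(1) N by simp
   next
    case 3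
    have iN: "i \<le> Suc N" using i(1) N by simp
    then obtain M where M: "N = Suc M" using 3(1) p(3) by (cases N) auto
    have nm: "n - m < i" using 3(1) p(1) by simp
    have "fc X N i ?a = dg X M p (fc X M (i - 1) (fc X N (Suc p) w))"
     using fc_dg_greater[OF 3(1), of M "fc X N (Suc p) w"] iN fw M by simp
    also have "fc X M (i - 1) (fc X N (Suc p) w) = fc X M (Suc p) (y i)"
     using fc_fc[OF 3(1), of M w] w(1) w(2)[OF i(1)] nm iN M by simp
    also have "dg X M p (fc X M (Suc p) (y i)) = fc X N i ?b"
     using fc_dg_greater[OF 3(1), of M "y (Suc p)"] iN y[OF p(4,5)] M compat[OF 3(1) i(1) p(5) 3(2) M] by simp
    finally show ?thesis using adjust_face(2)[OF w(1) ab iN] w(2)[OF i(1)] nm by simp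
   qed
  qed
  then show ?case using adjust_face(1)[OF w(1) ab le0] N by blast
 qed
 from this[OF le_refl] obtain h where h: "h \<in> pts X n" "\<And>i. i \<le> n ==> i \<noteq> k ==> fc X N i h = y i"
  using n by (metis diff_diff_cancel linorder_neqE_nat)
 have "sact X n \<mu> h = x \<mu>" if "\<mu> \<in> horn n k" for \<mu>
  using horn_eq_sact[of N k x h \<mu>] x n(2) h that unfolding N y_def by simp
 then show ?thesis using h(1) by blast
qed

end


section \<open>Horn comparison maps of simplicial groups as covers by cancellation\<close>

section \<open>Simplicial group objects are infinity-groupoids\<close>

lemma glevel_simps [simp]:
 "Gob (glevel G j) = level (Gob G) j" "Gsq (glevel G j) = level (Gsq G) j"
 "Gfst (glevel G j) = comps (Gfst G) j" "Gsnd (glevel G j) = comps (Gsnd G) j"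
 "Gpt (glevel G j) = level (Gpt G) j" "Gmult (glevel G j) = comps (Gmult G) j"
 "Gunit (glevel G j) = comps (Gunit G) j" "Ginv (glevel G j) = comps (Ginv G) j"
 by (simp_all add: glevel_def)

text \<open>The structure maps are taken in the category of simplicial objects, the group laws level
  by level; in this form both parts can be verified for the image in D.\<close>

locale simplicial_group_object = category C for C :: "('o, 'm) cat" (structure) +
 fixes G :: "('o, 'm) sgrp"
 assumes sCat_pregroup: "pregroup (sCat C) G"
  and glevel_group: "\<And>n. group_object C (glevel G n)"
begin

lemma sobj_Gob: "is_sobj C (Gob G)" and sobj_Gsq: "is_sobj C (Gsq G)"
 and smap_mult: "is_smap C (Gsq G) (Gob G) (comps (Gmult G))"
 and smap_fst: "is_smap C (Gsq G) (Gob G) (comps (Gfst G))"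
 and smap_snd: "is_smap C (Gsq G) (Gob G) (comps (Gsnd G))"
 using pregroup.mult_Hom[OF sCat_pregroup] bin_product_Hom[OF pregroup.square[OF sCat_pregroup]]
 by (auto simp: sCat_Hom)

lemma glevel_pregroup: "pregroup C (glevel G n)"
 using glevel_group group_object.axioms(1) by blast

text \<open>A common form for faces and degeneracies: an operator of G paired with the same operator
  of the square, compatible with multiplication and projections by naturality of these maps.\<close>

lemma operator_gmul:
 assumes f: "f \<in> (level (Gob G) m) -> (level (Gob G) n)" and f': "f' \<in> (level (Gsq G) m) -> (level (Gsq G) n)"
  and e: "f \<cdot> comps (Gmult G) m = comps (Gmult G) n \<cdot> f'" "f \<cdot> comps (Gfst G) m = comps (Gfst G) n \<cdot> f'"
   "f \<cdot> comps (Gsnd G) m = comps (Gsnd G) n \<cdot> f'"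
  and ab: "a \<in> T -> (level (Gob G) m)" "b \<in> T -> (level (Gob G) m)"
 shows "f \<cdot> gmul C (glevel G m) a b = gmul C (glevel G n) (f \<cdot> a) (f \<cdot> b)"
proof -
 interpret m: group_object C "glevel G m" by (rule glevel_group)
 interpret n: group_object C "glevel G n" by (rule glevel_group)
 note hm = bin_product_Hom[OF m.square, simplified]
 have "gpair C (glevel G n) (f \<cdot> comps (Gfst G) m) (f \<cdot> comps (Gsnd G) m) = f'"
  by (rule n.gpair_eqI[of _ "level (Gsq G) m"])
   (use comp_Hom[OF f hm(1)] comp_Hom[OF f hm(2)] f' e(2,3) in simp_all)
 then have "f \<cdot> Gmult (glevel G m) = gmul C (glevel G n) (f \<cdot> Gfst (glevel G m)) (f \<cdot> Gsnd (glevel G m))"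
  using e(1) by (simp add: gmul_def)
 then show ?thesis
  using m.hom_gmul[of f "level (Gob G) n" "glevel G n" a T b] f ab glevel_pregroup by simp
qed

lemma hset_simplicial_group:
 assumes T: "T \<in> Obj C"
 shows "simplicial_group (hset C (Gob G) T) (\<lambda>n. gmul C (glevel G n)) (\<lambda>n. gone C (glevel G n) T)
  (\<lambda>n a. Ginv (glevel G n) \<cdot> a)"
proof -
 interpret simplicial_set "hset C (Gob G) T" by (rule simplicial_set_hset[OF sobj_Gob])
 show ?thesis
 proof (unfold_locales, unfold hset_simps)
  fix n x y z
  interpret g: group_object C "glevel G n" by (rule glevel_group)
  note r = g.gmul_Hom g.gone_Hom[OF T] g.gmul_assoc g.one_gmul g.gmul_one g.inv_gmul g.gmul_inv
  show "gmul C (glevel G n) x y \<in> T -> (level (Gob G) n)"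
   if "x \<in> T -> (level (Gob G) n)" "y \<in> T -> (level (Gob G) n)" using r(1) that by simp
  show "gone C (glevel G n) T \<in> T -> (level (Gob G) n)" using r(2) by simp
  show "Ginv (glevel G n) \<cdot> x \<in> T -> (level (Gob G) n)" if "x \<in> T -> (level (Gob G) n)"
   using comp_Hom[OF g.inv_Hom] that by simp
  show "gmul C (glevel G n) (gmul C (glevel G n) x y) z = gmul C (glevel G n) x (gmul C (glevel G n) y z)"
   if "x \<in> T -> (level (Gob G) n)" "y \<in> T -> (level (Gob G) n)" "z \<in> T -> (level (Gob G) n)"
   using r(3) that by simp
  show "gmul C (glevel G n) (gone C (glevel G n) T) x = x" "gmul C (glevel G n) x (gone C (glevel G n) T) = x"
   "gmul C (glevel G n) (Ginv (glevel G n) \<cdot> x) x = gone C (glevel G n) T"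
   "gmul C (glevel G n) x (Ginv (glevel G n) \<cdot> x) = gone C (glevel G n) T"
   if "x \<in> T -> (level (Gob G) n)"
   using g.one_gmul[of x T] g.gmul_one[of x T] g.inv_gmul[of x T] g.gmul_inv[of x T] that by simp_all
 next
  fix n i x y assume i: "i \<le> Suc n" and xy: "x \<in> T -> (level (Gob G) (Suc n))" "y \<in> T -> (level (Gob G) (Suc n))"
  show "face (Gob G) n i \<cdot> gmul C (glevel G (Suc n)) x y = gmul C (glevel G n) (face (Gob G) n i \<cdot> x) (face (Gob G) n i \<cdot> y)"
   by (rule operator_gmul[OF sobj_face[OF sobj_Gob i] sobj_face[OF sobj_Gsq i] _ _ _ xy])
    (simp_all add: smap_face[OF smap_mult i] smap_face[OF smap_fst i] smap_face[OF smap_snd i])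
 next
  fix n i x y assume i: "i \<le> (n::nat)" and xy: "x \<in> T -> (level (Gob G) n)" "y \<in> T -> (level (Gob G) n)"
  show "degen (Gob G) n i \<cdot> gmul C (glevel G n) x y = gmul C (glevel G (Suc n)) (degen (Gob G) n i \<cdot> x) (degen (Gob G) n i \<cdot> y)"
   by (rule operator_gmul[OF sobj_degen[OF sobj_Gob i] sobj_degen[OF sobj_Gsq i] _ _ _ xy])
    (simp_all add: smap_degen[OF smap_mult i] smap_degen[OF smap_fst i] smap_degen[OF smap_snd i])
 qed
qed

end

context cover_category
begin

text \<open>A projection is a base change of the arrow from the other factor to the terminal
  object.\<close>

lemma bin_product_cover:
 assumes "bin_product C A B P p q"
 shows "p \<in> S" "q \<in> S"
proof -
 obtain t where t: "is_terminal C t" using terminal_cover by blast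
 note pq = bin_product_Hom[OF assms]
 obtain a where a: "a \<in> A -> t" using terminal_Hom_ex[OF t Hom_Obj(2)[OF pq(1)]] .
 obtain b where b: "b \<in> B -> t" using terminal_Hom_ex[OF t Hom_Obj(2)[OF pq(2)]] .
 have "is_pullback C a b p q" using bin_product_iff_pullback[OF t a b] assms by blast
 then show "p \<in> S" "q \<in> S" using S_base pullback_sym terminal_S[OF t a] terminal_S[OF t b] by blast+
qed

text \<open>A surjection of group objects with a section \<open>s\<close> is a cover by cancellation: \<open>(x, h) \<mapsto> x \<cdot> s h\<close>
 is a cover, being isomorphic to a projection, and so is its composite with the surjection,
 \<open>(x, h) \<mapsto> r x \<cdot> h\<close>.  Here the target is a matching object, whose generalized elements are multiplied
 pointwise.\<close>

lemma group_comparison_cover: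
 assumes G: "simplicial_group_object C G" and Z: "simplicial_map C (Gob G) Z \<psi>" "\<And>n. is_terminal C (level Z n)"
  and n: "1 \<le> n" "k \<le> n" and L: "is_rel_matching C (horn n k) n (Gob G, Z, \<psi>) L xL yL"
  and c: "c \<in> (level (Gob G) n) -> L" "\<And>\<mu>. \<mu> \<in> horn n k ==> xL \<mu> \<cdot> c = sop C (Gob G) n \<mu>"
 shows "c \<in> S"
proof -
 interpret G: simplicial_group_object C G by (rule G)
 interpret Z: simplicial_map C "Gob G" Z \<psi> by (rule Z(1))
 let ?X = "Gob G" and ?K = "horn n k"
 interpret g: group_object C "glevel G n" by (rule G.glevel_group)
 note K = ssubset_horn[OF n(2)] and tu = terminal_Hom_unique[OF Z(2) category_axioms]
 have Lp: "spoint ?K (hset C ?X L) xL" "yL \<in> L -> (level Z n)"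
  using Z.rel_matching_point[OF L] by (auto simp: is_rel_point_iff)
 have xH: "xL \<mu> \<in> L -> (level ?X (dim \<mu>))" if "\<mu> \<in> ?K" for \<mu> using spoint_pts[OF Lp(1) that] by simp
 have sH: "sop C ?X n \<mu> \<in> (level ?X n) -> (level ?X (dim \<mu>))" if "\<mu> \<in> ?K" for \<mu>
  using sop_Hom[OF G.sobj_Gob ssubset_std[OF K that]] .
 have Lo: "L \<in> Obj C" "level ?X n \<in> Obj C" using Hom_Obj c(1) by auto
 have L_eqI: "u = v" if "u \<in> T -> L" "v \<in> T -> L" "\<And>\<mu>. \<mu> \<in> ?K ==> xL \<mu> \<cdot> u = xL \<mu> \<cdot> v" for u v T
  using Z.rel_matching_unique[OF K L that] tu[OF comp_Hom[OF Lp(2) that(1)] comp_Hom[OF Lp(2) that(2)]] by blast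
 have L_lift: "\<exists>u\<in>Hom C T L. \<forall>\<mu>\<in>?K. xL \<mu> \<cdot> u = x \<mu>" if x: "spoint ?K (hset C ?X T) x" and T: "T \<in> Obj C" for T x
 proof -
  obtain y where y: "y \<in> T -> (level Z n)" using terminal_Hom_ex[OF Z(2) T] .
  have "is_rel_point C ?K n (?X, Z, \<psi>) T x y"
   unfolding is_rel_point_iff
  proof (intro conjI ballI x y)
   fix \<mu> assume k: "\<mu> \<in> ?K"
   have "x \<mu> \<in> T -> (level ?X (dim \<mu>))" using spoint_pts[OF x k] by simp
   then show "\<psi> (dim \<mu>) \<cdot> x \<mu> = sop C Z n \<mu> \<cdot> y"
    by (intro tu[of _ T "dim \<mu>"] comp_Hom[OF Z.phi_Hom] comp_Hom[OF sop_Hom[OF Z.sobj_Y ssubset_std[OF K k]] y])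
  qed
  then show ?thesis by (rule Z.rel_matching_lift[OF L]) blast
 qed
 have cmul: "xL \<mu> \<cdot> (c \<cdot> gmul C (glevel G n) a b) = gmul C (glevel G (dim \<mu>)) (sop C ?X n \<mu> \<cdot> a) (sop C ?X n \<mu> \<cdot> b)"
  if k: "\<mu> \<in> ?K" and ab: "a \<in> T -> (level ?X n)" "b \<in> T -> (level ?X n)" for a b T \<mu>
 proof -
  interpret s: simplicial_group "hset C ?X T" "\<lambda>n. gmul C (glevel G n)" "\<lambda>n. gone C (glevel G n) T" "\<lambda>n a. Ginv (glevel G n) \<cdot> a"
   by (rule G.hset_simplicial_group[OF Hom_Obj(1)[OF ab(1)]])
  note kn = ssubset_std[OF K k]
  have m: "gmul C (glevel G n) a b \<in> T -> (level ?X n)" using s.mul_pts[of a n b] ab by simp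
  show ?thesis
   using assoc[OF xH[OF k] c(1) m] c(2)[OF k] s.sact_mul[of a n b \<mu>] ab kn
    sact_hset[OF G.sobj_Gob kn m] sact_hset[OF G.sobj_Gob kn ab(1)] sact_hset[OF G.sobj_Gob kn ab(2)] by simp
 qed
 interpret l: simplicial_group "hset C ?X L" "\<lambda>n. gmul C (glevel G n)" "\<lambda>n. gone C (glevel G n) L" "\<lambda>n a. Ginv (glevel G n) \<cdot> a"
  by (rule G.hset_simplicial_group[OF Lo(1)])
 \<comment> \<open>Moore's filler of the universal horn, the one formed by the coordinates of
   \<open>L\<close>, is a section of \<open>c\<close>.\<close>
 obtain s where s: "s \<in> L -> (level ?X n)" "\<And>\<mu>. \<mu> \<in> ?K ==> sop C ?X n \<mu> \<cdot> s = xL \<mu>"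
  using l.horn_filler[OF n Lp(1)] sact_hset[OF G.sobj_Gob] ssubset_std[OF K] by (metis hset_simps(1))
 obtain P p q where P: "bin_product C (level ?X n) L P p q" using ex_bin_product[OF Lo(2,1)] by blast
 note pq = bin_product_Hom[OF P]
 define f where "f = gmul C (glevel G n) p (s \<cdot> q)"
 have sq: "s \<cdot> q \<in> P -> (level ?X n)" using s(1) pq by blast
 have f: "f \<in> P -> (level ?X n)" unfolding f_def using g.gmul_Hom pq sq by simp
 have fu: "f \<cdot> u = gmul C (glevel G n) (p \<cdot> u) (s \<cdot> (q \<cdot> u))" if u: "u \<in> T -> P" for u T
  unfolding f_def using g.gmul_comp[of p P "s \<cdot> q" u T] pq sq u assoc[OF s(1) pq(2) u] by simp
 \<comment> \<open>Right multiplication by the filler is invertible, so \<open>f\<close> may replace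
   \<open>p\<close> as a coordinate on the product; in particular \<open>f\<close> is a
   projection.\<close>
 have "bin_product C (level ?X n) L P f q"
  unfolding bin_product_def
 proof (intro conjI allI ballI f pq(2))
  fix T a b assume ab: "a \<in> T -> (level ?X n)" "b \<in> T -> L"
  have sb: "s \<cdot> b \<in> T -> (level ?X n)" using s(1) ab(2) by blast
  interpret t: simplicial_group "hset C ?X T" "\<lambda>n. gmul C (glevel G n)" "\<lambda>n. gone C (glevel G n) T" "\<lambda>n a. Ginv (glevel G n) \<cdot> a"
   by (rule G.hset_simplicial_group[OF Hom_Obj(1)[OF ab(1)]])
  let ?i = "Ginv (glevel G n) \<cdot> (s \<cdot> b)"
  have i: "?i \<in> T -> (level ?X n)" using t.inv_pts[of "s \<cdot> b" n] sb by simp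
  obtain u where u: "u \<in> T -> P" "p \<cdot> u = gmul C (glevel G n) a ?i" "q \<cdot> u = b"
   using ex1_implies_ex[OF bin_product_ex1[OF P t.mul_pts[of a n ?i, simplified hset_simps, OF ab(1) i] ab(2)]] by blast
  have fua: "f \<cdot> u = a"
   using fu[OF u(1)] u(2,3) t.mul_assoc[of a n ?i "s \<cdot> b"] t.inv_mul[of "s \<cdot> b" n] t.mul_one[of a n] ab(1) i sb by simp
  have uniq: "v = u" if v: "v \<in> T -> P" "f \<cdot> v = a" "q \<cdot> v = b" for v
  proof (rule bin_product_unique[OF P v(1) u(1)])
   show "p \<cdot> v = p \<cdot> u"
    using t.right_cancel[of "s \<cdot> b" n "p \<cdot> v" "p \<cdot> u"] sb comp_Hom[OF pq(1) v(1)] comp_Hom[OF pq(1) u(1)]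
     fu[OF v(1)] fu[OF u(1)] v(2,3) u(3) fua by simp
  qed (use v(3) u(3) in simp)
  show "\<exists>!u. u \<in> T -> P \<and> f \<cdot> u = a \<and> q \<cdot> u = b"
   by (rule ex1I[of _ u]) (use u(1,3) fua uniq in blast)+
 qed
 then have fS: "f \<in> S" by (rule bin_product_cover)
 have cf: "c \<cdot> f \<in> P -> L" using c(1) f by blast
 have cfu: "xL \<mu> \<cdot> ((c \<cdot> f) \<cdot> u) = gmul C (glevel G (dim \<mu>)) (sop C ?X n \<mu> \<cdot> (p \<cdot> u)) (xL \<mu> \<cdot> (q \<cdot> u))"
  if k: "\<mu> \<in> ?K" and u: "u \<in> T -> P" for \<mu> u T
  using assoc[OF c(1) f u] fu[OF u] cmul[OF k comp_Hom[OF pq(1) u] comp_Hom[OF s(1) comp_Hom[OF pq(2) u]]]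
   assoc[OF sH[OF k] s(1) comp_Hom[OF pq(2) u]] s(2)[OF k] by simp
 \<comment> \<open>With the simplex fixed, the horn is recovered from the product by left division,
   which is performed at each simplex of the horn.\<close>
 have "bin_product C (level ?X n) L P p (c \<cdot> f)"
  unfolding bin_product_def
 proof (intro conjI allI ballI pq(1) cf)
  fix T a b assume ab: "a \<in> T -> (level ?X n)" "b \<in> T -> L"
  have To: "T \<in> Obj C" using Hom_Obj ab by blast
  interpret t: simplicial_group "hset C ?X T" "\<lambda>n. gmul C (glevel G n)" "\<lambda>n. gone C (glevel G n) T" "\<lambda>n a. Ginv (glevel G n) \<cdot> a"
   by (rule G.hset_simplicial_group[OF To])
  have sa: "sop C ?X n \<mu> \<cdot> a \<in> T -> (level ?X (dim \<mu>))" if "\<mu> \<in> ?K" for \<mu> using sH[OF that] ab(1) by blast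
  have xb: "xL \<mu> \<cdot> b \<in> T -> (level ?X (dim \<mu>))" if "\<mu> \<in> ?K" for \<mu> using xH[OF that] ab(2) by blast
  have "spoint ?K (hset C ?X T) (\<lambda>\<mu>. sop C ?X n \<mu> \<cdot> a)"
   using spoint_subset[OF spoint_sop[OF G.sobj_Gob ab(1)]] K unfolding ssubset_def by blast
  then have "spoint ?K (hset C ?X T) (\<lambda>\<mu>. gmul C (glevel G (dim \<mu>)) (Ginv (glevel G (dim \<mu>)) \<cdot> (sop C ?X n \<mu> \<cdot> a)) (xL \<mu> \<cdot> b))"
   by (rule t.spoint_mul[OF K t.spoint_inv[OF K] spoint_precomp[OF ssubset_Nil[OF K] G.sobj_Gob Lp(1) ab(2)]])
  from L_lift[OF this To] obtain d where d: "d \<in> T -> L"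
   "\<And>\<mu>. \<mu> \<in> ?K ==> xL \<mu> \<cdot> d = gmul C (glevel G (dim \<mu>)) (Ginv (glevel G (dim \<mu>)) \<cdot> (sop C ?X n \<mu> \<cdot> a)) (xL \<mu> \<cdot> b)"
   by blast
  obtain u where u: "u \<in> T -> P" "p \<cdot> u = a" "q \<cdot> u = d"
   using ex1_implies_ex[OF bin_product_ex1[OF P ab(1) d(1)]] by blast
  have cfub: "(c \<cdot> f) \<cdot> u = b"
  proof (rule L_eqI[OF comp_Hom[OF cf u(1)] ab(2)])
   fix \<mu> assume k: "\<mu> \<in> ?K"
   show "xL \<mu> \<cdot> ((c \<cdot> f) \<cdot> u) = xL \<mu> \<cdot> b"
    using cfu[OF k u(1)] u(2,3) d(2)[OF k] t.mul_inv_cancel[of "sop C ?X n \<mu> \<cdot> a" "dim \<mu>" "xL \<mu> \<cdot> b"] sa[OF k] xb[OF k] by simp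
  qed
  have uniq: "v = u" if v: "v \<in> T -> P" "p \<cdot> v = a" "(c \<cdot> f) \<cdot> v = b" for v
  proof (rule bin_product_unique[OF P v(1) u(1)])
   show "q \<cdot> v = q \<cdot> u"
   proof (rule L_eqI[OF comp_Hom[OF pq(2) v(1)] comp_Hom[OF pq(2) u(1)]])
    fix \<mu> assume k: "\<mu> \<in> ?K"
    have xq: "xL \<mu> \<cdot> (q \<cdot> w) \<in> T -> (level ?X (dim \<mu>))" if "w \<in> T -> P" for w
     using xH[OF k] pq(2) that by blast
    show "xL \<mu> \<cdot> (q \<cdot> v) = xL \<mu> \<cdot> (q \<cdot> u)"
     using t.left_cancel[of "sop C ?X n \<mu> \<cdot> a" "dim \<mu>" "xL \<mu> \<cdot> (q \<cdot> v)" "xL \<mu> \<cdot> (q \<cdot> u)"]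
      xq[OF v(1)] xq[OF u(1)] sa[OF k] v u cfu[OF k v(1)] cfu[OF k u(1)] cfub by simp
   qed
  qed (use v(2) u(2) in simp)
  show "\<exists>!u. u \<in> T -> P \<and> p \<cdot> u = a \<and> (c \<cdot> f) \<cdot> u = b"
   by (rule ex1I[of _ u]) (use u(1,2) cfub uniq in blast)+
 qed
 then have "c \<cdot> f \<in> S" by (rule bin_product_cover)
 then show ?thesis using S_cancelD[OF f c(1) fS] by blast
qed

end

context geometric
begin

text \<open>The comparison maps of lower dimension are needed to construct the matching object;
  \<open>group_comparison_cover\<close> then shows the next one to be a cover.\<close>

lemma group_inf_groupoid_matched:
 assumes G: "simplicial_group_object C G" and Z: "simplicial_map C (Gob G) Z \<psi>" "\<And>n. is_terminal C (level Z n)"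
  and n: "1 \<le> n" "k \<le> n"
 shows "rel_matching_cover C S (horn n k) n (Gob G, Z, \<psi>)"
 using n
proof (induction n arbitrary: k rule: less_induct)
 case (less n)
 interpret Z: geometric_map C S D S' F "Gob G" Z \<psi> by (rule geometric_mapI[OF Z(1)])
 obtain L x y where L: "Z.matched (horn n k) n L x y"
  using inf_groupoid_matched[OF Z.geometric_map_axioms Z(2) less.prems less.IH] by blast
 have M: "is_rel_matching C (horn n k) n (Gob G, Z, \<psi>) L x y" using L by (simp add: Z.matched_def)
 obtain c where c: "c \<in> (level (Gob G) n) -> L" "\<And>\<mu>. \<mu> \<in> horn n k ==> x \<mu> \<cdot> c = sop C (Gob G) n \<mu>" "y \<cdot> c = \<psi> n"
  using Z.rel_matching_comparison[OF M ssubset_horn[OF less.prems(2)]] by metis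
 have "c \<in> S" using C.group_comparison_cover[OF G Z less.prems M c(1,2)] by blast
 then show ?case using Z.rel_matching_coverI[OF M _ c] by blast
qed

end

section \<open>Simplicial identities for a recursive model of \<open>Wbar\<close>\<close>

section \<open>The classifying space of a simplicial group\<close>

text \<open>\<open>W\<close> is a model of \<open>Wbar X\<close>: an \<open>(n + 1)\<close>-simplex is a pair consisting of its leading coordinate
 \<open>top\<close> and of its face \<open>d\<^sub>0\<close>, and these determine faces and degeneracies recursively.\<close>

locale classifying_set = simplicial_group X mul one inv
 for X :: "'a sset" and mul one inv +
 fixes W :: "'b sset" and top :: "nat => 'b => 'a"
 assumes W_0: "\<And>z z'. z \<in> pts W 0 ==> z' \<in> pts W 0 ==> z = z'"
  and top_pts: "\<And>n z. z \<in> pts W (Suc n) ==> top n z \<in> pts X n"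
  and W_fc: "\<And>n i z. i \<le> Suc n ==> z \<in> pts W (Suc n) ==> fc W n i z \<in> pts W n"
  and W_dg: "\<And>n i z. i \<le> n ==> z \<in> pts W n ==> dg W n i z \<in> pts W (Suc n)"
  and W_ext: "\<And>n z z'. z \<in> pts W (Suc n) ==> z' \<in> pts W (Suc n) ==> top n z = top n z' ==>
   fc W n 0 z = fc W n 0 z' ==> z = z'"
  and W_cons: "\<And>n g w. g \<in> pts X n ==> w \<in> pts W n ==> \<exists>z\<in>pts W (Suc n). top n z = g \<and> fc W n 0 z = w"
  and top_fc_1: "\<And>n z. z \<in> pts W (Suc (Suc n)) ==>
   top n (fc W (Suc n) 1 z) = mul n (fc X n 0 (top (Suc n) z)) (top n (fc W (Suc n) 0 z))"
  and top_fc: "\<And>n i z. 1 \<le> i ==> i \<le> Suc n ==> z \<in> pts W (Suc (Suc n)) ==>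
   top n (fc W (Suc n) (Suc i) z) = fc X n i (top (Suc n) z)"
  and fc0_fc: "\<And>n i z. i \<le> Suc n ==> z \<in> pts W (Suc (Suc n)) ==>
   fc W n 0 (fc W (Suc n) (Suc i) z) = fc W n i (fc W (Suc n) 0 z)"
  and top_dg_0: "\<And>n z. z \<in> pts W n ==> top n (dg W n 0 z) = one n"
  and fc0_dg_0: "\<And>n z. z \<in> pts W n ==> fc W n 0 (dg W n 0 z) = z"
  and top_dg: "\<And>n i z. i \<le> n ==> z \<in> pts W (Suc n) ==>
   top (Suc n) (dg W (Suc n) (Suc i) z) = dg X n i (top n z)"
  and fc0_dg: "\<And>n i z. i \<le> n ==> z \<in> pts W (Suc n) ==>
   fc W (Suc n) 0 (dg W (Suc n) (Suc i) z) = dg W n i (fc W n 0 z)"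
begin

text \<open>Both sides are compared by \<open>d_0\<close> and by leading coordinate. The
  \<open>d_0\<close> parts agree by induction. In the leading coordinate only \<open>d_1\<close>
  multiplies two entries, so the cases depend on where a \<open>d_1\<close> occurs.\<close>

lemma W_fc_fc:
 "i < j ==> j \<le> Suc (Suc n) ==> z \<in> pts W (Suc (Suc n)) ==>
  fc W n i (fc W (Suc n) j z) = fc W n (j - 1) (fc W (Suc n) i z)"
proof (induction n arbitrary: i j z)
 case 0
 then show ?case by (intro W_0 W_fc) auto
next
 case (Suc m)
 obtain j' where j: "j = Suc j'" using Suc.prems by (cases j) auto
 let ?n = "Suc m" and ?z0 = "fc W (Suc (Suc m)) 0 z" and ?t = "top (Suc (Suc m)) z"
 note z = Suc.prems(3)
 have z0: "?z0 \<in> pts W (Suc ?n)" and t: "?t \<in> pts X (Suc ?n)" using W_fc top_pts z by auto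
 show ?case
 proof (cases i)
  case 0
  then show ?thesis using fc0_fc[of j' ?n z] Suc.prems j by simp
 next
  case (Suc i')
  have ij: "i' < j'" "j' \<le> Suc ?n" "i' \<le> ?n" using Suc.prems j Suc by auto
  obtain j'' where j'': "j' = Suc j''" using ij by (cases j') auto
  let ?u = "fc W (Suc ?n) (Suc j') z" and ?v = "fc W (Suc ?n) (Suc i') z"
  have u: "?u \<in> pts W (Suc ?n)" and v: "?v \<in> pts W (Suc ?n)" using W_fc z ij by auto
  have "fc W ?n (Suc i') ?u = fc W ?n j' ?v"
  proof (rule W_ext)
   show "fc W ?n (Suc i') ?u \<in> pts W ?n" "fc W ?n j' ?v \<in> pts W ?n" using W_fc u v ij by auto
   show "fc W m 0 (fc W ?n (Suc i') ?u) = fc W m 0 (fc W ?n j' ?v)"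
    using fc0_fc[of i' m ?u] fc0_fc[of j'' m ?v] fc0_fc[of j' ?n z] fc0_fc[of i' ?n z]
     Suc.IH[of i' j' ?z0] ij j'' u v z z0 by simp
   have tu: "top ?n ?u = fc X ?n j' ?t" using top_fc[of j' ?n z] ij z by simp
   show "top m (fc W ?n (Suc i') ?u) = top m (fc W ?n j' ?v)"
   proof (cases i')
    case 0
    have tv: "top ?n ?v = mul ?n (fc X ?n 0 ?t) (top ?n ?z0)" using top_fc_1[OF z] 0 by simp
    have l: "top m (fc W ?n (Suc i') ?u) = mul m (fc X m 0 (fc X ?n j' ?t)) (top m (fc W ?n j' ?z0))"
     using top_fc_1[OF u] tu fc0_fc[of j' ?n z] ij z 0 by simp
    have tz0: "top ?n ?z0 \<in> pts X ?n" "fc X ?n 0 ?t \<in> pts X ?n" using top_pts z0 fc_pts t by auto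
    show ?thesis
    proof (cases j'')
     \<comment> \<open>The identity \<open>d_1 d_2 = d_1 d_1\<close>, where three entries are
       multiplied: associativity and the multiplicativity of \<open>d_0\<close> make it
       hold.\<close>
     case 0
     have "top m (fc W ?n j' ?v) = mul m (fc X m 0 (top ?n ?v)) (top m (fc W ?n 0 ?v))"
      using top_fc_1[OF v] j'' 0 by simp
     also have "\<dots> = mul m (mul m (fc X m 0 (fc X ?n 0 ?t)) (fc X m 0 (top ?n ?z0))) (top m (fc W ?n 0 ?z0))"
      using tv fc_mul[of 0 m, OF _ tz0(2,1)] fc0_fc[of 0 ?n z] z \<open>i' = 0\<close> by simp
     also have "\<dots> = mul m (fc X m 0 (fc X ?n 0 ?t)) (mul m (fc X m 0 (top ?n ?z0)) (top m (fc W ?n 0 ?z0)))"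
      by (rule mul_assoc) (use fc_pts tz0 top_pts W_fc z0 in auto)
     also have "\<dots> = mul m (fc X m 0 (fc X ?n j' ?t)) (top m (fc W ?n j' ?z0))"
      using top_fc_1[OF z0] fc_fc[of 0 1 m ?t] t j'' 0 by simp
     finally show ?thesis using l by simp
    next
     case (Suc l')
     have "top m (fc W ?n j' ?v) = fc X m j'' (top ?n ?v)" using top_fc[of j'' m ?v] v ij j'' Suc by simp
     also have "\<dots> = mul m (fc X m j'' (fc X ?n 0 ?t)) (fc X m j'' (top ?n ?z0))"
      using tv fc_mul[of j'' m, OF _ tz0(2,1)] ij j'' by simp
     also have "\<dots> = mul m (fc X m 0 (fc X ?n j' ?t)) (top m (fc W ?n j' ?z0))"
      using fc_fc[of 0 j' m ?t] t ij j'' top_fc[of j'' m ?z0] z0 Suc by simp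
     finally show ?thesis using l by simp
    qed
   next
    case (Suc l)
    have "top m (fc W ?n (Suc i') ?u) = fc X m i' (fc X ?n j' ?t)"
     using top_fc[of i' m ?u] u tu ij Suc by simp
    also have "\<dots> = fc X m j'' (fc X ?n i' ?t)" using fc_fc[of i' j' m ?t] t ij j'' by simp
    also have "\<dots> = top m (fc W ?n j' ?v)"
     using top_fc[of j'' m ?v] v top_fc[of i' ?n z] z ij j'' Suc by simp
    finally show ?thesis .
   qed
  qed
  then show ?thesis using j Suc by simp
 qed
qed

lemma W_dg_dg:
 "i \<le> j ==> j \<le> n ==> z \<in> pts W n ==>
  dg W (Suc n) i (dg W n j z) = dg W (Suc n) (Suc j) (dg W n i z)"
proof (induction n arbitrary: i j z)
 case 0
 have d: "dg W 0 0 z \<in> pts W 1" using W_dg[of 0 0 z] 0 by simp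
 have "dg W (Suc 0) 0 (dg W 0 0 z) = dg W (Suc 0) (Suc 0) (dg W 0 0 z)"
  by (rule W_ext[of _ 1])
   (use 0 d W_dg[of 0 1 "dg W 0 0 z"] W_dg[of 1 1 "dg W 0 0 z"]
    top_dg_0[of "dg W 0 0 z" 1] top_dg[of 0 0 "dg W 0 0 z"] top_dg_0[of z 0] dg_one[of 0 0]
    fc0_dg_0[of "dg W 0 0 z" 1] fc0_dg[of 0 0 "dg W 0 0 z"] fc0_dg_0[of z 0] in simp_all)
 then show ?case using 0 by simp
next
 case (Suc m)
 let ?n = "Suc m"
 note z = Suc.prems(3)
 have d: "dg W ?n j z \<in> pts W (Suc ?n)" "dg W ?n i z \<in> pts W (Suc ?n)" using W_dg z Suc.prems by auto
 show ?case
 proof (rule W_ext)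
  show "dg W (Suc ?n) i (dg W ?n j z) \<in> pts W (Suc (Suc ?n))" "dg W (Suc ?n) (Suc j) (dg W ?n i z) \<in> pts W (Suc (Suc ?n))"
   using W_dg d Suc.prems by auto
  have r: "top (Suc ?n) (dg W (Suc ?n) (Suc j) (dg W ?n i z)) = dg X ?n j (top ?n (dg W ?n i z))"
   "fc W (Suc ?n) 0 (dg W (Suc ?n) (Suc j) (dg W ?n i z)) = dg W ?n j (fc W ?n 0 (dg W ?n i z))"
   using top_dg[of j ?n "dg W ?n i z"] fc0_dg[of j ?n "dg W ?n i z"] d Suc.prems by simp_all
  show "top (Suc ?n) (dg W (Suc ?n) i (dg W ?n j z)) = top (Suc ?n) (dg W (Suc ?n) (Suc j) (dg W ?n i z))"
  proof (cases i)
   case 0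
   then show ?thesis using r(1) top_dg_0[OF d(1)] top_dg_0[OF z] dg_one[of j ?n] Suc.prems by simp
  next
   case (Suc i')
   then obtain j' where j: "j = Suc j'" using Suc.prems by (cases j) auto
   have t: "top m z \<in> pts X m" using top_pts[OF z] .
   show ?thesis using r(1) top_dg[of i' ?n "dg W ?n j z"] d top_dg[of j' m z] top_dg[of i' m z] z Suc j
     Suc.prems dg_dg[of i' j' m "top m z"] t by simp
  qed
  show "fc W (Suc ?n) 0 (dg W (Suc ?n) i (dg W ?n j z)) = fc W (Suc ?n) 0 (dg W (Suc ?n) (Suc j) (dg W ?n i z))"
  proof (cases i)
   case 0
   then show ?thesis using r(2) fc0_dg_0[OF d(1)] fc0_dg_0[OF z] by simp
  next
   case (Suc i')
   then obtain j' where j: "j = Suc j'" using Suc.prems by (cases j) auto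
   show ?thesis using r(2) fc0_dg[of i' ?n "dg W ?n j z"] d fc0_dg[of j' m z] fc0_dg[of i' m z] z Suc j
     Suc.prems Suc.IH[of i' j' "fc W m 0 z"] W_fc[of 0 m z] by simp
  qed
 qed
qed

lemma W_fc_dg_less:
 "i < j ==> j \<le> Suc n ==> z \<in> pts W (Suc n) ==>
  fc W (Suc n) i (dg W (Suc n) j z) = dg W n (j - 1) (fc W n i z)"
proof (induction n arbitrary: i j z)
 case 0
 then have e: "i = 0" "j = 1" by auto
 show ?case unfolding e using fc0_dg[of 0 0 z] 0(3) by simp
next
 case (Suc m)
 let ?n = "Suc m"
 note z = Suc.prems(3)
 obtain j' where j: "j = Suc j'" using Suc.prems by (cases j) auto
 let ?y = "dg W (Suc ?n) (Suc j') z" and ?z0 = "fc W ?n 0 z" and ?t = "top ?n z"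
 have y: "?y \<in> pts W (Suc (Suc ?n))" using W_dg z Suc.prems j by auto
 have z0: "?z0 \<in> pts W ?n" and t: "?t \<in> pts X ?n" using W_fc top_pts z by auto
 have y0: "fc W (Suc ?n) 0 ?y = dg W ?n j' ?z0" and ty: "top (Suc ?n) ?y = dg X ?n j' ?t"
  using fc0_dg[of j' ?n z] top_dg[of j' ?n z] z Suc.prems j by simp_all
 show ?case
 proof (cases i)
  case 0
  then show ?thesis using y0 j by simp
 next
  case (Suc i')
  then obtain j'' where j'': "j' = Suc j''" using Suc.prems j by (cases j') auto
  have ij: "i' < j'" "j' \<le> ?n" "j'' \<le> m" "i' \<le> m" using Suc.prems j j'' Suc by auto
  let ?v = "fc W ?n (Suc i') z"
  have v: "?v \<in> pts W ?n" using W_fc z ij by auto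
  have "fc W (Suc ?n) (Suc i') ?y = dg W ?n j' ?v"
  proof (rule W_ext)
   show "fc W (Suc ?n) (Suc i') ?y \<in> pts W (Suc ?n)" "dg W ?n j' ?v \<in> pts W (Suc ?n)"
    using W_fc W_dg y v ij by auto
   show "fc W ?n 0 (fc W (Suc ?n) (Suc i') ?y) = fc W ?n 0 (dg W ?n j' ?v)"
    using fc0_fc[of i' ?n ?y] y y0 fc0_dg[of j'' m ?v] v fc0_fc[of i' m z] z Suc.IH[of i' j' ?z0] z0 ij j'' by simp
   have r: "top ?n (dg W ?n j' ?v) = dg X m j'' (top m ?v)" using top_dg[of j'' m ?v] v ij j'' by simp
   show "top ?n (fc W (Suc ?n) (Suc i') ?y) = top ?n (dg W ?n j' ?v)"
   proof (cases i')
    case 0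
    have "top ?n (fc W (Suc ?n) (Suc i') ?y) = mul ?n (fc X ?n 0 (dg X ?n j' ?t)) (dg X m j'' (top m ?z0))"
     using top_fc_1[OF y] 0 ty y0 top_dg[of j'' m ?z0] z0 ij j'' by simp
    also have "\<dots> = dg X m j'' (mul m (fc X m 0 ?t) (top m ?z0))"
     using fc_dg_less[of 0 j' m ?t] dg_mul[of j'' m "fc X m 0 ?t" "top m ?z0"] t fc_pts top_pts z0 ij j'' by simp
    finally show ?thesis using r top_fc_1[OF z] 0 by simp
   next
    case (Suc l)
    then show ?thesis
     using top_fc[of i' ?n ?y] y ty r top_fc[of i' m z] z fc_dg_less[of i' j' m ?t] t ij j'' by simp
   qed
  qed
  then show ?thesis using j Suc by simp
 qed
qed

text \<open>Both unit laws enter: in \<open>d_1 s_0\<close> the inserted unit is multiplied on the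
  left, in \<open>d_1 s_1\<close> on the right.\<close>

lemma W_fc_dg_id: "i = j \<or> i = Suc j ==> j \<le> n ==> z \<in> pts W n ==> fc W n i (dg W n j z) = z"
proof (induction n arbitrary: i j z)
 case 0
 then show ?case using W_fc W_dg by (intro W_0) auto
next
 case (Suc m)
 let ?n = "Suc m" and ?z0 = "fc W m 0 z" and ?t = "top m z"
 note z = Suc.prems(3)
 have z0: "?z0 \<in> pts W m" and t: "?t \<in> pts X m" using W_fc top_pts z by auto
 have y: "dg W ?n j z \<in> pts W (Suc ?n)" using W_dg z Suc.prems by auto
 show ?case
 proof (cases i)
  case 0
  then show ?thesis using Suc.prems fc0_dg_0[OF z] by simp
 next
  case (Suc i')
  show ?thesis
  proof (rule W_ext)
   show "fc W ?n i (dg W ?n j z) \<in> pts W ?n" using W_fc y Suc.prems by auto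
   show "z \<in> pts W ?n" by (rule z)
   show "top m (fc W ?n i (dg W ?n j z)) = ?t"
   proof (cases j)
    case 0
    then have "i = 1" using Suc.prems Suc by auto
    then show ?thesis
     using top_fc_1[OF y] 0 top_dg_0[OF z] fc0_dg_0[OF z] fc_one[of 0 m] one_mul[OF t] by simp
   next
    case j: (Suc j')
    have i': "i' = j' \<or> i' = Suc j'" "j' \<le> m" "i' \<le> Suc m" using Suc.prems Suc j by auto
    have ty: "top ?n (dg W ?n j z) = dg X m j' ?t" using top_dg[of j' m z] z i' j by simp
    show ?thesis
    proof (cases i')
     case 0
     then have "j' = 0" using i' by simp
     then show ?thesis
      using top_fc_1[OF y] ty 0 Suc j fc0_dg[of 0 m z] z top_dg_0[OF z0] fc_dg_id[of 0 0 m ?t] t mul_one[OF t] by simp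
    next
     case l: (Suc l)
     then show ?thesis using top_fc[of i' m, OF _ _ y] ty Suc i' fc_dg_id[of i' j' m ?t] t by simp
    qed
   qed
   show "fc W m 0 (fc W ?n i (dg W ?n j z)) = ?z0"
   proof (cases j)
    case 0
    then have "i = 1" using Suc.prems Suc by auto
    then show ?thesis using fc0_fc[of 0 m, OF _ y] 0 fc0_dg_0[OF z] by simp
   next
    case j: (Suc j')
    have i': "i' = j' \<or> i' = Suc j'" "j' \<le> m" "i' \<le> Suc m" using Suc.prems Suc j by auto
    then show ?thesis using fc0_fc[of i' m, OF _ y] fc0_dg[of j' m z] z Suc.IH[of i' j' ?z0] z0 Suc j by simp
   qed
  qed
 qed
qed

lemma W_fc_dg_greater:
 "Suc j < i ==> i \<le> Suc (Suc n) ==> z \<in> pts W (Suc n) ==>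
  fc W (Suc n) i (dg W (Suc n) j z) = dg W n j (fc W n (i - 1) z)"
proof (induction n arbitrary: i j z)
 case 0
 then have e: "i = 2" "j = 0" by auto
 have y: "dg W 1 0 z \<in> pts W 2" using W_dg[of 0 1 z] 0 by (simp add: numeral_2_eq_2)
 have w: "fc W 0 1 z \<in> pts W 0" using W_fc[of 1 0 z] 0 by simp
 have z: "z \<in> pts W (Suc 0)" using 0 by simp
 have "fc W 1 2 (dg W 1 0 z) = dg W 0 0 (fc W 0 1 z)"
  by (rule W_ext[of _ 0])
   (use W_fc[of 2 1 "dg W 1 0 z"] y W_dg[of 0 0, OF _ w] top_fc[of 1 0 "dg W 1 0 z"] top_dg_0[OF z] fc_one[of 1 0]
    top_dg_0[OF w] fc0_fc[of 1 0 "dg W 1 0 z"] fc0_dg_0[OF z] fc0_dg_0[OF w] in \<open>simp_all add: numeral_2_eq_2\<close>)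
 then show ?case by (simp add: e)
next
 case (Suc m)
 let ?n = "Suc m" and ?z0 = "fc W (Suc m) 0 z" and ?t = "top (Suc m) z"
 note z = Suc.prems(3)
 obtain i' where i: "i = Suc i'" using Suc.prems by (cases i) auto
 then obtain i'' where i'': "i' = Suc i''" using Suc.prems by (cases i') auto
 have z0: "?z0 \<in> pts W ?n" and t: "?t \<in> pts X ?n" using W_fc top_pts z by auto
 have y: "dg W (Suc ?n) j z \<in> pts W (Suc (Suc ?n))" using W_dg z Suc.prems by auto
 have v: "fc W ?n i' z \<in> pts W ?n" using W_fc z Suc.prems i by auto
 have b: "i' \<le> Suc ?n" "j < i'" "j \<le> ?n" using Suc.prems i by auto
 have "fc W (Suc ?n) (Suc i') (dg W (Suc ?n) j z) = dg W ?n j (fc W ?n i' z)"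
 proof (rule W_ext)
  show "fc W (Suc ?n) (Suc i') (dg W (Suc ?n) j z) \<in> pts W (Suc ?n)" "dg W ?n j (fc W ?n i' z) \<in> pts W (Suc ?n)"
   using W_fc W_dg y v b by auto
  have tl: "top ?n (fc W (Suc ?n) (Suc i') (dg W (Suc ?n) j z)) = fc X ?n i' (top (Suc ?n) (dg W (Suc ?n) j z))"
   using top_fc[of i' ?n, OF _ _ y] b i'' by simp
  have dl: "fc W ?n 0 (fc W (Suc ?n) (Suc i') (dg W (Suc ?n) j z)) = fc W ?n i' (fc W (Suc ?n) 0 (dg W (Suc ?n) j z))"
   using fc0_fc[of i' ?n, OF _ y] b by simp
  show "top ?n (fc W (Suc ?n) (Suc i') (dg W (Suc ?n) j z)) = top ?n (dg W ?n j (fc W ?n i' z))"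
  proof (cases j)
   case 0
   then show ?thesis using tl top_dg_0[OF z] top_dg_0[OF v] fc_one[of i' ?n] b by simp
  next
   case (Suc j')
   then show ?thesis
    using tl top_dg[of j' ?n z] z top_dg[of j' m "fc W ?n i' z"] v top_fc[of i'' m z] b i''
     fc_dg_greater[of j' i' m ?t] t by simp
  qed
  show "fc W ?n 0 (fc W (Suc ?n) (Suc i') (dg W (Suc ?n) j z)) = fc W ?n 0 (dg W ?n j (fc W ?n i' z))"
  proof (cases j)
   case 0
   then show ?thesis using dl fc0_dg_0[OF z] fc0_dg_0[OF v] by simp
  next
   case (Suc j')
   then show ?thesis
    using dl fc0_dg[of j' ?n z] z fc0_dg[of j' m "fc W ?n i' z"] v fc0_fc[of i'' m z] b i''
     Suc.IH[of j' i' ?z0] z0 by simp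
  qed
 qed
 then show ?case by (simp add: i)
qed

sublocale W: simplicial_set W
 by unfold_locales (fact W_fc W_dg W_fc_fc W_dg_dg W_fc_dg_less W_fc_dg_id W_fc_dg_greater)+

end

section \<open>A horn in \<open>Wbar\<close> as one prescribed face and a horn in the group\<close>

subsection \<open>Horns in the classifying space\<close>

text \<open>The join of a new initial vertex with \<open>\<nu>\<close>, whose vertices move up by
  one. Values of a point on such simplices are simplices of the decalage.\<close>

definition cone_list :: "nat list => nat list" where
 "cone_list \<nu> = 0 # map Suc \<nu>"

lemma dim_cone_list [simp]: "\<nu> \<noteq> [] ==> dim (cone_list \<nu>) = Suc (dim \<nu>)"
 by (cases \<nu>) (simp_all add: cone_list_def)

lemma del_nth_cone_list: "del_nth (Suc i) (cone_list \<nu>) = cone_list (del_nth i \<nu>)"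
 and dup_nth_cone_list: "dup_nth (Suc i) (cone_list \<nu>) = cone_list (dup_nth i \<nu>)"
 by (simp_all add: cone_list_def del_nth_map dup_nth_map)

lemma cone_list_upt: "cone_list [0..<Suc m] = [0..<Suc (Suc m)]"
 unfolding cone_list_def by (metis map_Suc_upt upt_conv_Cons zero_less_Suc)

lemma map_Suc_std_simplex: "\<nu> \<in> std_simplex m ==> map Suc \<nu> \<in> std_simplex (Suc m)"
 by (auto simp: std_simplex_def sorted_map)

lemma cone_list_std_simplex: "\<nu> \<in> std_simplex m ==> cone_list \<nu> \<in> std_simplex (Suc m)"
 by (auto simp: std_simplex_def sorted_map cone_list_def)

lemma std_simplex_Suc_cases:
 assumes "\<mu> \<in> std_simplex (Suc m)" "0 \<notin> set \<mu>"
 obtains \<nu> where "\<nu> \<in> std_simplex m" "\<mu> = map Suc \<nu>"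
proof
 have "map (Suc \<circ> (\<lambda>v. v - 1)) \<mu> = \<mu>"
  by (rule map_idI) (use assms(2) in \<open>metis comp_apply diff_Suc_1 not0_implies_Suc\<close>)
 then show "\<mu> = map Suc (map (\<lambda>v. v - 1) \<mu>)" by simp
 show "map (\<lambda>v. v - 1) \<mu> \<in> std_simplex m"
  using assms by (force simp: std_simplex_def sorted_map intro: sorted_wrt_mono_rel[of \<mu> "(\<le>)"])
qed

lemma insert_Suc_atMost: "insert 0 (Suc ` A) = {..Suc m} \<longleftrightarrow> A = {..m}"
 by (simp add: atMost_Suc_eq_insert_0) (metis image_insert insert_ident inj_Suc inj_image_eq_iff imageE nat.distinct(1))

text \<open>A cone always contains the vertex 0, so only its base decides. For apex
  \<open>k + 1\<close> the bases form a horn, for apex 0 the whole boundary; this difference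
  separates the two treatments of horns below.\<close>

lemma cone_list_horn:
 assumes "\<nu> \<in> std_simplex m"
 shows "cone_list \<nu> \<in> horn (Suc m) (Suc k) \<longleftrightarrow> \<nu> \<in> horn m k"
  and "cone_list \<nu> \<in> horn (Suc m) 0 \<longleftrightarrow> \<nu> \<in> bdry m"
proof -
 have "insert (Suc k) (set (cone_list \<nu>)) = insert 0 (Suc ` insert k (set \<nu>))" by (auto simp: cone_list_def)
 then show "cone_list \<nu> \<in> horn (Suc m) (Suc k) \<longleftrightarrow> \<nu> \<in> horn m k"
  using assms cone_list_std_simplex[OF assms] insert_Suc_atMost[of "insert k (set \<nu>)" m] by (simp add: horn_def)
 have "insert 0 (set (cone_list \<nu>)) = insert 0 (Suc ` set \<nu>)" by (auto simp: cone_list_def)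
 then show "cone_list \<nu> \<in> horn (Suc m) 0 \<longleftrightarrow> \<nu> \<in> bdry m"
  using assms cone_list_std_simplex[OF assms] insert_Suc_atMost[of "set \<nu>" m] by (simp add: horn_def bdry_def)
qed

text \<open>Neither the apex nor the simplex contains the vertex 0. So for a positive apex the
  entire face opposite 0 is prescribed.\<close>

lemma map_Suc_horn: "\<nu> \<in> std_simplex m ==> map Suc \<nu> \<in> horn (Suc m) (Suc k)"
proof -
 assume t: "\<nu> \<in> std_simplex m"
 have "0 \<notin> insert (Suc k) (set (map Suc \<nu>))" "(0::nat) \<in> {..Suc m}" by auto
 then have "insert (Suc k) (set (map Suc \<nu>)) \<noteq> {..Suc m}" by metis
 then show ?thesis using map_Suc_std_simplex[OF t] by (simp add: horn_def)
qed

text \<open>Simplices with first vertex \<open>0\<close> are degenerations of cones.\<close>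

lemma horn_generated [consumes 3, case_names base cone dup apex]:
 assumes "\<mu> \<in> horn (Suc m) k" "1 \<le> m" "k \<le> Suc m"
  and base: "\<And>\<nu>. \<nu> \<in> std_simplex m ==> map Suc \<nu> \<in> horn (Suc m) k ==> P (map Suc \<nu>)"
  and cone: "\<And>\<nu>. \<nu> \<in> std_simplex m ==> cone_list \<nu> \<in> horn (Suc m) k ==> P (cone_list \<nu>)"
  and dup: "\<And>\<mu>. \<mu> \<in> horn (Suc m) k ==> P \<mu> ==> P (dup_nth 0 \<mu>)"
  and apex: "\<And>v. v \<le> m ==> cone_list [v] \<in> horn (Suc m) k ==> P (del_nth 1 (cone_list [v]))"
 shows "P \<mu>"
 using assms(1)
proof (induction \<mu>)
 case Nil
 then show ?case by (simp add: horn_def std_simplex_def)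
next
 case (Cons a r)
 note K = ssubset_horn[OF assms(3)]
 have s: "a # r \<in> std_simplex (Suc m)" using Cons.prems by (simp add: horn_def)
 show ?case
 proof (cases "a = 0")
  case False
  then have "0 \<notin> set (a # r)" using s by (auto simp: std_simplex_def)
  then show ?thesis using std_simplex_Suc_cases[OF s] base Cons.prems by metis
 next
  case a: True
  show ?thesis
  proof (cases "r = []")
   case True
   \<comment> \<open>Any edge of the horn issuing from 0 would do to reach the vertex
     \<open>[0]\<close> as a face. For positive \<open>k\<close> the edge to the apex is taken,
     otherwise the edge from 0 to 1.\<close>
   define v where "v = (if k = 0 then 0 else k - 1)"
   have v: "v \<le> m" "cone_list [v] \<in> horn (Suc m) k"
   proof -
    show "v \<le> m" using assms(3) by (auto simp: v_def)
    then have st: "[v] \<in> std_simplex m" by (simp add: std_simplex_def)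
    have "card {v} \<noteq> card {..m}" using assms(2) by simp
    then have ne: "{v} \<noteq> {..m}" by metis
    show "cone_list [v] \<in> horn (Suc m) k"
    proof (cases k)
     case 0
     then show ?thesis using cone_list_horn(2)[OF st] st ne by (simp add: bdry_def)
    next
     case (Suc k')
     then show ?thesis using cone_list_horn(1)[OF st, of k'] st ne by (simp add: horn_def v_def)
    qed
   qed
   have "del_nth 1 (cone_list [v]) = [0]" by (simp add: cone_list_def)
   then show ?thesis using apex[OF v] a True by simp
  next
   case False
   then have rs: "r \<in> std_simplex (Suc m)" using s by (auto simp: std_simplex_def)
   have rK: "r \<in> horn (Suc m) k" using K Cons.prems rs unfolding ssubset_def by (meson set_subset_Cons)
   show ?thesis
   proof (cases "0 \<in> set r")
    case True
    then obtain r' where "r = 0 # r'" using rs by (cases r) (auto simp: std_simplex_def)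
    then show ?thesis using dup[OF rK Cons.IH[OF rK]] a by simp
   next
    case False
    then obtain \<nu> where "\<nu> \<in> std_simplex m" "r = map Suc \<nu>" using std_simplex_Suc_cases[OF rs] by metis
    then show ?thesis using cone[of \<nu>] Cons.prems a by (simp add: cone_list_def)
   qed
  qed
 qed
qed

context simplicial_set
begin

text \<open>Deletion and duplication at positive positions keep the apex, and these are the
  operators of the decalage.\<close>

lemma spoint_cone_list:
 assumes x: "spoint K X x" and K: "\<And>\<nu>. \<nu> \<in> A ==> cone_list \<nu> \<in> K \<and> \<nu> \<noteq> []"
 shows "spoint A (dec X) (\<lambda>\<nu>. x (cone_list \<nu>))"
 unfolding spoint_def
proof (intro conjI ballI allI impI)
 fix \<nu> assume t: "\<nu> \<in> A"
 note K = K[OF t]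
 have d: "dim (cone_list \<nu>) = Suc (dim \<nu>)" using K by simp
 show "x (cone_list \<nu>) \<in> pts (dec X) (dim \<nu>)" using spoint_pts[OF x] K d by (fastforce simp: dec_def)
 fix m i
 show "x (cone_list (del_nth i \<nu>)) = fc (dec X) m i (x (cone_list \<nu>))" if "dim \<nu> = Suc m" "i \<le> Suc m"
  using spoint_del[OF x, of "cone_list \<nu>" "Suc m" "Suc i"] K d that by (simp add: del_nth_cone_list dec_def)
 show "x (cone_list (dup_nth i \<nu>)) = dg (dec X) m i (x (cone_list \<nu>))" if "dim \<nu> = m" "i \<le> m"
  using spoint_dup[OF x, of "cone_list \<nu>" "Suc i"] K d that by (simp add: dup_nth_cone_list dec_def)
qed

lemma spoint_map_Suc:
 assumes x: "spoint K X x" and K: "\<And>\<nu>. \<nu> \<in> A ==> map Suc \<nu> \<in> K"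
 shows "spoint A X (\<lambda>\<nu>. x (map Suc \<nu>))"
 unfolding spoint_def
proof (intro conjI ballI allI impI)
 fix \<nu> assume t: "\<nu> \<in> A"
 note K = K[OF t]
 show "x (map Suc \<nu>) \<in> pts X (dim \<nu>)" using spoint_pts[OF x K] by simp
 fix m i
 show "x (map Suc (del_nth i \<nu>)) = fc X m i (x (map Suc \<nu>))" if "dim \<nu> = Suc m" "i \<le> Suc m"
  using spoint_del[OF x K, of m i] that by (simp add: del_nth_map)
 show "x (map Suc (dup_nth i \<nu>)) = dg X m i (x (map Suc \<nu>))" if "dim \<nu> = m" "i \<le> m"
  using spoint_dup[OF x K, of i] that by (simp add: dup_nth_map)
qed

lemma sact_cone_list:
 assumes "z \<in> pts X (Suc m)" "\<nu> \<in> std_simplex m"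
 shows "sact X (Suc m) (cone_list \<nu>) z = sact (dec X) m \<nu> z"
proof -
 have "spoint (std_simplex m) (dec X) (\<lambda>\<nu>. sact X (Suc m) (cone_list \<nu>) z)"
  by (rule spoint_cone_list[OF spoint_std_sact(1)[OF assms(1)]])
   (use cone_list_std_simplex in \<open>auto simp: std_simplex_def\<close>)
 from sact_eq[OF this assms(2)] show ?thesis
  unfolding cone_list_upt using sact_upt[OF assms(1)] by simp
qed

lemma sact_map_Suc:
 assumes "z \<in> pts X (Suc m)" "\<nu> \<in> std_simplex m"
 shows "sact X (Suc m) (map Suc \<nu>) z = sact X m \<nu> (fc X m 0 z)"
proof -
 have "spoint (std_simplex m) X (\<lambda>\<nu>. sact X (Suc m) (map Suc \<nu>) z)"
  by (rule spoint_map_Suc[OF spoint_std_sact(1)[OF assms(1)] map_Suc_std_simplex])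
 from sact_eq[OF this assms(2)] have "sact X m \<nu> (sact X (Suc m) (map Suc [0..<Suc m]) z) = sact X (Suc m) (map Suc \<nu>) z" .
 moreover have "map Suc [0..<Suc m] = del_nth 0 [0..<Suc (Suc m)]"
  using cone_list_upt[of m] by (simp add: cone_list_def del: upt_Suc) (metis del_nth_0)
 ultimately show ?thesis using sact_face[OF assms(1), of 0] by (simp del: upt_Suc)
qed

lemma fc0_sact_dec:
 assumes "z \<in> pts X (Suc m)" "\<nu> \<in> std_simplex m"
 shows "fc X (dim \<nu>) 0 (sact (dec X) m \<nu> z) = sact X m \<nu> (fc X m 0 z)"
proof -
 have "\<nu> \<noteq> []" using assms(2) by (auto simp: std_simplex_def)
 then have "sact X (Suc m) (del_nth 0 (cone_list \<nu>)) z = fc X (dim \<nu>) 0 (sact X (Suc m) (cone_list \<nu>) z)"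
  using sact_del_nth[OF assms(1) cone_list_std_simplex[OF assms(2)]] by simp
 then show ?thesis using sact_cone_list[OF assms] sact_map_Suc[OF assms] by (simp add: cone_list_def)
qed

lemma sact_dec_pts: "z \<in> pts X (Suc m) ==> \<nu> \<in> std_simplex m ==> sact (dec X) m \<nu> z \<in> pts X (Suc (dim \<nu>))"
 using simplicial_set.sact_pts[OF simplicial_set_dec[OF simplicial_set_axioms], of z m \<nu>] by (simp add: dec_def)

end

context classifying_set
begin

text \<open>Two simplices of the decalage of \<open>W\<close> over the same simplex of \<open>W\<close> differ by a simplex of \<open>X\<close>.\<close>

lemma spoint_difference:
 assumes K: "ssubset n K" and x: "spoint K (dec W) x" and y: "spoint K (dec W) y"
  and e: "\<And>\<nu>. \<nu> \<in> K ==> fc W (dim \<nu>) 0 (x \<nu>) = fc W (dim \<nu>) 0 (y \<nu>)"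
 shows "spoint K X (\<lambda>\<nu>. mul (dim \<nu>) (top (dim \<nu>) (x \<nu>)) (inv (dim \<nu>) (top (dim \<nu>) (y \<nu>))))"
 unfolding spoint_def
proof (intro conjI ballI allI impI)
 fix \<nu> assume t: "\<nu> \<in> K"
 have xy: "x \<nu> \<in> pts W (Suc (dim \<nu>))" "y \<nu> \<in> pts W (Suc (dim \<nu>))"
  using spoint_pts[OF x t] spoint_pts[OF y t] by (simp_all add: dec_def)
 note txy = top_pts[OF xy(1)] top_pts[OF xy(2)]
 show "mul (dim \<nu>) (top (dim \<nu>) (x \<nu>)) (inv (dim \<nu>) (top (dim \<nu>) (y \<nu>))) \<in> pts X (dim \<nu>)"
  using txy mul_pts inv_pts by blast
 have ne: "\<nu> \<noteq> []" using ssubset_Nil[OF K] t by blast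
 fix m i
 show "mul (dim (del_nth i \<nu>)) (top (dim (del_nth i \<nu>)) (x (del_nth i \<nu>))) (inv (dim (del_nth i \<nu>)) (top (dim (del_nth i \<nu>)) (y (del_nth i \<nu>)))) =
   fc X m i (mul (dim \<nu>) (top (dim \<nu>) (x \<nu>)) (inv (dim \<nu>) (top (dim \<nu>) (y \<nu>))))"
  if d: "dim \<nu> = Suc m" "i \<le> Suc m"
 proof -
  let ?tx = "top (Suc m) (x \<nu>)" and ?ty = "top (Suc m) (y \<nu>)"
  have p: "x \<nu> \<in> pts W (Suc (Suc m))" "y \<nu> \<in> pts W (Suc (Suc m))" using xy d by simp_all
  have tp: "?tx \<in> pts X (Suc m)" "?ty \<in> pts X (Suc m)" using txy d by simp_all
  have dl: "x (del_nth i \<nu>) = fc W (Suc m) (Suc i) (x \<nu>)" "y (del_nth i \<nu>) = fc W (Suc m) (Suc i) (y \<nu>)"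
   using spoint_del[OF x t d] spoint_del[OF y t d] by (simp_all add: dec_def)
  have r: "fc X m i (mul (Suc m) ?tx (inv (Suc m) ?ty)) = mul m (fc X m i ?tx) (inv m (fc X m i ?ty))"
   using fc_mul[OF d(2) tp(1) inv_pts[OF tp(2)]] fc_inv[OF d(2) tp(2)] by simp
  have "mul m (top m (fc W (Suc m) (Suc i) (x \<nu>))) (inv m (top m (fc W (Suc m) (Suc i) (y \<nu>)))) = mul m (fc X m i ?tx) (inv m (fc X m i ?ty))"
  proof (cases i)
   case 0
   let ?a = "fc X m 0 ?tx" and ?b = "fc X m 0 ?ty" and ?c = "top m (fc W (Suc m) 0 (x \<nu>))"
   have ab: "?a \<in> pts X m" "?b \<in> pts X m" "?c \<in> pts X m" using fc_pts tp top_pts W_fc p by auto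
   \<comment> \<open>Under \<open>d_1\<close> both leading coordinates acquire the same right
     factor, that of the common \<open>d_0\<close>, and it cancels from the quotient.\<close>
   have "inv m (mul m ?b ?c) = mul m (inv m ?c) (inv m ?b)"
    by (rule inv_eqI[symmetric]) (use ab in \<open>simp_all add: mul_pts inv_pts mul_assoc mul_inv_cancel mul_inv\<close>)
   then have "mul m (mul m ?a ?c) (inv m (mul m ?b ?c)) = mul m ?a (inv m ?b)"
    using ab by (simp add: mul_pts inv_pts mul_assoc mul_inv_cancel)
   moreover have "fc W (Suc m) 0 (x \<nu>) = fc W (Suc m) 0 (y \<nu>)" using e[OF t] d by simp
   ultimately show ?thesis using top_fc_1[OF p(1)] top_fc_1[OF p(2)] 0 by simp
  next
   case (Suc l)
   then show ?thesis using top_fc[OF _ d(2) p(1)] top_fc[OF _ d(2) p(2)] by simp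
  qed
  then show ?thesis using dl r d dim_del_nth[OF d] by simp
 qed
 show "mul (dim (dup_nth i \<nu>)) (top (dim (dup_nth i \<nu>)) (x (dup_nth i \<nu>))) (inv (dim (dup_nth i \<nu>)) (top (dim (dup_nth i \<nu>)) (y (dup_nth i \<nu>)))) =
   dg X m i (mul (dim \<nu>) (top (dim \<nu>) (x \<nu>)) (inv (dim \<nu>) (top (dim \<nu>) (y \<nu>))))"
  if d: "dim \<nu> = m" "i \<le> m"
 proof -
  have i: "i \<le> dim \<nu>" using d by simp
  have p: "x \<nu> \<in> pts W (Suc m)" "y \<nu> \<in> pts W (Suc m)" using xy d by simp_all
  have tp: "top m (x \<nu>) \<in> pts X m" "top m (y \<nu>) \<in> pts X m" using txy d by simp_all
  have dl: "x (dup_nth i \<nu>) = dg W (Suc m) (Suc i) (x \<nu>)" "y (dup_nth i \<nu>) = dg W (Suc m) (Suc i) (y \<nu>)"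
   using spoint_dup[OF x t i] spoint_dup[OF y t i] d by (simp_all add: dec_def)
  show ?thesis
   using dl dim_dup_nth[OF ne i] d top_dg[OF d(2) p(1)] top_dg[OF d(2) p(2)]
    dg_mul[OF d(2) tp(1) inv_pts[OF tp(2)]] dg_inv[OF d(2) tp(2)] by simp
 qed
qed

lemma spoint_sact_dec: "z \<in> pts W (Suc m) ==> spoint (std_simplex m) (dec W) (\<lambda>\<nu>. sact (dec W) m \<nu> z)"
 using simplicial_set.spoint_std_sact(1)[OF simplicial_set_dec[OF W.simplicial_set_axioms], of z m] by (simp add: dec_def)

lemma sact_dec_upt: "z \<in> pts W (Suc m) ==> sact (dec W) m [0..<Suc m] z = z"
 using simplicial_set.sact_upt[OF simplicial_set_dec[OF W.simplicial_set_axioms], of z m] by (simp add: dec_def del: upt_Suc)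

text \<open>\<open>z\<close> is compared with \<open>s_0 (d_0 z)\<close>, which has the same
  \<open>d_0\<close> and trivial leading coordinate. Their difference is the simplex of X spanned by
  \<open>top m z\<close>, so the remaining factor depends on \<open>d_0 z\<close> alone.\<close>

lemma top_sact_dec:
 assumes z: "z \<in> pts W (Suc m)" and t: "\<nu> \<in> std_simplex m"
 shows "top (dim \<nu>) (sact (dec W) m \<nu> z) =
  mul (dim \<nu>) (sact X m \<nu> (top m z)) (top (dim \<nu>) (sact (dec W) m \<nu> (dg W m 0 (fc W m 0 z))))"
proof -
 let ?b = "dg W m 0 (fc W m 0 z)"
 have z0: "fc W m 0 z \<in> pts W m" using W_fc z by simp
 have b: "?b \<in> pts W (Suc m)" using W_dg z0 by simp
 have p: "sact (dec W) m \<nu> z \<in> pts W (Suc (dim \<nu>))" "sact (dec W) m \<nu> ?b \<in> pts W (Suc (dim \<nu>))"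
  using W.sact_dec_pts z b t by auto
 note tp = top_pts[OF p(1)] top_pts[OF p(2)]
 have "spoint (std_simplex m) X (\<lambda>\<nu>. mul (dim \<nu>) (top (dim \<nu>) (sact (dec W) m \<nu> z)) (inv (dim \<nu>) (top (dim \<nu>) (sact (dec W) m \<nu> ?b))))"
  by (rule spoint_difference[OF ssubset_std_simplex spoint_sact_dec[OF z] spoint_sact_dec[OF b]])
   (simp add: W.fc0_sact_dec[OF z] W.fc0_sact_dec[OF b] fc0_dg_0[OF z0])
 from sact_eq[OF this t]
 have "sact X m \<nu> (mul m (top m z) (inv m (top m ?b))) =
   mul (dim \<nu>) (top (dim \<nu>) (sact (dec W) m \<nu> z)) (inv (dim \<nu>) (top (dim \<nu>) (sact (dec W) m \<nu> ?b)))"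
  using sact_dec_upt[OF z] sact_dec_upt[OF b] by (simp del: upt_Suc)
 moreover have "mul m (top m z) (inv m (top m ?b)) = top m z"
  using top_dg_0[OF z0] top_pts[OF z] inv_eqI[of "one m" m "one m"] by (simp add: one_pts one_mul mul_one)
 ultimately show ?thesis using tp by (simp add: mul_assoc inv_pts inv_mul mul_one)
qed

text \<open>On lists starting with 0 the remaining factor of \<open>top_sact_dec\<close> is trivial:
  there the cone in \<open>s_0 (d_0 z)\<close> is itself of the form \<open>s_0 w\<close>, with the
  unit as its leading coordinate.\<close>

lemma top_sact_dec_apex:
 assumes z: "z \<in> pts W (Suc m)" and t: "0 # r \<in> std_simplex m"
 shows "top (length r) (sact (dec W) m (0 # r) z) = sact X m (0 # r) (top m z)"
proof -
 let ?t = "0 # r" and ?w = "fc W m 0 z"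
 have w: "?w \<in> pts W m" using W_fc z by simp
 have b: "dg W m 0 ?w \<in> pts W (Suc m)" using W_dg w by simp
 \<comment> \<open>The list \<open>0, 0, 1, ..., m\<close> of the degeneracy \<open>s_0\<close>;
   composed with the cone on \<open>0 # r\<close> it yields \<open>0 # 0 # r\<close>.\<close>
 let ?s = "dup_nth 0 [0..<Suc m]"
 have u: "[0..<Suc m] = 0 # [1..<Suc m]" by (simp add: upt_conv_Cons del: upt_Suc)
 have s: "?s \<in> std_simplex m" "dim ?s = Suc m"
  using std_simplex_dup_nth[OF upt_in_std_simplex, of 0 m] by (simp_all add: u del: upt_Suc)
 have sn: "?s ! (Suc v) = v" if "v \<le> m" for v
 proof -
  have "?s ! (Suc v) = [0..<Suc m] ! v" by (simp add: u del: upt_Suc)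
  then show ?thesis using that by (simp del: upt_Suc)
 qed
 have "?s ! 0 = 0" by (simp add: u del: upt_Suc)
 moreover have "map ((!) ?s) (map Suc ?t) = ?t"
  unfolding map_map by (rule map_idI) (use sn t in \<open>auto simp: std_simplex_def simp del: upt_Suc\<close>)
 ultimately have l: "lcomp ?s (cone_list ?t) = dup_nth 0 ?t"
  by (simp add: lcomp_def cone_list_def del: upt_Suc)
 have ds: "sact W m ?s ?w = dg W m 0 ?w"
  using W.sact_dup_nth[OF w upt_in_std_simplex, of 0] W.sact_upt[OF w] by (simp del: upt_Suc)
 have "sact (dec W) m ?t (dg W m 0 ?w) = sact W (Suc m) (cone_list ?t) (sact W m ?s ?w)"
  unfolding ds using W.sact_cone_list[OF b t] by simp
 also have "sact W (Suc m) (cone_list ?t) (sact W m ?s ?w) = sact W m (dup_nth 0 ?t) ?w"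
  using W.sact_lcomp[OF w s(1), of "cone_list ?t"] cone_list_std_simplex[OF t] s(2) l by simp
 also have "\<dots> = dg W (length r) 0 (sact W m ?t ?w)" using W.sact_dup_nth[OF w t, of 0] by simp
 finally have "top (length r) (sact (dec W) m ?t (dg W m 0 ?w)) = one (length r)"
  using top_dg_0 W.sact_pts[OF w t] by simp
 then show ?thesis
  using top_sact_dec[OF z t] sact_pts[OF top_pts[OF z] t] by (simp add: mul_one)
qed

text \<open>The leading coordinate of \<open>d_1 z\<close> is that of \<open>d_0 z\<close> with a
  known left factor, so cancellation recovers it. Thus \<open>d_1\<close> can serve as second
  coordinate when \<open>d_0\<close> is the missing face of the horn.\<close>

lemma W_ext_1:
 assumes z: "z \<in> pts W (Suc (Suc n))" "z' \<in> pts W (Suc (Suc n))" and t: "top (Suc n) z = top (Suc n) z'"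
  and f: "fc W (Suc n) 1 z = fc W (Suc n) 1 z'"
 shows "z = z'"
proof (rule W_ext[OF z t W_ext])
 show p: "fc W (Suc n) 0 z \<in> pts W (Suc n)" "fc W (Suc n) 0 z' \<in> pts W (Suc n)" using W_fc z by auto
 show "top n (fc W (Suc n) 0 z) = top n (fc W (Suc n) 0 z')"
 proof (rule left_cancel)
  show "fc X n 0 (top (Suc n) z) \<in> pts X n" using fc_pts top_pts[OF z(1)] by simp
  show "mul n (fc X n 0 (top (Suc n) z)) (top n (fc W (Suc n) 0 z)) = mul n (fc X n 0 (top (Suc n) z)) (top n (fc W (Suc n) 0 z'))"
   using top_fc_1[OF z(1)] top_fc_1[OF z(2)] t f by simp
 qed (use top_pts p in auto)
 show "fc W n 0 (fc W (Suc n) 0 z) = fc W n 0 (fc W (Suc n) 0 z')"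
  using fc0_fc[of 0 n, OF _ z(1)] fc0_fc[of 0 n, OF _ z(2)] f by simp
qed

lemma dec_W_horn_eqI:
 assumes m: "1 \<le> m" "k \<le> Suc m" and w: "spoint (horn (Suc m) k) W w" and z: "z \<in> pts W (Suc m)"
  and base: "\<And>\<nu>. \<nu> \<in> std_simplex m ==> map Suc \<nu> \<in> horn (Suc m) k ==> sact W (Suc m) (map Suc \<nu>) z = w (map Suc \<nu>)"
  and cone: "\<And>\<nu>. \<nu> \<in> std_simplex m ==> cone_list \<nu> \<in> horn (Suc m) k ==> sact (dec W) m \<nu> z = w (cone_list \<nu>)"
  and k: "\<mu> \<in> horn (Suc m) k"
 shows "sact W (Suc m) \<mu> z = w \<mu>"
 using k m
proof (induction rule: horn_generated)
 case (base \<nu>)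
 then show ?case using assms(5) by blast
next
 case (cone \<nu>)
 then show ?case using assms(6) W.sact_cone_list[OF z] by simp
next
 case (dup \<mu>)
 then show ?case
  using spoint_dup[OF w, of \<mu> 0] W.sact_dup_nth[OF z, of \<mu> 0] ssubset_std[OF ssubset_horn[OF m(2)]] by simp
next
 case (apex v)
 have v: "[v] \<in> std_simplex m" using apex(1) by (simp add: std_simplex_def)
 have d: "dim (cone_list [v]) = Suc 0" by simp
 show ?case
  using spoint_del[OF w apex(2) d, of 1] W.sact_del_nth[OF z cone_list_std_simplex[OF v] d, of 1]
   assms(6)[OF v apex(2)] W.sact_cone_list[OF z v] by simp
qed

text \<open>By \<open>top_sact_dec\<close> the cone on \<open>\<nu>\<close> in \<open>z\<close> has
  leading coordinate \<open>sact X m \<nu> (top m z)\<close> times a factor given by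
  \<open>d_0 z\<close>. For a positive apex that face is prescribed by the horn, and the quotient
  removes the factor. What is left is the horn that \<open>top m z\<close> must fill.\<close>

definition inner_difference :: "nat => (nat list => 'b) => nat list => 'a" where
 "inner_difference m w \<nu> = mul (dim \<nu>) (top (dim \<nu>) (w (cone_list \<nu>)))
   (inv (dim \<nu>) (top (dim \<nu>) (sact (dec W) m \<nu> (dg W m 0 (w (map Suc [0..<Suc m]))))))"

text \<open>The face \<open>d_0\<close> belongs to the horn and fixes \<open>d_0 z\<close>. The
  remaining simplices are generated by cones, whose own \<open>d_0\<close> is then fixed, so each of
  them constrains the leading coordinate only.\<close>

lemma inner_horn:
 assumes m: "1 \<le> m" "k \<le> m" and w: "spoint (horn (Suc m) (Suc k)) W w"
 shows "spoint (horn m k) X (inner_difference m w)"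
  and "w (map Suc [0..<Suc m]) \<in> pts W m"
  and "z \<in> pts W (Suc m) ==>
   (\<forall>\<mu>\<in>horn (Suc m) (Suc k). sact W (Suc m) \<mu> z = w \<mu>) \<longleftrightarrow>
   fc W m 0 z = w (map Suc [0..<Suc m]) \<and> (\<forall>\<nu>\<in>horn m k. sact X m \<nu> (top m z) = inner_difference m w \<nu>)"
proof -
 let ?H = "horn (Suc m) (Suc k)" and ?w0 = "w (map Suc [0..<Suc m])"
 note K = ssubset_horn[OF m(2)]
 have s: "spoint (std_simplex m) W (\<lambda>\<nu>. w (map Suc \<nu>))"
  by (rule W.spoint_map_Suc[OF w map_Suc_horn])
 show w0: "?w0 \<in> pts W m" using spoint_pts[OF s upt_in_std_simplex] by (simp del: upt_Suc)
 have ws: "w (map Suc \<nu>) = sact W m \<nu> ?w0" if "\<nu> \<in> std_simplex m" for \<nu>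
  using sact_eq[OF s that] by simp
 let ?b = "dg W m 0 ?w0"
 have b: "?b \<in> pts W (Suc m)" using W_dg w0 by simp
 have cH: "cone_list \<nu> \<in> ?H" if "\<nu> \<in> horn m k" for \<nu>
  using cone_list_horn(1)[OF ssubset_std[OF K that]] that by simp
 have x: "spoint (horn m k) (dec W) (\<lambda>\<nu>. w (cone_list \<nu>))"
  by (rule W.spoint_cone_list[OF w]) (use cH ssubset_Nil[OF K] in blast)
 have fx: "fc W (dim \<nu>) 0 (w (cone_list \<nu>)) = sact W m \<nu> ?w0" if t: "\<nu> \<in> horn m k" for \<nu>
 proof -
  have "\<nu> \<noteq> []" using ssubset_Nil[OF K] t by blast
  then have "w (del_nth 0 (cone_list \<nu>)) = fc W (dim \<nu>) 0 (w (cone_list \<nu>))"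
   using spoint_del[OF w cH[OF t]] by simp
  then show ?thesis using ws[OF ssubset_std[OF K t]] by (simp add: cone_list_def)
 qed
 have fb: "fc W (dim \<nu>) 0 (sact (dec W) m \<nu> ?b) = sact W m \<nu> ?w0" if t: "\<nu> \<in> horn m k" for \<nu>
  using W.fc0_sact_dec[OF b ssubset_std[OF K t]] fc0_dg_0[OF w0] by simp
 show "spoint (horn m k) X (inner_difference m w)"
  unfolding inner_difference_def
  by (rule spoint_difference[OF K x]) (use spoint_subset[OF spoint_sact_dec[OF b]] K fx fb in \<open>auto simp: ssubset_def\<close>)
 assume z: "z \<in> pts W (Suc m)"
 show "(\<forall>\<mu>\<in>?H. sact W (Suc m) \<mu> z = w \<mu>) \<longleftrightarrow>
   fc W m 0 z = ?w0 \<and> (\<forall>\<nu>\<in>horn m k. sact X m \<nu> (top m z) = inner_difference m w \<nu>)" (is "?l \<longleftrightarrow> ?r")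
 proof
  assume l: ?l
  have f: "fc W m 0 z = ?w0"
   using l map_Suc_horn[OF upt_in_std_simplex] W.sact_map_Suc[OF z upt_in_std_simplex] W.sact_upt[of "fc W m 0 z" m] W_fc[of 0 m z] z
   by (metis le0)
  have "sact X m \<nu> (top m z) = inner_difference m w \<nu>" if t: "\<nu> \<in> horn m k" for \<nu>
  proof -
   note ts = ssubset_std[OF K t]
   have "sact (dec W) m \<nu> z = w (cone_list \<nu>)" using l cH[OF t] W.sact_cone_list[OF z ts] by simp
   then have e: "top (dim \<nu>) (w (cone_list \<nu>)) = mul (dim \<nu>) (sact X m \<nu> (top m z)) (top (dim \<nu>) (sact (dec W) m \<nu> ?b))"
    using top_sact_dec[OF z ts] f by simp
   show ?thesis unfolding inner_difference_def e
    using sact_pts[OF top_pts[OF z] ts] top_pts[OF W.sact_dec_pts[OF b ts]] by (simp add: mul_assoc inv_pts mul_inv mul_one)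
  qed
  then show ?r using f by blast
 next
  assume r: ?r
  have "sact W (Suc m) \<mu> z = w \<mu>" if k: "\<mu> \<in> ?H" for \<mu>
  proof (rule dec_W_horn_eqI[OF m(1) _ w z _ _ k])
   show "Suc k \<le> Suc m" using m by simp
   show "sact W (Suc m) (map Suc \<nu>) z = w (map Suc \<nu>)" if "\<nu> \<in> std_simplex m" for \<nu>
    using W.sact_map_Suc[OF z that] r ws[OF that] by simp
   fix \<nu> assume "\<nu> \<in> std_simplex m" "cone_list \<nu> \<in> ?H"
   then have t: "\<nu> \<in> horn m k" using cone_list_horn(1) by blast
   note ts = ssubset_std[OF K t]
   show "sact (dec W) m \<nu> z = w (cone_list \<nu>)"
   proof (rule W_ext)
    show p: "sact (dec W) m \<nu> z \<in> pts W (Suc (dim \<nu>))" using W.sact_dec_pts[OF z ts] .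
    show q: "w (cone_list \<nu>) \<in> pts W (Suc (dim \<nu>))" using spoint_pts[OF x t] by (simp add: dec_def)
    show "fc W (dim \<nu>) 0 (sact (dec W) m \<nu> z) = fc W (dim \<nu>) 0 (w (cone_list \<nu>))"
     using W.fc0_sact_dec[OF z ts] fx[OF t] r by simp
    show "top (dim \<nu>) (sact (dec W) m \<nu> z) = top (dim \<nu>) (w (cone_list \<nu>))"
     using top_sact_dec[OF z ts] r t top_pts[OF q] top_pts[OF W.sact_dec_pts[OF b ts]]
     by (simp add: inner_difference_def mul_assoc inv_pts inv_mul mul_one)
   qed
  qed
  then show ?l by blast
 qed
qed

text \<open>For apex 0 the face \<open>d_0\<close> is missing, so the factor removed by
  \<open>inner_difference\<close> is unknown. On cones over \<open>0 # \<nu>\<close> it is trivial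
  by \<open>top_sact_dec_apex\<close>, and \<open>d_0\<close> in the group then drops the auxiliary
  vertex.\<close>

definition outer_difference :: "(nat list => 'b) => nat list => 'a" where
 "outer_difference w \<nu> = fc X (dim \<nu>) 0 (top (Suc (dim \<nu>)) (w (cone_list (0 # \<nu>))))"

text \<open>The face \<open>d_1\<close>, the cone on the face opposite 0 of the base, takes the
  place of the missing \<open>d_0\<close>. The prescribed horn in the group arises because
  \<open>0 # \<nu>\<close> lies in the boundary exactly when \<open>\<nu>\<close> lies in the horn
  at 0.\<close>

lemma outer_horn:
 assumes m: "1 \<le> m" and w: "spoint (horn (Suc m) 0) W w"
 defines "x1 \<equiv> w (cone_list (map Suc [0..<m]))"
 shows "spoint (horn m 0) X (outer_difference w)"
  and "x1 \<in> pts W m"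
  and "z \<in> pts W (Suc m) ==>
   (\<forall>\<mu>\<in>horn (Suc m) 0. sact W (Suc m) \<mu> z = w \<mu>) \<longleftrightarrow>
   fc W m 1 z = x1 \<and> (\<forall>\<nu>\<in>horn m 0. sact X m \<nu> (top m z) = outer_difference w \<nu>)"
proof -
 let ?H = "horn (Suc m) 0"
 note K = ssubset_horn[OF le0, of m] and B = ssubset_bdry[of m]
 obtain q where q: "m = Suc q" using m by (cases m) auto
 have x: "spoint (bdry m) (dec W) (\<lambda>\<nu>. w (cone_list \<nu>))"
  by (rule W.spoint_cone_list[OF w]) (use cone_list_horn(2) ssubset_std[OF B] ssubset_Nil[OF B] in blast)
 have c: "0 # \<nu> \<in> bdry m" "\<nu> \<noteq> []" "\<nu> \<in> std_simplex m" if "\<nu> \<in> horn m 0" for \<nu>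
  using that ssubset_Nil[OF K] by (auto simp: horn_def bdry_def std_simplex_def)
 have xp: "w (cone_list \<nu>) \<in> pts W (Suc (dim \<nu>))" if "\<nu> \<in> bdry m" for \<nu>
  using spoint_pts[OF x that] by (simp add: dec_def)
 have dc: "dim (0 # \<nu>) = Suc (dim \<nu>)" if "\<nu> \<noteq> []" for \<nu> :: "nat list" using that by (cases \<nu>) auto
 show "spoint (horn m 0) X (outer_difference w)"
  unfolding spoint_def
 proof (intro conjI ballI allI impI)
  fix \<nu> assume t: "\<nu> \<in> horn m 0"
  note c = c[OF t]
  let ?y = "w (cone_list (0 # \<nu>))"
  have y: "?y \<in> pts W (Suc (Suc (dim \<nu>)))" using xp[OF c(1)] dc[OF c(2)] by simp
  have ty: "top (Suc (dim \<nu>)) ?y \<in> pts X (Suc (dim \<nu>))" using top_pts[OF y] .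
  show "outer_difference w \<nu> \<in> pts X (dim \<nu>)" unfolding outer_difference_def using fc_pts[OF _ ty] by simp
  fix l i
  show "outer_difference w (del_nth i \<nu>) = fc X l i (outer_difference w \<nu>)" if d: "dim \<nu> = Suc l" "i \<le> Suc l"
  proof -
   have "w (cone_list (0 # del_nth i \<nu>)) = fc W (Suc (Suc l)) (Suc (Suc i)) ?y"
    using spoint_del[OF x c(1), of "Suc l" "Suc i"] dc[OF c(2)] d by (simp add: dec_def)
   then have "outer_difference w (del_nth i \<nu>) = fc X l 0 (fc X (Suc l) (Suc i) (top (Suc (Suc l)) ?y))"
    unfolding outer_difference_def using dim_del_nth[OF d] top_fc[of "Suc i" "Suc l" ?y] y d by simp
   also have "\<dots> = fc X l i (fc X (Suc l) 0 (top (Suc (Suc l)) ?y))"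
    using fc_fc[of 0 "Suc i" l] ty d by simp
   finally show ?thesis using d by (simp add: outer_difference_def)
  qed
  show "outer_difference w (dup_nth i \<nu>) = dg X l i (outer_difference w \<nu>)" if d: "dim \<nu> = l" "i \<le> l"
  proof -
   have "w (cone_list (0 # dup_nth i \<nu>)) = dg W (Suc (Suc l)) (Suc (Suc i)) ?y"
    using spoint_dup[OF x c(1), of "Suc i"] dc[OF c(2)] d by (simp add: dec_def)
   then have "outer_difference w (dup_nth i \<nu>) = fc X (Suc l) 0 (dg X (Suc l) (Suc i) (top (Suc l) ?y))"
    unfolding outer_difference_def using dim_dup_nth[OF c(2), of i] top_dg[of "Suc i" "Suc l" ?y] y d by simp
   also have "\<dots> = dg X l i (fc X l 0 (top (Suc l) ?y))"
    using fc_dg_less[of 0 "Suc i" l] ty d by simp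
   finally show ?thesis using d by (simp add: outer_difference_def)
  qed
 qed
 let ?d = "del_nth 0 [0..<Suc m]"
 have de: "?d = map Suc [0..<m]" using cone_list_upt[of q] q by (simp add: cone_list_def del: upt_Suc) (metis del_nth_0)
 note fd = face_simplex[of 0 q, folded q, OF le0]
 have db: "?d \<in> bdry m" using fd(1,4) by (auto simp: bdry_def simp del: upt_Suc)
 have x1: "w (cone_list ?d) = x1" unfolding x1_def de ..
 show x1p: "x1 \<in> pts W m" using xp[OF db] fd(2) x1 q by (simp del: upt_Suc)
 assume z: "z \<in> pts W (Suc m)"
 have dW: "simplicial_set (dec W)" by (rule simplicial_set_dec[OF W.simplicial_set_axioms])
 have zd: "z \<in> pts (dec W) m" using z by (simp add: dec_def)
 have f1: "sact (dec W) m ?d z = fc W m 1 z"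
  using simplicial_set.sact_face[OF dW, of z q 0] zd q by (simp add: dec_def del: upt_Suc)
 show "(\<forall>\<mu>\<in>?H. sact W (Suc m) \<mu> z = w \<mu>) \<longleftrightarrow>
   fc W m 1 z = x1 \<and> (\<forall>\<nu>\<in>horn m 0. sact X m \<nu> (top m z) = outer_difference w \<nu>)" (is "?l \<longleftrightarrow> ?r")
 proof
  assume l: ?l
  have xz: "sact (dec W) m \<nu> z = w (cone_list \<nu>)" if t: "\<nu> \<in> bdry m" for \<nu>
   using l W.sact_cone_list[OF z ssubset_std[OF B t]] cone_list_horn(2)[OF ssubset_std[OF B t]] t by simp
  have "sact X m \<nu> (top m z) = outer_difference w \<nu>" if t: "\<nu> \<in> horn m 0" for \<nu>
  proof -
   note c = c[OF t]
   have s: "0 # \<nu> \<in> std_simplex m" using ssubset_std[OF B c(1)] .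
   have "outer_difference w \<nu> = fc X (dim \<nu>) 0 (sact X m (0 # \<nu>) (top m z))"
    unfolding outer_difference_def xz[OF c(1), symmetric] using top_sact_dec_apex[OF z s] dc[OF c(2)] by simp
   also have "\<dots> = sact X m \<nu> (top m z)"
    using sact_del_nth[OF top_pts[OF z] s dc[OF c(2)], of 0] by simp
   finally show ?thesis by simp
  qed
  then show ?r using xz[OF db] f1 x1 by simp
 next
  assume r: ?r
  \<comment> \<open>Boundary simplices avoiding 0 lie on the face fixed by \<open>x1\<close>. For
    those starting with 0, the horn in the group gives the leading coordinate and the tail of the
    list gives \<open>d_1\<close>, which together suffice by \<open>W_ext_1\<close>.\<close>
  have xz: "\<nu> \<in> bdry m ==> sact (dec W) m \<nu> z = w (cone_list \<nu>)" for \<nu>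
  proof (induction \<nu>)
   case Nil
   then show ?case using ssubset_Nil[OF B] by blast
  next
   case (Cons a r')
   note s = ssubset_std[OF B Cons.prems]
   show ?case
   proof (cases "a = 0")
    case False
    then have "set (a # r') \<subseteq> set ?d" unfolding fd(4) using s by (auto simp: std_simplex_def)
    note rk = rank_list[OF fd(1,3) s this]
    have "sact (dec W) m (a # r') z = sact (dec W) q (rank_list ?d (a # r')) (sact (dec W) m ?d z)"
     using simplicial_set.sact_lcomp[OF dW zd fd(1) rk(1)] unfolding rk(2) fd(2) .
    also have "sact (dec W) m ?d z = w (cone_list ?d)" using f1 r x1 by simp
    also have "sact (dec W) q (rank_list ?d (a # r')) (w (cone_list ?d)) = w (cone_list (a # r'))"
     using spoint_sact[OF B db x rk(1)] unfolding rk(2) fd(2) by simp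
    finally show ?thesis .
   next
    case a: True
    have p: "sact (dec W) m (a # r') z \<in> pts W (Suc (length r'))" "w (cone_list (a # r')) \<in> pts W (Suc (length r'))"
     using W.sact_dec_pts[OF z s] xp[OF Cons.prems] by simp_all
    have "a # r' \<in> horn m 0" using Cons.prems a s by (auto simp: horn_def bdry_def)
    then have "sact X m (a # r') (top m z) = outer_difference w (a # r')" using r by blast
    \<comment> \<open>Since \<open>a = 0\<close>, the cone on \<open>0 # a # r'\<close> is a
      degeneracy of the cone on \<open>a # r'\<close>, so \<open>outer_difference\<close> returns
      the leading coordinate of the latter.\<close>
    also have "\<dots> = fc X (length r') 0 (dg X (length r') 0 (top (length r') (w (cone_list (a # r')))))"
     unfolding outer_difference_def
     using spoint_dup[OF x Cons.prems, of 0] top_dg[of 0 "length r'", OF _ p(2)] a by (simp add: dec_def)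
    also have "\<dots> = top (length r') (w (cone_list (a # r')))" using fc_dg_id top_pts[OF p(2)] by simp
    finally have te: "top (length r') (sact (dec W) m (a # r') z) = top (length r') (w (cone_list (a # r')))"
     using top_sact_dec_apex[OF z, of r'] s a by simp
    show ?thesis
    proof (cases "r' = []")
     case True
     then show ?thesis using W_ext[OF p te] W_0[OF W_fc W_fc] p by simp
    next
     case False
     then obtain l where l: "length r' = Suc l" by (cases r') auto
     have "r' \<in> std_simplex m" using s False by (auto simp: std_simplex_def)
     then have "r' \<in> bdry m" using B Cons.prems unfolding ssubset_def by (meson set_subset_Cons)
     then have "sact (dec W) m r' z = w (cone_list r')" by (rule Cons.IH)
     moreover have "sact (dec W) m r' z = fc W (Suc l) 1 (sact (dec W) m (a # r') z)"
      using simplicial_set.sact_del_nth[OF dW zd s, of l 0] l by (simp add: dec_def)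
     moreover have "w (cone_list r') = fc W (Suc l) 1 (w (cone_list (a # r')))"
      using spoint_del[OF x Cons.prems, of l 0] l by (simp add: dec_def)
     ultimately show ?thesis using W_ext_1[of _ l] p te l by simp
    qed
   qed
  qed
  have "sact W (Suc m) \<mu> z = w \<mu>" if k: "\<mu> \<in> ?H" for \<mu>
  proof (rule dec_W_horn_eqI[OF m le0 w z _ _ k])
   show cz: "sact (dec W) m \<nu> z = w (cone_list \<nu>)" if "\<nu> \<in> std_simplex m" "cone_list \<nu> \<in> ?H" for \<nu>
    using xz cone_list_horn(2)[OF that(1)] that(2) by blast
   fix \<nu> assume t: "\<nu> \<in> std_simplex m" "map Suc \<nu> \<in> ?H"
   then have cH: "cone_list \<nu> \<in> ?H" using cone_list_std_simplex[OF t(1)] by (simp add: horn_def cone_list_def)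
   have "\<nu> \<noteq> []" using t by (auto simp: std_simplex_def)
   then have "w (map Suc \<nu>) = fc W (dim \<nu>) 0 (w (cone_list \<nu>))"
    using spoint_del[OF w cH, of "dim \<nu>" 0] by (simp add: cone_list_def dim_def)
   then show "sact W (Suc m) (map Suc \<nu>) z = w (map Suc \<nu>)"
    using W.sact_map_Suc[OF z t(1)] W.fc0_sact_dec[OF z t(1)] cz[OF t(1) cH] by simp
  qed
  then show ?l by blast
 qed
qed

text \<open>The formula for the leading coordinate of \<open>d_1 z\<close> is solved for that of
  \<open>d_0 z\<close>, which determines \<open>u\<close> and then \<open>z\<close>. With
  \<open>W_ext_1\<close> this makes \<open>top\<close> and \<open>d_1\<close> a full set of
  coordinates.\<close>

lemma ex_top_fc_1:
 assumes a: "a \<in> pts X (Suc q)" and y: "y \<in> pts W (Suc q)"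
 shows "\<exists>z\<in>pts W (Suc (Suc q)). top (Suc q) z = a \<and> fc W (Suc q) 1 z = y"
proof -
 let ?a = "fc X q 0 a"
 have ap: "?a \<in> pts X q" using fc_pts a by simp
 have y0: "fc W q 0 y \<in> pts W q" using W_fc y by simp
 note ty = top_pts[OF y]
 obtain u where u: "u \<in> pts W (Suc q)" "top q u = mul q (inv q ?a) (top q y)" "fc W q 0 u = fc W q 0 y"
  using W_cons[OF mul_pts[OF inv_pts[OF ap] ty] y0] by blast
 obtain z where z: "z \<in> pts W (Suc (Suc q))" "top (Suc q) z = a" "fc W (Suc q) 0 z = u"
  using W_cons[OF a u(1)] by blast
 have "fc W (Suc q) 1 z = y"
 proof (rule W_ext)
  show "fc W (Suc q) 1 z \<in> pts W (Suc q)" using W_fc z(1) by simp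
  show "top q (fc W (Suc q) 1 z) = top q y" using top_fc_1[OF z(1)] z u mul_inv_cancel[OF ap ty] by simp
  show "fc W q 0 (fc W (Suc q) 1 z) = fc W q 0 y" using fc0_fc[of 0 q, OF _ z(1)] z u by simp
 qed (rule y)
 then show ?thesis using z by blast
qed

end

section \<open>\<open>Wbar\<close> of a group object, its coordinates and its Kan property\<close>

section \<open>The functor Wbar on simplicial group objects\<close>

lemma ex1_eqD: "\<exists>!x. P x ==> P a ==> P b ==> a = b"
 by auto

lemma Wbar_simps [simp]:
 "level (OMap (Wbar C) G) = Wob C G" "face (OMap (Wbar C) G) = Wface C G" "degen (OMap (Wbar C) G) = Wdegen C G"
 "AMap (Wbar C) (G, H, f) = (OMap (Wbar C) G, OMap (Wbar C) H,
  \<lambda>n. Wtuple C H n (Wob C G n) (\<lambda>j. comps f j \<cdot>\<^bsub>C\<^esub> Wproj C G n j))"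
 by (simp_all add: Wbar_def Let_def)

text \<open>\<open>Wprod\<close> chooses a product by description, so products must be known to
  exist. In C they are built from pullbacks of covers; for an image in D the images of those
  products serve.\<close>

locale wbar_object = simplicial_group_object +
 assumes ex_products: "\<And>n. \<exists>P p. is_product C {..<n} (level (Gob G)) P p"
begin

lemma Wob_product: "is_product C {..<n} (level (Gob G)) (Wob C G n) (Wproj C G n)"
proof -
 have "\<exists>Pp. case Pp of (P, p) => is_product C {..<n} (level (Gob G)) P p"
  using ex_products[of n] by auto
 from someI_ex[OF this] show ?thesis
  unfolding Wob_def Wproj_def Wprod_def by (simp add: case_prod_unfold)
qed

lemma Wob_Obj: "Wob C G n \<in> Obj C"
 using Wob_product by (simp add: is_product_def)

lemma Wproj_Hom: "j < n ==> Wproj C G n j \<in> (Wob C G n) -> (level (Gob G) j)"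
 using Wob_product[of n] by (simp add: is_product_def)

lemma Wob_ex1:
 assumes "T \<in> Obj C" "\<And>j. j < n ==> a j \<in> T -> (level (Gob G) j)"
 shows "\<exists>!u. u \<in> T -> (Wob C G n) \<and> (\<forall>j<n. Wproj C G n j \<cdot> u = a j)"
proof -
 have "\<forall>i\<in>{..<n}. a i \<in> T -> (level (Gob G) i)" using assms(2) by simp
 then have "\<exists>!u. u \<in> T -> (Wob C G n) \<and> (\<forall>i\<in>{..<n}. Wproj C G n i \<cdot> u = a i)"
  using Wob_product[of n] assms(1) unfolding is_product_def by blast
 then show ?thesis by (simp only: Ball_def lessThan_iff)
qed

lemma Wtuple:
 assumes "T \<in> Obj C" "\<And>j. j < n ==> a j \<in> T -> (level (Gob G) j)"
 shows "Wtuple C G n T a \<in> T -> (Wob C G n)" and "j < n ==> Wproj C G n j \<cdot> Wtuple C G n T a = a j"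
 using theI'[OF Wob_ex1[OF assms]] by (simp_all add: Wtuple_def)

lemma Wob_eqI:
 assumes u: "u \<in> T -> (Wob C G n)" "v \<in> T -> (Wob C G n)"
  and e: "\<And>j. j < n ==> Wproj C G n j \<cdot> u = Wproj C G n j \<cdot> v"
 shows "u = v"
proof -
 have ex: "\<exists>!w. w \<in> T -> (Wob C G n) \<and> (\<forall>j<n. Wproj C G n j \<cdot> w = Wproj C G n j \<cdot> v)"
  by (rule Wob_ex1[OF Hom_Obj(1)[OF u(1)]]) (use comp_Hom[OF Wproj_Hom u(2)] in simp)
 have "u \<in> T -> (Wob C G n) \<and> (\<forall>j<n. Wproj C G n j \<cdot> u = Wproj C G n j \<cdot> v)" using u(1) e by simp
 moreover have "v \<in> T -> (Wob C G n) \<and> (\<forall>j<n. Wproj C G n j \<cdot> v = Wproj C G n j \<cdot> v)" using u(2) by simp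
 ultimately show "u = v" by (rule ex1_eqD[OF ex])
qed

lemma Wface_aux:
 assumes i: "i \<le> Suc n"
 defines "a \<equiv> \<lambda>j. if n < j + i then face (Gob G) j (j + i - n) \<cdot> Wproj C G (Suc n) (Suc j)
       else if j + i = n then gmul C (glevel G j) (face (Gob G) j 0 \<cdot> Wproj C G (Suc n) (Suc j)) (Wproj C G (Suc n) j)
       else Wproj C G (Suc n) j"
 shows "j < n ==> a j \<in> (Wob C G (Suc n)) -> (level (Gob G) j)"
  and "Wface C G n i = Wtuple C G n (Wob C G (Suc n)) a"
proof -
 show "Wface C G n i = Wtuple C G n (Wob C G (Suc n)) a" by (simp add: Wface_def a_def Let_def)
 assume j: "j < n"
 have p: "Wproj C G (Suc n) (Suc j) \<in> (Wob C G (Suc n)) -> (level (Gob G) (Suc j))"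
  "Wproj C G (Suc n) j \<in> (Wob C G (Suc n)) -> (level (Gob G) j)" using Wproj_Hom j by auto
 have "j + i - n \<le> Suc j" using i by auto
 then have "face (Gob G) j (j + i - n) \<in> (level (Gob G) (Suc j)) -> (level (Gob G) j)" using sobj_face[OF sobj_Gob] by blast
 moreover have "face (Gob G) j 0 \<in> (level (Gob G) (Suc j)) -> (level (Gob G) j)" using sobj_face[OF sobj_Gob] by blast
 ultimately show "a j \<in> (Wob C G (Suc n)) -> (level (Gob G) j)"
  unfolding a_def using p pregroup.gmul_Hom[OF glevel_pregroup[of j]] by simp (meson comp_Hom)
qed

lemma Wface_Hom: "i \<le> Suc n ==> Wface C G n i \<in> (Wob C G (Suc n)) -> (Wob C G n)"
 unfolding Wface_aux(2) by (rule Wtuple(1)[OF Wob_Obj Wface_aux(1)])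

lemma Wproj_faces:
 assumes "i \<le> Suc n" "j < n"
 shows "Wproj C G n j \<cdot> Wface C G n i = (if n < j + i then face (Gob G) j (j + i - n) \<cdot> Wproj C G (Suc n) (Suc j)
  else if j + i = n then gmul C (glevel G j) (face (Gob G) j 0 \<cdot> Wproj C G (Suc n) (Suc j)) (Wproj C G (Suc n) j) else Wproj C G (Suc n) j)"
 unfolding Wface_aux(2)[OF assms(1)] by (rule Wtuple(2)[OF Wob_Obj Wface_aux(1)[OF assms(1)] assms(2)])

lemma Wproj_Wface:
 assumes i: "i \<le> Suc n" and j: "j < n" and z: "z \<in> T -> (Wob C G (Suc n))"
 shows "Wproj C G n j \<cdot> (Wface C G n i \<cdot> z) =
  (if n < j + i then face (Gob G) j (j + i - n) \<cdot> (Wproj C G (Suc n) (Suc j) \<cdot> z)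
   else if j + i = n then gmul C (glevel G j) (face (Gob G) j 0 \<cdot> (Wproj C G (Suc n) (Suc j) \<cdot> z)) (Wproj C G (Suc n) j \<cdot> z)
   else Wproj C G (Suc n) j \<cdot> z)"
proof -
 have p: "Wproj C G (Suc n) (Suc j) \<in> (Wob C G (Suc n)) -> (level (Gob G) (Suc j))"
  "Wproj C G (Suc n) j \<in> (Wob C G (Suc n)) -> (level (Gob G) j)" using Wproj_Hom j by auto
 have "j + i - n \<le> Suc j" using i by auto
 then have f: "face (Gob G) j (j + i - n) \<in> (level (Gob G) (Suc j)) -> (level (Gob G) j)"
  "face (Gob G) j 0 \<in> (level (Gob G) (Suc j)) -> (level (Gob G) j)" using sobj_face[OF sobj_Gob] by blast+
 have "Wproj C G n j \<cdot> (Wface C G n i \<cdot> z) = (Wproj C G n j \<cdot> Wface C G n i) \<cdot> z"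
  using assoc[OF Wproj_Hom[OF j] Wface_Hom[OF i] z] by simp
 also note Wproj_faces[OF i j]
 finally show ?thesis
  using assoc[OF f(1) p(1) z] assoc[OF f(2) p(1) z]
   pregroup.gmul_comp[OF glevel_pregroup[of j], of "face (Gob G) j 0 \<cdot> Wproj C G (Suc n) (Suc j)" "Wob C G (Suc n)" "Wproj C G (Suc n) j" z T]
   comp_Hom[OF f(2) p(1)] p(2) z by simp
qed

lemma Wdegen_aux:
 assumes i: "i \<le> n"
 defines "a \<equiv> \<lambda>j. if n < j + i then degen (Gob G) (j - 1) (j + i - n - 1) \<cdot> Wproj C G n (j - 1)
       else if j + i = n then gone C (glevel G j) (Wob C G n)
       else Wproj C G n j"
 shows "j < Suc n ==> a j \<in> (Wob C G n) -> (level (Gob G) j)"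
  and "Wdegen C G n i = Wtuple C G (Suc n) (Wob C G n) a"
proof -
 show "Wdegen C G n i = Wtuple C G (Suc n) (Wob C G n) a" by (simp add: Wdegen_def a_def Let_def)
 assume j: "j < Suc n"
 consider "n < j + i" | "j + i = n" | "j + i < n" by linarith
 then show "a j \<in> (Wob C G n) -> (level (Gob G) j)"
 proof cases
  case 1
  then obtain j' where j': "j = Suc j'" using i by (cases j) auto
  have "j' < n" "j + i - n - 1 \<le> j'" using 1 j i j' by auto
  then show ?thesis unfolding a_def using 1 comp_Hom[OF sobj_degen[OF sobj_Gob] Wproj_Hom] j' by simp
 next
  case 2
  then show ?thesis unfolding a_def using pregroup.gone_Hom[OF glevel_pregroup Wob_Obj] by simp
 next
  case 3
  then show ?thesis unfolding a_def using Wproj_Hom by simp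
 qed
qed

lemma Wdegen_Hom: "i \<le> n ==> Wdegen C G n i \<in> (Wob C G n) -> (Wob C G (Suc n))"
 unfolding Wdegen_aux(2) by (rule Wtuple(1)[OF Wob_Obj Wdegen_aux(1)])

lemma Wproj_degens:
 assumes "i \<le> n" "j < Suc n"
 shows "Wproj C G (Suc n) j \<cdot> Wdegen C G n i = (if n < j + i then degen (Gob G) (j - 1) (j + i - n - 1) \<cdot> Wproj C G n (j - 1)
  else if j + i = n then gone C (glevel G j) (Wob C G n) else Wproj C G n j)"
 unfolding Wdegen_aux(2)[OF assms(1)] by (rule Wtuple(2)[OF Wob_Obj Wdegen_aux(1)[OF assms(1)] assms(2)])

lemma Wproj_Wdegen:
 assumes i: "i \<le> n" and j: "j < Suc n" and z: "z \<in> T -> (Wob C G n)"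
 shows "Wproj C G (Suc n) j \<cdot> (Wdegen C G n i \<cdot> z) =
  (if n < j + i then degen (Gob G) (j - 1) (j + i - n - 1) \<cdot> (Wproj C G n (j - 1) \<cdot> z)
   else if j + i = n then gone C (glevel G j) T
   else Wproj C G n j \<cdot> z)"
proof -
 have "Wproj C G (Suc n) j \<cdot> (Wdegen C G n i \<cdot> z) = (Wproj C G (Suc n) j \<cdot> Wdegen C G n i) \<cdot> z"
  using assoc[OF Wproj_Hom[OF j] Wdegen_Hom[OF i] z] by simp
 note e = this[unfolded Wproj_degens[OF i j]]
 have "n < j + i ==> (degen (Gob G) (j - 1) (j + i - n - 1) \<cdot> Wproj C G n (j - 1)) \<cdot> z =
   degen (Gob G) (j - 1) (j + i - n - 1) \<cdot> (Wproj C G n (j - 1) \<cdot> z)"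
 proof -
  assume h: "n < j + i"
  then have "j - 1 < n" "j + i - n - 1 \<le> j - 1" using j i by auto
  then show ?thesis using assoc[OF sobj_degen[OF sobj_Gob] Wproj_Hom z] by blast
 qed
 then show ?thesis using e pregroup.gone_comp[OF glevel_pregroup z] by simp
qed

abbreviation "W \<equiv> OMap (Wbar C) G"

text \<open>The projection to the highest factor is the leading coordinate, and \<open>d_0\<close>
  forgets exactly that factor. The axioms of the recursive model are then the coordinate formulas of
  \<open>Wbar\<close>, compared index by index.\<close>

lemma classifying_hset:
 assumes T: "T \<in> Obj C"
 shows "classifying_set (hset C (Gob G) T) (\<lambda>n. gmul C (glevel G n)) (\<lambda>n. gone C (glevel G n) T)
  (\<lambda>n a. Ginv (glevel G n) \<cdot> a) (hset C W T) (\<lambda>n z. Wproj C G (Suc n) n \<cdot> z)"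
proof -
 interpret simplicial_group "hset C (Gob G) T" "\<lambda>n. gmul C (glevel G n)" "\<lambda>n. gone C (glevel G n) T"
  "\<lambda>n a. Ginv (glevel G n) \<cdot> a" by (rule hset_simplicial_group[OF T])
 have f: "Wface C G n i \<cdot> z \<in> T -> (Wob C G n)" if "i \<le> Suc n" "z \<in> T -> (Wob C G (Suc n))" for n i z
  using Wface_Hom that by blast
 have d: "Wdegen C G n i \<cdot> z \<in> T -> (Wob C G (Suc n))" if "i \<le> n" "z \<in> T -> (Wob C G n)" for n i z
  using Wdegen_Hom that by blast
 have f0: "Wproj C G n j \<cdot> (Wface C G n 0 \<cdot> z) = Wproj C G (Suc n) j \<cdot> z" if "j < n" "z \<in> T -> (Wob C G (Suc n))" for n j z
  using Wproj_Wface[OF _ that, of 0] that by simp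
 show ?thesis
 proof (unfold_locales, unfold hset_simps Wbar_simps)
  fix n i z
  show "z = z'" if "z \<in> T -> (Wob C G 0)" "z' \<in> T -> (Wob C G 0)" for z' using Wob_eqI[OF that] by simp
  show "Wproj C G (Suc n) n \<cdot> z \<in> T -> (level (Gob G) n)" if "z \<in> T -> (Wob C G (Suc n))"
   using Wproj_Hom that by blast
  show "Wface C G n i \<cdot> z \<in> T -> (Wob C G n)" if "i \<le> Suc n" "z \<in> T -> (Wob C G (Suc n))" using f that .
  show "Wdegen C G n i \<cdot> z \<in> T -> (Wob C G (Suc n))" if "i \<le> n" "z \<in> T -> (Wob C G n)" using d that .
  show "z = z'" if z: "z \<in> T -> (Wob C G (Suc n))" "z' \<in> T -> (Wob C G (Suc n))"
   and t: "Wproj C G (Suc n) n \<cdot> z = Wproj C G (Suc n) n \<cdot> z'" "Wface C G n 0 \<cdot> z = Wface C G n 0 \<cdot> z'" for z'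
  proof (rule Wob_eqI[OF z])
   fix j assume "j < Suc n"
   then show "Wproj C G (Suc n) j \<cdot> z = Wproj C G (Suc n) j \<cdot> z'"
    using f0[OF _ z(1), of j] f0[OF _ z(2), of j] t by (cases "j = n") auto
  qed
  show "\<exists>z\<in>Hom C T (Wob C G (Suc n)). Wproj C G (Suc n) n \<cdot> z = g \<and> Wface C G n 0 \<cdot> z = w"
   if g: "g \<in> T -> (level (Gob G) n)" and w: "w \<in> T -> (Wob C G n)" for g w
  proof -
   let ?a = "\<lambda>j. if j = n then g else Wproj C G n j \<cdot> w"
   have a: "?a j \<in> T -> (level (Gob G) j)" if "j < Suc n" for j
   proof (cases "j = n")
    case False
    then have "j < n" using that by simp
    then show ?thesis using comp_Hom[OF Wproj_Hom w] by simp
   qed (use g in simp)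
   note t = Wtuple(1)[where n = "Suc n" and a = ?a, OF T a, simplified] Wtuple(2)[where n = "Suc n" and a = ?a, OF T a, simplified]
   have "Wface C G n 0 \<cdot> Wtuple C G (Suc n) T ?a = w"
   proof (rule Wob_eqI[OF f[OF le0 t(1)] w])
    fix j assume j: "j < n"
    then show "Wproj C G n j \<cdot> (Wface C G n 0 \<cdot> Wtuple C G (Suc n) T ?a) = Wproj C G n j \<cdot> w"
     using f0[OF j t(1)] t(2)[of j] by simp
   qed
   then show ?thesis using t(1) t(2)[of n] by (intro bexI[of _ "Wtuple C G (Suc n) T ?a"]) simp_all
  qed
  show "Wproj C G (Suc n) n \<cdot> (Wface C G (Suc n) 1 \<cdot> z) =
    gmul C (glevel G n) (face (Gob G) n 0 \<cdot> (Wproj C G (Suc (Suc n)) (Suc n) \<cdot> z)) (Wproj C G (Suc n) n \<cdot> (Wface C G (Suc n) 0 \<cdot> z))"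
   if "z \<in> T -> (Wob C G (Suc (Suc n)))"
   using Wproj_Wface[of 1 "Suc n" n, OF _ _ that] f0[of n "Suc n", OF _ that] by simp
  show "Wproj C G (Suc n) n \<cdot> (Wface C G (Suc n) (Suc i) \<cdot> z) = face (Gob G) n i \<cdot> (Wproj C G (Suc (Suc n)) (Suc n) \<cdot> z)"
   if "1 \<le> i" "i \<le> Suc n" "z \<in> T -> (Wob C G (Suc (Suc n)))"
   using Wproj_Wface[of "Suc i" "Suc n" n, OF _ _ that(3)] that(1,2) by simp
  show "Wface C G n 0 \<cdot> (Wface C G (Suc n) (Suc i) \<cdot> z) = Wface C G n i \<cdot> (Wface C G (Suc n) 0 \<cdot> z)"
   if i: "i \<le> Suc n" and z: "z \<in> T -> (Wob C G (Suc (Suc n)))"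
  proof (rule Wob_eqI)
   have fz: "Wface C G (Suc n) (Suc i) \<cdot> z \<in> T -> (Wob C G (Suc n))" "Wface C G (Suc n) 0 \<cdot> z \<in> T -> (Wob C G (Suc n))"
    using f i z by auto
   then show "Wface C G n 0 \<cdot> (Wface C G (Suc n) (Suc i) \<cdot> z) \<in> T -> (Wob C G n)"
    "Wface C G n i \<cdot> (Wface C G (Suc n) 0 \<cdot> z) \<in> T -> (Wob C G n)" using f i by auto
   fix j assume j: "j < n"
   show "Wproj C G n j \<cdot> (Wface C G n 0 \<cdot> (Wface C G (Suc n) (Suc i) \<cdot> z)) = Wproj C G n j \<cdot> (Wface C G n i \<cdot> (Wface C G (Suc n) 0 \<cdot> z))"
    using f0[OF j fz(1)] Wproj_Wface[OF _ _ z, of "Suc i" j] Wproj_Wface[OF i j fz(2)] f0[OF _ z, of j] f0[OF _ z, of "Suc j"] i j by simp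
  qed
  show "Wproj C G (Suc n) n \<cdot> (Wdegen C G n 0 \<cdot> z) = gone C (glevel G n) T" if "z \<in> T -> (Wob C G n)"
   using Wproj_Wdegen[of 0 n n, OF _ _ that] by simp
  show "Wface C G n 0 \<cdot> (Wdegen C G n 0 \<cdot> z) = z" if z: "z \<in> T -> (Wob C G n)"
  proof (rule Wob_eqI[OF f[OF le0 d[OF le0 z]] z])
   fix j assume j: "j < n"
   then show "Wproj C G n j \<cdot> (Wface C G n 0 \<cdot> (Wdegen C G n 0 \<cdot> z)) = Wproj C G n j \<cdot> z"
    using f0[OF j d[OF le0 z]] Wproj_Wdegen[OF le0 _ z, of j] by simp
  qed
  show "Wproj C G (Suc (Suc n)) (Suc n) \<cdot> (Wdegen C G (Suc n) (Suc i) \<cdot> z) = degen (Gob G) n i \<cdot> (Wproj C G (Suc n) n \<cdot> z)"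
   if "i \<le> n" "z \<in> T -> (Wob C G (Suc n))"
   using Wproj_Wdegen[of "Suc i" "Suc n" "Suc n", OF _ _ that(2)] that(1) by simp
  show "Wface C G (Suc n) 0 \<cdot> (Wdegen C G (Suc n) (Suc i) \<cdot> z) = Wdegen C G n i \<cdot> (Wface C G n 0 \<cdot> z)"
   if i: "i \<le> n" and z: "z \<in> T -> (Wob C G (Suc n))"
  proof (rule Wob_eqI)
   have dz: "Wdegen C G (Suc n) (Suc i) \<cdot> z \<in> T -> (Wob C G (Suc (Suc n)))" "Wface C G n 0 \<cdot> z \<in> T -> (Wob C G n)"
    using d f i z by auto
   then show "Wface C G (Suc n) 0 \<cdot> (Wdegen C G (Suc n) (Suc i) \<cdot> z) \<in> T -> (Wob C G (Suc n))"
    "Wdegen C G n i \<cdot> (Wface C G n 0 \<cdot> z) \<in> T -> (Wob C G (Suc n))" using d f i by auto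
   fix j assume j: "j < Suc n"
   show "Wproj C G (Suc n) j \<cdot> (Wface C G (Suc n) 0 \<cdot> (Wdegen C G (Suc n) (Suc i) \<cdot> z)) = Wproj C G (Suc n) j \<cdot> (Wdegen C G n i \<cdot> (Wface C G n 0 \<cdot> z))"
    using f0[OF j dz(1)] Wproj_Wdegen[OF _ _ z, of "Suc i" j] Wproj_Wdegen[OF i j dz(2)] f0[OF _ z, of j] f0[OF _ z, of "j - 1"] i j by auto
  qed
 qed
qed

end

locale wbar_points = wbar_object C G for C :: "('o, 'm) cat" and G +
 fixes T
 assumes T_Obj: "T \<in> Obj C"

sublocale wbar_points \<subseteq> classifying_set "hset C (Gob G) T" "\<lambda>n. gmul C (glevel G n)" "\<lambda>n. gone C (glevel G n) T"
  "\<lambda>n a. Ginv (glevel G n) \<cdot>\<^bsub>C\<^esub> a" "hset C W T" "\<lambda>n z. Wproj C G (Suc n) n \<cdot>\<^bsub>C\<^esub> z"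
 by (rule classifying_hset[OF T_Obj])

context wbar_object
begin

text \<open>The recursive model supplies the simplicial identities on generalized elements, and
  \<open>is_sobjI\<close> returns them to arrows.\<close>

lemma is_sobj_W: "is_sobj C W"
proof (rule is_sobjI, unfold Wbar_simps)
 fix T assume T: "T \<in> Obj C"
 interpret wbar_points C G T by unfold_locales (rule T)
 show "simplicial_set (hset C W T)" by (rule W.simplicial_set_axioms)
qed (use Wob_Obj Wface_Hom Wdegen_Hom in auto)

text \<open>Maps into \<open>Wbar\<close> are checked coordinatewise. This serves both the action of
  \<open>Wbar\<close> on homomorphisms and the comparison with the image under F.\<close>

lemma Wtuple_smap:
 assumes V: "is_sobj C V" and q: "\<And>n j. j < n ==> q n j \<in> (level V n) -> (level (Gob G) j)"
  and face: "\<And>n i j. i \<le> Suc n ==> j < n ==> q n j \<cdot> face V n i =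
   (if n < j + i then face (Gob G) j (j + i - n) \<cdot> q (Suc n) (Suc j)
    else if j + i = n then gmul C (glevel G j) (face (Gob G) j 0 \<cdot> q (Suc n) (Suc j)) (q (Suc n) j) else q (Suc n) j)"
  and degen: "\<And>n i j. i \<le> n ==> j < Suc n ==> q (Suc n) j \<cdot> degen V n i =
   (if n < j + i then degen (Gob G) (j - 1) (j + i - n - 1) \<cdot> q n (j - 1)
    else if j + i = n then gone C (glevel G j) (level V n) else q n j)"
 shows "is_smap C V W (\<lambda>n. Wtuple C G n (level V n) (q n))"
proof -
 define w where "w n = Wtuple C G n (level V n) (q n)" for n
 have w: "w n \<in> (level V n) -> (Wob C G n)" "j < n ==> Wproj C G n j \<cdot> w n = q n j" for n j
  unfolding w_def using Wtuple[where n = n, OF sobj_level[OF V] q] by simp_all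
 have wz: "Wproj C G n j \<cdot> (w n \<cdot> z) = q n j \<cdot> z" if "j < n" "z \<in> T -> (level V n)" for n j z T
  using assoc[OF Wproj_Hom[OF that(1)] w(1) that(2)] w(2)[OF that(1)] by simp
 have "is_smap C V W w"
  unfolding is_smap_def Wbar_simps
 proof (intro conjI allI impI w(1))
  fix n i
  show "w n \<cdot> face V n i = Wface C G n i \<cdot> w (Suc n)" if i: "i \<le> Suc n"
  proof (rule Wob_eqI[OF comp_Hom[OF w(1) sobj_face[OF V i]] comp_Hom[OF Wface_Hom[OF i] w(1)]])
   show "Wproj C G n j \<cdot> (w n \<cdot> face V n i) = Wproj C G n j \<cdot> (Wface C G n i \<cdot> w (Suc n))" if j: "j < n" for j
    using wz[OF j sobj_face[OF V i]] face[OF i j] Wproj_Wface[OF i j w(1)] w(2)[of "Suc j" "Suc n"] w(2)[of j "Suc n"] j by simp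
  qed
  show "w (Suc n) \<cdot> degen V n i = Wdegen C G n i \<cdot> w n" if i: "i \<le> n"
  proof (rule Wob_eqI[OF comp_Hom[OF w(1) sobj_degen[OF V i]] comp_Hom[OF Wdegen_Hom[OF i] w(1)]])
   fix j assume j: "j < Suc n"
   have "n < j + i ==> j - 1 < n" using i j by auto
   then show "Wproj C G (Suc n) j \<cdot> (w (Suc n) \<cdot> degen V n i) = Wproj C G (Suc n) j \<cdot> (Wdegen C G n i \<cdot> w n)"
    using wz[OF j sobj_degen[OF V i]] degen[OF i j] Wproj_Wdegen[OF i j w(1)] w(2)[of "j - 1" n] w(2)[of j n] j by simp
  qed
 qed
 then show ?thesis by (simp add: w_def[abs_def])
qed

end

lemma (in category) W_arrow:
 assumes G: "wbar_object C G" and H: "wbar_object C H"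
  and f: "\<And>j. f j \<in> (level (Gob G) j) -> (level (Gob H) j)"
 defines "w \<equiv> \<lambda>n. Wtuple C H n (Wob C G n) (\<lambda>j. f j \<cdot> Wproj C G n j)"
 shows "w n \<in> (Wob C G n) -> (Wob C H n)"
  and "j < n ==> Wproj C H n j \<cdot> w n = f j \<cdot> Wproj C G n j"
  and "j < n ==> z \<in> T -> (Wob C G n) ==> Wproj C H n j \<cdot> (w n \<cdot> z) = f j \<cdot> (Wproj C G n j \<cdot> z)"
proof -
 interpret G: wbar_object C G by (rule G)
 interpret H: wbar_object C H by (rule H)
 have a: "f j \<cdot> Wproj C G n j \<in> (Wob C G n) -> (level (Gob H) j)" if "j < n" for j
  using f G.Wproj_Hom[OF that] by blast
 show w: "w n \<in> (Wob C G n) -> (Wob C H n)" unfolding w_def by (rule H.Wtuple(1)[OF G.Wob_Obj a])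
 show e: "Wproj C H n j \<cdot> w n = f j \<cdot> Wproj C G n j" if "j < n" for j
  unfolding w_def by (rule H.Wtuple(2)[OF G.Wob_Obj a that])
 show "Wproj C H n j \<cdot> (w n \<cdot> z) = f j \<cdot> (Wproj C G n j \<cdot> z)" if "j < n" "z \<in> T -> (Wob C G n)"
  using assoc[OF H.Wproj_Hom[OF that(1)] w that(2)] assoc[OF f G.Wproj_Hom[OF that(1)] that(2)] e[OF that(1)] by simp
qed

text \<open>The image of the unit is idempotent, and in a group only the unit is.\<close>

lemma (in category) hom_gone:
 assumes "group_object C G" "group_object C H" and f: "f \<in> (Gob G) -> (Gob H)"
  and h: "\<And>T a b. a \<in> T -> (Gob G) ==> b \<in> T -> (Gob G) ==> f \<cdot> gmul C G a b = gmul C H (f \<cdot> a) (f \<cdot> b)"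
  and T: "T \<in> Obj C"
 shows "f \<cdot> gone C G T = gone C H T"
proof -
 interpret G: group_object C G by fact
 interpret H: group_object C H by fact
 let ?e = "f \<cdot> gone C G T" and ?i = "Ginv H \<cdot> (f \<cdot> gone C G T)"
 have e: "?e \<in> T -> (Gob H)" using f G.gone_Hom[OF T] by blast
 have i: "?i \<in> T -> (Gob H)" using H.inv_Hom e by blast
 have ee: "gmul C H ?e ?e = ?e" using h[OF G.gone_Hom[OF T] G.gone_Hom[OF T]] G.one_gmul[OF G.gone_Hom[OF T]] by simp
 have "gmul C H (gmul C H ?i ?e) ?e = gmul C H ?i ?e" using H.gmul_assoc[OF i e e] ee by simp
 then show ?thesis using H.inv_gmul[OF e] H.one_gmul[OF e] by simp
qed

lemma (in category) W_arrow_smap: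
 assumes G: "wbar_object C G" and H: "wbar_object C H"
  and f: "is_smap C (Gob G) (Gob H) f"
  and h: "\<And>j T a b. a \<in> T -> (level (Gob G) j) ==> b \<in> T -> (level (Gob G) j) ==>
   f j \<cdot> gmul C (glevel G j) a b = gmul C (glevel H j) (f j \<cdot> a) (f j \<cdot> b)"
 shows "is_smap C (OMap (Wbar C) G) (OMap (Wbar C) H) (\<lambda>n. Wtuple C H n (Wob C G n) (\<lambda>j. f j \<cdot> Wproj C G n j))"
proof -
 interpret G: wbar_object C G by (rule G)
 interpret H: wbar_object C H by (rule H)
 note fH = smap_Hom[OF f]
 show ?thesis
 proof (rule H.Wtuple_smap[OF G.is_sobj_W, where q = "\<lambda>n j. f j \<cdot> Wproj C G n j", unfolded Wbar_simps])
  show "f j \<cdot> Wproj C G n j \<in> (Wob C G n) -> (level (Gob H) j)" if "j < n" for n j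
   by (rule comp_Hom[OF fH G.Wproj_Hom[OF that]])
  fix n i j
  show "(f j \<cdot> Wproj C G n j) \<cdot> Wface C G n i =
   (if n < j + i then face (Gob H) j (j + i - n) \<cdot> (f (Suc j) \<cdot> Wproj C G (Suc n) (Suc j))
    else if j + i = n then gmul C (glevel H j) (face (Gob H) j 0 \<cdot> (f (Suc j) \<cdot> Wproj C G (Suc n) (Suc j))) (f j \<cdot> Wproj C G (Suc n) j)
    else f j \<cdot> Wproj C G (Suc n) j)" if i: "i \<le> Suc n" and j: "j < n"
  proof -
   have p: "Wproj C G (Suc n) (Suc j) \<in> (Wob C G (Suc n)) -> (level (Gob G) (Suc j))"
    "Wproj C G (Suc n) j \<in> (Wob C G (Suc n)) -> (level (Gob G) j)" using G.Wproj_Hom j by auto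
   have k: "j + i - n \<le> Suc j" using i by auto
   have fp: "f j \<cdot> (face (Gob G) j k \<cdot> Wproj C G (Suc n) (Suc j)) = face (Gob H) j k \<cdot> (f (Suc j) \<cdot> Wproj C G (Suc n) (Suc j))"
    if "k \<le> Suc j" for k
    using assoc[OF fH sobj_face[OF G.sobj_Gob that] p(1)] assoc[OF sobj_face[OF H.sobj_Gob that] fH p(1)] smap_face[OF f that] by simp
   show ?thesis
    using assoc[OF fH G.Wproj_Hom[OF j] G.Wface_Hom[OF i]] G.Wproj_faces[OF i j] fp[OF k] fp[OF le0]
     h[OF comp_Hom[OF sobj_face[OF G.sobj_Gob le0] p(1)] p(2)] by simp
  qed
  show "(f j \<cdot> Wproj C G (Suc n) j) \<cdot> Wdegen C G n i =
   (if n < j + i then degen (Gob H) (j - 1) (j + i - n - 1) \<cdot> (f (j - 1) \<cdot> Wproj C G n (j - 1))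
    else if j + i = n then gone C (glevel H j) (Wob C G n) else f j \<cdot> Wproj C G n j)" if i: "i \<le> n" and j: "j < Suc n"
  proof (cases "n < j + i")
   case True
   then obtain j' where j': "j = Suc j'" using i by (cases j) auto
   have b: "j' < n" "j + i - n - 1 \<le> j'" using True j i j' by auto
   show ?thesis
    using assoc[OF fH G.Wproj_Hom[OF j] G.Wdegen_Hom[OF i]] G.Wproj_degens[OF i j] True j'
     assoc[OF fH sobj_degen[OF G.sobj_Gob b(2)] G.Wproj_Hom[OF b(1)]]
     assoc[OF sobj_degen[OF H.sobj_Gob b(2)] fH G.Wproj_Hom[OF b(1)]] smap_degen[OF f b(2)] by simp
  next
   case False
   have "f j \<cdot> gone C (glevel G j) (Wob C G n) = gone C (glevel H j) (Wob C G n)"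
    by (rule hom_gone[OF G.glevel_group H.glevel_group _ _ G.Wob_Obj]) (use fH h in simp_all)
   then show ?thesis using assoc[OF fH G.Wproj_Hom[OF j] G.Wdegen_Hom[OF i]] G.Wproj_degens[OF i j] False by simp
  qed
 qed
qed

lemma ssmap_dec: "ssmap X Y \<phi> ==> ssmap (dec X) (dec Y) (\<lambda>n. \<phi> (Suc n))"
 unfolding ssmap_def dec_def by auto

text \<open>A pair \<open>a\<close>, \<open>b\<close> with the same image in \<open>L'\<close> has a
  unique lift to P: its first coordinate is \<open>a\<close>, and the other is forced to be
  \<open>\<omega> \<cdot> b\<close> by the requirement on \<open>c\<close>.\<close>

lemma (in category) pullback_of_coordinates:
 assumes P: "bin_product C A B P t \<delta>" and c: "c \<in> P -> L" and c': "c' \<in> A -> L'"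
  and v: "v \<in> L -> L'" and w: "\<omega> \<in> L -> B"
  and eq: "\<And>T z b. z \<in> T -> P ==> b \<in> T -> L ==>
   c \<cdot> z = b \<longleftrightarrow> \<delta> \<cdot> z = \<omega> \<cdot> b \<and> c' \<cdot> (t \<cdot> z) = v \<cdot> b"
 shows "is_pullback C c' v t c"
proof (rule pullbackI[OF c' v bin_product_Hom(1)[OF P] c])
 note t = bin_product_Hom[OF P] and id = Idm_Hom[OF Hom_Obj(1)[OF c]]
 show "c' \<cdot> t = v \<cdot> c" using eq[OF id c] comp_Idm[OF c] comp_Idm[OF t(1)] by simp
 show "\<exists>u\<in>Hom C T P. t \<cdot> u = a \<and> c \<cdot> u = b"
  if ab: "a \<in> T -> A" "b \<in> T -> L" "c' \<cdot> a = v \<cdot> b" for T a b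
 proof -
  obtain u where u: "u \<in> T -> P" "t \<cdot> u = a" "\<delta> \<cdot> u = \<omega> \<cdot> b"
   using ex1_implies_ex[OF bin_product_ex1[OF P ab(1) comp_Hom[OF w ab(2)]]] by blast
  then show ?thesis using eq[OF u(1) ab(2)] ab(3) by blast
 qed
 show "u = u'" if u: "u \<in> T -> P" "u' \<in> T -> P" "t \<cdot> u = t \<cdot> u'" "c \<cdot> u = c \<cdot> u'" for T u u'
  using bin_product_unique[OF P u(1-3)] eq[OF u(1) comp_Hom[OF c u(2)]] eq[OF u(2) comp_Hom[OF c u(2)]] u(4) by simp
qed

context wbar_object
begin

lemma W_spoint_precomp:
 assumes "spoint K (hset C W L) x" "[] \<notin> K" "b \<in> T -> L"
 shows "spoint K (hset C W T) (\<lambda>\<mu>. x \<mu> \<cdot> b)"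
 by (rule spoint_precomp[OF assms(2) is_sobj_W assms(1,3)])

lemma Wtop_comp:
 "z \<in> L -> (Wob C G (Suc n)) ==> b \<in> T -> L ==> Wproj C G (Suc n) n \<cdot> (z \<cdot> b) = (Wproj C G (Suc n) n \<cdot> z) \<cdot> b"
 using assoc[OF Wproj_Hom[of n "Suc n"]] by simp

text \<open>The two coordinate systems on a level of \<open>Wbar\<close>: with \<open>d_0\<close>
  for horns of positive apex, with \<open>d_1\<close> for apex 0.\<close>

lemma bin_product_top_face:
 shows "bin_product C (level (Gob G) m) (Wob C G m) (Wob C G (Suc m)) (Wproj C G (Suc m) m) (Wface C G m 0)"
  and "1 \<le> m ==> bin_product C (level (Gob G) m) (Wob C G m) (Wob C G (Suc m)) (Wproj C G (Suc m) m) (Wface C G m 1)"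
proof -
 have t: "Wproj C G (Suc m) m \<in> (Wob C G (Suc m)) -> (level (Gob G) m)" using Wproj_Hom by simp
 show "bin_product C (level (Gob G) m) (Wob C G m) (Wob C G (Suc m)) (Wproj C G (Suc m) m) (Wface C G m 0)"
 proof (rule bin_productI[OF t Wface_Hom[OF le0]])
  fix T a b assume ab: "a \<in> T -> (level (Gob G) m)" "b \<in> T -> (Wob C G m)"
  interpret T: wbar_points C G T by unfold_locales (rule Hom_Obj(1)[OF ab(1)])
  show "\<exists>z\<in>Hom C T (Wob C G (Suc m)). Wproj C G (Suc m) m \<cdot> z = a \<and> Wface C G m 0 \<cdot> z = b"
   using T.W_cons[of a m b] ab by simp
 next
  fix T u v assume z: "u \<in> T -> (Wob C G (Suc m))" "v \<in> T -> (Wob C G (Suc m))"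
   "Wproj C G (Suc m) m \<cdot> u = Wproj C G (Suc m) m \<cdot> v" "Wface C G m 0 \<cdot> u = Wface C G m 0 \<cdot> v"
  interpret T: wbar_points C G T by unfold_locales (rule Hom_Obj(1)[OF z(1)])
  show "u = v" by (rule T.W_ext[of _ m]) (simp_all add: z)
 qed
 assume "1 \<le> m"
 then obtain q where q: "m = Suc q" by (cases m) auto
 show "bin_product C (level (Gob G) m) (Wob C G m) (Wob C G (Suc m)) (Wproj C G (Suc m) m) (Wface C G m 1)"
 proof (rule bin_productI[OF t Wface_Hom])
  fix T a b assume ab: "a \<in> T -> (level (Gob G) m)" "b \<in> T -> (Wob C G m)"
  interpret T: wbar_points C G T by unfold_locales (rule Hom_Obj(1)[OF ab(1)])
  show "\<exists>z\<in>Hom C T (Wob C G (Suc m)). Wproj C G (Suc m) m \<cdot> z = a \<and> Wface C G m 1 \<cdot> z = b"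
   using T.ex_top_fc_1[of a q b] ab by (simp add: q)
 next
  fix T u v assume z: "u \<in> T -> (Wob C G (Suc m))" "v \<in> T -> (Wob C G (Suc m))"
   "Wproj C G (Suc m) m \<cdot> u = Wproj C G (Suc m) m \<cdot> v" "Wface C G m 1 \<cdot> u = Wface C G m 1 \<cdot> v"
  interpret T: wbar_points C G T by unfold_locales (rule Hom_Obj(1)[OF z(1)])
  show "u = v" by (rule T.W_ext_1[of _ q]) (use z in \<open>simp_all add: q\<close>)
 qed simp
qed

text \<open>In terms of its leading coordinate and of one of its faces, the simplices with a given horn are those
 with a given face whose leading coordinate has a given horn.\<close>

lemma W_horn_coordinates:
 assumes m: "1 \<le> m" "k \<le> Suc m" and x: "spoint (horn (Suc m) k) (hset C W L) x" and L: "L \<in> Obj C"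
 obtains \<delta> k' \<xi> \<omega> where "bin_product C (level (Gob G) m) (Wob C G m) (Wob C G (Suc m)) (Wproj C G (Suc m) m) \<delta>"
  "k' \<le> m" "spoint (horn m k') (hset C (Gob G) L) \<xi>" "\<omega> \<in> L -> (Wob C G m)"
  "\<And>T z b. z \<in> T -> (Wob C G (Suc m)) ==> b \<in> T -> L ==>
   (\<forall>\<mu>\<in>horn (Suc m) k. sop C W (Suc m) \<mu> \<cdot> z = x \<mu> \<cdot> b) \<longleftrightarrow>
   \<delta> \<cdot> z = \<omega> \<cdot> b \<and> (\<forall>\<nu>\<in>horn m k'. sop C (Gob G) m \<nu> \<cdot> (Wproj C G (Suc m) m \<cdot> z) = \<xi> \<nu> \<cdot> b)"
proof -
 note H = ssubset_horn[OF m(2)]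
 have x': "spoint (horn (Suc m) k) (hset C W T) (\<lambda>\<mu>. x \<mu> \<cdot> b)" if "b \<in> T -> L" for T b
  using W_spoint_precomp[OF x ssubset_Nil[OF H] that] .
 have xH: "x \<mu> \<in> L -> (Wob C G (dim \<mu>))" if "\<mu> \<in> horn (Suc m) k" for \<mu> using spoint_pts[OF x that] by simp
 have sW: "sop C W (Suc m) \<mu> \<cdot> z = sact (hset C W T) (Suc m) \<mu> z"
  if "\<mu> \<in> horn (Suc m) k" "z \<in> T -> (Wob C G (Suc m))" for \<mu> z T
  using sact_hset[OF is_sobj_W ssubset_std[OF H that(1)]] that(2) by simp
 have sG: "sop C (Gob G) m \<nu> \<cdot> (Wproj C G (Suc m) m \<cdot> z) = sact (hset C (Gob G) T) m \<nu> (Wproj C G (Suc m) m \<cdot> z)"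
  if "\<nu> \<in> horn m k'" "k' \<le> m" "z \<in> T -> (Wob C G (Suc m))" for \<nu> k' z T
  using sact_hset[OF sobj_Gob ssubset_std[OF ssubset_horn[OF that(2)] that(1)] comp_Hom[OF Wproj_Hom[OF lessI] that(3)]] by simp
 interpret L: wbar_points C G L by unfold_locales (rule L)
 show thesis
 proof (cases k)
  case (Suc k')
  then have k': "k' \<le> m" using m by simp
  note x = x[unfolded Suc] and x' = x'[unfolded Suc]
  let ?d = "map Suc [0..<Suc m]"
  have w: "x ?d \<in> L -> (Wob C G m)" using L.inner_horn(2)[OF m(1) k' x] by simp
  show thesis
  proof (rule that[OF bin_product_top_face(1) k' L.inner_horn(1)[OF m(1) k' x] w])
   fix T z b assume z: "z \<in> T -> (Wob C G (Suc m))" and b: "b \<in> T -> L"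
   interpret T: wbar_points C G T by unfold_locales (rule Hom_Obj(1)[OF b])
   \<comment> \<open>The horn in the group is constructed over \<open>L\<close> from the universal
     horn; it must also be the one constructed over T from the pulled back horn, so that the
     description holds at every stage.\<close>
   have nat: "T.inner_difference m (\<lambda>\<mu>. x \<mu> \<cdot> b) \<nu> = L.inner_difference m x \<nu> \<cdot> b" if t: "\<nu> \<in> horn m k'" for \<nu>
   proof -
    have st: "\<nu> \<in> std_simplex m" using ssubset_std[OF ssubset_horn[OF k'] t] .
    let ?y = "degen W m 0 \<cdot> x ?d"
    have y: "?y \<in> L -> (Wob C G (Suc m))" using Wdegen_Hom[of 0 m] w by auto
    have "cone_list \<nu> \<in> horn (Suc m) (Suc k')" using cone_list_horn(1)[OF st] t by simp
    then have c: "x (cone_list \<nu>) \<in> L -> (Wob C G (Suc (dim \<nu>)))" using xH[of "cone_list \<nu>"] st Suc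
     by (auto simp: std_simplex_def)
    have s: "sact (dec (hset C W T)) m \<nu> (?y \<cdot> b) = sact (dec (hset C W L)) m \<nu> ?y \<cdot> b"
     by (rule simplicial_set.sact_ssmap[OF simplicial_set_dec[OF simplicial_set_hset[OF is_sobj_W]] ssmap_dec[OF ssmap_precomp[OF is_sobj_W b]] _ st])
      (use y in \<open>simp add: dec_def\<close>)
    have sp: "sact (dec (hset C W L)) m \<nu> ?y \<in> L -> (Wob C G (Suc (dim \<nu>)))"
     using L.W.sact_dec_pts[of ?y m \<nu>] y st by simp
    have yb: "degen W m 0 \<cdot> (x ?d \<cdot> b) = ?y \<cdot> b" using assoc[OF Wdegen_Hom[of 0 m] w b] by simp
    interpret g: group_object C "glevel G (dim \<nu>)" by (rule glevel_group)
    have p: "Wproj C G (Suc (dim \<nu>)) (dim \<nu>) \<cdot> x (cone_list \<nu>) \<in> L -> (level (Gob G) (dim \<nu>))"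
     "Wproj C G (Suc (dim \<nu>)) (dim \<nu>) \<cdot> sact (dec (hset C W L)) m \<nu> ?y \<in> L -> (level (Gob G) (dim \<nu>))"
     using Wproj_Hom[of "dim \<nu>" "Suc (dim \<nu>)"] c sp by auto
    show ?thesis unfolding T.inner_difference_def L.inner_difference_def hset_simps yb s
      Wtop_comp[OF c b] Wtop_comp[OF sp b]
     using g.gmul_comp[OF _ comp_Hom[OF g.inv_Hom] b] assoc[OF g.inv_Hom _ b] p by simp
   qed
   have "(\<forall>\<mu>\<in>horn (Suc m) k. sop C W (Suc m) \<mu> \<cdot> z = x \<mu> \<cdot> b) \<longleftrightarrow>
     (\<forall>\<mu>\<in>horn (Suc m) (Suc k'). sact (hset C W T) (Suc m) \<mu> z = x \<mu> \<cdot> b)" using sW[OF _ z] Suc by simp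
   also have "\<dots> \<longleftrightarrow> Wface C G m 0 \<cdot> z = x ?d \<cdot> b \<and>
     (\<forall>\<nu>\<in>horn m k'. sact (hset C (Gob G) T) m \<nu> (Wproj C G (Suc m) m \<cdot> z) = T.inner_difference m (\<lambda>\<mu>. x \<mu> \<cdot> b) \<nu>)"
    using T.inner_horn(3)[OF m(1) k' x'[OF b], of z] z by simp
   finally show "(\<forall>\<mu>\<in>horn (Suc m) k. sop C W (Suc m) \<mu> \<cdot> z = x \<mu> \<cdot> b) \<longleftrightarrow>
     Wface C G m 0 \<cdot> z = x ?d \<cdot> b \<and>
     (\<forall>\<nu>\<in>horn m k'. sop C (Gob G) m \<nu> \<cdot> (Wproj C G (Suc m) m \<cdot> z) = L.inner_difference m x \<nu> \<cdot> b)"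
    using sG[OF _ k' z] nat by simp
  qed
 next
  case 0
  note x = x[unfolded 0] and x' = x'[unfolded 0]
  let ?d = "cone_list (map Suc [0..<m])"
  have w: "x ?d \<in> L -> (Wob C G m)" using L.outer_horn(2)[OF m(1) x] by simp
  show thesis
  proof (rule that[OF bin_product_top_face(2)[OF m(1)] le0 L.outer_horn(1)[OF m(1) x] w])
   fix T z b assume z: "z \<in> T -> (Wob C G (Suc m))" and b: "b \<in> T -> L"
   interpret T: wbar_points C G T by unfold_locales (rule Hom_Obj(1)[OF b])
   have nat: "T.outer_difference (\<lambda>\<mu>. x \<mu> \<cdot> b) \<nu> = L.outer_difference x \<nu> \<cdot> b" if t: "\<nu> \<in> horn m 0" for \<nu>
   proof -
    let ?D = "dim \<nu>"
    have st: "\<nu> \<in> std_simplex m" using ssubset_std[OF ssubset_horn[OF le0] t] .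
    then have st0: "0 # \<nu> \<in> std_simplex m" and l: "length \<nu> = Suc ?D" by (auto simp: std_simplex_def dim_def)
    have "cone_list (0 # \<nu>) \<in> horn (Suc m) 0" using cone_list_horn(2)[OF st0] t by (auto simp: horn_def bdry_def st0)
    then have c: "x (cone_list (0 # \<nu>)) \<in> L -> (Wob C G (Suc (Suc ?D)))" using xH[of "cone_list (0 # \<nu>)"] l 0 by simp
    have f: "face (Gob G) ?D 0 \<in> (level (Gob G) (Suc ?D)) -> (level (Gob G) ?D)" using sobj_face[OF sobj_Gob] by simp
    show ?thesis unfolding T.outer_difference_def L.outer_difference_def hset_simps Wtop_comp[OF c b]
     using assoc[OF f comp_Hom[OF Wproj_Hom[OF lessI] c] b] by simp
   qed
   have "(\<forall>\<mu>\<in>horn (Suc m) k. sop C W (Suc m) \<mu> \<cdot> z = x \<mu> \<cdot> b) \<longleftrightarrow>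
     (\<forall>\<mu>\<in>horn (Suc m) 0. sact (hset C W T) (Suc m) \<mu> z = x \<mu> \<cdot> b)" using sW[OF _ z] 0 by simp
   also have "\<dots> \<longleftrightarrow> Wface C G m 1 \<cdot> z = x ?d \<cdot> b \<and>
     (\<forall>\<nu>\<in>horn m 0. sact (hset C (Gob G) T) m \<nu> (Wproj C G (Suc m) m \<cdot> z) = T.outer_difference (\<lambda>\<mu>. x \<mu> \<cdot> b) \<nu>)"
    using T.outer_horn(3)[OF m(1) x'[OF b], of z] z by simp
   finally show "(\<forall>\<mu>\<in>horn (Suc m) k. sop C W (Suc m) \<mu> \<cdot> z = x \<mu> \<cdot> b) \<longleftrightarrow>
     Wface C G m 1 \<cdot> z = x ?d \<cdot> b \<and>
     (\<forall>\<nu>\<in>horn m 0. sop C (Gob G) m \<nu> \<cdot> (Wproj C G (Suc m) m \<cdot> z) = L.outer_difference x \<nu> \<cdot> b)"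
    using sG[OF _ le0 z] nat by simp
  qed
 qed
qed

end

context geometric
begin

text \<open>In dimension \<open>m + 1\<close> the comparison map of \<open>Wbar G\<close> is the
  base change of the one of G in dimension \<open>m\<close>, by the coordinates of the horn.
  Dimension 1 is separate, as there is no horn of dimension 0.\<close>

lemma W_kan:
 assumes G: "wbar_object C G" and Z: "simplicial_map C (OMap (Wbar C) G) Z \<psi>" "\<And>n. is_terminal C (level Z n)"
  and n: "1 \<le> n" "k \<le> n"
 shows "rel_matching_cover C S (horn n k) n (OMap (Wbar C) G, Z, \<psi>)"
 using n
proof (induction n arbitrary: k rule: less_induct)
 case (less n)
 interpret G: wbar_object C G by (rule G)
 interpret Z: simplicial_map C G.W Z \<psi> by (rule Z(1))
 note tu = terminal_Hom_unique[OF Z(2) C.category_axioms]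
 note H = ssubset_horn[OF less.prems(2)]
 interpret gm: geometric_map C S D S' F G.W Z \<psi> by (rule geometric_mapI[OF Z(1)])
 obtain L x y where "gm.matched (horn n k) n L x y"
  using inf_groupoid_matched[OF gm.geometric_map_axioms Z(2) less.prems less.IH] by blast
 then have M: "is_rel_matching C (horn n k) n (G.W, Z, \<psi>) L x y" by (simp add: gm.matched_def)
 note pt = Z.rel_matching_point[OF M, unfolded is_rel_point_iff]
 then have x: "spoint (horn n k) (hset C G.W L) x" and y: "y \<in> L -> (level Z n)" by auto
 have L: "L \<in> Obj C" using C.Hom_Obj(1)[OF y] .
 obtain c where c: "c \<in> (level G.W n) -> L" "\<And>\<mu>. \<mu> \<in> horn n k ==> x \<mu> \<cdot> c = sop C G.W n \<mu>" "y \<cdot> c = \<psi> n"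
  by (rule Z.rel_matching_comparison[OF M H]) blast
 have xH: "x \<mu> \<in> L -> (Wob C G (dim \<mu>))" if "\<mu> \<in> horn n k" for \<mu> using spoint_pts[OF x that] by simp
 have uniq: "b = b'" if b: "b \<in> T -> L" "b' \<in> T -> L" "\<And>\<mu>. \<mu> \<in> horn n k ==> x \<mu> \<cdot> b = x \<mu> \<cdot> b'" for T b b'
  by (rule Z.rel_matching_unique[OF H M b tu[OF C.comp_Hom[OF y b(1)] C.comp_Hom[OF y b(2)]]])
 have "c \<in> S"
 proof (cases "n = 1")
  case True
  \<comment> \<open>A horn of dimension 1 is a vertex with its degeneracies, and
    \<open>Wbar G\<close> is terminal in degree 0, so each stage has exactly one such horn.\<close>
  have "is_terminal C L"
   unfolding is_terminal_def
  proof (intro conjI ballI L)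
   fix T assume T: "T \<in> Obj C"
   have eq: "b = b'" if b: "b \<in> T -> L" "b' \<in> T -> L" for b b'
   proof (rule uniq[OF b])
    fix \<mu> assume k: "\<mu> \<in> horn n k"
    then have "set \<mu> \<subseteq> {..1}" "\<mu> \<noteq> []" "insert k (set \<mu>) \<noteq> {..1}" using True by (auto simp: horn_def std_simplex_def)
    moreover have "{..1} = {0, 1::nat}" by auto
    moreover have "k = 0 \<or> k = 1" using less.prems(2) True by auto
    ultimately have "set \<mu> \<subseteq> {k}" by auto
    then have kl: "\<mu> = lcomp [k] (map (\<lambda>_. 0) \<mu>)" by (auto simp: lcomp_def intro!: map_idI[symmetric])
    have th: "map (\<lambda>_. 0) \<mu> \<in> std_simplex (dim [k])" using \<open>\<mu> \<noteq> []\<close> by (auto simp: std_simplex_def sorted_map)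
    have a: "[k] \<in> horn n k" by (rule apex_in_horn[OF less.prems])
    have "x \<mu> \<cdot> b = sact (hset C G.W T) (dim [k]) (map (\<lambda>_. 0) \<mu>) (x [k] \<cdot> b)" if "b \<in> T -> L" for b
     using spoint_sact[OF H a G.W_spoint_precomp[OF x ssubset_Nil[OF H] that] th] kl by simp
    moreover have "x [k] \<cdot> b = x [k] \<cdot> b'"
     by (rule G.Wob_eqI[of _ T 0]) (use C.comp_Hom[OF xH[OF a]] b in simp_all)
    ultimately show "x \<mu> \<cdot> b = x \<mu> \<cdot> b'" using b by simp
   qed
   \<comment> \<open>For existence, the horn of the simplex whose coordinates are units.\<close>
   have u: "c \<cdot> Wtuple C G n T (\<lambda>j. gone C (glevel G j) T) \<in> T -> L"
    by (rule C.comp_Hom[of _ "Wob C G n"]) (use c(1) G.Wtuple(1)[OF T pregroup.gone_Hom[OF G.glevel_pregroup T, simplified]] in simp_all)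
   show "\<exists>!u. u \<in> T -> L" by (metis u eq)
  qed
  then show ?thesis using C.terminal_S c(1) by blast
 next
  case False
  then obtain m where n: "n = Suc m" and m: "1 \<le> m" using less.prems(1) by (cases n) auto
  note K = less.prems(2)[unfolded n]
  show ?thesis
  proof (rule G.W_horn_coordinates[OF m K x[unfolded n] L])
  fix \<delta> k' \<xi> \<omega>
  assume P: "bin_product C (level (Gob G) m) (Wob C G m) (Wob C G (Suc m)) (Wproj C G (Suc m) m) \<delta>"
   and k': "k' \<le> m" and xi: "spoint (horn m k') (hset C (Gob G) L) \<xi>" and w: "\<omega> \<in> L -> (Wob C G m)"
   and eq: "\<And>T z b. z \<in> T -> (Wob C G (Suc m)) ==> b \<in> T -> L ==>
    (\<forall>\<mu>\<in>horn (Suc m) k. sop C G.W (Suc m) \<mu> \<cdot> z = x \<mu> \<cdot> b) \<longleftrightarrow>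
    \<delta> \<cdot> z = \<omega> \<cdot> b \<and> (\<forall>\<nu>\<in>horn m k'. sop C (Gob G) m \<nu> \<cdot> (Wproj C G (Suc m) m \<cdot> z) = \<xi> \<nu> \<cdot> b)"
  obtain \<chi> where chi: "simplicial_map C (Gob G) Z \<chi>" using C.terminal_smap[OF G.sobj_Gob Z.sobj_Y Z(2)] .
  interpret GZ: simplicial_map C "Gob G" Z \<chi> by (rule chi)
  note H' = ssubset_horn[OF k']
  from group_inf_groupoid_matched[OF G.simplicial_group_object_axioms chi Z(2) m k']
  obtain L' x' y' c' where M': "is_rel_matching C (horn m k') m (Gob G, Z, \<chi>) L' x' y'" and c': "c' \<in> S"
   "c' \<in> (level (Gob G) m) -> L'" "\<And>\<nu>. \<nu> \<in> horn m k' ==> x' \<nu> \<cdot> c' = sop C (Gob G) m \<nu>"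
   unfolding rel_matching_cover_def by auto
  have x'H: "x' \<nu> \<in> L' -> (level (Gob G) (dim \<nu>))" if "\<nu> \<in> horn m k'" for \<nu>
   using GZ.rel_point_Hom(1)[OF GZ.rel_matching_point[OF M'] that] .
  have y'H: "y' \<in> L' -> (level Z m)" using GZ.rel_point_Hom(2)[OF GZ.rel_matching_point[OF M']] .
  obtain yv where yv: "yv \<in> L -> (level Z m)" using terminal_Hom_ex[OF Z(2) L] .
  have "is_rel_point C (horn m k') m (Gob G, Z, \<chi>) L \<xi> yv"
   unfolding is_rel_point_iff
  proof (intro conjI ballI xi yv)
   fix \<nu> assume t: "\<nu> \<in> horn m k'"
   have "\<xi> \<nu> \<in> L -> (level (Gob G) (dim \<nu>))" using spoint_pts[OF xi t] by simp
   then show "\<chi> (dim \<nu>) \<cdot> \<xi> \<nu> = sop C Z m \<nu> \<cdot> yv"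
    using tu[OF C.comp_Hom[OF GZ.phi_Hom] C.comp_Hom[OF C.sop_Hom[OF Z.sobj_Y ssubset_std[OF H' t]] yv]] by simp
  qed
  from GZ.rel_matching_lift[OF M' this] obtain v where v: "v \<in> L -> L'" "\<And>\<nu>. \<nu> \<in> horn m k' ==> x' \<nu> \<cdot> v = \<xi> \<nu>"
   by metis
  have t: "Wproj C G (Suc m) m \<in> (Wob C G (Suc m)) -> (level (Gob G) m)" using G.Wproj_Hom by simp
  have cH: "c \<in> (Wob C G (Suc m)) -> L" using c(1) n by simp
  \<comment> \<open>Equality of arrows into the matching objects \<open>L\<close> and
    \<open>L'\<close> is equality on all simplices of the horns, which turns the coordinate
    description of horns into the hypothesis of \<open>pullback_of_coordinates\<close>.\<close>
  have "is_pullback C c' v (Wproj C G (Suc m) m) c"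
  proof (rule C.pullback_of_coordinates[OF P cH c'(2) v(1) w])
   fix T z b assume z: "z \<in> T -> (Wob C G (Suc m))" and b: "b \<in> T -> L"
   note tz = C.comp_Hom[OF t z]
   have xc: "x \<mu> \<cdot> (c \<cdot> z) = sop C G.W (Suc m) \<mu> \<cdot> z" if "\<mu> \<in> horn n k" for \<mu>
    using C.assoc[OF xH[OF that] cH z] c(2)[OF that] n by simp
   have l: "c \<cdot> z = b \<longleftrightarrow> (\<forall>\<mu>\<in>horn (Suc m) k. sop C G.W (Suc m) \<mu> \<cdot> z = x \<mu> \<cdot> b)"
   proof
    assume "\<forall>\<mu>\<in>horn (Suc m) k. sop C G.W (Suc m) \<mu> \<cdot> z = x \<mu> \<cdot> b"
    then show "c \<cdot> z = b" by (intro uniq[OF C.comp_Hom[OF cH z] b]) (simp add: xc n)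
   qed (use xc n in auto)
   have xc': "x' \<nu> \<cdot> (c' \<cdot> (Wproj C G (Suc m) m \<cdot> z)) = sop C (Gob G) m \<nu> \<cdot> (Wproj C G (Suc m) m \<cdot> z)"
    "x' \<nu> \<cdot> (v \<cdot> b) = \<xi> \<nu> \<cdot> b" if "\<nu> \<in> horn m k'" for \<nu>
    using C.assoc[OF x'H[OF that] c'(2) tz] c'(3)[OF that] C.assoc[OF x'H[OF that] v(1) b] v(2)[OF that] by simp_all
   note h = C.comp_Hom[OF c'(2) tz] C.comp_Hom[OF v(1) b]
   have r: "c' \<cdot> (Wproj C G (Suc m) m \<cdot> z) = v \<cdot> b \<longleftrightarrow>
     (\<forall>\<nu>\<in>horn m k'. sop C (Gob G) m \<nu> \<cdot> (Wproj C G (Suc m) m \<cdot> z) = \<xi> \<nu> \<cdot> b)" (is "_ \<longleftrightarrow> ?R")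
   proof
    assume R: "?R"
    show "c' \<cdot> (Wproj C G (Suc m) m \<cdot> z) = v \<cdot> b"
     by (rule GZ.rel_matching_unique[OF H' M' h _ tu[OF C.comp_Hom[OF y'H h(1)] C.comp_Hom[OF y'H h(2)]]])
      (use xc' R in simp)
   qed (use xc' in simp)
   show "c \<cdot> z = b \<longleftrightarrow> \<delta> \<cdot> z = \<omega> \<cdot> b \<and> c' \<cdot> (Wproj C G (Suc m) m \<cdot> z) = v \<cdot> b"
    unfolding l r by (rule eq[OF z b])
  qed
  then show "c \<in> S" by (rule C.S_base[OF c'(1)])
  qed
 qed
 then show ?case using Z.rel_matching_coverI[OF M _ c(1) c(2,3)] by blast
qed

lemma inf_groupoid_W:
 assumes G: "wbar_object C G"
 shows "inf_groupoid C S (OMap (Wbar C) G)"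
proof -
 obtain t where t: "is_terminal C t" using C.terminal_cover by blast
 show ?thesis
  by (rule C.inf_groupoidI[OF t wbar_object.is_sobj_W[OF G]], rule W_kan[OF G]) (use t in simp_all)
qed

end

section \<open>Finite products from binary ones, and their preservation\<close>

section \<open>Finite products\<close>

context category
begin

lemma productI:
 assumes "P \<in> Obj C" "\<And>i. i \<in> I ==> p i \<in> P -> (A i)"
  and "\<And>T a. T \<in> Obj C ==> (\<And>i. i \<in> I ==> a i \<in> T -> (A i)) ==> \<exists>u\<in>Hom C T P. \<forall>i\<in>I. p i \<cdot> u = a i"
  and u: "\<And>T u v. u \<in> T -> P ==> v \<in> T -> P ==> (\<And>i. i \<in> I ==> p i \<cdot> u = p i \<cdot> v) ==> u = v"
 shows "is_product C I A P p"
 unfolding is_product_def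
proof (intro conjI ballI allI impI assms(1,2))
 fix T a assume T: "T \<in> Obj C" and a: "\<forall>i\<in>I. a i \<in> T -> (A i)"
 then have "\<exists>w\<in>Hom C T P. \<forall>i\<in>I. p i \<cdot> w = a i" by (intro assms(3)) simp_all
 then obtain w where w: "w \<in> T -> P" "\<forall>i\<in>I. p i \<cdot> w = a i" by (rule bexE)
 show "\<exists>!u. u \<in> T -> P \<and> (\<forall>i\<in>I. p i \<cdot> u = a i)"
 proof (rule ex1I)
  show "w \<in> T -> P \<and> (\<forall>i\<in>I. p i \<cdot> w = a i)" using w by simp
  fix v assume v: "v \<in> T -> P \<and> (\<forall>i\<in>I. p i \<cdot> v = a i)"
  show "v = w" by (rule u[OF conjunct1[OF v] w(1)]) (use v w(2) in simp)
 qed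
qed

lemma product_lift:
 assumes P: "is_product C I A P p" and T: "T \<in> Obj C" and a: "\<And>i. i \<in> I ==> a i \<in> T -> (A i)"
 obtains u where "u \<in> T -> P" "\<And>i. i \<in> I ==> p i \<cdot> u = a i"
proof -
 have "\<forall>i\<in>I. a i \<in> T -> (A i)" using a by simp
 then have "\<exists>!u. u \<in> T -> P \<and> (\<forall>i\<in>I. p i \<cdot> u = a i)" using P T unfolding is_product_def by simp
 from ex1_implies_ex[OF this] obtain u where u: "u \<in> T -> P" "\<forall>i\<in>I. p i \<cdot> u = a i" by (elim exE conjE)
 show thesis by (rule that[OF u(1) bspec[OF u(2)]])
qed

lemma product_Hom: "is_product C I A P p ==> i \<in> I ==> p i \<in> P -> (A i)"
 and product_Obj: "is_product C I A P p ==> P \<in> Obj C"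
 by (simp_all add: is_product_def)

lemma product_unique:
 assumes P: "is_product C I A P p" and u: "u \<in> T -> P" "v \<in> T -> P"
  and e: "\<And>i. i \<in> I ==> p i \<cdot> u = p i \<cdot> v"
 shows "u = v"
proof -
 have "\<forall>i\<in>I. p i \<cdot> v \<in> T -> (A i)" using comp_Hom[OF product_Hom[OF P] u(2)] by simp
 then have ex: "\<exists>!w. w \<in> T -> P \<and> (\<forall>i\<in>I. p i \<cdot> w = p i \<cdot> v)"
  using P Hom_Obj(1)[OF u(1)] unfolding is_product_def by simp
 show ?thesis by (rule ex1_eqD[OF ex]) (simp_all add: u e)
qed

lemma product_empty_iff: "is_product C {} A P p \<longleftrightarrow> is_terminal C P"
 by (simp add: is_product_def is_terminal_def)

lemma product_Suc:
 assumes P: "is_product C {..<n} A P p" and Q: "bin_product C (A n) P Q (q n) \<delta>"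
  and q: "\<And>j. j < n ==> q j = p j \<cdot> \<delta>"
 shows "is_product C {..<Suc n} A Q q"
proof (rule productI)
 note h = bin_product_Hom[OF Q]
 have pH: "p j \<in> P -> (A j)" if "j < n" for j using product_Hom[OF P] that by simp
 have qu: "q j \<cdot> u = p j \<cdot> (\<delta> \<cdot> u)" if "j < n" "u \<in> T -> Q" for j u T
  using assoc[OF pH[OF that(1)] h(2) that(2)] q[OF that(1)] by simp
 show "Q \<in> Obj C" using Hom_Obj(1)[OF h(1)] .
 show "q j \<in> Q -> (A j)" if "j \<in> {..<Suc n}" for j
  using that h(1) q[of j] comp_Hom[OF pH h(2), of j] by (cases "j = n") simp_all
 show "u = v" if u: "u \<in> T -> Q" "v \<in> T -> Q" and e: "\<And>i. i \<in> {..<Suc n} ==> q i \<cdot> u = q i \<cdot> v" for T u v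
 proof (rule bin_product_unique[OF Q u])
  show "q n \<cdot> u = q n \<cdot> v" using e by simp
  show "\<delta> \<cdot> u = \<delta> \<cdot> v"
  proof (rule product_unique[OF P comp_Hom[OF h(2) u(1)] comp_Hom[OF h(2) u(2)]])
   show "p i \<cdot> (\<delta> \<cdot> u) = p i \<cdot> (\<delta> \<cdot> v)" if "i \<in> {..<n}" for i
    using qu[OF _ u(1), of i] qu[OF _ u(2), of i] e[of i] that by simp
  qed
 qed
 show "\<exists>u\<in>Hom C T Q. \<forall>i\<in>{..<Suc n}. q i \<cdot> u = a i"
  if T: "T \<in> Obj C" and a: "\<And>i. i \<in> {..<Suc n} ==> a i \<in> T -> (A i)" for T a
 proof (rule product_lift[OF P T])
  show "i \<in> {..<n} ==> a i \<in> T -> (A i)" for i using a by simp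
  fix v assume v: "v \<in> T -> P" "\<And>i. i \<in> {..<n} ==> p i \<cdot> v = a i"
  have "a n \<in> T -> (A n)" using a by simp
  from ex1_implies_ex[OF bin_product_ex1[OF Q this v(1)]]
  obtain u where u: "u \<in> T -> Q" "q n \<cdot> u = a n" "\<delta> \<cdot> u = v" by (elim exE conjE)
  show ?thesis
  proof (intro bexI[OF _ u(1)] ballI)
   fix i assume "i \<in> {..<Suc n}"
   then show "q i \<cdot> u = a i" using u(2,3) qu[OF _ u(1), of i] v(2)[of i] by (cases "i = n") simp_all
  qed
 qed
qed

lemma product_Suc_bin_product:
 assumes P: "is_product C {..<Suc n} A P p" and R: "is_product C {..<n} A R r"
  and d: "\<delta> \<in> P -> R" "\<And>j. j < n ==> r j \<cdot> \<delta> = p j"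
 shows "bin_product C (A n) R P (p n) \<delta>"
proof (rule bin_productI[OF _ d(1)])
 have rH: "r j \<in> R -> (A j)" if "j < n" for j using product_Hom[OF R] that by simp
 have pu: "p j \<cdot> u = r j \<cdot> (\<delta> \<cdot> u)" if "j < n" "u \<in> T -> P" for j u T
  using assoc[OF rH[OF that(1)] d(1) that(2)] d(2)[OF that(1)] by simp
 show "p n \<in> P -> (A n)" using product_Hom[OF P] by simp
 fix T
 show "u = v" if u: "u \<in> T -> P" "v \<in> T -> P" "p n \<cdot> u = p n \<cdot> v" "\<delta> \<cdot> u = \<delta> \<cdot> v" for u v
 proof (rule product_unique[OF P u(1,2)])
  show "p j \<cdot> u = p j \<cdot> v" if "j \<in> {..<Suc n}" for j
   using that pu[OF _ u(1), of j] pu[OF _ u(2), of j] u(3,4) by (cases "j = n") simp_all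
 qed
 fix a b assume a: "a \<in> T -> (A n)" and b: "b \<in> T -> R"
 let ?a = "\<lambda>j. if j = n then a else r j \<cdot> b"
 show "\<exists>u\<in>Hom C T P. p n \<cdot> u = a \<and> \<delta> \<cdot> u = b"
 proof (rule product_lift[OF P Hom_Obj(1)[OF a]])
  show "?a j \<in> T -> (A j)" if "j \<in> {..<Suc n}" for j
   using that a comp_Hom[OF rH b, of j] by (cases "j = n") simp_all
  fix u assume u: "u \<in> T -> P" "\<And>j. j \<in> {..<Suc n} ==> p j \<cdot> u = ?a j"
  have "\<delta> \<cdot> u = b"
  proof (rule product_unique[OF R comp_Hom[OF d(1) u(1)] b])
   show "r j \<cdot> (\<delta> \<cdot> u) = r j \<cdot> b" if "j \<in> {..<n}" for j using pu[OF _ u(1), of j] u(2)[of j] that by simp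
  qed
  then show ?thesis using u(2)[of n] by (intro bexI[OF _ u(1)]) simp
 qed
qed

end

lemma (in cover_category) ex_product:
 assumes "\<And>j. A j \<in> Obj C"
 shows "\<exists>P p. is_product C {..<n::nat} A P p"
proof (induction n)
 case 0
 then show ?case using terminal_cover by (auto simp: product_empty_iff)
next
 case (Suc n)
 then obtain P p where P: "is_product C {..<n} A P p" by blast
 obtain Q t \<delta> where Q: "bin_product C (A n) P Q t \<delta>" using ex_bin_product[OF assms product_Obj[OF P]] by blast
 have "is_product C {..<Suc n} A Q (\<lambda>j. if j = n then t else p j \<cdot> \<delta>)"
  by (rule product_Suc[OF P]) (use Q in simp_all)
 then show ?case by blast
qed

text \<open>A product of \<open>n + 1\<close> factors is a binary product of the last factor and a
  product of the others. F preserves the binary product, and the others are covered by induction,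
  starting from a terminal object.\<close>

lemma (in geometric_terminal) F_is_product:
 assumes "is_product C {..<n::nat} A P p" "\<And>j. A j \<in> Obj C"
 shows "is_product D {..<n} (\<lambda>j. OMap F (A j)) (OMap F P) (\<lambda>j. AMap F (p j))"
 using assms(1)
proof (induction n arbitrary: P p)
 case 0
 then show ?case using F_terminal by (simp add: C.product_empty_iff D.product_empty_iff)
next
 case (Suc n)
 obtain R r where R: "is_product C {..<n} A R r" using C.ex_product[of A n] assms(2) by blast
 have pH: "j \<in> {..<n} ==> p j \<in> P -> (A j)" for j using C.product_Hom[OF Suc.prems] by simp
 obtain \<delta> where d: "\<delta> \<in> P -> R" "\<And>j. j \<in> {..<n} ==> r j \<cdot> \<delta> = p j"
  using C.product_lift[OF R C.product_Obj[OF Suc.prems] pH] by metis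
 have "bin_product C (A n) R P (p n) \<delta>" by (rule C.product_Suc_bin_product[OF Suc.prems R d(1)]) (use d(2) in simp)
 from D.product_Suc[where q = "\<lambda>j. AMap F (p j)", OF Suc.IH[OF R] F_bin_product[OF this]]
 show ?case using F_comp[OF C.product_Hom[OF R] d(1)] d(2) by simp
qed

section \<open>Levels of group objects, homomorphisms and the functor laws\<close>

section \<open>Functoriality of Wbar\<close>

text \<open>Makes passage to a level a functor that preserves products, so that levelwise group
  objects are an instance of \<open>group_image\<close>.\<close>

definition evaluation :: "nat => (('o, 'm) sobj, ('o, 'm) sarr, 'o, 'm) func" where
 "evaluation j = \<lparr>OMap = (\<lambda>X. level X j), AMap = (\<lambda>f. comps f j)\<rparr>"

lemma grpFun_evaluation: "OMap (grpFun (evaluation j)) G = glevel G j"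
 by (simp add: grpFun_def glevel_def evaluation_def Let_def)

lemma (in cover_category) product_functor_evaluation: "product_functor (sCat C) C (evaluation j)"
proof -
 interpret s: category "sCat C" by (rule category_sCat)
 obtain t where t: "is_terminal C t" using terminal_cover by blast
 show ?thesis
 proof
  show "is_functor (sCat C) C (evaluation j)"
   unfolding is_functor_def
  proof (intro conjI ballI impI is_category_sCat is_cat)
   fix f assume "f \<in> Arr (sCat C)"
   then show "AMap (evaluation j) f \<in> (OMap (evaluation j) (Dom (sCat C) f)) -> (OMap (evaluation j) (Cod (sCat C) f))"
    using smap_Hom by (cases f) (auto simp: evaluation_def)
  qed (auto simp: evaluation_def comps_def sobj_level)
  show "\<exists>P p q. bin_product (sCat C) X Y P p q" if "X \<in> Obj (sCat C)" "Y \<in> Obj (sCat C)" for X Y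
   using ex_bin_product_sCat[OF that] .
  show "bin_product C (OMap (evaluation j) X) (OMap (evaluation j) Y) (OMap (evaluation j) P) (AMap (evaluation j) p) (AMap (evaluation j) q)"
   if "bin_product (sCat C) X Y P p q" for X Y P p q
   using bin_product_sCat_level[OF that] by (simp add: evaluation_def)
  show "is_terminal C (OMap (evaluation j) Z)" if "is_terminal (sCat C) Z" for Z
   using terminal_level[OF t that] by (simp add: evaluation_def)
 qed
qed

lemma (in cover_category) wbar_objectI:
 assumes G: "group_object (sCat C) G"
 shows "wbar_object C G"
proof -
 interpret G: group_object "sCat C" G by (rule G)
 have g: "group_object C (glevel G j)" for j
  using product_functor.group_image[OF product_functor_evaluation G] by (simp only: grpFun_evaluation)
 have "level (Gob G) j \<in> Obj C" for j
  using G.Hom_Obj(2)[OF G.mult_Hom] sobj_level by simp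
 then show ?thesis
  by (intro wbar_object.intro wbar_object_axioms.intro simplicial_group_object.intro simplicial_group_object_axioms.intro
   category_axioms G.pregroup_axioms g ex_product)
qed

text \<open>The products chosen in C have product images, which witness \<open>ex_products\<close>
  in D. The group laws are transported at each level separately.\<close>

lemma (in geometric_terminal) wbar_object_image:
 assumes G: "group_object (sCat C) G"
 shows "wbar_object D (OMap (grpFun (sFun F)) G)"
  and "is_product D {..<n} (level (Gob (OMap (grpFun (sFun F)) G))) (OMap F (Wob C G n)) (\<lambda>j. AMap F (Wproj C G n j))"
  and "glevel (OMap (grpFun (sFun F)) G) j = OMap (grpFun F) (glevel G j)"
proof -
 interpret G: wbar_object C G by (rule C.wbar_objectI[OF G])
 interpret s: product_functor "sCat C" "sCat D" "sFun F" by (rule product_functor_sFun)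
 show l: "glevel (OMap (grpFun (sFun F)) G) j = OMap (grpFun F) (glevel G j)" for j
  by (simp add: glevel_def grpFun_def Let_def)
 show p: "is_product D {..<n} (level (Gob (OMap (grpFun (sFun F)) G))) (OMap F (Wob C G n)) (\<lambda>j. AMap F (Wproj C G n j))" for n
  using F_is_product[OF G.Wob_product sobj_level[OF G.sobj_Gob]] by (simp add: sFun_def Let_def)
 have g: "group_object D (glevel (OMap (grpFun (sFun F)) G) n)" for n
  unfolding l by (rule base.group_image[OF G.glevel_group])
 show "wbar_object D (OMap (grpFun (sFun F)) G)"
  by (intro wbar_object.intro wbar_object_axioms.intro simplicial_group_object.intro simplicial_group_object_axioms.intro
   D.category_axioms s.pregroup_image[OF G.sCat_pregroup] g exI) (rule p)
qed

lemma is_functor_func_comp: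
 assumes "is_functor C D F" "is_functor D E G"
 shows "is_functor C E (func_comp G F)"
proof -
 have "AMap F f \<in> Arr D" "Dom D (AMap F f) = OMap F (Dom C f)" "Cod D (AMap F f) = OMap F (Cod C f)" if "f \<in> Arr C" for f
  using assms(1) that unfolding is_functor_def Hom_def by auto
 moreover from this assms(2) have "AMap G (AMap F f) \<in> Hom E (OMap G (OMap F (Dom C f))) (OMap G (OMap F (Cod C f)))" if "f \<in> Arr C" for f
  using that unfolding is_functor_def by metis
 ultimately show ?thesis using assms unfolding is_functor_def func_comp_def by simp
qed

context category
begin

text \<open>The pairing into the square formed among simplicial objects has at each level the
  pairing formed there, so a homomorphism of simplicial groups is one levelwise.\<close>

lemma glevel_gmul:
 assumes G: "wbar_object C G" and ab: "a \<in> T -> (level (Gob G) j)" "b \<in> T -> (level (Gob G) j)"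
  and H: "wbar_object C H" and f: "(G, H, f) \<in> Arr (Grp (sCat C))"
 shows "comps f j \<cdot> gmul C (glevel G j) a b = gmul C (glevel H j) (comps f j \<cdot> a) (comps f j \<cdot> b)"
proof -
 interpret s: category "sCat C" by (rule category_sCat)
 interpret G: wbar_object C G by (rule G)
 interpret H: wbar_object C H by (rule H)
 interpret h: pregroup "sCat C" H by (rule H.sCat_pregroup)
 interpret g: pregroup "sCat C" G by (rule G.sCat_pregroup)
 interpret hj: pregroup C "glevel H j" by (rule H.glevel_pregroup)
 interpret gj: pregroup C "glevel G j" by (rule G.glevel_pregroup)
 note f = s.Grp_ArrD(3,4)[OF f]
 note sq = bin_product_Hom[OF g.square]
 note fs = s.comp_Hom[OF f(1) sq(1)] s.comp_Hom[OF f(1) sq(2)]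
 let ?u = "gpair (sCat C) H (f \<cdot>\<^bsub>sCat C\<^esub> Gfst G) (f \<cdot>\<^bsub>sCat C\<^esub> Gsnd G)"
 note u = h.gpair[OF fs]
 have fj: "comps f j \<in> (level (Gob G) j) -> (level (Gob H) j)" using f(1) smap_Hom by (auto simp: sCat_Hom)
 have uj: "comps ?u j \<in> (level (Gsq G) j) -> (level (Gsq H) j)" using u(1) sq smap_Hom by (auto simp: sCat_Hom)
 have pj: "comps (Gfst G) j \<in> (level (Gsq G) j) -> (level (Gob G) j)" "comps (Gsnd G) j \<in> (level (Gsq G) j) -> (level (Gob G) j)"
  using sq smap_Hom by (auto simp: sCat_Hom)
 have "comps (Gfst H) j \<cdot> comps ?u j = comps f j \<cdot> comps (Gfst G) j" "comps (Gsnd H) j \<cdot> comps ?u j = comps f j \<cdot> comps (Gsnd G) j"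
  using arg_cong[OF u(2), of "\<lambda>h. comps h j"] arg_cong[OF u(3), of "\<lambda>h. comps h j"] by simp_all
 then have "gpair C (glevel H j) (comps f j \<cdot> comps (Gfst G) j) (comps f j \<cdot> comps (Gsnd G) j) = comps ?u j"
  using hj.gpair_eqI[of "comps f j \<cdot> comps (Gfst G) j" "level (Gsq G) j" "comps f j \<cdot> comps (Gsnd G) j" "comps ?u j"] uj
   comp_Hom[OF fj pj(1)] comp_Hom[OF fj pj(2)] by simp
 then have "comps f j \<cdot> Gmult (glevel G j) = gmul C (glevel H j) (comps f j \<cdot> Gfst (glevel G j)) (comps f j \<cdot> Gsnd (glevel G j))"
  using arg_cong[OF f(2), of "\<lambda>h. comps h j"] by (simp add: gmul_def)
 from gj.hom_gmul[OF _ this hj.pregroup_axioms, of "level (Gob H) j" a T b] show ?thesis using fj ab by simp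
qed

lemma Wbar_Hom:
 assumes G: "wbar_object C G" and H: "wbar_object C H" and f: "(G, H, f) \<in> Arr (Grp (sCat C))"
 shows "AMap (Wbar C) (G, H, f) \<in> Hom (sCat C) (OMap (Wbar C) G) (OMap (Wbar C) H)"
proof -
 interpret s: category "sCat C" by (rule category_sCat)
 have "is_smap C (Gob G) (Gob H) (comps f)" using s.Grp_ArrD(3)[OF f] by (simp add: sCat_Hom)
 from W_arrow_smap[OF G H this glevel_gmul[OF G _ _ H f]] show ?thesis
  using wbar_object.is_sobj_W[OF G] wbar_object.is_sobj_W[OF H] by (simp add: sCat_Hom)
qed

lemma Wbar_arrow_Hom: "(G, H, f) \<in> Arr (Grp (sCat C)) ==> comps f j \<in> (level (Gob G) j) -> (level (Gob H) j)"
 using category.Grp_ArrD(3)[OF category_sCat] smap_Hom by (fastforce simp: sCat_Hom)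

text \<open>Only the values of \<open>K\<close> need to have the products that define \<open>Wbar\<close>.\<close>

lemma is_functor_Wbar:
 assumes K: "is_functor E (Grp (sCat C)) K" and W: "\<And>X. X \<in> Obj E ==> wbar_object C (OMap K X)"
  and g: "\<And>X. X \<in> Obj E ==> inf_groupoid C S (OMap (Wbar C) (OMap K X))"
 shows "is_functor E (Gpd C S) (func_comp (Wbar C) K)"
proof -
 have E: "category E" using K by unfold_locales (simp add: is_functor_def)
 then interpret E: category E .
 have KA: "\<exists>f'. AMap K f = (OMap K (Dom E f), OMap K (Cod E f), f') \<and> (OMap K (Dom E f), OMap K (Cod E f), f') \<in> Arr (Grp (sCat C))"
  if "f \<in> Arr E" for f
  using K that unfolding is_functor_def Hom_def by (cases "AMap K f") force
 have dc: "Dom E f \<in> Obj E" "Cod E f \<in> Obj E" if "f \<in> Arr E" for f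
  using that E.is_cat unfolding is_category_def by auto
 show ?thesis
  unfolding is_functor_def func_comp_def func.simps o_apply Gpd_def
 proof (intro conjI ballI impI is_category_full_subcategory is_category_sCat E.is_cat)
 fix X assume X: "X \<in> Obj E"
 interpret X: wbar_object C "OMap K X" by (rule W[OF X])
 show "OMap (Wbar C) (OMap K X) \<in> Obj (full_subcategory (sCat C) (inf_groupoid C S))" using g[OF X] X.is_sobj_W by simp
 have "(\<lambda>n. Wtuple C (OMap K X) n (Wob C (OMap K X) n) (\<lambda>j. Idm C (level (Gob (OMap K X)) j) \<cdot> Wproj C (OMap K X) n j)) = (\<lambda>n. Idm C (Wob C (OMap K X) n))"
 proof
  fix n
  have i: "Idm C (level (Gob (OMap K X)) j) \<in> (level (Gob (OMap K X)) j) -> (level (Gob (OMap K X)) j)" for j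
   using Idm_Hom sobj_level[OF X.sobj_Gob] by blast
  note w = W_arrow[OF X.wbar_object_axioms X.wbar_object_axioms i]
  show "Wtuple C (OMap K X) n (Wob C (OMap K X) n) (\<lambda>j. Idm C (level (Gob (OMap K X)) j) \<cdot> Wproj C (OMap K X) n j) = Idm C (Wob C (OMap K X) n)"
  proof (rule X.Wob_eqI[OF w(1) Idm_Hom[OF X.Wob_Obj]])
   fix j assume "j < n"
   note p = X.Wproj_Hom[OF this]
   show "Wproj C (OMap K X) n j \<cdot> Wtuple C (OMap K X) n (Wob C (OMap K X) n) (\<lambda>j. Idm C (level (Gob (OMap K X)) j) \<cdot> Wproj C (OMap K X) n j) =
     Wproj C (OMap K X) n j \<cdot> Idm C (Wob C (OMap K X) n)"
    using w(2)[OF \<open>j < n\<close>] comp_Idm[OF p] Idm_comp[OF p] by simp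
  qed
 qed
 moreover have "AMap K (Idm E X) = (OMap K X, OMap K X, Idm (sCat C) (Gob (OMap K X)))"
  using K X unfolding is_functor_def by simp
 ultimately show "AMap (Wbar C) (AMap K (Idm E X)) = Idm (full_subcategory (sCat C) (inf_groupoid C S)) (OMap (Wbar C) (OMap K X))"
  by simp
next
 fix f assume f: "f \<in> Arr E"
 obtain f' where f': "AMap K f = (OMap K (Dom E f), OMap K (Cod E f), f')" "(OMap K (Dom E f), OMap K (Cod E f), f') \<in> Arr (Grp (sCat C))"
  using KA[OF f] by blast
 show "AMap (Wbar C) (AMap K f) \<in> Hom (full_subcategory (sCat C) (inf_groupoid C S)) (OMap (Wbar C) (OMap K (Dom E f))) (OMap (Wbar C) (OMap K (Cod E f)))"
  unfolding full_subcategory_Hom f'(1) using Wbar_Hom[OF W W f'(2)] g dc[OF f] by blast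
 fix h assume h: "h \<in> Arr E" and e: "Cod E f = Dom E h"
 obtain h' where h': "AMap K h = (OMap K (Dom E h), OMap K (Cod E h), h')" "(OMap K (Dom E h), OMap K (Cod E h), h') \<in> Arr (Grp (sCat C))"
  using KA[OF h] by blast
 let ?X = "OMap K (Dom E f)" and ?Y = "OMap K (Dom E h)" and ?Z = "OMap K (Cod E h)"
 interpret X: wbar_object C ?X by (rule W[OF dc(1)[OF f]])
 interpret Y: wbar_object C ?Y by (rule W[OF dc(1)[OF h]])
 interpret Z: wbar_object C ?Z by (rule W[OF dc(2)[OF h]])
 have fH: "comps f' j \<in> (level (Gob ?X) j) -> (level (Gob ?Y) j)" for j using Wbar_arrow_Hom[OF f'(2)] e by simp
 have hH: "comps h' j \<in> (level (Gob ?Y) j) -> (level (Gob ?Z) j)" for j using Wbar_arrow_Hom[OF h'(2)] .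
 note wf = W_arrow[OF X.wbar_object_axioms Y.wbar_object_axioms fH]
 note wh = W_arrow[OF Y.wbar_object_axioms Z.wbar_object_axioms hH]
 note w = W_arrow[OF X.wbar_object_axioms Z.wbar_object_axioms comp_Hom[OF hH fH]]
 have "(\<lambda>n. Wtuple C ?Z n (Wob C ?X n) (\<lambda>j. (comps h' j \<cdot> comps f' j) \<cdot> Wproj C ?X n j)) =
  (\<lambda>n. Wtuple C ?Z n (Wob C ?Y n) (\<lambda>j. comps h' j \<cdot> Wproj C ?Y n j) \<cdot> Wtuple C ?Y n (Wob C ?X n) (\<lambda>j. comps f' j \<cdot> Wproj C ?X n j))"
 proof
  fix n
  show "Wtuple C ?Z n (Wob C ?X n) (\<lambda>j. (comps h' j \<cdot> comps f' j) \<cdot> Wproj C ?X n j) =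
   Wtuple C ?Z n (Wob C ?Y n) (\<lambda>j. comps h' j \<cdot> Wproj C ?Y n j) \<cdot> Wtuple C ?Y n (Wob C ?X n) (\<lambda>j. comps f' j \<cdot> Wproj C ?X n j)"
   by (rule Z.Wob_eqI[OF w(1) comp_Hom[OF wh(1) wf(1)]])
    (use w(2) wh(3)[OF _ wf(1)] wf(2) assoc[OF hH fH X.Wproj_Hom] in simp)
 qed
 moreover have "AMap K (h \<cdot>\<^bsub>E\<^esub> f) = (?X, ?Z, h' \<cdot>\<^bsub>sCat C\<^esub> f')"
  using K f h e f'(1) h'(1) unfolding is_functor_def by simp
 ultimately show "AMap (Wbar C) (AMap K (h \<cdot>\<^bsub>E\<^esub> f)) = AMap (Wbar C) (AMap K h) \<cdot>\<^bsub>full_subcategory (sCat C) (inf_groupoid C S)\<^esub> AMap (Wbar C) (AMap K f)"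
  using f'(1) h'(1) e by simp
qed
qed

end

section \<open>Invariance under levelwise isomorphism and the natural isomorphism\<close>

section \<open>Comparison of the two Wbar constructions\<close>

context category
begin

lemma inverse_square:
 assumes f: "f \<in> X -> Y" "g \<in> Y -> X" "g \<cdot> f = Idm C X"
  and f': "f' \<in> X' -> Y'" "g' \<in> Y' -> X'" "f' \<cdot> g' = Idm C Y'"
  and ab: "a \<in> X' -> X" "b \<in> Y' -> Y" "f \<cdot> a = b \<cdot> f'"
 shows "g \<cdot> b = a \<cdot> g'"
proof -
 have "b = (f \<cdot> a) \<cdot> g'" using assoc[OF ab(2) f'(1,2)] f'(3) ab(3) comp_Idm[OF ab(2)] by simp
 also have "\<dots> = f \<cdot> (a \<cdot> g')" by (rule assoc[OF f(1) ab(1) f'(2)])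
 finally have "g \<cdot> b = g \<cdot> (f \<cdot> (a \<cdot> g'))" by simp
 also have "\<dots> = a \<cdot> g'" using assoc[OF f(2,1) comp_Hom[OF ab(1) f'(2)]] f(3) Idm_comp[OF comp_Hom[OF ab(1) f'(2)]] by simp
 finally show ?thesis .
qed

text \<open>Inverses of the components automatically commute with the operators, by
  \<open>inverse_square\<close>.\<close>

lemma smap_inverse:
 assumes "simplicial_map C X Y \<phi>" and iso: "\<And>n. is_iso C (\<phi> n)"
 obtains \<psi> where "simplicial_map C Y X \<psi>" "\<And>n. \<psi> n \<cdot> \<phi> n = Idm C (level X n)" "\<And>n. \<phi> n \<cdot> \<psi> n = Idm C (level Y n)"
proof -
 interpret simplicial_map C X Y \<phi> by fact
 let ?P = "\<lambda>n g. g \<in> (level Y n) -> (level X n) \<and> g \<cdot> \<phi> n = Idm C (level X n) \<and> \<phi> n \<cdot> g = Idm C (level Y n)"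
 define \<psi> where "\<psi> n = (SOME g. ?P n g)" for n
 have "\<exists>g. ?P n g" for n by (rule is_isoE[OF iso phi_Hom[of n]]) blast
 from someI_ex[OF this] have p: "\<psi> n \<in> (level Y n) -> (level X n)" "\<psi> n \<cdot> \<phi> n = Idm C (level X n)" "\<phi> n \<cdot> \<psi> n = Idm C (level Y n)" for n
  by (simp_all add: \<psi>_def)
 have "is_smap C Y X \<psi>"
  unfolding is_smap_def
 proof (intro conjI allI impI p(1))
  show "\<psi> n \<cdot> face Y n i = face X n i \<cdot> \<psi> (Suc n)" if "i \<le> Suc n" for n i
   by (rule inverse_square[OF phi_Hom p(1,2) phi_Hom p(1,3) sobj_face[OF sobj_X that] sobj_face[OF sobj_Y that] smap_face[OF smap that]])
  show "\<psi> (Suc n) \<cdot> degen Y n i = degen X n i \<cdot> \<psi> n" if "i \<le> n" for n i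
   by (rule inverse_square[OF phi_Hom p(1,2) phi_Hom p(1,3) sobj_degen[OF sobj_X that] sobj_degen[OF sobj_Y that] smap_degen[OF smap that]])
 qed
 then have "simplicial_map C Y X \<psi>" using sobj_X sobj_Y by unfold_locales
 then show thesis using that p(2,3) by blast
qed

end

text \<open>The same object represents both limits once its coordinates are composed with
  \<open>\<phi>\<close>, and the comparison map changes by the isomorphism \<open>\<psi> n\<close>,
  which is a cover.\<close>

lemma (in covers) rel_matching_cover_iso:
 assumes f: "simplicial_map C X Y \<phi>" "simplicial_map C Y X \<psi>" "\<And>n. \<psi> n \<cdot> \<phi> n = Idm C (level X n)" "\<And>n. \<phi> n \<cdot> \<psi> n = Idm C (level Y n)"
  and Z: "simplicial_map C X Z \<alpha>" "simplicial_map C Y Z \<beta>" "\<And>n. \<beta> n \<cdot> \<phi> n = \<alpha> n"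
  and K: "ssubset n K" and r: "rel_matching_cover C S K n (X, Z, \<alpha>)"
 shows "rel_matching_cover C S K n (Y, Z, \<beta>)"
proof -
 interpret f: simplicial_map C X Y \<phi> by fact
 interpret g: simplicial_map C Y X \<psi> by fact
 interpret a: simplicial_map C X Z \<alpha> by fact
 interpret b: simplicial_map C Y Z \<beta> by fact
 obtain L x y c where M: "is_rel_matching C K n (X, Z, \<alpha>) L x y" and c: "c \<in> S" "c \<in> (level X n) -> L"
  "\<And>\<mu>. \<mu> \<in> K ==> x \<mu> \<cdot> c = sop C X n \<mu>" "y \<cdot> c = \<alpha> n"
  using r unfolding rel_matching_cover_def by auto
 note pt = a.rel_matching_point[OF M]
 note xH = a.rel_point_Hom(1)[OF pt] and yH = a.rel_point_Hom(2)[OF pt]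
 note x = pt[unfolded is_rel_point_iff]
 let ?x = "\<lambda>\<mu>. \<phi> (dim \<mu>) \<cdot> x \<mu>"
 have ba: "\<beta> m \<cdot> (\<phi> m \<cdot> u) = \<alpha> m \<cdot> u" if "u \<in> T -> (level X m)" for m u T
  using assoc[OF b.phi_Hom f.phi_Hom that] Z(3) by simp
 have gf: "\<psi> m \<cdot> (\<phi> m \<cdot> u) = u" if "u \<in> T -> (level X m)" for m u T
  using assoc[OF g.phi_Hom f.phi_Hom that] f(3) Idm_comp[OF that] by simp
 have fg: "\<phi> m \<cdot> (\<psi> m \<cdot> u) = u" if "u \<in> T -> (level Y m)" for m u T
  using assoc[OF f.phi_Hom g.phi_Hom that] f(4) Idm_comp[OF that] by simp
 have xu: "?x \<mu> \<cdot> u = \<phi> (dim \<mu>) \<cdot> (x \<mu> \<cdot> u)" if "\<mu> \<in> K" "u \<in> T -> L" for \<mu> u T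
  by (rule assoc[OF f.phi_Hom xH[OF that(1)] that(2)])
 have M': "is_rel_matching C K n (Y, Z, \<beta>) L ?x y"
 proof (rule b.rel_matchingI)
  show "is_rel_point C K n (Y, Z, \<beta>) L ?x y"
   unfolding is_rel_point_iff
  proof (intro conjI ballI yH)
   show "spoint K (hset C Y L) ?x"
    by (rule ssmap_spoint[OF ssubset_Nil[OF K] ssmap_postcomp[OF f.sobj_X f.sobj_Y f.smap]]) (use x in simp)
   show "\<beta> (dim \<mu>) \<cdot> ?x \<mu> = sop C Z n \<mu> \<cdot> y" if "\<mu> \<in> K" for \<mu> using ba[OF xH[OF that]] x that by simp
  qed
 next
  fix T x' y' assume p': "is_rel_point C K n (Y, Z, \<beta>) T x' y'"
  note x' = p'[unfolded is_rel_point_iff] and x'H = b.rel_point_Hom[OF p']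
  have "is_rel_point C K n (X, Z, \<alpha>) T (\<lambda>\<mu>. \<psi> (dim \<mu>) \<cdot> x' \<mu>) y'"
   unfolding is_rel_point_iff
  proof (intro conjI ballI x'H(2))
   show "spoint K (hset C X T) (\<lambda>\<mu>. \<psi> (dim \<mu>) \<cdot> x' \<mu>)"
    by (rule ssmap_spoint[OF ssubset_Nil[OF K] ssmap_postcomp[OF g.sobj_X g.sobj_Y g.smap]]) (use x' in simp)
   show "\<alpha> (dim \<mu>) \<cdot> (\<psi> (dim \<mu>) \<cdot> x' \<mu>) = sop C Z n \<mu> \<cdot> y'" if "\<mu> \<in> K" for \<mu>
    using ba[OF comp_Hom[OF g.phi_Hom x'H(1)[OF that]]] fg[OF x'H(1)[OF that]] x' that by simp
  qed
  from a.rel_matching_lift[OF M this] obtain u where u: "u \<in> T -> L" "\<And>\<mu>. \<mu> \<in> K ==> x \<mu> \<cdot> u = \<psi> (dim \<mu>) \<cdot> x' \<mu>" "y \<cdot> u = y'"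
   by blast
  show "\<exists>u\<in>Hom C T L. (\<forall>\<mu>\<in>K. ?x \<mu> \<cdot> u = x' \<mu>) \<and> y \<cdot> u = y'"
   by (intro bexI[OF _ u(1)] conjI ballI u(3)) (simp add: xu[OF _ u(1)] u(2) fg[OF x'H(1)])
 next
  fix T u u' assume u: "u \<in> T -> L" "u' \<in> T -> L" "\<And>\<mu>. \<mu> \<in> K ==> ?x \<mu> \<cdot> u = ?x \<mu> \<cdot> u'" "y \<cdot> u = y \<cdot> u'"
  show "u = u'"
  proof (rule a.rel_matching_unique[OF K M u(1,2) _ u(4)])
   fix \<mu> assume k: "\<mu> \<in> K"
   have "\<psi> (dim \<mu>) \<cdot> (\<phi> (dim \<mu>) \<cdot> (x \<mu> \<cdot> u)) = \<psi> (dim \<mu>) \<cdot> (\<phi> (dim \<mu>) \<cdot> (x \<mu> \<cdot> u'))"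
    using u(3)[OF k] xu[OF k u(1)] xu[OF k u(2)] by simp
   then show "x \<mu> \<cdot> u = x \<mu> \<cdot> u'" using gf[OF comp_Hom[OF xH[OF k] u(1)]] gf[OF comp_Hom[OF xH[OF k] u(2)]] by simp
  qed
 qed
 have "is_iso C (\<psi> n)" by (rule is_isoI[OF g.phi_Hom f.phi_Hom f(4,3)])
 then have "c \<cdot> \<psi> n \<in> S" by (intro S_comp[OF c(1,2) S_iso g.phi_Hom])
 moreover have "c \<cdot> \<psi> n \<in> (level Y n) -> L" by (rule comp_Hom[OF c(2) g.phi_Hom])
 moreover have "?x \<mu> \<cdot> (c \<cdot> \<psi> n) = sop C Y n \<mu>" if k: "\<mu> \<in> K" for \<mu>
 proof -
  note ks = ssubset_std[OF K k]
  have "x \<mu> \<cdot> (c \<cdot> \<psi> n) = sop C X n \<mu> \<cdot> \<psi> n" using assoc[OF xH[OF k] c(2) g.phi_Hom] c(3)[OF k] by simp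
  also have "\<dots> = \<psi> (dim \<mu>) \<cdot> sop C Y n \<mu>" using sop_natural[OF g.sobj_X g.sobj_Y g.smap ks] by simp
  finally show ?thesis using xu[OF k comp_Hom[OF c(2) g.phi_Hom]] fg[OF sop_Hom[OF f.sobj_Y ks]] by simp
 qed
 moreover have "y \<cdot> (c \<cdot> \<psi> n) = \<beta> n"
 proof -
  have "y \<cdot> (c \<cdot> \<psi> n) = (\<beta> n \<cdot> \<phi> n) \<cdot> \<psi> n" using assoc[OF yH c(2) g.phi_Hom] c(4) Z(3) by simp
  also have "\<dots> = \<beta> n" using assoc[OF b.phi_Hom f.phi_Hom g.phi_Hom] f(4) comp_Idm[OF b.phi_Hom] by simp
  finally show ?thesis .
 qed
 ultimately show ?thesis by (rule b.rel_matching_coverI[OF M'])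
qed

text \<open>Composition with the inverse gives a map from Y to the same terminal base. It is applied
  in D, along the comparison isomorphism, to obtain the Kan property of \<open>Wbar\<close> of the
  image group.\<close>

lemma (in covers) inf_groupoid_iso:
 assumes X: "inf_groupoid C S X" and f: "simplicial_map C X Y \<phi>" "\<And>n. is_iso C (\<phi> n)"
 shows "inf_groupoid C S Y"
proof -
 obtain Z h where Z: "is_terminal (sCat C) Z" "h \<in> Hom (sCat C) X Z" "kan_fibration C S h"
  using X by (auto simp: inf_groupoid_def)
 obtain \<alpha> where a: "h = (X, Z, \<alpha>)" "is_sobj C X" "is_sobj C Z" "is_smap C X Z \<alpha>" using sCat_HomE[OF Z(2)] by metis
 obtain \<psi> where p: "simplicial_map C Y X \<psi>" "\<And>n. \<psi> n \<cdot> \<phi> n = Idm C (level X n)" "\<And>n. \<phi> n \<cdot> \<psi> n = Idm C (level Y n)"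
  by (rule smap_inverse[OF f]) (rule that)
 interpret f: simplicial_map C X Y \<phi> by fact
 interpret p: simplicial_map C Y X \<psi> by fact
 interpret a: simplicial_map C X Z \<alpha> using a by unfold_locales
 define \<beta> where "\<beta> = (\<lambda>n. \<alpha> n \<cdot> \<psi> n)"
 have b: "simplicial_map C Y Z \<beta>"
  using smap_comp[OF p.sobj_X a.sobj_X a.sobj_Y p.smap a.smap] f.sobj_Y a.sobj_Y unfolding \<beta>_def by unfold_locales
 have ba: "\<beta> n \<cdot> \<phi> n = \<alpha> n" for n
  using assoc[OF a.phi_Hom p.phi_Hom f.phi_Hom] p(2) comp_Idm[OF a.phi_Hom] by (simp add: \<beta>_def)
 have "kan_fibration C S (Y, Z, \<beta>)"
  using Z(3) rel_matching_cover_iso[OF f(1) p a.simplicial_map_axioms b ba ssubset_horn] f.sobj_Y a.sobj_Y simplicial_map.smap[OF b]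
  unfolding kan_fibration_def a(1) by simp
 then show ?thesis
  unfolding inf_groupoid_def using Z(1) f.sobj_Y a.sobj_Y simplicial_map.smap[OF b]
  by (intro conjI exI[of _ Z] exI[of _ "(Y, Z, \<beta>)"]) (simp_all add: sCat_Hom)
qed

lemma (in category) is_iso_Gpd:
 assumes X: "inf_groupoid C S X" "inf_groupoid C S Y" and f: "simplicial_map C X Y \<phi>" "\<And>n. is_iso C (\<phi> n)"
 shows "(X, Y, \<phi>) \<in> Hom (Gpd C S) X Y" "is_iso (Gpd C S) (X, Y, \<phi>)"
proof -
 obtain \<psi> where p: "simplicial_map C Y X \<psi>" "\<And>n. \<psi> n \<cdot> \<phi> n = Idm C (level X n)" "\<And>n. \<phi> n \<cdot> \<psi> n = Idm C (level Y n)"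
  by (rule smap_inverse[OF f]) (rule that)
 interpret f: simplicial_map C X Y \<phi> by fact
 interpret p: simplicial_map C Y X \<psi> by fact
 interpret s: category "Gpd C S"
  by unfold_locales (simp add: Gpd_def is_category_full_subcategory is_category_sCat)
 show fH: "(X, Y, \<phi>) \<in> Hom (Gpd C S) X Y" using X f.sobj_X f.sobj_Y f.smap by (simp add: Gpd_def full_subcategory_Hom sCat_Hom)
 have gH: "(Y, X, \<psi>) \<in> Hom (Gpd C S) Y X" using X p.sobj_X p.sobj_Y p.smap by (simp add: Gpd_def full_subcategory_Hom sCat_Hom)
 show "is_iso (Gpd C S) (X, Y, \<phi>)" by (rule s.is_isoI[OF fH gH]) (simp_all add: Gpd_def p(2,3))
qed

context geometric_terminal
begin

abbreviation "FGrp \<equiv> grpFun (sFun F)"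

text \<open>The choices behind \<open>Wob\<close> in C and in D are unrelated. This is the canonical
  arrow from the image of the product chosen in C to the product chosen in D.\<close>

definition comparison where
 "comparison G n = Wtuple D (OMap FGrp G) n (OMap F (Wob C G n)) (\<lambda>j. AMap F (Wproj C G n j))"

lemma comparison:
 assumes G: "group_object (sCat C) G"
 shows "comparison G n \<in> Hom D (OMap F (Wob C G n)) (Wob D (OMap FGrp G) n)"
  and "j < n ==> Wproj D (OMap FGrp G) n j \<cdot>\<^bsub>D\<^esub> comparison G n = AMap F (Wproj C G n j)"
  and "is_iso D (comparison G n)"
proof -
 interpret G: wbar_object C G by (rule C.wbar_objectI[OF G])
 interpret H: wbar_object D "OMap FGrp G" by (rule wbar_object_image(1)[OF G])
 note P = wbar_object_image(2)[OF G, of n]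
 have a: "AMap F (Wproj C G n j) \<in> Hom D (OMap F (Wob C G n)) (level (Gob (OMap FGrp G)) j)" if "j < n" for j
  using D.product_Hom[OF P] that by simp
 show c: "comparison G n \<in> Hom D (OMap F (Wob C G n)) (Wob D (OMap FGrp G) n)"
  unfolding comparison_def by (rule H.Wtuple(1)[OF F_Obj[OF G.Wob_Obj] a])
 show e: "Wproj D (OMap FGrp G) n j \<cdot>\<^bsub>D\<^esub> comparison G n = AMap F (Wproj C G n j)" if "j < n" for j
  unfolding comparison_def by (rule H.Wtuple(2)[OF F_Obj[OF G.Wob_Obj] a that])
 obtain g where g: "g \<in> Hom D (Wob D (OMap FGrp G) n) (OMap F (Wob C G n))" "\<And>j. j \<in> {..<n} ==> AMap F (Wproj C G n j) \<cdot>\<^bsub>D\<^esub> g = Wproj D (OMap FGrp G) n j"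
  using D.product_lift[OF P H.Wob_Obj H.Wproj_Hom] by (metis lessThan_iff)
 have gc: "g \<cdot>\<^bsub>D\<^esub> comparison G n = Idm D (OMap F (Wob C G n))"
 proof (rule D.product_unique[OF P D.comp_Hom[OF g(1) c] D.Idm_Hom[OF F_Obj[OF G.Wob_Obj]]])
  fix j assume j: "j \<in> {..<n}"
  then have "j < n" by simp
  show "AMap F (Wproj C G n j) \<cdot>\<^bsub>D\<^esub> (g \<cdot>\<^bsub>D\<^esub> comparison G n) = AMap F (Wproj C G n j) \<cdot>\<^bsub>D\<^esub> Idm D (OMap F (Wob C G n))"
   using D.assoc[OF a[OF \<open>j < n\<close>] g(1) c] g(2)[OF j] e[OF \<open>j < n\<close>] D.comp_Idm[OF a[OF \<open>j < n\<close>]] by simp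
 qed
 have "comparison G n \<cdot>\<^bsub>D\<^esub> g = Idm D (Wob D (OMap FGrp G) n)"
 proof (rule H.Wob_eqI[OF D.comp_Hom[OF c g(1)] D.Idm_Hom[OF H.Wob_Obj]])
  fix j assume j: "j < n"
  show "Wproj D (OMap FGrp G) n j \<cdot>\<^bsub>D\<^esub> (comparison G n \<cdot>\<^bsub>D\<^esub> g) = Wproj D (OMap FGrp G) n j \<cdot>\<^bsub>D\<^esub> Idm D (Wob D (OMap FGrp G) n)"
   using D.assoc[OF H.Wproj_Hom[OF j] c g(1)] e[OF j] g(2)[of j] j D.comp_Idm[OF H.Wproj_Hom[OF j]] by simp
 qed
 then show "is_iso D (comparison G n)" by (rule D.is_isoI[OF c g(1) gc])
qed

text \<open>F carries the coordinate formulas of \<open>Wbar\<close> to the same formulas in D,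
  because it preserves products and units of generalized elements; \<open>Wtuple_smap\<close> reads
  them as simpliciality.\<close>

lemma comparison_smap:
 assumes G: "group_object (sCat C) G"
 shows "simplicial_map D (OMap (sFun F) (OMap (Wbar C) G)) (OMap (Wbar D) (OMap FGrp G)) (comparison G)"
proof -
 interpret G: wbar_object C G by (rule C.wbar_objectI[OF G])
 interpret H: wbar_object D "OMap FGrp G" by (rule wbar_object_image(1)[OF G])
 have "is_smap D (OMap (sFun F) G.W) H.W (\<lambda>n. Wtuple D (OMap FGrp G) n (OMap F (Wob C G n)) (\<lambda>j. AMap F (Wproj C G n j)))"
 proof (rule H.Wtuple_smap[OF sFun_sobj[OF G.is_sobj_W], unfolded sFun_simps Wbar_simps grpFun_simps])
  show "AMap F (Wproj C G n j) \<in> Hom D (OMap F (Wob C G n)) (OMap F (level (Gob G) j))" if "j < n" for n j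
   by (rule F_Hom[OF G.Wproj_Hom[OF that]])
  fix n i j
  show "AMap F (Wproj C G n j) \<cdot>\<^bsub>D\<^esub> AMap F (Wface C G n i) =
   (if n < j + i then AMap F (face (Gob G) j (j + i - n)) \<cdot>\<^bsub>D\<^esub> AMap F (Wproj C G (Suc n) (Suc j))
    else if j + i = n then gmul D (glevel (OMap FGrp G) j) (AMap F (face (Gob G) j 0) \<cdot>\<^bsub>D\<^esub> AMap F (Wproj C G (Suc n) (Suc j))) (AMap F (Wproj C G (Suc n) j))
    else AMap F (Wproj C G (Suc n) j))" if i: "i \<le> Suc n" and j: "j < n"
  proof -
   have p: "Wproj C G (Suc n) (Suc j) \<in> (Wob C G (Suc n)) -> (level (Gob G) (Suc j))"
    "Wproj C G (Suc n) j \<in> (Wob C G (Suc n)) -> (level (Gob G) j)" using G.Wproj_Hom j by auto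
   have k: "j + i - n \<le> Suc j" using i by auto
   note fc = sobj_face[OF G.sobj_Gob k] sobj_face[OF G.sobj_Gob le0, of j]
   show ?thesis
    using F_comp[OF G.Wproj_Hom[OF j] G.Wface_Hom[OF i], symmetric] G.Wproj_faces[OF i j] F_comp[OF fc(1) p(1)] F_comp[OF fc(2) p(1)]
     base.F_gmul[OF G.glevel_pregroup, of "face (Gob G) j 0 \<cdot> Wproj C G (Suc n) (Suc j)" _ j "Wproj C G (Suc n) j", folded wbar_object_image(3)[OF G]]
     C.comp_Hom[OF fc(2) p(1)] p(2) by simp
  qed
  show "AMap F (Wproj C G (Suc n) j) \<cdot>\<^bsub>D\<^esub> AMap F (Wdegen C G n i) =
   (if n < j + i then AMap F (degen (Gob G) (j - 1) (j + i - n - 1)) \<cdot>\<^bsub>D\<^esub> AMap F (Wproj C G n (j - 1))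
    else if j + i = n then gone D (glevel (OMap FGrp G) j) (OMap F (Wob C G n)) else AMap F (Wproj C G n j))" if i: "i \<le> n" and j: "j < Suc n"
  proof (cases "n < j + i")
   case True
   then have "j - 1 < n" "j + i - n - 1 \<le> j - 1" "Suc (j - 1) = j" using i j by auto
   then show ?thesis
    using F_comp[OF G.Wproj_Hom[OF j] G.Wdegen_Hom[OF i], symmetric] G.Wproj_degens[OF i j] True
     F_comp[OF sobj_degen[OF G.sobj_Gob] G.Wproj_Hom, of "j + i - n - 1" "j - 1" n] by simp
  next
   case False
   then show ?thesis using F_comp[OF G.Wproj_Hom[OF j] G.Wdegen_Hom[OF i], symmetric] G.Wproj_degens[OF i j]
    base.F_gone[OF G.glevel_pregroup G.Wob_Obj, of j n, folded wbar_object_image(3)[OF G]] by simp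
  qed
 qed
 then show ?thesis using sFun_sobj[OF G.is_sobj_W] H.is_sobj_W unfolding comparison_def[abs_def] by unfold_locales
qed

lemma comparison_natural:
 assumes f: "(G, H, f) \<in> Arr (Grp (sCat C))"
 shows "comparison H n \<cdot>\<^bsub>D\<^esub> comps (AMap (sFun F) (AMap (Wbar C) (G, H, f))) n =
  comps (AMap (Wbar D) (AMap FGrp (G, H, f))) n \<cdot>\<^bsub>D\<^esub> comparison G n"
proof -
 interpret sC: category "sCat C" by (rule C.category_sCat)
 note gf = sC.Grp_ArrD[OF f]
 interpret G: wbar_object C G by (rule C.wbar_objectI[OF gf(1)])
 interpret H: wbar_object C H by (rule C.wbar_objectI[OF gf(2)])
 interpret FG: wbar_object D "OMap FGrp G" by (rule wbar_object_image(1)[OF gf(1)])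
 interpret FH: wbar_object D "OMap FGrp H" by (rule wbar_object_image(1)[OF gf(2)])
 note fH = C.Wbar_arrow_Hom[OF f]
 have FfH: "AMap F (comps f j) \<in> Hom D (level (Gob (OMap FGrp G)) j) (level (Gob (OMap FGrp H)) j)" for j
  using F_Hom[OF fH] by simp
 note w = C.W_arrow[OF G.wbar_object_axioms H.wbar_object_axioms fH]
 note w' = D.W_arrow[OF FG.wbar_object_axioms FH.wbar_object_axioms FfH]
 note cG = comparison[OF gf(1)] and cH = comparison[OF gf(2)]
 have "comparison H n \<cdot>\<^bsub>D\<^esub> AMap F (Wtuple C H n (Wob C G n) (\<lambda>j. comps f j \<cdot> Wproj C G n j)) =
  Wtuple D (OMap FGrp H) n (Wob D (OMap FGrp G) n) (\<lambda>j. AMap F (comps f j) \<cdot>\<^bsub>D\<^esub> Wproj D (OMap FGrp G) n j) \<cdot>\<^bsub>D\<^esub> comparison G n"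
 proof (rule FH.Wob_eqI[OF D.comp_Hom[OF cH(1) F_Hom[OF w(1)]] D.comp_Hom[OF w'(1) cG(1)]])
  fix j assume j: "j < n"
  show "Wproj D (OMap FGrp H) n j \<cdot>\<^bsub>D\<^esub> (comparison H n \<cdot>\<^bsub>D\<^esub> AMap F (Wtuple C H n (Wob C G n) (\<lambda>j. comps f j \<cdot> Wproj C G n j))) =
   Wproj D (OMap FGrp H) n j \<cdot>\<^bsub>D\<^esub> (Wtuple D (OMap FGrp H) n (Wob D (OMap FGrp G) n) (\<lambda>j. AMap F (comps f j) \<cdot>\<^bsub>D\<^esub> Wproj D (OMap FGrp G) n j) \<cdot>\<^bsub>D\<^esub> comparison G n)"
   using D.assoc[OF FH.Wproj_Hom[OF j] cH(1) F_Hom[OF w(1)]] cH(2)[OF j] F_comp[OF H.Wproj_Hom[OF j] w(1)] w(2)[OF j]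
    F_comp[OF fH G.Wproj_Hom[OF j]] w'(3)[OF j cG(1)] cG(2)[OF j] by simp
 qed
 then show ?thesis by simp
qed

lemma Wbar_naturally_isomorphic:
 assumes t: "is_terminal D t"
 shows "naturally_isomorphic (Grp (sCat C)) (Gpd D S') (func_comp (sFun F) (Wbar C)) (func_comp (Wbar D) FGrp)"
 unfolding naturally_isomorphic_def
proof (intro conjI exI ballI)
 interpret sC: category "sCat C" by (rule C.category_sCat)
 have gr: "group_object (sCat C) G" if "G \<in> Obj (Grp (sCat C))" for G using that by (simp add: sC.is_group_object_iff)
 have iC: "inf_groupoid C S (OMap (Wbar C) G)" if "G \<in> Obj (Grp (sCat C))" for G
  using inf_groupoid_W[OF C.wbar_objectI[OF gr[OF that]]] .
 have iF: "inf_groupoid D S' (OMap (sFun F) (OMap (Wbar C) G))" if "G \<in> Obj (Grp (sCat C))" for G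
  by (rule inf_groupoid_preserved[OF iC[OF that] t])
 have iD: "inf_groupoid D S' (OMap (Wbar D) (OMap FGrp G))" if "G \<in> Obj (Grp (sCat C))" for G
  by (rule D.inf_groupoid_iso[OF iF[OF that] comparison_smap[OF gr[OF that]] comparison(3)[OF gr[OF that]]])
 \<comment> \<open>\<open>is_functor_Wbar\<close> concerns a composite with a functor
   \<open>K\<close>; taking the identity for \<open>K\<close> yields \<open>Wbar C\<close>
   itself.\<close>
 let ?I = "\<lparr>OMap = id, AMap = id\<rparr>"
 have "is_functor (Grp (sCat C)) (Grp (sCat C)) ?I"
  using sC.is_category_Grp unfolding is_functor_def Hom_def by simp
 from C.is_functor_Wbar[OF this, of S] have "is_functor (Grp (sCat C)) (Gpd C S) (func_comp (Wbar C) ?I)"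
  using C.wbar_objectI gr iC by simp
 then have "is_functor (Grp (sCat C)) (Gpd C S) (Wbar C)"
  by (subst func.equality[of "Wbar C" "func_comp (Wbar C) ?I"]) (simp_all add: func_comp_def)
 from is_functor_func_comp[OF this is_functor_Gpd[OF t]]
 show F1: "is_functor (Grp (sCat C)) (Gpd D S') (func_comp (sFun F) (Wbar C))" .
 show F2: "is_functor (Grp (sCat C)) (Gpd D S') (func_comp (Wbar D) FGrp)"
  by (rule D.is_functor_Wbar[OF product_functor.is_functor_grpFun[OF product_functor_sFun] wbar_object_image(1)[OF gr] iD])
 let ?e = "\<lambda>G. (OMap (sFun F) (OMap (Wbar C) G), OMap (Wbar D) (OMap FGrp G), comparison G)"
 fix G assume G: "G \<in> Obj (Grp (sCat C))"
 show "?e G \<in> Hom (Gpd D S') (OMap (func_comp (sFun F) (Wbar C)) G) (OMap (func_comp (Wbar D) FGrp) G)" "is_iso (Gpd D S') (?e G)"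
  using D.is_iso_Gpd[OF iF[OF G] iD[OF G] comparison_smap[OF gr[OF G]] comparison(3)[OF gr[OF G]]] by (simp_all add: func_comp_def)
next
 fix h assume h: "h \<in> Arr (Grp (sCat C))"
 obtain G H f where e: "h = (G, H, f)" by (cases h)
 from comparison_natural[OF h[unfolded e]]
 show "(\<lambda>G. (OMap (sFun F) (OMap (Wbar C) G), OMap (Wbar D) (OMap FGrp G), comparison G)) (Cod (Grp (sCat C)) h) \<cdot>\<^bsub>Gpd D S'\<^esub> AMap (func_comp (sFun F) (Wbar C)) h =
  AMap (func_comp (Wbar D) FGrp) h \<cdot>\<^bsub>Gpd D S'\<^esub> (\<lambda>G. (OMap (sFun F) (OMap (Wbar C) G), OMap (Wbar D) (OMap FGrp G), comparison G)) (Dom (Grp (sCat C)) h)"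
  by (simp add: e func_comp_def Gpd_def)
qed

end

theorem proposition2p18:
  fixes C :: "('o, 'm) cat" and S :: "'m set"
    and D :: "('p, 'n) cat" and S' :: "'n set"
    and F :: "('o, 'm, 'p, 'n) func"
  assumes C: "category_with_covers C S"
    and D: "descent_category D S'"
    and F: "geometric_functor C S D S' F"
  shows
    "(is_functor (sCat C) (sCat D) (sFun F) \<and>
      is_functor (Gpd C S) (Gpd D S') (sFun F) \<and>
      (\<forall>f\<in>Arr (Gpd C S). kan_fibration C S f \<longrightarrow> kan_fibration D S' (AMap (sFun F) f)) \<and>
      (\<forall>f\<in>Arr (Gpd C S). covering_fibration C S f \<longrightarrow>
         covering_fibration D S' (AMap (sFun F) f)) \<and>
      (reflects_covers C S S' F \<longrightarrow>
         (\<forall>f\<in>Arr (Gpd C S). kan_fibration D S' (AMap (sFun F) f) \<longrightarrow> kan_fibration C S f) \<and>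
         (\<forall>f\<in>Arr (Gpd C S). covering_fibration D S' (AMap (sFun F) f) \<longrightarrow>
            covering_fibration C S f))) \<and>
     ((\<forall>f\<in>Arr (Gpd C S). hypercover C S f \<longrightarrow> hypercover D S' (AMap (sFun F) f)) \<and>
      (reflects_covers C S S' F \<longrightarrow>
         (\<forall>f\<in>Arr (Gpd C S). hypercover D S' (AMap (sFun F) f) \<longrightarrow> hypercover C S f))) \<and>
     (\<forall>f g p q. covering_fibration C S f \<longrightarrow> is_pullback (Gpd C S) f g p q \<longrightarrow>
        is_pullback (Gpd D S') (AMap (sFun F) f) (AMap (sFun F) g)
          (AMap (sFun F) p) (AMap (sFun F) q)) \<and>
     (preserves_terminal C D F \<longrightarrow>
        is_functor (Grp C) (Grp D) (grpFun F) \<and>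
        is_functor (Grp (sCat C)) (Grp (sCat D)) (grpFun (sFun F))) \<and>
     (preserves_terminal C D F \<longrightarrow>
        naturally_isomorphic (Grp (sCat C)) (Gpd D S')
          (func_comp (sFun F) (Wbar C))
          (func_comp (Wbar D) (grpFun (sFun F))))"
proof -
 interpret C: cover_category C S by (rule cover_categoryI[OF C])
 interpret D: covers D S' by (rule covers_descent[OF D])
 interpret geometric C S D S' F
  by unfold_locales (use F in \<open>simp_all add: geometric_functor_def\<close>)
 obtain t where t: "is_terminal D t" using D unfolding descent_category_def by auto
 have E: "\<exists>X Y \<phi>. f = (X, Y, \<phi>) \<and> simplicial_map C X Y \<phi> \<and> inf_groupoid C S Y" if "f \<in> Arr (Gpd C S)" for f
  by (rule Gpd_ArrE[OF that C.is_cat]) blast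
 have kan: "kan_fibration D S' (AMap (sFun F) f)" if "f \<in> Arr (Gpd C S)" "kan_fibration C S f" for f
  using E[OF that(1)] that(2) kan_preserved by blast
 have kan': "kan_fibration C S f" if "f \<in> Arr (Gpd C S)" "reflects_covers C S S' F" "kan_fibration D S' (AMap (sFun F) f)" for f
  using E[OF that(1)] that(2,3) kan_reflected by blast
 have hc: "hypercover D S' (AMap (sFun F) f)" if "f \<in> Arr (Gpd C S)" "hypercover C S f" for f
  using E[OF that(1)] that(2) hypercover_preserved by blast
 have hc': "hypercover C S f" if "f \<in> Arr (Gpd C S)" "reflects_covers C S S' F" "hypercover D S' (AMap (sFun F) f)" for f
  using E[OF that(1)] that(2,3) hypercover_reflected by blast
 have arr: "comps f 0 \<in> Arr C" if "f \<in> Arr (Gpd C S)" for f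
  using E[OF that] HomD(1)[OF simplicial_map.phi_Hom] by fastforce
 \<comment> \<open>The degree 0 condition of a covering fibration concerns a single arrow of C, to
   which \<open>reflects_covers\<close> applies directly.\<close>
 have refl: "comps f 0 \<in> S" if "f \<in> Arr (Gpd C S)" "reflects_covers C S S' F" "AMap F (comps f 0) \<in> S'" for f
  using arr[OF that(1)] that(2,3) by (simp add: reflects_covers_def)
 have grp: "is_functor (Grp C) (Grp D) (grpFun F) \<and> is_functor (Grp (sCat C)) (Grp (sCat D)) (grpFun (sFun F)) \<and>
   naturally_isomorphic (Grp (sCat C)) (Gpd D S') (func_comp (sFun F) (Wbar C)) (func_comp (Wbar D) (grpFun (sFun F)))"
  if "preserves_terminal C D F"
 proof -
  \<comment> \<open>Preservation of terminal objects enters here: the unit of a group object starts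
    at one, and products are presented as pullbacks over one.\<close>
  interpret geometric_terminal C S D S' F by unfold_locales (rule that)
  show ?thesis
   using base.is_functor_grpFun product_functor.is_functor_grpFun[OF product_functor_sFun] Wbar_naturally_isomorphic[OF t] by blast
 qed
 show ?thesis
  using is_functor_sFun is_functor_Gpd[OF t] kan kan' hc hc' pullback_preserved[OF t] grp
  by (intro conjI impI ballI allI) (auto simp: covering_fibration_def intro: F_S refl)
qed

end
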